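(* Let $M$ be a smooth manifold of dimension $n\ge2$, let $k\in\mathbb{N}$ and $1\le p\le n-1$. Let $\mathcal{I}^k_{p,p}$ be the vector space of $\mathit{Vect}(M)$-invariant linear operators from $\mathcal{D}^k_p(M)$ to $\mathcal{D}_p(M)$. If $k\neq1$ and $(k,p)\ne(2,n-1)$, then $\mathcal{I}^k_{p,p}$ is generated by the identity map. If $k=1$ or $(k,p)=(2,n-1)$, then another generator is given by $d^*\circ K$, i.e. $\mathcal{I}^k_{p,p}$ is generated by the identity map and $d^*\circ K$.
   Context: Manifolds are second-countable, smooth, Hausdorff and connected. $\mathcal{D}^k_p=\mathcal{D}^k_p(M)$ is the space of linear differential operators of order at most $k$ from $p$-forms $\Omega^p(M)$ to $C^\infty(M)$, and $\mathcal{D}_p=\bigcup_k\mathcal{D}^k_p$. A vector field $X$ acts by $\mathcal{L}_XD=L_X\circ D-D\circ L_X$ ($L_X$ the usual Lie derivative). $\mathcal{I}^k_{p,q}$ is the space of linear maps $T:\mathcal{D}^k_p(M)\to\mathcal{D}_q(M)$ with $T(\mathcal{L}_XD)=\mathcal{L}_XT(D)$ for all $X\in\mathit{Vect}(M)$, $D\in\mathcal{D}^k_p(M)$ (no continuity or locality is assumed). The inclusion $\mathcal{D}^k_p\subset\mathcal{D}_p$ is referred to as the identity map. $d^*:\mathcal{D}^k_p\to\mathcal{D}^{k+1}_{p-1}$ is $D\mapsto D\circ d$, with $d$ the de Rham differential. Symbols: $\mathcal{S}^k_p=\Gamma(\wedge^pTM\otimes S^kTM)$, viewed in local coordinates as polynomials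 of degree $k$ in $\xi\in T^*_xM$ with $p$-vector coefficients. The $k$-th order principal symbol $\sigma:\mathcal{D}^k_p\to\mathcal{S}^k_p$ sends $D:\omega\mapsto\sum_{|\alpha|\le k}\langle A_\alpha(x),\partial_x^\alpha\omega\rangle$ to $\sum_{|\alpha|=k}\xi^\alpha A_\alpha(x)$. The Koszul differential is $\delta:\mathcal{S}^k_p\to\mathcal{S}^{k-1}_{p+1}$, $\delta(\Lambda\otimes P)=\sum_j(\partial_{x^j}\wedge\Lambda)\otimes\partial_{\xi_j}P$. The map $K$ is defined on $\mathcal{D}^k_p$ when $k=1$ or $(k,p)=(2,n-1)$ by $$K:\mathcal{D}^k_p\to\mathcal{D}^{k-1}_{p+1}:D\mapsto\mathcal{Q}(\delta(\sigma(D))),$$ where $\mathcal{Q}$ is the following globally defined $\mathit{Vect}(M)$-equivariant map. On $\mathcal{S}^0_{p+1}$ it is the isomorphism $\mathcal{S}^0_{p+1}\to\mathcal{D}^0_{p+1}$, $A\mapsto(\omega\mapsto\langle A,\omega\rangle)$. On $\mathcal{S}^1_n$ it is the map $\mathcal{S}^1_n\to\mathcal{D}^1_n$ given in any chart by sending $\sum_i\xi_iA^i(x)$ to the operator $\omega\mapsto\sum_i\langle A^i,\partial_{x^i}\omega\rangle+\frac12\sum_i\langle\partial_{x^i}A^i,\omega\rangle$ (derivatives on components). *)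

theory Defs
  imports "HOL-Analysis.Analysis" "HOL-Library.Function_Algebras" "HOL-Library.Multiset"
begin

text \<open>
  Smooth manifolds of dimension \<open>CARD('n)\<close>, modelled by a topology and a maximal smooth atlas.
  A tensor field is a family of local representatives, one for every chart of the maximal atlas and
  living on the coordinate image of that chart, subject to the usual transformation law.
  All maps between function spaces are extended by zero outside of their intended domain, so
  that equality of such maps is equality on that domain.
\<close>

definition restrict0 :: "'x set \<Rightarrow> ('x \<Rightarrow> 'y::zero) \<Rightarrow> 'x \<Rightarrow> 'y" where
  "restrict0 S f = (\<lambda>x. if x \<in> S then f x else 0)"


section \<open>Calculus on open subsets of Euclidean space\<close>

definition pd :: "'n::finite \<Rightarrow> (real^'n \<Rightarrow> real) \<Rightarrow> real^'n \<Rightarrow> real" where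
  "pd i f y = frechet_derivative f (at y) (axis i 1)"

text \<open>The intended use of the next two notions is for open \<open>S\<close> only.\<close>

primrec Ck_on :: "nat \<Rightarrow> (real^'n::finite) set \<Rightarrow> (real^'n \<Rightarrow> real) \<Rightarrow> bool" where
  "Ck_on 0 S f \<longleftrightarrow> continuous_on S f"
| "Ck_on (Suc r) S f \<longleftrightarrow> f differentiable_on S \<and> (\<forall>i. Ck_on r S (pd i f))"

definition smooth_on :: "(real^'n::finite) set \<Rightarrow> (real^'n \<Rightarrow> real) \<Rightarrow> bool" where
  "smooth_on S f \<longleftrightarrow> (\<forall>r. Ck_on r S f)"

text \<open>Multi-indices are multisets of coordinate indices. The order in which the partial
  derivatives are taken is irrelevant, as only smooth functions are differentiated.\<close>

definition mpd :: "'n::finite multiset \<Rightarrow> (real^'n \<Rightarrow> real) \<Rightarrow> real^'n \<Rightarrow> real" where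
  "mpd \<alpha> f = foldr pd (SOME l. mset l = \<alpha>) f"


section \<open>Smooth manifolds\<close>

type_synonym ('a, 'n) chart = "'a set \<times> ('a \<Rightarrow> real^'n)"

abbreviation cdom :: "('a, 'n::finite) chart \<Rightarrow> 'a set" where
  "cdom c \<equiv> fst c"

abbreviation coord :: "('a, 'n::finite) chart \<Rightarrow> 'a \<Rightarrow> real^'n" where
  "coord c \<equiv> snd c"

abbreviation cimg :: "('a, 'n::finite) chart \<Rightarrow> (real^'n) set" where
  "cimg c \<equiv> snd c ` fst c"

abbreviation cinv :: "('a, 'n::finite) chart \<Rightarrow> real^'n \<Rightarrow> 'a" where
  "cinv c \<equiv> inv_into (fst c) (snd c)"

definition is_chart :: "'a topology \<Rightarrow> ('a, 'n::finite) chart \<Rightarrow> bool" where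
  "is_chart X c \<longleftrightarrow> openin X (cdom c) \<and> open (cimg c) \<and>
     homeomorphic_map (subtopology X (cdom c)) (top_of_set (cimg c)) (coord c)"

definition transition :: "('a, 'n::finite) chart \<Rightarrow> ('a, 'n) chart \<Rightarrow> 'n \<Rightarrow> real^'n \<Rightarrow> real" where
  "transition c c' j y = coord c' (cinv c y) $ j"

definition compatible :: "('a, 'n::finite) chart \<Rightarrow> ('a, 'n) chart \<Rightarrow> bool" where
  "compatible c c' \<longleftrightarrow>
     (\<forall>j. smooth_on (coord c ` (cdom c \<inter> cdom c')) (transition c c' j)) \<and>
     (\<forall>j. smooth_on (coord c' ` (cdom c \<inter> cdom c')) (transition c' c j))"

definition smooth_manifold :: "'a topology \<Rightarrow> ('a, 'n::finite) chart set \<Rightarrow> bool" where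
  "smooth_manifold X \<A> \<longleftrightarrow>
     Hausdorff_space X \<and> second_countable X \<and> connected_space X \<and>
     (\<forall>c\<in>\<A>. is_chart X c) \<and> \<Union> (cdom ` \<A>) = topspace X \<and>
     (\<forall>c\<in>\<A>. \<forall>c'\<in>\<A>. compatible c c') \<and>
     (\<forall>c. is_chart X c \<and> (\<forall>c'\<in>\<A>. compatible c c') \<longrightarrow> c \<in> \<A>)"

definition points :: "('a, 'n::finite) chart set \<Rightarrow> 'a set" where
  "points \<A> = \<Union> (cdom ` \<A>)"

text \<open>A function on the manifold from local expressions \<open>F c\<close> that agree on overlaps;
  then the choice of a chart around each point is irrelevant.\<close>

definition glue :: "('a, 'n::finite) chart set \<Rightarrow> (('a, 'n) chart \<Rightarrow> real^'n \<Rightarrow> real) \<Rightarrow> 'a \<Rightarrow> real" where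
  "glue \<A> F = restrict0 (points \<A>)
     (\<lambda>x. let c = (SOME c. c \<in> \<A> \<and> x \<in> cdom c) in F c (coord c x))"

definition smooth_functions :: "('a, 'n::finite) chart set \<Rightarrow> ('a \<Rightarrow> real) set" where
  "smooth_functions \<A> = {f. (\<forall>x. x \<notin> points \<A> \<longrightarrow> f x = 0) \<and>
     (\<forall>c\<in>\<A>. smooth_on (cimg c) (f \<circ> cinv c))}"


section \<open>Vector fields and differential forms\<close>

type_synonym ('a, 'n) vfield = "('a, 'n) chart \<Rightarrow> real^'n \<Rightarrow> real^'n"

definition vector_fields :: "('a, 'n::finite) chart set \<Rightarrow> ('a, 'n) vfield set" where
  "vector_fields \<A> = {V.
     (\<forall>c y. c \<notin> \<A> \<or> y \<notin> cimg c \<longrightarrow> V c y = 0) \<and>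
     (\<forall>c\<in>\<A>. \<forall>j. smooth_on (cimg c) (\<lambda>y. V c y $ j)) \<and>
     (\<forall>c\<in>\<A>. \<forall>c'\<in>\<A>. \<forall>x \<in> cdom c \<inter> cdom c'. \<forall>j.
        V c' (coord c' x) $ j =
          (\<Sum>i\<in>UNIV. pd i (transition c c' j) (coord c x) * V c (coord c x) $ i))}"

text \<open>Alternating tensors of degree \<open>p\<close> on \<open>\<real>\<^sup>n\<close> (elements of \<open>\<Lambda>\<^sup>p\<close> of the space or of its dual)
  are given by their components, indexed by lists of length \<open>p\<close>. The convention is that
  \<open>\<partial>\<^sub>1 \<and> \<dots> \<and> \<partial>\<^sub>p\<close> and \<open>dx\<^sup>1 \<and> \<dots> \<and> dx\<^sup>p\<close> have component 1 at the index list \<open>[1, \<dots>, p]\<close>.\<close>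

definition alternating :: "nat \<Rightarrow> ('n::finite list \<Rightarrow> real) \<Rightarrow> bool" where
  "alternating p a \<longleftrightarrow> (\<forall>I. length I \<noteq> p \<longrightarrow> a I = 0) \<and>
     (\<forall>I s t. s < length I \<and> t < length I \<and> s \<noteq> t \<longrightarrow> a (I[s := I ! t, t := I ! s]) = - a I)"

definition pairing :: "nat \<Rightarrow> ('n::finite list \<Rightarrow> real) \<Rightarrow> ('n list \<Rightarrow> real) \<Rightarrow> real" where
  "pairing p a b = (\<Sum>I | length I = p. a I * b I) / fact p"

definition omit :: "nat \<Rightarrow> 'b list \<Rightarrow> 'b list" where
  "omit s I = take s I @ drop (Suc s) I"

text \<open>Components of \<open>\<partial>\<^sub>j \<and> \<Lambda>\<close>.\<close>

definition wedge :: "'n::finite \<Rightarrow> ('n list \<Rightarrow> real) \<Rightarrow> 'n list \<Rightarrow> real" where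
  "wedge j \<Lambda> I = (\<Sum>s<length I. if I ! s = j then (-1) ^ s * \<Lambda> (omit s I) else 0)"

type_synonym ('a, 'n) form = "('a, 'n) chart \<Rightarrow> real^'n \<Rightarrow> 'n list \<Rightarrow> real"

definition forms :: "('a, 'n::finite) chart set \<Rightarrow> nat \<Rightarrow> ('a, 'n) form set" where
  "forms \<A> p = {\<omega>.
     (\<forall>c y. c \<notin> \<A> \<or> y \<notin> cimg c \<longrightarrow> \<omega> c y = 0) \<and>
     (\<forall>c y. alternating p (\<omega> c y)) \<and>
     (\<forall>c\<in>\<A>. \<forall>I. smooth_on (cimg c) (\<lambda>y. \<omega> c y I)) \<and>
     (\<forall>c\<in>\<A>. \<forall>c'\<in>\<A>. \<forall>x \<in> cdom c \<inter> cdom c'. \<forall>I. length I = p \<longrightarrow>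
        \<omega> c (coord c x) I =
          (\<Sum>J | length J = p.
             (\<Prod>s<p. pd (I ! s) (transition c c' (J ! s)) (coord c x)) * \<omega> c' (coord c' x) J))}"

definition on_charts :: "('a, 'n::finite) chart set \<Rightarrow> ('a, 'n) form \<Rightarrow> ('a, 'n) form" where
  "on_charts \<A> F = (\<lambda>c. restrict0 {y. c \<in> \<A> \<and> y \<in> cimg c} (F c))"

definition ext_d :: "('a, 'n::finite) chart set \<Rightarrow> ('a, 'n) form \<Rightarrow> ('a, 'n) form" where
  "ext_d \<A> \<omega> = on_charts \<A> (\<lambda>c y I.
     \<Sum>s<length I. (-1) ^ s * pd (I ! s) (\<lambda>z. \<omega> c z (omit s I)) y)"

definition lie_fun ::
  "('a, 'n::finite) chart set \<Rightarrow> ('a, 'n) vfield \<Rightarrow> ('a \<Rightarrow> real) \<Rightarrow> 'a \<Rightarrow> real" where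
  "lie_fun \<A> V f = glue \<A> (\<lambda>c y. \<Sum>i\<in>UNIV. V c y $ i * pd i (f \<circ> cinv c) y)"

definition lie_form ::
  "('a, 'n::finite) chart set \<Rightarrow> ('a, 'n) vfield \<Rightarrow> ('a, 'n) form \<Rightarrow> ('a, 'n) form" where
  "lie_form \<A> V \<omega> = on_charts \<A> (\<lambda>c y I.
     (\<Sum>i\<in>UNIV. V c y $ i * pd i (\<lambda>z. \<omega> c z I) y) +
     (\<Sum>s<length I. \<Sum>j\<in>UNIV. pd (I ! s) (\<lambda>z. V c z $ j) y * \<omega> c y (I[s := j])))"


section \<open>Differential operators from forms to functions\<close>

type_synonym ('a, 'n) operator = "('a, 'n) form \<Rightarrow> 'a \<Rightarrow> real"

text \<open>\<open>A\<close> is a family of coefficients of \<open>D\<close> in the chart \<open>c\<close>, i.e. in coordinates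
  \<open>D \<omega> = \<Sum>\<^bsub>|\<alpha>| \<le> k\<^esub> \<langle>A\<^sub>\<alpha>, \<partial>\<^sup>\<alpha> \<omega>\<rangle>\<close>, derivatives being taken on components.\<close>

definition local_coeffs :: "('a, 'n::finite) chart set \<Rightarrow> nat \<Rightarrow> nat \<Rightarrow> ('a, 'n) operator \<Rightarrow>
    ('a, 'n) chart \<Rightarrow> ('n multiset \<Rightarrow> real^'n \<Rightarrow> 'n list \<Rightarrow> real) \<Rightarrow> bool" where
  "local_coeffs \<A> k p D c A \<longleftrightarrow>
     (\<forall>\<alpha> y. size \<alpha> \<le> k \<and> y \<in> cimg c \<longrightarrow> alternating p (A \<alpha> y)) \<and>
     (\<forall>\<alpha> I. size \<alpha> \<le> k \<longrightarrow> smooth_on (cimg c) (\<lambda>y. A \<alpha> y I)) \<and>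
     (\<forall>\<omega>\<in>forms \<A> p. \<forall>y\<in>cimg c. D \<omega> (cinv c y) =
        (\<Sum>\<alpha> | size \<alpha> \<le> k. pairing p (A \<alpha> y) (\<lambda>I. mpd \<alpha> (\<lambda>z. \<omega> c z I) y)))"

definition diffops_le ::
  "('a, 'n::finite) chart set \<Rightarrow> nat \<Rightarrow> nat \<Rightarrow> ('a, 'n) operator set" where
  "diffops_le \<A> k p = {D.
     (\<forall>\<omega>. \<omega> \<notin> forms \<A> p \<longrightarrow> D \<omega> = 0) \<and>
     (\<forall>\<omega>\<in>forms \<A> p. D \<omega> \<in> smooth_functions \<A>) \<and>
     (\<forall>c\<in>\<A>. \<exists>A. local_coeffs \<A> k p D c A)}"

definition diffops :: "('a, 'n::finite) chart set \<Rightarrow> nat \<Rightarrow> ('a, 'n) operator set" where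
  "diffops \<A> p = (\<Union>k. diffops_le \<A> k p)"

definition lie_op :: "('a, 'n::finite) chart set \<Rightarrow> nat \<Rightarrow> ('a, 'n) vfield \<Rightarrow>
    ('a, 'n) operator \<Rightarrow> ('a, 'n) operator" where
  "lie_op \<A> p V D = restrict0 (forms \<A> p) (\<lambda>\<omega>. lie_fun \<A> V (D \<omega>) - D (lie_form \<A> V \<omega>))"

text \<open>\<open>d\<^sup>*\<close> on operators on \<open>p\<close>-forms; to be used for \<open>p > 0\<close>.\<close>

definition d_star ::
  "('a, 'n::finite) chart set \<Rightarrow> nat \<Rightarrow> ('a, 'n) operator \<Rightarrow> ('a, 'n) operator" where
  "d_star \<A> p D = restrict0 (forms \<A> (p - 1)) (\<lambda>\<omega>. D (ext_d \<A> \<omega>))"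

definition op_scale :: "real \<Rightarrow> (('a, 'n::finite) operator \<Rightarrow> ('a, 'n) operator) \<Rightarrow>
    (('a, 'n) operator \<Rightarrow> ('a, 'n) operator)" where
  "op_scale r T = (\<lambda>D \<omega> x. r * T D \<omega> x)"

lemma module_op_scale: "module op_scale"
  by unfold_locales (auto simp: op_scale_def fun_eq_iff algebra_simps)

definition invariant_ops :: "('a, 'n::finite) chart set \<Rightarrow> nat \<Rightarrow> nat \<Rightarrow> nat \<Rightarrow>
    (('a, 'n) operator \<Rightarrow> ('a, 'n) operator) set" where
  "invariant_ops \<A> k p q = {T.
     (\<forall>D. D \<notin> diffops_le \<A> k p \<longrightarrow> T D = 0) \<and>
     (\<forall>D\<in>diffops_le \<A> k p. T D \<in> diffops \<A> q) \<and>
     (\<forall>D\<in>diffops_le \<A> k p. \<forall>E\<in>diffops_le \<A> k p. T (D + E) = T D + T E) \<and>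
     (\<forall>D\<in>diffops_le \<A> k p. \<forall>r::real. T (\<lambda>\<omega> x. r * D \<omega> x) = (\<lambda>\<omega> x. r * T D \<omega> x)) \<and>
     (\<forall>V\<in>vector_fields \<A>. \<forall>D\<in>diffops_le \<A> k p. T (lie_op \<A> p V D) = lie_op \<A> q V (T D))}"


section \<open>Principal symbol, Koszul differential and the map \<open>K\<close>\<close>

text \<open>A symbol is given in every chart by a function of the base point \<open>y\<close> and the covector
  \<open>\<xi>\<close>, polynomial in \<open>\<xi>\<close>, with values in (components of) multivectors.\<close>

type_synonym ('a, 'n) symb = "('a, 'n) chart \<Rightarrow> real^'n \<Rightarrow> real^'n \<Rightarrow> 'n list \<Rightarrow> real"

text \<open>The coefficients of a differential operator in a chart are unique on the image of that
  chart, hence the choice is irrelevant there.\<close>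

definition principal_symbol ::
  "('a, 'n::finite) chart set \<Rightarrow> nat \<Rightarrow> nat \<Rightarrow> ('a, 'n) operator \<Rightarrow> ('a, 'n) symb" where
  "principal_symbol \<A> k p D c y \<xi> I =
     (let A = (SOME A. local_coeffs \<A> k p D c A)
      in \<Sum>\<alpha> | size \<alpha> = k. (\<Prod>i\<in>#\<alpha>. \<xi> $ i) * A \<alpha> y I)"

definition koszul :: "('a, 'n::finite) symb \<Rightarrow> ('a, 'n) symb" where
  "koszul S c y \<xi> I = (\<Sum>j\<in>UNIV. wedge j (\<lambda>J. pd j (\<lambda>\<eta>. S c y \<eta> J) \<xi>) I)"

text \<open>Symbols of degree 0 are constant in \<open>\<xi>\<close>, so evaluation at \<open>\<xi> = 0\<close> yields the multivector field.\<close>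

definition quantize0 ::
  "('a, 'n::finite) chart set \<Rightarrow> nat \<Rightarrow> ('a, 'n) symb \<Rightarrow> ('a, 'n) operator" where
  "quantize0 \<A> p S = restrict0 (forms \<A> p) (\<lambda>\<omega>. glue \<A> (\<lambda>c y. pairing p (S c y 0) (\<omega> c y)))"

text \<open>For a symbol \<open>S = \<Sum>\<^sub>i \<xi>\<^sub>i A\<^sup>i\<close> of degree 1, the value at \<open>\<xi> = axis i 1\<close> is \<open>A\<^sup>i\<close>.\<close>

definition quantize1 ::
  "('a, 'n::finite) chart set \<Rightarrow> ('a, 'n) symb \<Rightarrow> ('a, 'n) operator" where
  "quantize1 \<A> S = restrict0 (forms \<A> CARD('n)) (\<lambda>\<omega>. glue \<A> (\<lambda>c y.
     (\<Sum>i\<in>UNIV. pairing CARD('n) (S c y (axis i 1)) (\<lambda>I. pd i (\<lambda>z. \<omega> c z I) y)) +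
     1/2 * (\<Sum>i\<in>UNIV. pairing CARD('n) (\<lambda>I. pd i (\<lambda>z. S c z (axis i 1) I) y) (\<omega> c y))))"

text \<open>Only meaningful for \<open>k = 1\<close> and for \<open>(k, p) = (2, CARD('n) - 1)\<close>.\<close>

definition K_map :: "('a, 'n::finite) chart set \<Rightarrow> nat \<Rightarrow> nat \<Rightarrow>
    ('a, 'n) operator \<Rightarrow> ('a, 'n) operator" where
  "K_map \<A> k p D =
     (if k = 1 then quantize0 \<A> (p + 1) (koszul (principal_symbol \<A> k p D))
      else quantize1 \<A> (koszul (principal_symbol \<A> k p D)))"

definition identity_op :: "('a, 'n::finite) chart set \<Rightarrow> nat \<Rightarrow> nat \<Rightarrow>
    ('a, 'n) operator \<Rightarrow> ('a, 'n) operator" where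
  "identity_op \<A> k p = restrict0 (diffops_le \<A> k p) (\<lambda>D. D)"

definition d_star_K :: "('a, 'n::finite) chart set \<Rightarrow> nat \<Rightarrow> nat \<Rightarrow>
    ('a, 'n) operator \<Rightarrow> ('a, 'n) operator" where
  "d_star_K \<A> k p = restrict0 (diffops_le \<A> k p) (d_star \<A> (p + 1) \<circ> K_map \<A> k p)"

end

theory Submission
  imports Defs "HOL-Computational_Algebra.Polynomial" "HOL-Combinatorics.Permutations"
begin

text \<open>An invariant \<open>T\<close> is local, because an operator that vanishes near a point is annihilated there by many
  vector fields, among them the Euler field, which acts on jets at the point by positive scalars. At a point, \<open>T\<close> is
  determined on operators of order \<open>j\<close> by its value on \<open>\<partial>\<^sub>1\<^sup>j \<omega>\<^bsub>2\<dots>p+1\<^esub>\<close>: linear fields make this operator cyclic, and their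
  weights leave two unknown scalars \<open>a\<^sub>j\<close> and \<open>b\<^sub>j\<close>. Quadratic and cubic fields relate these for different \<open>j\<close> and leave
  only \<open>a\<^sub>0\<close> free, together with \<open>a\<^sub>k\<close> if \<open>k = 1\<close>, or if \<open>k = 2\<close> and no index outside \<open>1, \<dots>, p+1\<close> exists. These two
  scalars are realised by the identity and by \<open>d\<^sup>* \<circ> K\<close>; they are locally constant by translation invariance, hence
  constant on a connected manifold.\<close>

section \<open>Smooth functions on open sets\<close>

text \<open>No continuity of \<open>T\<close> is at hand, so variable coefficients cannot be handled
  by Taylor expansion. Two devices replace it. A field cut off inside the region where
  \<open>D\<close> vanishes has zero Lie derivative on \<open>D\<close>, which yields locality. And
  every coefficient function is a partial derivative \<open>pd l1 h\<close>, so that fields with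
  component \<open>h\<close> lead from constant to arbitrary coefficients; this is why
  antiderivatives are built. The two scalars of order j become transparent as a_j + b_j Z, where Z
  exchanges an exterior index with the derivatives: a_j + j b_j is, up to j!, the value on a word
  whose derivatives all equal that exterior index, and it turns out independent of j, while b_j = 0
  for 0 < j < k. After subtraction of the identity only a_k = - k b_k is open, and the third index
  or the cubic fields supply one more equation. Invariance of the second generator is verified
  without transforming symbols: an operator of order k, applied to a form vanishing to order k at a
  point, sees exactly its principal symbol, and this value refers to no chart.\<close>

abbreviation Sm :: "(real^'n::finite) set => (real^'n => real) => bool" where "Sm == smooth_on"
abbreviation rp :: "nat => 'b => 'b multiset" where "rp == replicate_mset"
abbreviation am :: "'b => 'b multiset => 'b multiset" where "am == add_mset"
abbreviation Ls :: "nat => 'b list set" where "Ls p == {b. length b = p}"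
lemmas scong = sum.cong[OF refl]
lemmas mult_if = if_distrib[of "\<lambda>x. x * u" for u]
abbreviation sumU :: "('b => 'c::comm_monoid_add) => 'c" (binder "SU " 10) where "sumU f == sum f UNIV"

lemma linear_axis_sum:
 fixes f :: "real^'n::finite => real"
 assumes "linear f"
 shows "f v = (SU i. v $ i * f (axis i 1))"
proof -
 have "f v = f (SU i. (v $ i) *\<^sub>R axis i 1)"
  by (simp add: basis_expansion flip: scalar_mult_eq_scaleR)
 also have "... = (SU i. v $ i * f (axis i 1))"
  using assms by (simp add: linear_sum linear_scale)
 finally show ?thesis .
qed

lemma pd_eqI: "(f has_derivative f') (at y) ==> pd i f y = f' (axis i 1)"
 unfolding pd_def using frechet_derivative_at by metis

lemma has_derivative_pd:
 assumes "f differentiable (at y)"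
 shows "(f has_derivative (%v. SU i. v $ i * pd i f y)) (at y)"
proof -
 have *: "(f has_derivative frechet_derivative f (at y)) (at y)"
  using assms frechet_derivative_works by blast
 then have "frechet_derivative f (at y) = (%v. SU i. v $ i * pd i f y)"
  unfolding pd_def using linear_axis_sum has_derivative_linear by blast
 with * show ?thesis by simp
qed

text \<open>Having a given derivative at \<open>y\<close> is a local property, so
  \<open>frechet_derivative\<close> makes the same choice for both functions, differentiable or not.
  Local expressions in a chart carry meaning only on an open set, and comparisons of their
  derivatives go through this fact.\<close>

lemma pd_cong:
 assumes "open S" "y \<in> S" "!!z. z \<in> S ==> f z = g z"
 shows "pd i f y = pd i g y"
proof -
 have "(f has_derivative f') (at y) = (g has_derivative f') (at y)" for f'
  using has_derivative_transform_within_open[OF _ assms(1,2)] assms(3) by metis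
 then show ?thesis unfolding pd_def frechet_derivative_def by simp
qed

lemma differentiable_cong_open:
 assumes "open S" "!!z. z \<in> S ==> f z = g z" "f differentiable_on S"
 shows "g differentiable_on S"
 using assms unfolding differentiable_on_def differentiable_def
 by (metis has_derivative_transform_within_open)

lemma pd_const [simp]: "pd i (%_. c) y = 0"
 by (rule pd_eqI[OF has_derivative_const])

lemma pd_add:
 assumes "f differentiable at y" "g differentiable at y"
 shows "pd i (%z. f z + g z) y = pd i f y + pd i g y"
proof -
 from assms obtain f' g' where *: "(f has_derivative f') (at y)" "(g has_derivative g') (at y)"
  unfolding differentiable_def by blast
 show ?thesis
  unfolding pd_eqI[OF has_derivative_add[OF *]] pd_eqI[OF *(1)] pd_eqI[OF *(2)] ..
qed

lemma pd_mult:
 assumes "f differentiable at y" "g differentiable at y"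
 shows "pd i (%z. f z * g z) y = f y * pd i g y + pd i f y * g y"
proof -
 from assms obtain f' g' where *: "(f has_derivative f') (at y)" "(g has_derivative g') (at y)"
  unfolding differentiable_def by blast
 show ?thesis
  unfolding pd_eqI[OF has_derivative_mult[OF *]] pd_eqI[OF *(1)] pd_eqI[OF *(2)] ..
qed

lemma pd_coord [simp]: "pd i (%y. y $ j) y = (if i = j then 1 else 0)"
 using pd_eqI[OF bounded_linear.has_derivative[OF bounded_linear_vec_nth has_derivative_ident], of i j y]
 by (simp add: axis_def)

lemma Ck_on_differentiable: "Ck_on (Suc r) S f ==> f differentiable_on S"
 by simp

lemma Ck_on_Suc_le: "Ck_on (Suc r) S f ==> Ck_on r S f"
proof (induction r arbitrary: f)
 case 0 then show ?case by (auto intro: differentiable_imp_continuous_on)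
next
 case (Suc r) then show ?case by (metis Ck_on.simps(2))
qed

lemma Ck_on_cong:
 "open S ==> (!!z. z \<in> S ==> f z = g z) ==> Ck_on r S f ==> Ck_on r S g"
proof (induction r arbitrary: f g)
 case 0 then show ?case using continuous_on_cong by (metis Ck_on.simps(1))
next
 case (Suc r)
 have "Ck_on r S (pd i g)" for i
 proof (rule Suc.IH[OF Suc.prems(1)])
  show "pd i f z = pd i g z" if "z \<in> S" for z by (rule pd_cong[OF Suc.prems(1) that Suc.prems(2)])
  show "Ck_on r S (pd i f)" using Suc.prems(3) by simp
 qed
 then show ?case using Suc.prems differentiable_cong_open[of S f g] by auto
qed

lemma Ck_on_subset: "open T ==> S \<subseteq> T ==> Ck_on r T f ==> Ck_on r S f"
 by (induction r arbitrary: f) (auto intro: continuous_on_subset differentiable_on_subset)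

lemma sm_cong: "open S ==> (!!z. z \<in> S ==> f z = g z) ==> Sm S f ==> Sm S g"
 unfolding smooth_on_def using Ck_on_cong by blast

lemma sm_subset: "open T ==> S \<subseteq> T ==> Sm T f ==> Sm S f"
 unfolding smooth_on_def using Ck_on_subset by blast

lemma sm_differentiable_on: "Sm S f ==> f differentiable_on S"
 unfolding smooth_on_def using Ck_on_differentiable by blast

lemma sm_diffble: "Sm S f ==> open S ==> y \<in> S ==> f differentiable (at y)"
 using sm_differentiable_on differentiable_on_eq_differentiable_at by blast

lemma sm_continuous: "Sm S f ==> continuous_on S f"
 unfolding smooth_on_def by (metis Ck_on.simps(1))

lemma sm_pd: "Sm S f ==> Sm S (pd i f)"
 unfolding smooth_on_def by (metis Ck_on.simps(2))

lemma smooth_onI: "f differentiable_on S ==> (!!i. Sm S (pd i f)) ==> Sm S f"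
 unfolding smooth_on_def
 by (metis Ck_on.simps differentiable_imp_continuous_on not0_implies_Suc)

text \<open>Extensions by zero are checked near the support and away from it separately; this lemma
  joins the two.\<close>

lemma sm_local:
 assumes "open S" "!!y. y \<in> S ==> \<exists>N. open N & y \<in> N & Sm (S \<inter> N) f"
 shows "Sm S f"
proof -
 have "Ck_on r S f" if "!!y. y \<in> S ==> \<exists>N. open N & y \<in> N & Ck_on r (S \<inter> N) f" for r f
  using that
 proof (induction r arbitrary: f)
  case 0
  have "continuous (at y) f" if "y \<in> S" for y
   using 0[OF that] that `open S`
   by (metis Ck_on.simps(1) Int_iff continuous_on_eq_continuous_at open_Int)
  then show ?case by (simp add: continuous_at_imp_continuous_on)
 next
  case (Suc r)
  have "Ck_on r S (pd i f)" for i by (rule Suc.IH) (use Suc.prems in force)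
  moreover have "f differentiable at y" if "y \<in> S" for y
   using Suc.prems[OF that] that `open S`
   by (metis Ck_on.simps(2) Int_iff differentiable_on_eq_differentiable_at open_Int)
  ultimately show ?case using `open S` by (simp add: differentiable_on_eq_differentiable_at)
 qed
 then show ?thesis using assms(2) unfolding smooth_on_def by meson
qed

lemma sm_const [intro, simp]:
 fixes S :: "(real^'n::finite) set"
 shows "Sm S (%_. c)"
proof -
 have "pd i (%_. c) = (%_::real^'n. 0)" for i :: 'n and c by (rule ext) (rule pd_const)
 then have "Ck_on r S (%_. c)" for r c
  by (induction r arbitrary: c) (simp_all add: differentiable_on_def)
 then show ?thesis unfolding smooth_on_def by blast
qed

lemma Ck_on_add: "open S ==> Ck_on r S f ==> Ck_on r S g ==> Ck_on r S (%z. f z + g z)"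
proof (induction r arbitrary: f g)
 case 0 then show ?case by (simp add: continuous_on_add)
next
 case (Suc r)
 have "Ck_on r S (pd i (%z. f z + g z))" for i
  by (rule Ck_on_cong[OF `open S` _ Suc.IH[OF `open S`, of "pd i f" "pd i g"]])
   (use Suc.prems in "auto simp: pd_add differentiable_on_eq_differentiable_at")
 then show ?case using Suc.prems by (auto simp: differentiable_on_add)
qed

lemma Ck_on_mult: "open S ==> Ck_on r S f ==> Ck_on r S g ==> Ck_on r S (%z. f z * g z)"
proof (induction r arbitrary: f g)
 case 0 then show ?case unfolding Ck_on.simps by (intro continuous_on_mult)
next
 case (Suc r)
 have "Ck_on r S (pd i (%z. f z * g z))" for i
 proof (rule Ck_on_cong[OF `open S`])
  show "f z * pd i g z + pd i f z * g z = pd i (%z. f z * g z) z" if "z \<in> S" for z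
   using Suc.prems that by (simp add: pd_mult differentiable_on_eq_differentiable_at)
  show "Ck_on r S (%z. f z * pd i g z + pd i f z * g z)"
   using Suc.prems Ck_on_Suc_le by (intro Ck_on_add Suc.IH) auto
 qed
 then show ?case using Suc.prems by (auto simp: differentiable_on_mult)
qed

lemma sm_add [intro]: "open S ==> Sm S f ==> Sm S g ==> Sm S (%z. f z + g z)"
 unfolding smooth_on_def using Ck_on_add by blast

lemma sm_mult [intro]: "open S ==> Sm S f ==> Sm S g ==> Sm S (%z. f z * g z)"
 unfolding smooth_on_def using Ck_on_mult by blast

lemma sm_minus [intro]: "open S ==> Sm S f ==> Sm S (%z. - f z)"
 using sm_mult[of S "%_. -1" f] by simp

lemma sm_diff [intro]: "open S ==> Sm S f ==> Sm S g ==> Sm S (%z. f z - g z)"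
 using sm_add[of S f "%z. - g z"] sm_minus[of S g] by simp

lemma sm_sum [intro]:
 "open S ==> (!!i. i \<in> I ==> Sm S (f i)) ==> Sm S (%z. \<Sum>i\<in>I. f i z)"
 by (induction I rule: infinite_finite_induct) auto

lemma sm_prod [intro]:
 "open S ==> (!!i. i \<in> I ==> Sm S (f i)) ==> Sm S (%z. \<Prod>i\<in>I. f i z)"
 by (induction I rule: infinite_finite_induct) auto

lemma sm_prod_mset [intro]:
 "open S ==> (!!i. i \<in># I ==> Sm S (f i)) ==> Sm S (%z. \<Prod>i\<in>#I. f i z)"
 by (induction I) auto

lemma sm_sum_mset [intro]:
 "open S ==> (!!i. i \<in># I ==> Sm S (f i)) ==> Sm S (%z. \<Sum>i\<in>#I. f i z)"
 by (induction I) auto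

lemma sm_coord [intro]:
 assumes "open S"
 shows "Sm S (%y. y $ j)"
proof (rule smooth_onI)
 show "(%y. y $ j) differentiable_on S"
  by (simp add: bounded_linear_imp_differentiable_on bounded_linear_vec_nth)
 have "pd i (%y. y $ j) = (%_. if i = j then 1 else 0)" for i by (rule ext) (rule pd_coord)
 then show "Sm S (pd i (%y. y $ j))" for i using sm_const by metis
qed

lemma sm_power [intro]: "open S ==> Sm S f ==> Sm S (%z. f z ^ m)"
 by (induction m) auto

lemma sm_if: "(P ==> Sm S f) ==> (\<not> P ==> Sm S g) ==> Sm S (%z. if P then f z else g z)"
 by (cases P) simp_all

lemmas smooth_intros = sm_const sm_coord sm_add sm_diff sm_minus
 sm_mult sm_sum sm_prod sm_sum_mset sm_prod_mset sm_power
 sm_pd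

lemma pd_sum:
 "finite I ==> (!!i. i \<in> I ==> f i differentiable at y) ==> pd j (%z. \<Sum>i\<in>I. f i z) y = (\<Sum>i\<in>I. pd j (f i) y)"
 by (induction I rule: finite_induct) (auto simp: pd_add)

lemma pd_cmult: "f differentiable at y ==> pd i (%z. c * f z) y = c * pd i f y"
 using pd_mult[of "%_. c" y f i] by simp

lemma pd_minus: "f differentiable at y ==> pd i (%z. - f z) y = - pd i f y"
 using pd_cmult[of f y i "-1"] by simp

lemma pd_diff:
 "f differentiable at y ==> g differentiable at y ==> pd i (%z. f z - g z) y = pd i f y - pd i g y"
 using pd_add[of f y "%z. - g z" i] pd_minus[of g y i] by simp

lemma has_derivative_vec_lambda:
 fixes Ph :: "'m::finite => real^'n::finite => real"
 assumes "!!j. (Ph j has_derivative Ph' j) (at y)"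
 shows "((%z. \<chi> j. Ph j z) has_derivative (%v. \<chi> j. Ph' j v)) (at y)"
 unfolding has_derivative_componentwise_within[of "%z. \<chi> j. Ph j z"]
proof
 fix b :: "real^'m" assume "b \<in> Basis"
 then obtain j where b: "b = axis j 1" by (auto simp: Basis_vec_def)
 show "((%x. (\<chi> j. Ph j x) \<bullet> b) has_derivative (%x. (\<chi> j. Ph' j x) \<bullet> b)) (at y)"
  using assms[of j] by (simp add: b inner_axis)
qed

lemma chain_rule_pd:
 fixes Ph :: "'m::finite => real^'n::finite => real"
 assumes "!!j. Ph j differentiable (at y)" "f differentiable (at (\<chi> j. Ph j y))"
 shows "(%z. f (\<chi> j. Ph j z)) differentiable (at y)"
  "pd i (%z. f (\<chi> j. Ph j z)) y = (SU m. pd i (Ph m) y * pd m f (\<chi> j. Ph j y))"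
proof -
 have "((%z. \<chi> j. Ph j z) has_derivative (%v. \<chi> j. SU i. v $ i * pd i (Ph j) y)) (at y)"
  by (intro has_derivative_vec_lambda has_derivative_pd assms)
 from has_derivative_compose[OF this has_derivative_pd[OF assms(2)]]
 have *: "((%z. f (\<chi> j. Ph j z)) has_derivative
  (%v. SU m. (SU i. v $ i * pd i (Ph m) y) * pd m f (\<chi> j. Ph j y))) (at y)" by simp
 then show "(%z. f (\<chi> j. Ph j z)) differentiable (at y)" unfolding differentiable_def by blast
 have "(SU k. axis i 1 $ k * pd k (Ph m) y) = pd i (Ph m) y" for m
  by (simp add: axis_def mult_if cong: if_cong)
 then show "pd i (%z. f (\<chi> j. Ph j z)) y = (SU m. pd i (Ph m) y * pd m f (\<chi> j. Ph j y))"
  using pd_eqI[OF *, of i] by simp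
qed

text \<open>By the chain rule each derivative of the composite is a sum of products of derivatives
  of \<open>Ph\<close> with composites of derivatives of \<open>f\<close>. The induction on the
  order therefore quantifies over \<open>f\<close>.\<close>

lemma sm_compose:
 fixes Ph :: "'m::finite => real^'n::finite => real"
 assumes "open S" "open T" "!!j. Sm S (Ph j)" "!!y. y \<in> S ==> (\<chi> j. Ph j y) \<in> T" "Sm T f"
 shows "Sm S (%y. f (\<chi> j. Ph j y))"
proof -
 have "Ck_on r S (%y. f (\<chi> j. Ph j y))" if "Ck_on r T f" for r f
  using that
 proof (induction r arbitrary: f)
  case 0
  have "continuous_on S (%y. \<chi> j. Ph j y)"
   by (intro continuous_on_vec_lambda sm_continuous assms)
  moreover have "(%y. \<chi> j. Ph j y) ` S \<subseteq> T" using assms(4) by auto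
  ultimately show ?case using 0 by (auto intro: continuous_on_compose2)
 next
  case (Suc r)
  have d: "f differentiable (at (\<chi> j. Ph j y))" if "y \<in> S" for y
   using Suc.prems assms(2,4) that differentiable_on_eq_differentiable_at by auto
  have d': "Ph j differentiable (at y)" if "y \<in> S" for y j
   using sm_diffble assms that by blast
  have sumC: "Ck_on r S (%y. \<Sum>m\<in>M. g m y)" if "!!m. Ck_on r S (g m)" for M :: "'m set" and g
  proof (induction M rule: infinite_finite_induct)
   case (insert x F) then show ?case using Ck_on_add[OF `open S`] that by auto
  qed (use sm_const[of S 0] smooth_on_def in auto)
  have "Ck_on r S (pd i (%y. f (\<chi> j. Ph j y)))" for i
  proof (rule Ck_on_cong[OF `open S`])
   show "(SU m. pd i (Ph m) y * pd m f (\<chi> j. Ph j y)) = pd i (%y. f (\<chi> j. Ph j y)) y" if "y \<in> S" for y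
    using chain_rule_pd(2)[of Ph y f i] d d' that by simp
   show "Ck_on r S (%y. SU m. pd i (Ph m) y * pd m f (\<chi> j. Ph j y))"
    using Suc.IH Suc.prems sm_pd[OF assms(3)]
    by (intro sumC Ck_on_mult `open S`) (auto simp: smooth_on_def)
  qed
  then show ?case using chain_rule_pd(1)[of Ph _ f] d d' assms(1)
   by (auto simp: differentiable_on_eq_differentiable_at)
 qed
 then show ?thesis using assms(5) unfolding smooth_on_def by blast
qed

text \<open>The tower \<open>g\<close> of successive derivatives expresses smoothness of a function
  on the line, \<open>smooth_on\<close> being about functions of a vector.\<close>

lemma sm_real_compose:
 assumes "open S" "!!m t. (g m has_field_derivative g (Suc m) t) (at t)" "Sm S f"
 shows "Sm S (%y. (g 0 :: real => real) (f y))"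
proof -
 have d: "((%z. g m (f z)) has_derivative (%v. (SU i. v $ i * pd i f y) * g (Suc m) (f y))) (at y)"
  if "y \<in> S" for m y
  using has_derivative_compose[OF has_derivative_pd[OF sm_diffble[OF assms(3,1) that]]
   assms(2)[of m, unfolded has_field_derivative_def]]
  by (simp add: mult.commute)
 have "Ck_on r S (%y. g m (f y))" for r m
 proof (induction r arbitrary: m)
  case 0
  show ?case unfolding Ck_on.simps
   using d has_derivative_continuous[of "%z. g m (f z)"] continuous_at_imp_continuous_on by blast
 next
  case (Suc r)
  have "Ck_on r S (pd i (%y. g m (f y)))" for i
  proof (rule Ck_on_cong[OF `open S`])
   show "pd i f y * g (Suc m) (f y) = pd i (%y. g m (f y)) y" if "y \<in> S" for y
    using pd_eqI[OF d[OF that, of m], of i]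
    by (simp add: axis_def mult_if cong: if_cong)
   show "Ck_on r S (%y. pd i f y * g (Suc m) (f y))"
    using Suc.IH sm_pd[OF assms(3)] by (intro Ck_on_mult `open S`) (auto simp: smooth_on_def)
  qed
  then show ?case using d assms(1)
   by (auto simp: differentiable_on_eq_differentiable_at differentiable_def)
 qed
 then show ?thesis unfolding smooth_on_def by blast
qed

lemma has_field_derivative_line:
 fixes f :: "real^'n::finite => real"
 assumes "f differentiable (at (y + t *\<^sub>R axis i 1))"
 shows "((%t. f (y + t *\<^sub>R axis i 1)) has_field_derivative pd i f (y + t *\<^sub>R axis i 1)) (at t)"
proof -
 have "((%t. y + t *\<^sub>R axis i 1) has_derivative (%s. s *\<^sub>R axis i 1)) (at t)"
  by (auto intro!: derivative_eq_intros)
 from has_derivative_compose[OF this has_derivative_pd[OF assms]]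
 show ?thesis unfolding has_field_derivative_def
  by (rule has_derivative_eq_rhs)
   (auto simp: axis_def if_distrib[of "%x. _ * x"] mult_ac mult_if cong: if_cong)
qed

text \<open>The mean value theorem is applied twice, first in direction \<open>i\<close> to a
  difference in direction \<open>j\<close>. The left-hand side is symmetric in \<open>i\<close> and
  \<open>j\<close>, which is what the commutation of partial derivatives rests on.\<close>

lemma second_difference:
 fixes f :: "real^'n::finite => real"
 assumes "open S" "Sm S f" "h > 0"
  and "!!a b. 0 \<le> a ==> a \<le> h ==> 0 \<le> b ==> b \<le> h ==> y + a *\<^sub>R axis i 1 + b *\<^sub>R axis j 1 \<in> S"
 shows "\<exists>a b. 0 < a & a < h & 0 < b & b < h &
  f (y + h *\<^sub>R axis i 1 + h *\<^sub>R axis j 1) - f (y + h *\<^sub>R axis i 1) - f (y + h *\<^sub>R axis j 1) + f y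
   = h * h * pd j (pd i f) (y + a *\<^sub>R axis i 1 + b *\<^sub>R axis j 1)"
proof -
 let ?e = "axis i 1 :: real^'n" and ?e' = "axis j 1 :: real^'n"
 note d = sm_diffble[OF _ `open S`]
 let ?ph = "%a. f ((y + h *\<^sub>R ?e') + a *\<^sub>R ?e) - f (y + a *\<^sub>R ?e)"
 have "\<exists>z. 0 < z & z < h & ?ph h - ?ph 0
   = (h - 0) * (pd i f ((y + h *\<^sub>R ?e') + z *\<^sub>R ?e) - pd i f (y + z *\<^sub>R ?e))"
 proof (rule MVT2[OF `h > 0`])
  fix a :: real assume "0 \<le> a" "a \<le> h"
  then have "(y + h *\<^sub>R ?e') + a *\<^sub>R ?e \<in> S" "y + a *\<^sub>R ?e \<in> S"
   using assms(4)[of a h] assms(4)[of a 0] `h > 0` by (simp_all add: algebra_simps)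
  then show "(?ph has_field_derivative pd i f ((y + h *\<^sub>R ?e') + a *\<^sub>R ?e) - pd i f (y + a *\<^sub>R ?e)) (at a)"
   by (intro DERIV_diff has_field_derivative_line d[OF assms(2)])
 qed
 then obtain a where a: "0 < a" "a < h" "?ph h - ?ph 0
   = h * (pd i f ((y + h *\<^sub>R ?e') + a *\<^sub>R ?e) - pd i f (y + a *\<^sub>R ?e))" by auto
 let ?ps = "%b. pd i f ((y + a *\<^sub>R ?e) + b *\<^sub>R ?e')"
 have "\<exists>z. 0 < z & z < h & ?ps h - ?ps 0 = (h - 0) * (pd j (pd i f) ((y + a *\<^sub>R ?e) + z *\<^sub>R ?e'))"
  using a assms(4)
  by (intro MVT2[OF `h > 0`] has_field_derivative_line d[OF sm_pd[OF assms(2)]]) auto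
 then obtain b where b: "0 < b" "b < h" "?ps h - ?ps 0 = h * (pd j (pd i f) ((y + a *\<^sub>R ?e) + b *\<^sub>R ?e'))"
  by auto
 have "f (y + h *\<^sub>R ?e + h *\<^sub>R ?e') - f (y + h *\<^sub>R ?e) - f (y + h *\<^sub>R ?e') + f y = ?ph h - ?ph 0"
  by (simp add: algebra_simps)
 also have "... = h * (?ps h - ?ps 0)" using a(3) by (simp add: algebra_simps)
 finally show ?thesis using a b by (intro exI[of _ a] exI[of _ b]) (simp add: algebra_simps)
qed

lemma pd_commute:
 fixes f :: "real^'n::finite => real"
 assumes "open S" "Sm S f" "y \<in> S"
 shows "pd i (pd j f) y = pd j (pd i f) y"
proof (rule ccontr)
 let ?g = "pd j (pd i f)" and ?g' = "pd i (pd j f)"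
 assume "?g' y ~= ?g y"
 then have e: "\<bar>?g y - ?g' y\<bar> / 2 > 0" by auto
 have c: "isCont ?g y" "isCont ?g' y"
  using sm_continuous[OF sm_pd[OF sm_pd[OF assms(2)]]] assms(1,3)
   continuous_on_eq_continuous_at by blast+
 obtain d1 where d1: "d1 > 0" "!!z. dist z y < d1 ==> dist (?g z) (?g y) < \<bar>?g y - ?g' y\<bar> / 2"
  using c(1) e unfolding continuous_at_eps_delta by blast
 obtain d2 where d2: "d2 > 0" "!!z. dist z y < d2 ==> dist (?g' z) (?g' y) < \<bar>?g y - ?g' y\<bar> / 2"
  using c(2) e unfolding continuous_at_eps_delta by blast
 obtain d3 where d3: "d3 > 0" "!!z. dist z y < d3 ==> z \<in> S"
  using assms(1,3) unfolding open_dist by blast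
 \<comment> \<open>The intermediate points lie within 2h of \<open>y\<close>; a third of the
   smallest radius keeps them inside all three balls.\<close>
 define h where "h = min d1 (min d2 d3) / 3"
 have h: "h > 0" "2 * h < d1" "2 * h < d2" "2 * h < d3" using d1(1) d2(1) d3(1) by (auto simp: h_def)
 have near: "dist (y + a *\<^sub>R axis i 1 + b *\<^sub>R axis j 1) y \<le> 2 * h"
  if "0 \<le> a" "a \<le> h" "0 \<le> b" "b \<le> h" for a b and i j :: 'n
 proof -
  have "norm (a *\<^sub>R axis i 1 + b *\<^sub>R axis j 1 :: real^'n) \<le> a + b"
   using norm_triangle_ineq[of "a *\<^sub>R axis i 1 :: real^'n" "b *\<^sub>R axis j 1"] that by simp
  then show ?thesis using that by (simp add: dist_norm add.assoc)
 qed
 have inS: "y + a *\<^sub>R axis i 1 + b *\<^sub>R axis j 1 \<in> S"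
  if "0 \<le> a" "a \<le> h" "0 \<le> b" "b \<le> h" for a b and i j :: 'n
  using d3(2) near[OF that, of i j] h by force
 obtain a b where ab: "0 < a" "a < h" "0 < b" "b < h"
  "f (y + h *\<^sub>R axis i 1 + h *\<^sub>R axis j 1) - f (y + h *\<^sub>R axis i 1) - f (y + h *\<^sub>R axis j 1) + f y
   = h * h * ?g (y + a *\<^sub>R axis i 1 + b *\<^sub>R axis j 1)"
  using second_difference[OF assms(1,2) h(1), of y i j] inS[of _ _ i j] by blast
 obtain a' b' where ab': "0 < a'" "a' < h" "0 < b'" "b' < h"
  "f (y + h *\<^sub>R axis j 1 + h *\<^sub>R axis i 1) - f (y + h *\<^sub>R axis j 1) - f (y + h *\<^sub>R axis i 1) + f y
   = h * h * ?g' (y + a' *\<^sub>R axis j 1 + b' *\<^sub>R axis i 1)"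
  using second_difference[OF assms(1,2) h(1), of y j i] inS[of _ _ j i] by blast
 have sw: "y + h *\<^sub>R axis j 1 + h *\<^sub>R axis i 1 = y + h *\<^sub>R axis i 1 + h *\<^sub>R axis j 1"
  by (simp add: algebra_simps)
 have "h * h * ?g (y + a *\<^sub>R axis i 1 + b *\<^sub>R axis j 1) = h * h * ?g' (y + a' *\<^sub>R axis j 1 + b' *\<^sub>R axis i 1)"
  using ab(5) ab'(5) unfolding sw by linarith
 then have eq: "?g (y + a *\<^sub>R axis i 1 + b *\<^sub>R axis j 1) = ?g' (y + a' *\<^sub>R axis j 1 + b' *\<^sub>R axis i 1)"
  using h(1) by simp
 have "dist (?g (y + a *\<^sub>R axis i 1 + b *\<^sub>R axis j 1)) (?g y) < \<bar>?g y - ?g' y\<bar> / 2"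
  by (rule d1(2), rule le_less_trans[OF near]) (use ab h in auto)
 moreover have "dist (?g' (y + a' *\<^sub>R axis j 1 + b' *\<^sub>R axis i 1)) (?g' y) < \<bar>?g y - ?g' y\<bar> / 2"
  by (rule d2(2), rule le_less_trans[OF near]) (use ab' h in auto)
 ultimately show False using eq unfolding dist_real_def by argo
qed

subsection \<open>Iterated partial derivatives\<close>

lemma foldr_pd_cong:
 assumes "open S" "!!z. z \<in> S ==> f z = g z" "y \<in> S"
 shows "foldr pd l f y = foldr pd l g y"
proof -
 have "y \<in> S ==> foldr pd l f y = foldr pd l g y" for y
 proof (induction l arbitrary: y)
  case (Cons a l)
  then show ?case using pd_cong[OF assms(1) Cons.prems Cons.IH] by simp
 qed (simp add: assms(2))
 then show ?thesis using assms(3) by blast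
qed

lemma sm_foldr_pd: "Sm S f ==> Sm S (foldr pd l f)"
 by (induction l) (auto intro: sm_pd)

lemma foldr_pd_move:
 assumes "open S" "Sm S f" "y \<in> S"
 shows "foldr pd (l1 @ x # l2) f y = pd x (foldr pd (l1 @ l2) f) y"
 using assms(3)
proof (induction l1 arbitrary: y)
 case (Cons a l1)
 have "foldr pd ((a # l1) @ x # l2) f y = pd a (pd x (foldr pd (l1 @ l2) f)) y"
  using Cons.IH by (auto intro: pd_cong[OF assms(1) Cons.prems])
 also have "... = pd x (pd a (foldr pd (l1 @ l2) f)) y"
  by (rule pd_commute[OF assms(1) _ Cons.prems]) (rule sm_foldr_pd[OF assms(2)])
 finally show ?case by simp
qed simp

lemma foldr_pd_perm:
 assumes "open S" "Sm S f"
 shows "mset l = mset l' ==> y \<in> S ==> foldr pd l f y = foldr pd l' f y"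
proof (induction l arbitrary: l' y)
 case (Cons x l)
 then have "x \<in> set l'" by (metis list.set_intros(1) mset_eq_setD)
 then obtain l1 l2 where l': "l' = l1 @ x # l2" by (meson split_list)
 then have "mset l = mset (l1 @ l2)" using Cons.prems(1) by simp
 then have "pd x (foldr pd l f) y = pd x (foldr pd (l1 @ l2) f) y"
  using Cons.IH pd_cong[OF assms(1) Cons.prems(2)] by blast
 then show ?case using foldr_pd_move[OF assms Cons.prems(2)] by (simp add: l')
qed simp

lemma mpd_empty [simp]: "mpd {#} f = f"
 unfolding mpd_def by simp

lemma mset_some: "mset (SOME l. mset l = al) = al"
 by (rule someI_ex) (rule ex_mset)

lemma mpd_foldr:
 assumes "open S" "Sm S f" "y \<in> S" "mset l = al"
 shows "mpd al f y = foldr pd l f y"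
 unfolding mpd_def by (rule foldr_pd_perm[OF assms(1,2) _ assms(3)]) (simp add: mset_some assms(4))

lemma sm_mpd [intro]: "Sm S f ==> Sm S (mpd al f)"
 unfolding mpd_def by (rule sm_foldr_pd)

lemma mpd_cong:
 assumes "open S" "y \<in> S" "!!z. z \<in> S ==> f z = g z"
 shows "mpd al f y = mpd al g y"
 unfolding mpd_def by (rule foldr_pd_cong[OF assms(1,3,2)])

lemma mpd_add_mset:
 assumes "open S" "Sm S f" "y \<in> S"
 shows "mpd (am i al) f y = pd i (mpd al f) y"
proof -
 obtain l where l: "mset l = al" using ex_mset by blast
 have "mpd (am i al) f y = foldr pd (i # l) f y" by (rule mpd_foldr[OF assms]) (simp add: l)
 also have "... = pd i (mpd al f) y"
  using mpd_foldr[OF assms(1,2) _ l] by (auto intro: pd_cong[OF assms(1,3)])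
 finally show ?thesis .
qed

lemma mpd_single: "mpd {#i#} f = pd i f"
proof -
 have "mset (SOME l. mset l = {#i#}) = {#i#}" by (rule mset_some)
 then have "(SOME l. mset l = {#i#}) = [i]" by simp
 then show ?thesis unfolding mpd_def by simp
qed

lemma mpd_pd:
 assumes "open S" "Sm S f" "y \<in> S"
 shows "mpd al (pd i f) y = pd i (mpd al f) y"
proof -
 obtain l where l: "mset l = al" using ex_mset by blast
 have "mpd al (pd i f) y = foldr pd (l @ [i]) f y"
  using mpd_foldr[OF assms(1) sm_pd[OF assms(2)] assms(3) l] by simp
 also have "... = pd i (foldr pd l f) y" using foldr_pd_move[OF assms, of l i "[]"] by simp
 also have "... = pd i (mpd al f) y"
  using mpd_foldr[OF assms(1,2) _ l] by (auto intro: pd_cong[OF assms(1,3)])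
 finally show ?thesis .
qed

lemma mpd_zero [simp]: "mpd al (%_. 0) = (%_. 0)"
proof -
 have "pd i (%_. 0) = (%_. 0)" for i :: 'a by (rule ext) (rule pd_const)
 then have "foldr pd l (%_. 0) = (%_. 0)" for l :: "'a list" by (induction l) auto
 then show ?thesis unfolding mpd_def by simp
qed

lemma mpd_add:
 assumes "open S" "Sm S f" "Sm S g" "y \<in> S"
 shows "mpd al (%z. f z + g z) y = mpd al f y + mpd al g y"
 using assms(4)
proof (induction al arbitrary: y)
 case (add i al)
 have "mpd (am i al) (%z. f z + g z) y = pd i (%z. mpd al f z + mpd al g z) y"
  unfolding mpd_add_mset[OF assms(1) sm_add[OF assms(1-3)] add.prems]
  using add.IH by (auto intro: pd_cong[OF assms(1) add.prems])
 also have "... = pd i (mpd al f) y + pd i (mpd al g) y"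
  using sm_diffble assms add.prems by (intro pd_add) blast+
 finally show ?case using mpd_add_mset assms(1-3) add.prems by metis
qed simp

lemma mpd_cmult:
 assumes "open S" "Sm S f" "y \<in> S"
 shows "mpd al (%z. c * f z) y = c * mpd al f y"
 using assms(3)
proof (induction al arbitrary: y)
 case (add i al)
 have "mpd (am i al) (%z. c * f z) y = pd i (%z. c * mpd al f z) y"
  unfolding mpd_add_mset[OF assms(1) sm_mult[OF assms(1) sm_const assms(2)] add.prems]
  using add.IH by (auto intro: pd_cong[OF assms(1) add.prems])
 also have "... = c * pd i (mpd al f) y"
  using sm_diffble assms add.prems by (intro pd_cmult) blast
 finally show ?case using mpd_add_mset assms(1-2) add.prems by metis
qed simp

lemma mpd_sum:
 assumes "open S" "finite I" "!!i. i \<in> I ==> Sm S (f i)" "y \<in> S"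
 shows "mpd al (%z. \<Sum>i\<in>I. f i z) y = (\<Sum>i\<in>I. mpd al (f i) y)"
 using assms(2,3)
proof (induction I rule: finite_induct)
 case (insert x F)
 have "Sm S (%z. \<Sum>i\<in>F. f i z)" by (rule sm_sum) (use assms(1) insert.prems in auto)
 then show ?case using mpd_add[OF assms(1) _ _ assms(4), of "f x" "%z. \<Sum>i\<in>F. f i z"] insert by simp
qed simp

subsection \<open>Bump functions and antiderivatives\<close>

text \<open>The functions p(1/t) exp(-1/t), continued by zero to t \<le> 0, are closed under
  differentiation. Carrying the polynomial turns the smoothness of exp(-1/t) into an explicit tower
  of derivatives.\<close>

definition flat_exp :: "real poly => real => real" where
 "flat_exp p t = (if t > 0 then poly p (1 / t) * exp (- 1 / t) else 0)"

lemma poly_over_exp_tendsto_0: "((%x. poly p x / exp x) \<longlongrightarrow> (0::real)) at_top"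
proof -
 have "((%x. \<Sum>i\<le>degree p. coeff p i * (x ^ i / exp x)) \<longlongrightarrow> (\<Sum>i\<le>degree p. coeff p i * 0)) at_top"
  by (intro tendsto_sum tendsto_mult tendsto_const tendsto_power_div_exp_0)
 then show ?thesis by (simp add: poly_altdef sum_divide_distrib)
qed

text \<open>With x = 1/t one has dx/dt = - x^2, whence the factor x^2 and the difference p - p'. At
  the origin only the right-hand difference quotient needs work: it is x p(x) / exp x as x tends to
  infinity.\<close>

lemma flat_exp_derivative:
 "(flat_exp p has_field_derivative flat_exp ([:0, 0, 1:] * (p - pderiv p)) t) (at t)"
proof -
 consider "t > 0" | "t < 0" | "t = 0" by linarith
 then show ?thesis
 proof cases
  case 1
  have "((%t. poly p (1 / t) * exp (- 1 / t)) has_field_derivative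
    flat_exp ([:0, 0, 1:] * (p - pderiv p)) t) (at t)"
   using 1 by (auto intro!: derivative_eq_intros poly_DERIV[THEN DERIV_chain2]
     simp: flat_exp_def field_simps power2_eq_square)
  then show ?thesis
   by (rule has_field_derivative_transform_within_open[of _ _ _ "{0<..}"])
    (use 1 in "auto simp: flat_exp_def")
 next
  case 2
  have "((%t. 0) has_field_derivative flat_exp ([:0, 0, 1:] * (p - pderiv p)) t) (at t)"
   using 2 by (auto simp: flat_exp_def)
  then show ?thesis
   by (rule has_field_derivative_transform_within_open[of _ _ _ "{..<0}"])
    (use 2 in "auto simp: flat_exp_def")
 next
  case 3
  have "((%h. flat_exp p h / h) \<longlongrightarrow> 0) (at_right 0)"
   unfolding filterlim_at_right_to_top
  proof (rule Lim_transform_eventually[OF poly_over_exp_tendsto_0[of "pCons 0 p"]])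
   show "\<forall>\<^sub>F x in at_top. poly (pCons 0 p) x / exp x = flat_exp p (inverse x) / inverse x"
    by (rule eventually_mono[OF eventually_gt_at_top[of 0]])
     (auto simp: flat_exp_def field_simps exp_minus)
  qed
  moreover have "((%h. flat_exp p h / h) \<longlongrightarrow> 0) (at_left 0)"
   by (rule Lim_transform_eventually[OF tendsto_const])
    (auto simp: flat_exp_def eventually_at_filter)
  ultimately have "((%h. flat_exp p h / h) \<longlongrightarrow> 0) (at 0)" by (simp add: filterlim_split_at)
  then show ?thesis using 3 by (simp add: DERIV_def flat_exp_def)
 qed
qed

lemma sm_flat_exp:
 fixes S :: "(real^'n::finite) set"
 assumes "open S" "Sm S f"
 shows "Sm S (%y. flat_exp 1 (f y))"
proof -
 let ?P = "%m. ((%p. [:0, 0, 1:] * (p - pderiv p)) ^^ m) 1"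
 have "(flat_exp (?P m) has_field_derivative flat_exp (?P (Suc m)) t) (at t)" for m t
  using flat_exp_derivative by simp
 from sm_real_compose[of S "%m. flat_exp (?P m)", OF assms(1) this assms(2)]
 show ?thesis by simp
qed

lemma norm_vec_power2: "(norm (v :: real^'n::finite))\<^sup>2 = (SU j. (v $ j)\<^sup>2)"
 unfolding power2_norm_eq_inner inner_vec_def by (simp add: power2_eq_square)

lemma bump_function:
 fixes y0 :: "real^'n::finite"
 assumes "r > 0"
 shows "\<exists>rh. Sm UNIV rh & (\<forall>y\<in>ball y0 (r / 2). rh y = 1) & (\<forall>y. y ~: ball y0 r --> rh y = 0)"
proof -
 \<comment> \<open>The scaling gives q < 1/2 on the inner ball and q \<ge> 2 off the outer one. So
   \<open>flat_exp 1 (q y - 1)\<close> vanishes inside and is at least exp(-1) outside, and applying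
   \<open>flat_exp 1\<close> to exp(-1) minus it yields a positive constant inside and zero
   outside.\<close>
 define q where "q y = 2 / r\<^sup>2 * (SU j. (y $ j - y0 $ j)\<^sup>2)" for y
 have q: "q y = 2 * (dist y0 y / r)\<^sup>2" for y
  by (simp add: q_def dist_norm norm_minus_commute[of y0] norm_vec_power2 power_divide)
 define rh where "rh y = flat_exp 1 (exp (-1) - flat_exp 1 (q y - 1)) * (1 / flat_exp 1 (exp (-1)))" for y
 have "Sm UNIV q" unfolding q_def by (intro smooth_intros open_UNIV)
 then have "Sm UNIV rh" unfolding rh_def
  by (intro smooth_intros sm_flat_exp open_UNIV)
 moreover have "rh y = 1" if "y \<in> ball y0 (r / 2)" for y
 proof -
  have "dist y0 y / r < 1 / 2" using that assms by (simp add: field_simps)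
  then have "(dist y0 y / r)\<^sup>2 < (1 / 2)\<^sup>2" using assms by (intro power_strict_mono) auto
  moreover have "(1 / 2 :: real)\<^sup>2 = 1 / 4" by (simp add: power2_eq_square)
  ultimately have "q y \<le> 1" unfolding q by linarith
  then show ?thesis by (simp add: rh_def flat_exp_def)
 qed
 moreover have "rh y = 0" if "y ~: ball y0 r" for y
 proof -
  have "dist y0 y / r \<ge> 1" using that assms by (simp add: field_simps)
  then have "(dist y0 y / r)\<^sup>2 \<ge> 1" by (simp add: one_le_power)
  then have "q y \<ge> 2" unfolding q by linarith
  then have "flat_exp 1 (q y - 1) \<ge> exp (-1)" by (simp add: flat_exp_def field_simps)
  then show ?thesis by (simp add: rh_def flat_exp_def)
 qed
 ultimately show ?thesis by blast
qed

text \<open>Slides the \<open>i\<close>-th coordinate towards that of \<open>y0\<close>: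
  \<open>ta = 1\<close> gives \<open>y\<close>, and \<open>ta = 0\<close> gives the foot on the
  hyperplane through \<open>y0\<close>. Integrating along this segment over a fixed interval avoids
  variable limits.\<close>

definition shrink :: "'n::finite => real^'n => real => real^'n => real^'n" where
 "shrink i y0 ta y = (\<chi> j. if j = i then y0 $ i + ta * (y $ i - y0 $ i) else y $ j)"

lemma shrink_in_ball: "0 \<le> ta ==> ta \<le> 1 ==> y \<in> ball y0 r ==> shrink i y0 ta y \<in> ball y0 r"
proof -
 assume *: "0 \<le> ta" "ta \<le> 1" "y \<in> ball y0 r"
 have "norm (shrink i y0 ta y - y0) \<le> norm (y - y0)"
  by (rule norm_le_componentwise_cart)
   (use * in "auto simp: shrink_def abs_mult intro: mult_left_le_one_le")
 then show ?thesis using * by (simp add: dist_norm norm_minus_commute)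
qed

lemma pd_shrink:
 assumes "Sm (ball y0 r) f" "0 \<le> ta" "ta \<le> 1" "y \<in> ball y0 r"
 shows "(%y. f (shrink i y0 ta y)) differentiable (at y)"
  "pd j (%y. f (shrink i y0 ta y)) y = (if j = i then ta else 1) * pd j f (shrink i y0 ta y)"
proof -
 let ?Ph = "%j y. if j = i then y0 $ i + ta * (y $ i - y0 $ i) else y $ j"
 have sm: "Sm UNIV (?Ph j)" for j
  by (cases "j = i") (simp_all, (intro smooth_intros open_UNIV)+)
 have d: "?Ph j differentiable (at y)" for j using sm_diffble[OF sm] by blast
 have d': "f differentiable (at (\<chi> j. ?Ph j y))"
  using sm_diffble[OF assms(1)] shrink_in_ball[OF assms(2-4)] by (simp add: shrink_def)
 have c: "(%z. z $ k) differentiable (at y)" for k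
  using sm_diffble[of UNIV "%z. z $ k"] sm_coord by blast
 have "pd j (?Ph m) y = (if j = m then (if j = i then ta else 1) else 0)" for m
 proof (cases "m = i")
  case True
  have "pd j (%y. y0 $ i + ta * (y $ i - y0 $ i)) y = ta * pd j (%y. y $ i) y"
   using c[of i] by (simp add: pd_add pd_cmult pd_diff)
  then show ?thesis using True by simp
 qed simp
 then show "pd j (%y. f (shrink i y0 ta y)) y = (if j = i then ta else 1) * pd j f (shrink i y0 ta y)"
  using chain_rule_pd(2)[of ?Ph y f j, OF d d'] unfolding shrink_def
  by (simp add: mult_if cong: if_cong)
 show "(%y. f (shrink i y0 ta y)) differentiable (at y)"
  using chain_rule_pd(1)[of ?Ph y f, OF d d'] unfolding shrink_def .
qed

lemma continuous_on_shrink: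
 assumes "continuous_on (ball y0 r) f"
 shows "continuous_on (ball y0 r \<times> {0..1}) (%(y, ta). f (shrink i y0 ta y))"
proof -
 have "continuous_on (ball y0 r \<times> {0..1::real}) (%x. shrink i y0 (snd x) (fst x))"
  unfolding shrink_def
 proof (rule continuous_on_vec_lambda)
  fix j
  show "continuous_on (ball y0 r \<times> {0..1::real})
   (%x. if j = i then y0 $ i + snd x * (fst x $ i - y0 $ i) else fst x $ j)"
   by (cases "j = i") (auto intro!: continuous_on_add continuous_on_mult continuous_on_diff
    continuous_on_const continuous_on_fst continuous_on_snd continuous_on_id continuous_on_component)
 qed
 from continuous_on_compose2[OF assms this] show ?thesis
  using shrink_in_ball by (fastforce simp: case_prod_beta)
qed

text \<open>A derivative in direction \<open>i\<close> produces one more factor \<open>ta\<close>,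
  other directions none. With the weight \<open>ta ^ m\<close> built in, the family is closed under
  partial derivatives and smoothness follows by induction.\<close>

definition shrink_integral :: "'n::finite => real^'n => nat => (real^'n => real) => real^'n => real" where
 "shrink_integral i y0 m f y = integral {0..1} (%ta. ta ^ m * f (shrink i y0 ta y))"

lemma shrink_integrable:
 assumes "Sm (ball y0 r) f" "y \<in> ball y0 r"
 shows "(%ta. ta ^ m * f (shrink i y0 ta y)) integrable_on {0..1}"
proof -
 have "continuous_on {0..1::real} (%ta. (%(y, ta). f (shrink i y0 ta y)) (y, ta))"
  by (rule continuous_on_compose2[OF continuous_on_shrink[OF sm_continuous[OF assms(1)]]])
   (use assms(2) in "auto intro!: continuous_on_Pair continuous_on_const continuous_on_id")
 then show ?thesis
  by (intro integrable_continuous_interval continuous_on_mult continuous_on_power continuous_on_id) simp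
qed

lemma shrink_integral_derivative:
 fixes y0 :: "real^'n::finite"
 assumes f: "Sm (ball y0 r) f" and y: "y \<in> ball y0 r"
 shows "(shrink_integral i y0 m f has_derivative
  (%v. SU j. v $ j * shrink_integral i y0 (if j = i then Suc m else m) (pd j f) y)) (at y)"
proof -
 \<comment> \<open>The Leibniz rule for parameter integrals expects the derivative as a bounded
   linear map; \<open>B j\<close> is the \<open>j\<close>-th coordinate functional in that
   type.\<close>
 define B :: "'n => ((real^'n) \<Rightarrow>\<^sub>L real)" where "B j = Blinfun (%v. v $ j)" for j
 have B: "blinfun_apply (B j) v = v $ j" for j v
  unfolding B_def by (simp add: bounded_linear_Blinfun_apply bounded_linear_vec_nth)
 define c where "c j z ta = ta ^ (if j = i then Suc m else m) * pd j f (shrink i y0 ta z)" for j z and ta :: real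
 define G where "G z ta = (SU j. c j z ta *\<^sub>R B j)" for z ta
 have cc: "continuous_on (ball y0 r \<times> {0..1}) (%(z, ta). c j z ta)" for j
  using continuous_on_shrink[OF sm_continuous[OF sm_pd[OF f]], of j i]
  unfolding c_def case_prod_beta
  by (intro continuous_on_mult continuous_on_power continuous_on_snd continuous_on_id)
 have cG: "continuous_on (ball y0 r \<times> {0..1}) (%(z, ta). G z ta)"
  unfolding G_def case_prod_beta
  by (intro continuous_on_sum continuous_on_scaleR continuous_on_const cc[unfolded case_prod_beta])
 have "((%z. integral (cbox 0 1) (%ta. ta ^ m * f (shrink i y0 ta z))) has_derivative
   blinfun_apply (integral (cbox 0 1) (G y))) (at y within ball y0 r)"
 proof (rule leibniz_rule)
  fix z and ta :: real assume z: "z \<in> ball y0 r" and "ta \<in> cbox 0 1"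
  then have ta: "0 \<le> ta" "ta \<le> 1" by auto
  have "((%z. f (shrink i y0 ta z)) has_derivative
    (%v. SU j. v $ j * ((if j = i then ta else 1) * pd j f (shrink i y0 ta z)))) (at z)"
   using has_derivative_pd[OF pd_shrink(1)[OF f ta z]] pd_shrink(2)[OF f ta z] by simp
  from has_derivative_mult_right[OF this, of "ta ^ m"]
  have "((%z. ta ^ m * f (shrink i y0 ta z)) has_derivative blinfun_apply (G z ta)) (at z)"
   by (rule has_derivative_eq_rhs)
    (auto simp: G_def c_def blinfun.sum_left blinfun.scaleR_left B sum_distrib_left fun_eq_iff
     intro!: sum.cong)
  then show "((%z. ta ^ m * f (shrink i y0 ta z)) has_derivative blinfun_apply (G z ta)) (at z within ball y0 r)"
   by (rule has_derivative_at_withinI)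
 next
  show "(%ta. ta ^ m * f (shrink i y0 ta z)) integrable_on cbox 0 1" if "z \<in> ball y0 r" for z
   using shrink_integrable[OF f that] by simp
 qed (use cG y in auto)
 moreover have "at y within ball y0 r = at y" by (rule at_within_open[OF y open_ball])
 moreover have *: "blinfun_apply (integral (cbox 0 1) (G y)) v =
   (SU j. v $ j * shrink_integral i y0 (if j = i then Suc m else m) (pd j f) y)" for v
 proof -
  have "continuous_on {0..1::real} (%ta. (%(z, ta). G z ta) (y, ta))"
   by (rule continuous_on_compose2[OF cG])
    (use y in "auto intro!: continuous_on_Pair continuous_on_const continuous_on_id")
  then have "G y integrable_on cbox 0 1" by (simp add: integrable_continuous_interval)
  then have "blinfun_apply (integral (cbox 0 1) (G y)) v = integral (cbox 0 1) (%ta. blinfun_apply (G y ta) v)"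
   by (rule blinfun_apply_integral)
  also have "... = integral {0..1} (%ta. SU j. v $ j * c j y ta)"
   by (simp add: G_def blinfun.sum_left blinfun.scaleR_left B mult.commute)
  also have "... = (SU j. integral {0..1} (%ta. v $ j * c j y ta))"
   unfolding c_def
   by (rule integral_sum) (use shrink_integrable[OF sm_pd[OF f] y] in "auto intro: integrable_on_mult_right simp del: power_Suc")
  finally show ?thesis by (simp add: c_def shrink_integral_def)
 qed
 have "blinfun_apply (integral (cbox 0 1) (G y)) =
   (%v. SU j. v $ j * shrink_integral i y0 (if j = i then Suc m else m) (pd j f) y)"
  by (rule ext) (rule *)
 ultimately show ?thesis unfolding shrink_integral_def by simp
qed

lemma sm_shrink_integral:
 assumes "Sm (ball y0 r) f"
 shows "Sm (ball y0 r) (shrink_integral i y0 m f)"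
proof -
 have "Ck_on s (ball y0 r) (shrink_integral i y0 m f)" if "Sm (ball y0 r) f" for s f m
  using that
 proof (induction s arbitrary: f m)
  case 0
  show ?case unfolding Ck_on.simps
   by (intro continuous_at_imp_continuous_on ballI has_derivative_continuous[OF shrink_integral_derivative[OF 0]])
 next
  case (Suc s)
  have "shrink_integral i y0 m f differentiable_on ball y0 r"
   using shrink_integral_derivative[OF Suc.prems]
   unfolding differentiable_on_eq_differentiable_at[OF open_ball] differentiable_def by blast
  moreover have "Ck_on s (ball y0 r) (pd j (shrink_integral i y0 m f))" for j
  proof (rule Ck_on_cong[OF open_ball _ Suc.IH[OF sm_pd[OF Suc.prems, of j], of "if j = i then Suc m else m"]])
   show "shrink_integral i y0 (if j = i then Suc m else m) (pd j f) z = pd j (shrink_integral i y0 m f) z"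
    if "z \<in> ball y0 r" for z
    using pd_eqI[OF shrink_integral_derivative[OF Suc.prems that], of j i m]
    by (simp add: axis_def mult_if cong: if_cong)
  qed
  ultimately show ?case by simp
 qed
 then show ?thesis using assms unfolding smooth_on_def by blast
qed

text \<open>The antiderivative is the integral of \<open>f\<close> along the
  \<open>i\<close>-direction from the hyperplane through \<open>y0\<close>. Its purpose comes later:
  it makes an arbitrary coefficient function a derivative of the component of a vector field that
  vanishes at the point.\<close>

lemma smooth_antiderivative:
 fixes y0 :: "real^'n::finite"
 assumes f: "Sm (ball y0 r) f"
 shows "\<exists>h. Sm (ball y0 r) h & (\<forall>y\<in>ball y0 r. pd i h y = f y) & h y0 = 0"
proof -
 define h where "h y = (y $ i - y0 $ i) * shrink_integral i y0 0 f y" for y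
 have sm: "Sm (ball y0 r) (%y. y $ i - y0 $ i)" by (intro smooth_intros open_ball)
 have sh: "Sm (ball y0 r) h" unfolding h_def
  using sm_mult[OF open_ball sm sm_shrink_integral[OF f]] .
 moreover have "pd i h y = f y" if y: "y \<in> ball y0 r" for y
 proof -
  have d: "(%z. z $ i) differentiable (at y)" 
   using sm_diffble[of UNIV "%z. z $ i"] sm_coord by blast
  have "pd i h y = (y $ i - y0 $ i) * pd i (shrink_integral i y0 0 f) y
    + pd i (%y. y $ i - y0 $ i) y * shrink_integral i y0 0 f y"
   unfolding h_def
   by (intro pd_mult sm_diffble[OF sm open_ball y]
    sm_diffble[OF sm_shrink_integral[OF f] open_ball y])
  also have "pd i (%y. y $ i - y0 $ i) y = 1" using d by (simp add: pd_diff)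
  also have "pd i (shrink_integral i y0 0 f) y = shrink_integral i y0 1 (pd i f) y"
   using pd_eqI[OF shrink_integral_derivative[OF f y], of i i 0]
   by (simp add: axis_def mult_if cong: if_cong)
  finally have *: "pd i h y = (y $ i - y0 $ i) * shrink_integral i y0 1 (pd i f) y + shrink_integral i y0 0 f y"
   by simp
  \<comment> \<open>The integrand is the derivative in \<open>ta\<close> of \<open>ta\<close> times
    \<open>f\<close> on the segment, so the integral is the value at the endpoint
    \<open>y\<close>.\<close>
  have "((%ta. f (shrink i y0 ta y) + ta * ((y $ i - y0 $ i) * pd i f (shrink i y0 ta y)))
    has_integral (1 * f (shrink i y0 1 y) - 0 * f (shrink i y0 0 y))) {0..1}"
  proof (rule fundamental_theorem_of_calculus)
   fix ta :: real assume "ta \<in> {0..1}"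
   then have ta: "0 \<le> ta" "ta \<le> 1" by auto
   have eq: "shrink i y0 ta y = shrink i y0 0 y + (ta * (y $ i - y0 $ i)) *\<^sub>R axis i 1" for ta
    by (simp add: vec_eq_iff shrink_def axis_def)
   have "((%t. f (shrink i y0 0 y + t *\<^sub>R axis i 1)) has_field_derivative
     pd i f (shrink i y0 ta y)) (at (ta * (y $ i - y0 $ i)))"
    using has_field_derivative_line[of f "shrink i y0 0 y" "ta * (y $ i - y0 $ i)" i]
     sm_diffble[OF f open_ball shrink_in_ball[OF ta y]] eq by metis
   moreover have "((%ta. ta * (y $ i - y0 $ i)) has_field_derivative (y $ i - y0 $ i)) (at ta)"
    by (auto intro!: derivative_eq_intros)
   ultimately have "((%ta. f (shrink i y0 0 y + (ta * (y $ i - y0 $ i)) *\<^sub>R axis i 1)) has_field_derivative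
     pd i f (shrink i y0 ta y) * (y $ i - y0 $ i)) (at ta)"
    by (rule DERIV_chain2)
   then have "((%ta. f (shrink i y0 ta y)) has_field_derivative
     pd i f (shrink i y0 ta y) * (y $ i - y0 $ i)) (at ta)"
    by (simp only: eq[symmetric])
   from DERIV_mult[OF DERIV_ident this]
   have "((%ta. ta * f (shrink i y0 ta y)) has_field_derivative
     f (shrink i y0 ta y) + ta * ((y $ i - y0 $ i) * pd i f (shrink i y0 ta y))) (at ta)"
    by (rule DERIV_cong) (simp add: algebra_simps)
   then show "((%ta. ta * f (shrink i y0 ta y)) has_vector_derivative
     f (shrink i y0 ta y) + ta * ((y $ i - y0 $ i) * pd i f (shrink i y0 ta y))) (at ta within {0..1})"
    unfolding has_real_derivative_iff_has_vector_derivative[symmetric]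
    by (rule has_field_derivative_at_within)
  qed simp
  moreover have "shrink i y0 1 y = y" by (simp add: shrink_def vec_eq_iff)
  ultimately have "integral {0..1} (%ta. f (shrink i y0 ta y) + ta * ((y $ i - y0 $ i) * pd i f (shrink i y0 ta y))) = f y"
   by (simp add: integral_unique)
  also have "(%ta. f (shrink i y0 ta y) + ta * ((y $ i - y0 $ i) * pd i f (shrink i y0 ta y)))
   = (%ta. ta ^ 0 * f (shrink i y0 ta y) + (y $ i - y0 $ i) * (ta ^ 1 * pd i f (shrink i y0 ta y)))"
   by (simp add: fun_eq_iff)
  also have "integral {0..1} ... = integral {0..1} (%ta. ta ^ 0 * f (shrink i y0 ta y))
    + integral {0..1} (%ta. (y $ i - y0 $ i) * (ta ^ 1 * pd i f (shrink i y0 ta y)))"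
   by (intro integral_add integrable_on_mult_right shrink_integrable[OF f y]
    shrink_integrable[OF sm_pd[OF f] y])
  also have "... = shrink_integral i y0 0 f y + (y $ i - y0 $ i) * shrink_integral i y0 1 (pd i f) y"
   unfolding shrink_integral_def by (simp only: integral_mult_right)
  finally show ?thesis using * by simp
 qed
 moreover have "h y0 = 0" by (simp add: h_def)
 ultimately show ?thesis by blast
qed

section \<open>Sums over index lists\<close>

lemma finite_lists_length [simp, intro]: "finite {b :: 'b::finite list. length b = p}"
 using finite_lists_length_eq[of "UNIV :: 'b set" p] by simp

lemma finite_multisets_less [simp, intro]: "finite {be :: 'b::finite multiset. size be < m}"
proof -
 have "{be :: 'b multiset. size be < m} \<subseteq> mset ` {l. set l \<subseteq> UNIV & length l \<le> m}"
 proof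
  fix be :: "'b multiset" assume "be \<in> {be. size be < m}"
  moreover obtain l where "mset l = be" using ex_mset by blast
  ultimately show "be \<in> mset ` {l. set l \<subseteq> UNIV & length l \<le> m}" by (auto simp flip: size_mset)
 qed
 moreover have "finite {l. set l \<subseteq> (UNIV :: 'b set) & length l \<le> m}"
  by (rule finite_lists_length_le) simp
 ultimately show ?thesis by (rule finite_surj[rotated])
qed

lemma finite_multisets_le [simp, intro]: "finite {be :: 'b::finite multiset. size be \<le> m}"
 using finite_multisets_less[of "Suc m"] by (simp add: less_Suc_eq_le)

lemma finite_multisets_eq [simp, intro]: "finite {be :: 'b::finite multiset. size be = m}"
 by (rule finite_subset[OF _ finite_multisets_le[of m]]) auto

lemma sum_lists_Suc:
 "(\<Sum>b | length b = Suc p. F b) = (\<Sum>i::'b::finite\<in>UNIV. \<Sum>b\<in>Ls p. F (i # b))"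
proof -
 have "(\<Sum>b | length b = Suc p. F b) = (\<Sum>x\<in>UNIV \<times> (Ls p). F (fst x # snd x))"
  by (rule sum.reindex_bij_witness[of _ "%x. fst x # snd x" "%b. (hd b, tl b)"])
   (auto simp: length_Suc_conv)
 then show ?thesis by (simp add: sum.cartesian_product case_prod_beta)
qed

lemma prod_sum_lists:
 fixes f :: "nat => 'b::finite => 'c::comm_semiring_1"
 shows "(\<Prod>s<p. SU m. f s m) = (\<Sum>K\<in>Ls p. \<Prod>s<p. f s (K ! s))"
proof (induction p arbitrary: f)
 case (Suc p)
 have "(\<Prod>s<Suc p. SU m. f s m) = (SU m. f 0 m) * (\<Prod>s<p. SU m. f (Suc s) m)"
  by (rule prod.lessThan_Suc_shift)
 also have "... = (SU m. f 0 m) * (\<Sum>K\<in>Ls p. \<Prod>s<p. f (Suc s) (K ! s))"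
  unfolding Suc.IH ..
 also have "... = (\<Sum>K | length K = Suc p. \<Prod>s<Suc p. f s (K ! s))"
  unfolding sum_lists_Suc prod.lessThan_Suc_shift
  by (simp add: sum_distrib_left sum_distrib_right sum.swap[of _ "UNIV"])
 finally show ?case .
qed simp

lemma prod_delta_lists:
 "length I = p ==> length J = p ==>
  (\<Prod>s<p. if I ! s = J ! s then 1 else 0) = (if I = J then 1 else (0::real))"
proof (cases "I = J")
 case False
 assume "length I = p" "length J = p"
 then obtain s where "s < p" "I ! s ~= J ! s" using False nth_equalityI by metis
 then have "(\<Prod>s<p. if I ! s = J ! s then 1 else (0::real)) = 0"
  by (intro prod_zero) (auto intro: bexI[of _ s])
 then show ?thesis using False by simp
qed simp

section \<open>Alternating tensors, pullback and exterior derivative on index lists\<close>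

definition swp :: "nat => nat => 'b list => 'b list" where
 "swp s t I = I[s := I ! t, t := I ! s]"

definition tps :: "nat => nat => nat => nat" where
 "tps s t r = (if r = s then t else if r = t then s else r)"

lemma length_swp [simp]: "length (swp s t I) = length I"
 by (simp add: swp_def)

lemma nth_swp: "s < length I ==> t < length I ==> r < length I ==> swp s t I ! r = I ! tps s t r"
 by (auto simp: swp_def nth_list_update tps_def)

lemma swp_swp [simp]: "s < length I ==> t < length I ==> swp s t (swp s t I) = I"
 by (rule nth_equalityI) (auto simp: nth_swp tps_def)

lemma alt_swp:
 "alternating p a \<longleftrightarrow> (\<forall>I. length I ~= p --> a I = 0) &
  (\<forall>I s t. length I = p --> s < p --> t < p --> s ~= t --> a (swp s t I) = - a I)"
proof -
 have "a (swp s t I) = - a I"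
  if "\<forall>I. length I ~= p --> a I = 0" "\<forall>I s t. length I = p --> s < p --> t < p --> s ~= t --> a (swp s t I) = - a I"
   "s < length I" "t < length I" "s ~= t" for I s t
  using that by (cases "length I = p") auto
 then show ?thesis unfolding alternating_def swp_def[symmetric] by blast
qed

lemma alternatingD:
 "alternating p a ==> length I = p ==> s < p ==> t < p ==> s ~= t ==> a (swp s t I) = - a I"
 unfolding alt_swp by blast

lemma alt_length: "alternating p a ==> length I ~= p ==> a I = 0"
 unfolding alternating_def by blast

lemma alt_not_distinct: "alternating p a ==> \<not> distinct I ==> a I = 0"
proof -
 assume a: "alternating p a" and "\<not> distinct I"
 then obtain s t where st: "s < length I" "t < length I" "s ~= t" "I ! s = I ! t"
  by (auto simp: distinct_conv_nth)
 then have "swp s t I = I" by (simp add: swp_def) (metis list_update_id list_update_same_conv)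
 then show ?thesis using a st alternatingD[of p a I s t] alt_length[of p a I]
  by (cases "length I = p") auto
qed

lemma sum_swp:
 "s < p ==> t < p ==> (\<Sum>J :: 'b::finite list | length J = p. F (swp s t J)) = (\<Sum>J\<in>Ls p. F J)"
 by (rule sum.reindex_bij_witness[of _ "swp s t" "swp s t"]) auto

lemma prod_swp:
 assumes "s < p" "t < p" "length I = p" "length J = p"
 shows "(\<Prod>r<p. M (swp s t I ! r) (swp s t J ! r)) = (\<Prod>r<p. (M (I ! r) (J ! r) :: real))"
proof -
 have "(\<Prod>r<p. M (swp s t I ! r) (swp s t J ! r)) = (\<Prod>r<p. M (I ! tps s t r) (J ! tps s t r))"
  using assms by (intro prod.cong) (auto simp: nth_swp)
 also have "... = (\<Prod>r<p. M (I ! r) (J ! r))"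
  by (rule prod.reindex_bij_witness[of _ "tps s t" "tps s t"])
   (use assms in "auto simp: tps_def")
 finally show ?thesis .
qed

lemma alt_zero [simp]: "alternating p (%_. 0)"
 unfolding alternating_def by simp

lemma alt_add: "alternating p a ==> alternating p b ==> alternating p (%I. a I + b I)"
 unfolding alternating_def by simp

lemma alt_cmult: "alternating p a ==> alternating p (%I. c * a I)"
 unfolding alternating_def by simp

lemma alt_sum: "(!!i. i \<in> S ==> alternating p (a i)) ==> alternating p (%I. \<Sum>i\<in>S. a i I)"
 unfolding alternating_def by (simp add: sum_negf)

text \<open>The pullback of a covariant tensor along the matrix \<open>M\<close>; for
  \<open>M\<close> the Jacobian of a transition this is the transformation law in
  \<open>forms\<close>.\<close>

definition pb :: "nat => ('n::finite => 'n => real) => ('n list => real) => 'n list => real" where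
 "pb p M et I = (if length I = p then \<Sum>J\<in>Ls p. (\<Prod>s<p. M (I ! s) (J ! s)) * et J else 0)"

lemma alt_pb: "alternating p et ==> alternating p (pb p M et)"
 unfolding alt_swp[of p "pb p M et"]
proof (intro conjI allI impI)
 fix I :: "'a list" and s t
 assume a: "alternating p et" and st: "length I = p" "s < p" "t < p" "s ~= t"
 have "pb p M et (swp s t I) = (\<Sum>J\<in>Ls p. (\<Prod>r<p. M (swp s t I ! r) (swp s t J ! r)) * et (swp s t J))"
  unfolding pb_def using st sum_swp[of s p t "%J. (\<Prod>r<p. M (swp s t I ! r) (J ! r)) * et J"] by simp
 also have "... = (\<Sum>J\<in>Ls p. - ((\<Prod>r<p. M (I ! r) (J ! r)) * et J))"
  using st alternatingD[OF a] by (intro sum.cong) (auto simp: prod_swp)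
 finally show "pb p M et (swp s t I) = - pb p M et I" using st by (simp add: pb_def sum_negf)
qed (simp add: pb_def)

lemma pb_pb: "pb p M (pb p N et) = pb p (%i j. SU m. M i m * N m j) et"
proof
 fix I :: "'a list"
 show "pb p M (pb p N et) I = pb p (%i j. SU m. M i m * N m j) et I"
 proof (cases "length I = p")
  case True
  have "pb p M (pb p N et) I = (\<Sum>K\<in>Ls p. \<Sum>J\<in>Ls p.
    (\<Prod>s<p. M (I ! s) (K ! s)) * ((\<Prod>s<p. N (K ! s) (J ! s)) * et J))"
   by (simp add: pb_def True sum_distrib_left)
  also have "... = (\<Sum>J\<in>Ls p. \<Sum>K\<in>Ls p.
    (\<Prod>s<p. M (I ! s) (K ! s) * N (K ! s) (J ! s)) * et J)"
   by (subst sum.swap) (simp add: prod.distrib mult.assoc)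
  also have "... = (\<Sum>J\<in>Ls p. (\<Prod>s<p. SU m. M (I ! s) m * N m (J ! s)) * et J)"
   by (simp add: prod_sum_lists sum_distrib_right)
  finally show ?thesis by (simp add: pb_def True)
 qed (simp add: pb_def)
qed

lemma pb_id: "(!!I. length I ~= p ==> et I = 0) ==> pb p (%i j. if i = j then 1 else 0) et = et"
proof
 fix I :: "'a list" assume *: "!!I. length I ~= p ==> et I = 0"
 show "pb p (%i j. if i = j then 1 else 0) et I = et I"
 proof (cases "length I = p")
  case True
  have "pb p (%i j. if i = j then 1 else 0) et I = (\<Sum>J\<in>Ls p. (if I = J then 1 else 0) * et J)"
   unfolding pb_def using True by (auto intro!: sum.cong simp: prod_delta_lists)
  also have "... = (\<Sum>J\<in>Ls p. if I = J then et J else 0)" by (intro sum.cong) auto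
  also have "... = et I" using True by (simp add: sum.delta)
  finally show ?thesis .
 qed (use * in "simp add: pb_def")
qed

text \<open>The components of \<open>d\<omega>\<close> in terms of \<open>A i b = \<partial>\<^sub>i \<omega>\<^sub>b\<close>, without signs: moving the new index to the
  position \<open>s\<close> in \<open>b\<close> costs \<open>(-1)\<^sup>s\<close>.\<close>

definition dform :: "('n::finite => 'n list => real) => 'n list => real" where
 "dform A I = (case I of [] => 0 | i # b => A i b - (\<Sum>s<length b. A (b ! s) (b[s := i])))"

lemma swp_Cons_Suc: "s < length b ==> t < length b ==> swp (Suc s) (Suc t) (i # b) = i # swp s t b"
 by (simp add: swp_def)

lemma swp_Cons_0: "q < length b ==> swp 0 (Suc q) (i # b) = b ! q # b[q := i]"
 by (simp add: swp_def)

lemma swp_commute: "swp s t I = swp t s I"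
 unfolding swp_def by (cases "s = t") (auto simp: list_update_swap)

lemma swp_update:
 assumes "q < length b" "r < length b" "q ~= r" "s < length b"
 shows "(swp q r b)[s := i] = swp q r (b[tps q r s := i])"
 using assms by (auto simp: swp_def tps_def list_eq_iff_nth_eq nth_list_update)

text \<open>A transposition either involves position 0 or not. Exchanging the head with entry
  \<open>q\<close> swaps the leading term with the \<open>q\<close>-th summand, and the other
  summands change sign because \<open>A\<close> alternates; a transposition inside the tail merely
  permutes the summands, with a sign.\<close>

lemma alt_dform:
 assumes a: "!!i. alternating p (A i)"
 shows "alternating (Suc p) (dform A)"
 unfolding alt_swp[of "Suc p"]
proof (intro conjI allI impI)
 fix I :: "'a list" assume "length I ~= Suc p"
 then show "dform A I = 0"
  using alt_length[OF a] by (auto simp: dform_def split: list.split)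
next
 fix I :: "'a list" and s t assume I: "length I = Suc p" and st: "s < Suc p" "t < Suc p" "s ~= t"
 obtain i b where Ib: "I = i # b" and b: "length b = p" using I by (auto simp: length_Suc_conv)
 have head: "dform A (swp 0 (Suc q) (i # b)) = - dform A (i # b)" if q: "q < p" for q
 proof -
  have "A ((b[q := i]) ! s) (b[q := i, s := b ! q]) =
    (if s = q then A i b else - A (b ! s) (b[s := i]))" if "s < p" for s
  proof (cases "s = q")
   case False
   have "b[q := i, s := b ! q] = swp q s (b[s := i])"
    using False q that b by (auto simp: swp_def list_eq_iff_nth_eq nth_list_update)
   then show ?thesis using False q that b alternatingD[OF a, of "b[s := i]" q s] by simp
  qed (use q b in simp)
  then have "(\<Sum>s<p. A ((b[q := i]) ! s) (b[q := i, s := b ! q])) =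
    (\<Sum>s<p. if s = q then A i b else - A (b ! s) (b[s := i]))" by simp
  also have "... = A i b + (\<Sum>s\<in>{..<p} - {q}. - A (b ! s) (b[s := i]))"
   using q by (subst sum.remove[of _ q]) (auto intro!: sum.cong)
  also have "(\<Sum>s\<in>{..<p} - {q}. - A (b ! s) (b[s := i])) =
    - ((\<Sum>s<p. A (b ! s) (b[s := i])) - A (b ! q) (b[q := i]))"
   using q by (subst sum.remove[of "{..<p}" q]) (auto simp: sum_negf)
  finally show ?thesis using q b by (simp add: swp_Cons_0 dform_def)
 qed
 have tail: "dform A (i # swp q r b) = - dform A (i # b)" if qr: "q < p" "r < p" "q ~= r" for q r
 proof -
  have "A (swp q r b ! s) ((swp q r b)[s := i]) = - A (b ! tps q r s) (b[tps q r s := i])"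
   if "s < p" for s
  proof -
   have t: "tps q r s < p" using qr that by (auto simp: tps_def)
   have "(swp q r b)[s := i] = swp q r (b[tps q r s := i])"
    using qr that b by (intro swp_update) auto
   then show ?thesis
    using alternatingD[OF a, of "b[tps q r s := i]" q r] qr b that by (simp add: nth_swp)
  qed
  then have "(\<Sum>s<p. A (swp q r b ! s) ((swp q r b)[s := i])) =
    (\<Sum>s<p. - A (b ! tps q r s) (b[tps q r s := i]))" by simp
  also have "... = (\<Sum>s<p. - A (b ! s) (b[s := i]))"
   by (rule sum.reindex_bij_witness[of _ "tps q r" "tps q r"])
    (use qr in "auto simp: tps_def")
  finally show ?thesis using alternatingD[OF a, of b q r] qr b by (simp add: dform_def sum_negf)
 qed
 show "dform A (swp s t I) = - dform A I"
 proof (cases s)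
  case 0
  then show ?thesis using st head[of "t - 1"] Ib by (cases t) auto
 next
  case (Suc s')
  show ?thesis
  proof (cases t)
   case 0
   then show ?thesis using st head[of s'] Ib Suc swp_commute by (metis Suc_less_eq)
  next
   case (Suc t')
   then show ?thesis using st tail[of s' t'] Ib `s = Suc s'` b by (simp add: swp_Cons_Suc)
  qed
 qed
qed

lemma swp_append: "swp (length u) (Suc (length u)) (u @ i # x # v) = u @ x # i # v"
 by (simp add: swp_def nth_append list_update_append)

lemma alt_cycle:
 assumes a: "alternating p a" and "length (i # b) = p" "s \<le> length b"
 shows "a (take s b @ i # drop s b) = (-1) ^ s * a (i # b)"
 using assms(3)
proof (induction s)
 case (Suc s)
 have l: "length (take s b @ i # drop s b) = p" using assms Suc by simp
 have "swp s (Suc s) (take s b @ i # drop s b) = take (Suc s) b @ i # drop (Suc s) b"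
    using swp_append[of "take s b" i "b ! s" "drop (Suc s) b"] Suc.prems
  by (simp add: min_def Cons_nth_drop_Suc take_Suc_conv_app_nth)
 then have "a (take (Suc s) b @ i # drop (Suc s) b) = - a (take s b @ i # drop s b)"
  using alternatingD[OF a l, of s "Suc s"] assms Suc.prems by simp
 then show ?case using Suc by simp
qed simp

lemma dform_omit:
 assumes a: "!!i. alternating p (A i)"
 shows "(\<Sum>s<length I. (-1) ^ s * A (I ! s) (omit s I)) = dform A I"
proof (cases I)
 case (Cons i b)
 have "(-1) ^ Suc s * A (b ! s) (i # omit s b) = - A (b ! s) (b[s := i])" if s: "s < length b" for s
 proof (cases "length b = p")
  case True
  have "take s (omit s b) @ i # drop s (omit s b) = b[s := i]"
   using s by (simp add: omit_def upd_conv_take_nth_drop min_def)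
  then have "A (b ! s) (b[s := i]) = (-1) ^ s * A (b ! s) (i # omit s b)"
   using alt_cycle[OF a, of i "omit s b" s] s True by (simp add: omit_def)
  then show ?thesis by (simp flip: mult.assoc power_add)
 next
  case False
  then show ?thesis using alt_length[OF a] s by (simp add: omit_def)
 qed
 then have "(\<Sum>s<length b. (-1) ^ Suc s * A (b ! s) (i # omit s b)) = (\<Sum>s<length b. - A (b ! s) (b[s := i]))"
  by simp
 moreover have "omit 0 (i # b) = b" "omit (Suc s) (i # b) = i # omit s b" for s
  by (simp_all add: omit_def)
 ultimately show ?thesis unfolding Cons length_Cons sum.lessThan_Suc_shift
  by (simp add: dform_def sum_negf del: power_Suc sum.lessThan_Suc)
qed (simp add: dform_def)

section \<open>Abstract differential operators\<close>

text \<open>The elements of \<open>F\<close> have components \<open>cmp w b\<close>, for \<open>b \<in> B\<close>, which are smooth on \<open>S\<close>; the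
  predicate \<open>dop m\<close> describes operators of order less than \<open>m\<close> on them.\<close>

locale jets =
 fixes F :: "'w set" and cmp :: "'w => 'b => real^'n::finite => real" and B :: "'b set" and S :: "(real^'n) set"
 assumes open_S: "open S" and finite_B: "finite B"
  and smooth_cmp: "!!w b. w \<in> F ==> b \<in> B ==> Sm S (cmp w b)"
begin

text \<open>The bound on the order is strict so that \<open>dop 0\<close> consists of zero
  operators. Remainders two orders below a word then need no separate treatment for words of size 0
  or 1.\<close>

definition dop :: "nat => ('w => real^'n => real) => bool" where
 "dop m H \<longleftrightarrow> (\<exists>e. (\<forall>be b. Sm S (e be b)) &
  (\<forall>w\<in>F. \<forall>y\<in>S. H w y = (\<Sum>be | size be < m. \<Sum>b\<in>B. e be b y * mpd be (cmp w b) y)))"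

lemma dop_cong: "dop m H ==> (!!w y. w \<in> F ==> y \<in> S ==> H' w y = H w y) ==> dop m H'"
 unfolding dop_def by simp

lemma dop_zero: "dop m (%_ _. 0)"
 unfolding dop_def by (rule exI[of _ "%_ _ _. 0"]) auto

lemma dop_add:
 assumes "dop m H" "dop m H'"
 shows "dop m (%w y. H w y + H' w y)"
proof -
 from assms obtain e e' where "\<forall>be b. Sm S (e be b)" "\<forall>be b. Sm S (e' be b)"
  "\<forall>w\<in>F. \<forall>y\<in>S. H w y = (\<Sum>be | size be < m. \<Sum>b\<in>B. e be b y * mpd be (cmp w b) y)"
  "\<forall>w\<in>F. \<forall>y\<in>S. H' w y = (\<Sum>be | size be < m. \<Sum>b\<in>B. e' be b y * mpd be (cmp w b) y)"
  unfolding dop_def by blast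
 then show ?thesis unfolding dop_def
  by (intro exI[of _ "%be b y. e be b y + e' be b y"])
   (simp add: sm_add open_S distrib_right sum.distrib)
qed

lemma dop_mult:
 assumes "Sm S g" "dop m H"
 shows "dop m (%w y. g y * H w y)"
proof -
 from assms obtain e where "\<forall>be b. Sm S (e be b)"
  "\<forall>w\<in>F. \<forall>y\<in>S. H w y = (\<Sum>be | size be < m. \<Sum>b\<in>B. e be b y * mpd be (cmp w b) y)"
  unfolding dop_def by blast
 then show ?thesis unfolding dop_def
  by (intro exI[of _ "%be b y. g y * e be b y"])
   (simp add: sm_mult assms(1) open_S sum_distrib_left mult.assoc)
qed

lemma dop_minus: "dop m H ==> dop m (%w y. - H w y)"
 using dop_mult[of "%_. -1" m H] by simp

lemma dop_diff: "dop m H ==> dop m H' ==> dop m (%w y. H w y - H' w y)"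
 using dop_add[of m H "%w y. - H' w y"] dop_minus[of m H'] by simp

lemma dop_sum: "(!!i. i \<in> I ==> dop m (H i)) ==> dop m (%w y. \<Sum>i\<in>I. H i w y)"
proof (induction I rule: infinite_finite_induct)
 case (insert x I)
 then show ?case using dop_add[of m "H x" "%w y. \<Sum>i\<in>I. H i w y"] by simp
qed (auto intro: dop_zero)

lemma dop_sum_mset: "(!!i. i \<in># I ==> dop m (H i)) ==> dop m (%w y. \<Sum>i\<in>#I. H i w y)"
proof (induction I)
 case (add x I)
 then show ?case using dop_add[of m "H x" "%w y. \<Sum>i\<in>#I. H i w y"] by simp
qed (auto intro: dop_zero)

lemma dop_mono:
 assumes "m \<le> m'" "dop m H"
 shows "dop m' H"
proof -
 from assms obtain e where e: "\<forall>be b. Sm S (e be b)"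
  "\<forall>w\<in>F. \<forall>y\<in>S. H w y = (\<Sum>be | size be < m. \<Sum>b\<in>B. e be b y * mpd be (cmp w b) y)"
  unfolding dop_def by blast
 have *: "(\<Sum>be | size be < m'. \<Sum>b\<in>B. (if size be < m then e be b y else 0) * mpd be (cmp w b) y) =
   (\<Sum>be | size be < m. \<Sum>b\<in>B. e be b y * mpd be (cmp w b) y)" for w y
  by (rule sum.mono_neutral_cong_right) (use assms(1) in "auto intro!: sum.neutral")
 show ?thesis unfolding dop_def
  by (rule exI[of _ "%be b y. if size be < m then e be b y else 0"])
   (use e in "auto simp: * intro: sm_if")
qed

lemma dop_word:
 assumes "Sm S g" "b \<in> B" "size al < m"
 shows "dop m (%w y. g y * mpd al (cmp w b) y)"
 unfolding dop_def
proof (intro exI conjI ballI allI)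
 let ?e = "%be b' y. if be = al & b' = b then g y else 0"
 fix w y
 have "(\<Sum>be | size be < m. \<Sum>b'\<in>B. ?e be b' y * mpd be (cmp w b') y) =
   (\<Sum>be | size be < m. if be = al then g y * mpd be (cmp w b) y else 0)"
  using assms(2) finite_B by (intro sum.cong) (auto simp: mult_if sum.delta cong: if_cong)
 also have "... = g y * mpd al (cmp w b) y" using assms(3) by (simp add: sum.delta')
 finally show "g y * mpd al (cmp w b) y = (\<Sum>be | size be < m. \<Sum>b'\<in>B. ?e be b' y * mpd be (cmp w b') y)" ..
 fix be b'
 show "Sm S (?e be b')" using assms(1) by (cases "be = al & b' = b") auto
qed

lemma dop_cmp: "b \<in> B ==> size al < m ==> dop m (%w y. mpd al (cmp w b) y)"
 using dop_word[of "%_. 1" b al m] by simp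

lemma sm_dop: "dop m H ==> w \<in> F ==> Sm S (H w)"
proof -
 assume "dop m H" "w \<in> F"
 then obtain e where e: "\<forall>be b. Sm S (e be b)"
  "\<forall>y\<in>S. H w y = (\<Sum>be | size be < m. \<Sum>b\<in>B. e be b y * mpd be (cmp w b) y)"
  unfolding dop_def by blast
 have "Sm S (%y. \<Sum>be | size be < m. \<Sum>b\<in>B. e be b y * mpd be (cmp w b) y)"
  using e(1) smooth_cmp[OF `w \<in> F`] open_S by (intro sm_sum sm_mult sm_mpd) auto
 then show ?thesis by (rule sm_cong[OF open_S, rotated]) (use e in auto)
qed

text \<open>The case \<open>m = 0\<close> is kept apart because the derivative of a zero remainder
  must stay zero; the bound \<open>Suc m\<close> would lose this in the induction on words.\<close>

lemma dop_pd:
 assumes "dop m H"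
 shows "dop (if m = 0 then 0 else Suc m) (%w. pd i (H w))"
proof -
 from assms obtain e where e: "\<forall>be b. Sm S (e be b)"
  "\<forall>w\<in>F. \<forall>y\<in>S. H w y = (\<Sum>be | size be < m. \<Sum>b\<in>B. e be b y * mpd be (cmp w b) y)"
  unfolding dop_def by blast
 have "dop (if m = 0 then 0 else Suc m) (%w y. \<Sum>be | size be < m. \<Sum>b\<in>B.
   (e be b y * mpd (am i be) (cmp w b) y + pd i (e be b) y * mpd be (cmp w b) y))"
  using e(1) by (intro dop_sum dop_add dop_word sm_pd) (auto split: if_splits)
 then show ?thesis
 proof (rule dop_cong)
  fix w y assume w: "w \<in> F" and y: "y \<in> S"
  note sm = sm_mult[OF open_S e(1)[rule_format] sm_mpd[OF smooth_cmp[OF w]]]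
  have "pd i (H w) y = pd i (%y. \<Sum>be | size be < m. \<Sum>b\<in>B. e be b y * mpd be (cmp w b) y) y"
   using e(2) w by (intro pd_cong[OF open_S y]) auto
  also have "... = (\<Sum>be | size be < m. pd i (%y. \<Sum>b\<in>B. e be b y * mpd be (cmp w b) y) y)"
   using sm by (intro pd_sum finite_multisets_less sm_diffble[OF sm_sum[OF open_S] open_S y]) auto
  also have "... = (\<Sum>be | size be < m. \<Sum>b\<in>B. pd i (%y. e be b y * mpd be (cmp w b) y) y)"
   using sm by (intro sum.cong pd_sum finite_B sm_diffble[OF _ open_S y]) auto
  also have "... = (\<Sum>be | size be < m. \<Sum>b\<in>B.
    (e be b y * mpd (am i be) (cmp w b) y + pd i (e be b) y * mpd be (cmp w b) y))"
  proof (intro sum.cong refl)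
   fix be b assume "b \<in> B"
   then show "pd i (%y. e be b y * mpd be (cmp w b) y) y =
     e be b y * mpd (am i be) (cmp w b) y + pd i (e be b) y * mpd be (cmp w b) y"
    using e(1) smooth_cmp[OF w] mpd_add_mset[OF open_S _ y]
    by (subst pd_mult) (auto intro!: sm_diffble[OF _ open_S y] sm_mpd)
  qed
  finally show "pd i (H w) y = (\<Sum>be | size be < m. \<Sum>b\<in>B.
    (e be b y * mpd (am i be) (cmp w b) y + pd i (e be b) y * mpd be (cmp w b) y))" .
 qed
qed

lemma dop_pd_Suc: "dop m H ==> dop (Suc m) (%w. pd i (H w))"
 using dop_pd[of m H i] dop_mono[of 0 "Suc m"] by (cases "m = 0") auto

end

lemma pd_sum_mset:
 assumes "!!x. x \<in># al ==> f x differentiable at y"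
 shows "pd i (%z. \<Sum>x\<in>#al. f x z) y = (\<Sum>x\<in>#al. pd i (f x) y)"
  "(%z. \<Sum>x\<in>#al. f x z) differentiable at y"
proof -
 have "pd i (%z. \<Sum>x\<in>#al. f x z) y = (\<Sum>x\<in>#al. pd i (f x) y) & (%z. \<Sum>x\<in>#al. f x z) differentiable at y"
  using assms
 proof (induction al)
  case (add x al)
  then show ?case by (simp add: pd_add differentiable_add)
 qed simp
 then show "pd i (%z. \<Sum>x\<in>#al. f x z) y = (\<Sum>x\<in>#al. pd i (f x) y)"
  "(%z. \<Sum>x\<in>#al. f x z) differentiable at y" by auto
qed

text \<open>Terms in which \<open>h\<close> is differentiated at most once are explicit; the rest
  has order at least two below \<open>al\<close>, with coefficients independent of \<open>f\<close>.
  In a Lie derivative \<open>f\<close> is itself a first derivative, so the explicit terms cover the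
  order that cancels and the one that matters.\<close>

lemma Leibniz_expansion:
 fixes h :: "real^'n::finite => real"
 assumes S: "open S" and h: "Sm S h"
 shows "\<exists>e. (\<forall>be. Sm S (e be)) & (\<forall>f y. Sm S f --> y \<in> S -->
  mpd al (%z. h z * f z) y = h y * mpd al f y + (\<Sum>x\<in>#al. pd x h y * mpd (al - {#x#}) f y) +
   (\<Sum>be | size be < size al - 1. e be y * mpd be f y))"
proof -
 interpret jets "{f. Sm S f}" "%f (_::unit). f" UNIV S
  by unfold_locales (auto simp: S)
 have "dop (size al - 1) (%f y. mpd al (%z. h z * f z) y -
   (h y * mpd al f y + (\<Sum>x\<in>#al. pd x h y * mpd (al - {#x#}) f y)))"
 proof (induction al)
  case empty
  show ?case by (rule dop_cong[OF dop_zero]) simp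
 next
  case (add i al)
  define R where "R f y = mpd al (%z. h z * f z) y -
   (h y * mpd al f y + (\<Sum>x\<in>#al. pd x h y * mpd (al - {#x#}) f y))" for f y
  have R: "dop (size al - 1) R" using add.IH unfolding R_def .
  have R': "dop (size al) (%f. pd i (R f))"
   using dop_pd[OF R, of i] by (rule dop_mono[rotated]) auto
  have "dop (size al) (%f y. pd i (R f) y + (\<Sum>x\<in>#al. pd i (pd x h) y * mpd (al - {#x#}) f y))"
   using h by (intro dop_add R' dop_sum_mset dop_word sm_pd)
    (auto simp: size_Diff_singleton nonempty_has_size dest: multi_member_split)
  then have "dop (size al) (%f y. mpd (am i al) (%z. h z * f z) y -
    (h y * mpd (am i al) f y + (\<Sum>x\<in>#am i al. pd x h y * mpd (am i al - {#x#}) f y)))"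
  proof (rule dop_cong)
   fix f y assume "f \<in> {f. Sm S f}" and y: "y \<in> S"
   then have f: "Sm S f" by simp
   note d = sm_diffble[OF _ S y]
   have dR: "R f differentiable at y" using d[OF sm_dop[OF R]] f by simp
   have dh: "(%z. h z * mpd be f z) differentiable at y" "(%z. pd x h z * mpd be f z) differentiable at y" for x be
    by (intro d sm_mult S h f sm_mpd sm_pd)+
   have "mpd (am i al) (%z. h z * f z) y = pd i (mpd al (%z. h z * f z)) y"
    by (rule mpd_add_mset[OF S sm_mult[OF S h f] y])
   also have "mpd al (%z. h z * f z) =
     (%y. R f y + (h y * mpd al f y + (\<Sum>x\<in>#al. pd x h y * mpd (al - {#x#}) f y)))"
    by (simp add: R_def fun_eq_iff)
   also have "pd i ... y = pd i (R f) y + (pd i (%z. h z * mpd al f z) y +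
     (\<Sum>x\<in>#al. pd i (%z. pd x h z * mpd (al - {#x#}) f z) y))"
    using dR dh pd_sum_mset[of al "%x z. pd x h z * mpd (al - {#x#}) f z" y]
    by (simp add: pd_add differentiable_add)
   also have "pd i (%z. h z * mpd al f z) y = h y * mpd (am i al) f y + pd i h y * mpd al f y"
    using d[OF h] d[OF sm_mpd[OF f]] by (subst pd_mult) (auto simp: mpd_add_mset[OF S f y])
   also have "(\<Sum>x\<in>#al. pd i (%z. pd x h z * mpd (al - {#x#}) f z) y) =
     (\<Sum>x\<in>#al. pd x h y * mpd (am i al - {#x#}) f y + pd i (pd x h) y * mpd (al - {#x#}) f y)"
   proof (rule arg_cong[where f = sum_mset], rule image_mset_cong)
    fix x assume "x \<in># al"
    then have "am i al - {#x#} = am i (al - {#x#})" by simp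
    then show "pd i (%z. pd x h z * mpd (al - {#x#}) f z) y =
      pd x h y * mpd (am i al - {#x#}) f y + pd i (pd x h) y * mpd (al - {#x#}) f y"
     using d[OF sm_pd[OF h]] d[OF sm_mpd[OF f]]
     by (subst pd_mult) (auto simp: mpd_add_mset[OF S f y])
   qed
   finally show "mpd (am i al) (%z. h z * f z) y -
     (h y * mpd (am i al) f y + (\<Sum>x\<in>#am i al. pd x h y * mpd (am i al - {#x#}) f y)) =
     pd i (R f) y + (\<Sum>x\<in>#al. pd i (pd x h) y * mpd (al - {#x#}) f y)"
    by (simp add: sum_mset.distrib)
  qed
  then show ?case by simp
 qed
 then obtain e where e: "\<forall>be b. Sm S (e be b)"
  "!!f y. Sm S f ==> y \<in> S ==> mpd al (%z. h z * f z) y -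
   (h y * mpd al f y + (\<Sum>x\<in>#al. pd x h y * mpd (al - {#x#}) f y)) =
   (\<Sum>be | size be < size al - 1. e be () y * mpd be f y)"
  unfolding dop_def by (auto simp: UNIV_unit)
 then show ?thesis
  by (intro exI[of _ "%be. e be ()"]) (simp add: algebra_simps)
qed

section \<open>Pullback of Lie derivatives and differentials\<close>

lemma sum_update:
 assumes "s < p"
 shows "(\<Sum>J :: 'b::finite list | length J = p. SU m. F J m) =
  (\<Sum>J\<in>Ls p. SU m. F (J[s := m]) (J ! s))"
proof -
 have "(\<Sum>x\<in>(Ls p) \<times> UNIV. F (fst x) (snd x)) =
   (\<Sum>x\<in>(Ls p) \<times> UNIV. F ((fst x)[s := snd x]) (fst x ! s))"
  by (rule sum.reindex_bij_witness[of _ "%x. ((fst x)[s := snd x], fst x ! s)" "%x. ((fst x)[s := snd x], fst x ! s)"])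
   (use assms in auto)
 then show ?thesis by (simp add: sum.cartesian_product case_prod_beta)
qed

lemma prod_update:
 fixes M :: "'b => 'b => real"
 assumes "s < p" "length I = p" "length J = p"
 shows "(\<Prod>q<p. M (I[s := j] ! q) (J ! q)) = M j (J ! s) * (\<Prod>q\<in>{..<p} - {s}. M (I ! q) (J ! q))"
  "(\<Prod>q<p. M (I ! q) (J[s := j] ! q)) = M (I ! s) j * (\<Prod>q\<in>{..<p} - {s}. M (I ! q) (J ! q))"
  "(\<Prod>q<p. M (I ! q) (J ! q)) = M (I ! s) (J ! s) * (\<Prod>q\<in>{..<p} - {s}. M (I ! q) (J ! q))"
proof -
 have "s \<in> {..<p}" using assms by simp
 then show "(\<Prod>q<p. M (I[s := j] ! q) (J ! q)) = M j (J ! s) * (\<Prod>q\<in>{..<p} - {s}. M (I ! q) (J ! q))"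
  "(\<Prod>q<p. M (I ! q) (J[s := j] ! q)) = M (I ! s) j * (\<Prod>q\<in>{..<p} - {s}. M (I ! q) (J ! q))"
  "(\<Prod>q<p. M (I ! q) (J ! q)) = M (I ! s) (J ! s) * (\<Prod>q\<in>{..<p} - {s}. M (I ! q) (J ! q))"
  using assms by (subst prod.remove[of "{..<p}" s]; auto intro!: arg_cong2[where f = "(*)"] prod.cong)+
qed

text \<open>The linear algebra behind naturality of the Lie derivative: \<open>M\<close> is the
  Jacobian of a coordinate change, \<open>H\<close> its derivative, and \<open>w\<close>,
  \<open>Dw\<close>, \<open>v'\<close>, \<open>dv'\<close> live in the other chart. The hypothesis
  on \<open>dv'\<close> is the differentiated transformation law of the field; it absorbs the terms
  containing \<open>H\<close>.\<close>

lemma pb_lie: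
 fixes M :: "'n::finite => 'n => real"
 assumes I: "length I = p"
  and W: "!!I. length I = p ==> W I = (\<Sum>J\<in>Ls p. (\<Prod>s<p. M (I ! s) (J ! s)) * w J)"
  and DW: "!!i I. length I = p ==> DW i I = (\<Sum>J\<in>Ls p.
   (\<Sum>s<p. H i (I ! s) (J ! s) * (\<Prod>q\<in>{..<p} - {s}. M (I ! q) (J ! q))) * w J +
   (\<Prod>s<p. M (I ! s) (J ! s)) * (SU m. M i m * Dw m J))"
  and v': "!!m. v' m = (SU i. M i m * v i)"
  and dv': "!!j k. (SU i. v i * H i j k + dv j i * M i k) = (SU m. M j m * dv' m k)"
 shows "(SU i. v i * DW i I) + (\<Sum>s<p. SU j. dv (I ! s) j * W (I[s := j])) =
  pb p M (%J. (SU m. v' m * Dw m J) + (\<Sum>s<p. SU j. dv' (J ! s) j * w (J[s := j]))) I"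
proof -
 let ?P = "%J. \<Prod>s<p. M (I ! s) (J ! s)" and ?Q = "%s J. \<Prod>q\<in>{..<p} - {s}. M (I ! q) (J ! q)"
 have 1: "(SU i. v i * DW i I) = (\<Sum>J\<in>Ls p. (\<Sum>s<p. (SU i. v i * H i (I ! s) (J ! s)) * ?Q s J) * w J)
   + (\<Sum>J\<in>Ls p. ?P J * (SU m. v' m * Dw m J))"
 proof -
  have "(SU i. v i * DW i I) = (SU i. \<Sum>J\<in>Ls p. (\<Sum>s<p. v i * H i (I ! s) (J ! s) * ?Q s J) * w J
    + ?P J * (SU m. M i m * v i * Dw m J))"
   unfolding DW[OF I] sum_distrib_left by (intro sum.cong) (auto simp: sum_distrib_left sum_distrib_right algebra_simps)
  also have "... = (\<Sum>J\<in>Ls p. SU i. (\<Sum>s<p. v i * H i (I ! s) (J ! s) * ?Q s J) * w J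
    + ?P J * (SU m. M i m * v i * Dw m J))" by (rule sum.swap)
  also have "... = (\<Sum>J\<in>Ls p. (SU i. \<Sum>s<p. v i * H i (I ! s) (J ! s) * ?Q s J) * w J
    + ?P J * (SU i m. M i m * v i * Dw m J))"
   by (simp add: sum.distrib sum_distrib_left sum_distrib_right)
  also have "... = (\<Sum>J\<in>Ls p. (\<Sum>s<p. SU i. v i * H i (I ! s) (J ! s) * ?Q s J) * w J
    + ?P J * (SU m i. M i m * v i * Dw m J))"
   by (subst (2) sum.swap, subst (3) sum.swap) (rule refl)
  finally show ?thesis by (simp add: v' sum.distrib sum_distrib_right)
 qed
 have 2: "(\<Sum>s<p. SU j. dv (I ! s) j * W (I[s := j])) =
   (\<Sum>J\<in>Ls p. (\<Sum>s<p. (SU i. dv (I ! s) i * M i (J ! s)) * ?Q s J) * w J)"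
 proof -
  have "(\<Sum>s<p. SU j. dv (I ! s) j * W (I[s := j])) =
    (\<Sum>s<p. SU j. \<Sum>J\<in>Ls p. dv (I ! s) j * M j (J ! s) * ?Q s J * w J)"
   using I by (intro sum.cong) (auto simp: W sum_distrib_left prod_update(1) mult.assoc intro!: sum.cong)
  also have "... = (\<Sum>s<p. \<Sum>J\<in>Ls p. SU j. dv (I ! s) j * M j (J ! s) * ?Q s J * w J)"
   by (intro sum.cong refl sum.swap)
  also have "... = (\<Sum>J\<in>Ls p. \<Sum>s<p. SU j. dv (I ! s) j * M j (J ! s) * ?Q s J * w J)"
   by (rule sum.swap)
  finally show ?thesis by (simp add: sum_distrib_right)
 qed
 have 3: "(\<Sum>J\<in>Ls p. ?P J * (\<Sum>s<p. SU j. dv' (J ! s) j * w (J[s := j]))) =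
   (\<Sum>J\<in>Ls p. (\<Sum>s<p. (SU m. M (I ! s) m * dv' m (J ! s)) * ?Q s J) * w J)"
 proof -
  have "(\<Sum>J\<in>Ls p. ?P J * (\<Sum>s<p. SU j. dv' (J ! s) j * w (J[s := j]))) =
    (\<Sum>s<p. \<Sum>J\<in>Ls p. SU j. ?P J * dv' (J ! s) j * w (J[s := j]))"
   by (subst sum.swap) (simp add: sum_distrib_left mult.assoc)
  also have "... = (\<Sum>s<p. \<Sum>J\<in>Ls p. SU m. M (I ! s) m * dv' m (J ! s) * ?Q s J * w J)"
  proof (rule scong)
   fix s assume "s \<in> {..<p}"
   then have s: "s < p" by simp
   show "(\<Sum>J\<in>Ls p. SU j. ?P J * dv' (J ! s) j * w (J[s := j])) =
     (\<Sum>J\<in>Ls p. SU m. M (I ! s) m * dv' m (J ! s) * ?Q s J * w J)"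
    by (subst sum_update[OF s]) (use s I in "auto simp: prod_update(2) mult_ac intro!: sum.cong")
  qed
  also have "... = (\<Sum>J\<in>Ls p. \<Sum>s<p. SU m. M (I ! s) m * dv' m (J ! s) * ?Q s J * w J)"
   by (rule sum.swap)
  finally show ?thesis by (simp add: sum_distrib_right)
 qed
 have "pb p M (%J. (SU m. v' m * Dw m J) + (\<Sum>s<p. SU j. dv' (J ! s) j * w (J[s := j]))) I =
   (\<Sum>J\<in>Ls p. ?P J * (SU m. v' m * Dw m J)) +
   (\<Sum>J\<in>Ls p. (\<Sum>s<p. (SU m. M (I ! s) m * dv' m (J ! s)) * ?Q s J) * w J)"
  unfolding 3[symmetric] by (simp add: pb_def I distrib_left sum.distrib)
 also have "... = (\<Sum>J\<in>Ls p. ?P J * (SU m. v' m * Dw m J)) +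
   (\<Sum>J\<in>Ls p. (\<Sum>s<p. (SU i. v i * H i (I ! s) (J ! s) + dv (I ! s) i * M i (J ! s)) * ?Q s J) * w J)"
  unfolding dv' ..
 finally show ?thesis unfolding 1 2 by (simp add: sum.distrib distrib_right)
qed

lemma sum_antisym:
 fixes Z :: "nat => nat => real"
 assumes "!!s r. s < p ==> r < p ==> r ~= s ==> Z s r = - Z r s"
 shows "(\<Sum>s<p. \<Sum>r\<in>{..<p} - {s}. Z s r) = 0"
proof -
 define Y where "Y s r = (if r = s then 0 else Z s r)" for s r
 have Y: "Y s r = - Y r s" if "s < p" "r < p" for s r
  unfolding Y_def using assms[of s r] that by simp
 have "(\<Sum>s<p. \<Sum>r\<in>{..<p} - {s}. Z s r) = (\<Sum>s<p. \<Sum>r<p. Y s r)"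
  by (rule scong, rule sum.mono_neutral_cong_left) (auto simp: Y_def)
 also have "... = (\<Sum>s<p. \<Sum>r<p. - Y r s)" by (intro sum.cong refl Y) auto
 also have "... = - (\<Sum>s<p. \<Sum>r<p. Y s r)" by (subst sum.swap) (simp add: sum_negf)
 finally have "(\<Sum>s<p. \<Sum>r<p. Y s r) = 0" "(\<Sum>s<p. \<Sum>r\<in>{..<p} - {s}. Z s r) = (\<Sum>s<p. \<Sum>r<p. Y s r)"
  using `(\<Sum>s<p. \<Sum>r\<in>{..<p} - {s}. Z s r) = (\<Sum>s<p. \<Sum>r<p. Y s r)` by linarith+
 then show ?thesis by simp
qed

text \<open>Second derivatives \<open>H\<close> of the coordinate change enter in two ways. Those
  contracted with the new index \<open>i\<close> cancel between the leading term and the subtracted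
  sum; those pairing two old indices form \<open>Z s r\<close>, antisymmetric because
  \<open>H\<close> is symmetric and \<open>w\<close> alternates.\<close>

lemma pb_dform:
 fixes M :: "'n::finite => 'n => real"
 assumes b: "length b = p" and alt: "alternating p w"
  and H: "!!i j k. H i j k = H j i k"
  and DW: "!!i I. length I = p ==> DW i I = (\<Sum>J\<in>Ls p.
   (\<Sum>s<p. H i (I ! s) (J ! s) * (\<Prod>q\<in>{..<p} - {s}. M (I ! q) (J ! q))) * w J +
   (\<Prod>s<p. M (I ! s) (J ! s)) * (SU m. M i m * Dw m J))"
 shows "dform DW (i # b) = pb (Suc p) M (dform Dw) (i # b)"
proof -
 let ?Q = "%s J. \<Prod>q\<in>{..<p} - {s}. M (b ! q) (J ! q)"
 let ?Q2 = "%s r J. \<Prod>q\<in>{..<p} - {s, r}. M (b ! q) (J ! q)"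
 define Z where "Z s r = (\<Sum>J\<in>Ls p. H (b ! s) (b ! r) (J ! r) * M i (J ! s) * ?Q2 s r J * w J)" for s r
 have Zsym: "Z s r = - Z r s" if sr: "s < p" "r < p" "r ~= s" for s r
 proof -
  have "Z r s = (\<Sum>J\<in>Ls p. H (b ! r) (b ! s) (swp s r J ! s) * M i (swp s r J ! r) *
    ?Q2 r s (swp s r J) * w (swp s r J))"
   unfolding Z_def by (rule sum_swp[OF sr(1,2), symmetric])
  also have "... = (\<Sum>J\<in>Ls p. - (H (b ! s) (b ! r) (J ! r) * M i (J ! s) * ?Q2 s r J * w J))"
  proof (intro sum.cong refl)
   fix J :: "'n list" assume "J \<in> (Ls p)"
   then have J: "length J = p" by simp
   have "?Q2 r s (swp s r J) = ?Q2 s r J"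
    using J sr by (intro prod.cong) (auto simp: nth_swp tps_def)
   moreover have "w (swp s r J) = - w J" using alternatingD[OF alt J, of s r] sr by auto
   ultimately show "H (b ! r) (b ! s) (swp s r J ! s) * M i (swp s r J ! r) * ?Q2 r s (swp s r J) * w (swp s r J)
     = - (H (b ! s) (b ! r) (J ! r) * M i (J ! s) * ?Q2 s r J * w J)"
    using J sr H[of "b ! r"] by (simp add: nth_swp tps_def)
  qed
  finally show ?thesis by (simp add: Z_def sum_negf)
 qed
 define E where "E s = (\<Sum>J\<in>Ls p. SU m. M i (J ! s) * ?Q s J * M (b ! s) m * Dw m J)" for s
 have s_term: "DW (b ! s) (b[s := i]) = (\<Sum>J\<in>Ls p. H i (b ! s) (J ! s) * ?Q s J * w J)
   + (\<Sum>r\<in>{..<p} - {s}. Z s r) + E s" if s: "s < p" for s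
 proof -
  have "DW (b ! s) (b[s := i]) = (\<Sum>J\<in>Ls p.
   (\<Sum>r<p. H (b ! s) (b[s := i] ! r) (J ! r) * (\<Prod>q\<in>{..<p} - {r}. M (b[s := i] ! q) (J ! q))) * w J)
   + (\<Sum>J\<in>Ls p. (\<Prod>q<p. M (b[s := i] ! q) (J ! q)) * (SU m. M (b ! s) m * Dw m J))"
   using b by (simp add: DW sum.distrib)
  also have "(\<Sum>J\<in>Ls p. (\<Prod>q<p. M (b[s := i] ! q) (J ! q)) * (SU m. M (b ! s) m * Dw m J)) = E s"
   unfolding E_def using s b
   by (intro sum.cong) (auto simp: prod_update(1) sum_distrib_left sum_distrib_right mult_ac)
  also have "(\<Sum>J\<in>Ls p.
   (\<Sum>r<p. H (b ! s) (b[s := i] ! r) (J ! r) * (\<Prod>q\<in>{..<p} - {r}. M (b[s := i] ! q) (J ! q))) * w J) =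
   (\<Sum>J\<in>Ls p. (H i (b ! s) (J ! s) * ?Q s J + (\<Sum>r\<in>{..<p} - {s}. H (b ! s) (b ! r) (J ! r) * M i (J ! s) * ?Q2 s r J)) * w J)"
  proof (intro sum.cong refl arg_cong2[where f = "(*)"])
   fix J :: "'n list"
   have "(\<Sum>r<p. H (b ! s) (b[s := i] ! r) (J ! r) * (\<Prod>q\<in>{..<p} - {r}. M (b[s := i] ! q) (J ! q))) =
    H (b ! s) (b[s := i] ! s) (J ! s) * (\<Prod>q\<in>{..<p} - {s}. M (b[s := i] ! q) (J ! q)) +
    (\<Sum>r\<in>{..<p} - {s}. H (b ! s) (b[s := i] ! r) (J ! r) * (\<Prod>q\<in>{..<p} - {r}. M (b[s := i] ! q) (J ! q)))"
    using s by (intro sum.remove) auto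
   also have "(\<Prod>q\<in>{..<p} - {s}. M (b[s := i] ! q) (J ! q)) = ?Q s J" by (intro prod.cong) auto
   also have "(\<Sum>r\<in>{..<p} - {s}. H (b ! s) (b[s := i] ! r) (J ! r) * (\<Prod>q\<in>{..<p} - {r}. M (b[s := i] ! q) (J ! q))) =
     (\<Sum>r\<in>{..<p} - {s}. H (b ! s) (b ! r) (J ! r) * M i (J ! s) * ?Q2 s r J)"
   proof (intro sum.cong refl)
    fix r assume r: "r \<in> {..<p} - {s}"
    have "(\<Prod>q\<in>{..<p} - {r}. M (b[s := i] ! q) (J ! q)) =
      M (b[s := i] ! s) (J ! s) * (\<Prod>q\<in>{..<p} - {r} - {s}. M (b[s := i] ! q) (J ! q))"
     using r s by (intro prod.remove) auto
    also have "(\<Prod>q\<in>{..<p} - {r} - {s}. M (b[s := i] ! q) (J ! q)) = ?Q2 s r J"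
     by (intro prod.cong) auto
    finally show "H (b ! s) (b[s := i] ! r) (J ! r) * (\<Prod>q\<in>{..<p} - {r}. M (b[s := i] ! q) (J ! q)) =
      H (b ! s) (b ! r) (J ! r) * M i (J ! s) * ?Q2 s r J"
     using r s b by simp
   qed
   finally show "(\<Sum>r<p. H (b ! s) (b[s := i] ! r) (J ! r) * (\<Prod>q\<in>{..<p} - {r}. M (b[s := i] ! q) (J ! q))) =
     H i (b ! s) (J ! s) * ?Q s J + (\<Sum>r\<in>{..<p} - {s}. H (b ! s) (b ! r) (J ! r) * M i (J ! s) * ?Q2 s r J)"
    using s b H[of i] by simp
  qed
  also have "... = (\<Sum>J\<in>Ls p. H i (b ! s) (J ! s) * ?Q s J * w J) +
    (\<Sum>J\<in>Ls p. \<Sum>r\<in>{..<p} - {s}. H (b ! s) (b ! r) (J ! r) * M i (J ! s) * ?Q2 s r J * w J)"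
   by (simp add: distrib_right sum.distrib sum_distrib_right)
  also have "(\<Sum>J\<in>Ls p. \<Sum>r\<in>{..<p} - {s}. H (b ! s) (b ! r) (J ! r) * M i (J ! s) * ?Q2 s r J * w J)
    = (\<Sum>r\<in>{..<p} - {s}. Z s r)"
   unfolding Z_def by (rule sum.swap)
  finally show ?thesis .
 qed
 have Z0: "(\<Sum>s<p. \<Sum>r\<in>{..<p} - {s}. Z s r) = 0" by (rule sum_antisym) (rule Zsym)
 have sw: "(\<Sum>s<p. \<Sum>J\<in>Ls p. G s J * w J) = (\<Sum>J\<in>Ls p. (\<Sum>s<p. G s J) * w J)"
  for G :: "nat => 'n list => real"
  unfolding sum_distrib_right by (rule sum.swap)
 have "(\<Sum>s<p. DW (b ! s) (b[s := i])) = (\<Sum>s<p. (\<Sum>J\<in>Ls p. H i (b ! s) (J ! s) * ?Q s J * w J)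
   + (\<Sum>r\<in>{..<p} - {s}. Z s r) + E s)"
  by (rule scong, rule s_term) simp
 then have "(\<Sum>s<p. DW (b ! s) (b[s := i])) = (\<Sum>s<p. \<Sum>J\<in>Ls p. H i (b ! s) (J ! s) * ?Q s J * w J) + (\<Sum>s<p. E s)"
  unfolding sum.distrib Z0 by simp
 moreover have "DW i b = (\<Sum>s<p. \<Sum>J\<in>Ls p. H i (b ! s) (J ! s) * ?Q s J * w J) +
   (\<Sum>J\<in>Ls p. SU m. M i m * (\<Prod>s<p. M (b ! s) (J ! s)) * Dw m J)"
  unfolding DW[OF b] sum.distrib sw by (simp add: sum_distrib_left sum_distrib_right mult_ac)
 ultimately have L: "dform DW (i # b) =
   (\<Sum>J\<in>Ls p. SU m. M i m * (\<Prod>s<p. M (b ! s) (J ! s)) * Dw m J) - (\<Sum>s<p. E s)"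
  by (simp add: dform_def b)
 have E': "E s = (\<Sum>J\<in>Ls p. SU m. M i m * (\<Prod>q<p. M (b ! q) (J ! q)) * Dw (J ! s) (J[s := m]))"
  if s: "s < p" for s
  unfolding E_def
  by (subst sum_update[OF s]) (use s b in "auto simp: prod_update(3)[OF s b] mult_ac intro!: sum.cong prod.cong")
 have "pb (Suc p) M (dform Dw) (i # b) = (SU m. \<Sum>J\<in>Ls p.
   M i m * (\<Prod>s<p. M (b ! s) (J ! s)) * (Dw m J - (\<Sum>s<p. Dw (J ! s) (J[s := m]))))"
  by (simp add: pb_def b sum_lists_Suc prod.lessThan_Suc_shift dform_def del: prod.lessThan_Suc)
 also have "... = (\<Sum>J\<in>Ls p. SU m. M i m * (\<Prod>s<p. M (b ! s) (J ! s)) * Dw m J) -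
   (\<Sum>J\<in>Ls p. SU m. \<Sum>s<p. M i m * (\<Prod>s<p. M (b ! s) (J ! s)) * Dw (J ! s) (J[s := m]))"
  by (subst sum.swap) (simp add: right_diff_distrib sum_subtractf sum_distrib_left)
 also have "(\<Sum>J\<in>Ls p. SU m. \<Sum>s<p. M i m * (\<Prod>s<p. M (b ! s) (J ! s)) * Dw (J ! s) (J[s := m])) =
   (\<Sum>s<p. E s)"
 proof -
  have "(\<Sum>J\<in>Ls p. SU m. \<Sum>s<p. M i m * (\<Prod>s<p. M (b ! s) (J ! s)) * Dw (J ! s) (J[s := m])) =
    (\<Sum>J\<in>Ls p. \<Sum>s<p. SU m. M i m * (\<Prod>s<p. M (b ! s) (J ! s)) * Dw (J ! s) (J[s := m]))"
   by (rule scong) (rule sum.swap)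
  also have "... = (\<Sum>s<p. \<Sum>J\<in>Ls p. SU m. M i m * (\<Prod>s<p. M (b ! s) (J ! s)) * Dw (J ! s) (J[s := m]))"
   by (rule sum.swap)
  also have "... = (\<Sum>s<p. E s)" by (rule scong, rule E'[symmetric]) simp
  finally show ?thesis .
 qed
 finally show ?thesis using L by simp
qed

section \<open>Charts\<close>

abbreviation ov :: "('a, 'n::finite) chart => ('a, 'n) chart => (real^'n) set" where
 "ov c c' \<equiv> coord c ` (cdom c \<inter> cdom c')"

abbreviation tr :: "('a, 'n::finite) chart => ('a, 'n) chart => real^'n => real^'n" where
 "tr c c' y \<equiv> coord c' (cinv c y)"

abbreviation Jac :: "('a, 'n::finite) chart => ('a, 'n) chart => real^'n => 'n => 'n => real" where
 "Jac c c' y i j \<equiv> pd i (transition c c' j) y"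

lemma tr_vec: "(\<chi> j. transition c c' j y) = tr c c' y"
 by (simp add: transition_def vec_eq_iff)

locale mfd =
 fixes X :: "'a topology" and \<A> :: "('a, 'n::finite) chart set"
 assumes mfd: "smooth_manifold X \<A>"
begin

abbreviation "Om == forms \<A>"
abbreviation "DO == diffops_le \<A>"
abbreviation "Lc == local_coeffs \<A>"
abbreviation "LF == lie_form \<A>"
abbreviation "LO == lie_op \<A>"
abbreviation "Vect == vector_fields \<A>"
abbreviation "Ed == ext_d \<A>"
abbreviation "Inv == invariant_ops \<A>"
abbreviation "Km == K_map \<A>"
abbreviation "dK == d_star_K \<A>"
abbreviation "pts == points \<A>"
abbreviation "idop == identity_op \<A>"

lemma chart: "c \<in> \<A> ==> is_chart X c"
 using mfd unfolding smooth_manifold_def by blast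

lemma compat: "c \<in> \<A> ==> c' \<in> \<A> ==> compatible c c'"
 using mfd unfolding smooth_manifold_def by blast

lemma points_topspace: "pts = topspace X"
 using mfd unfolding smooth_manifold_def points_def by auto

lemma oc: "c \<in> \<A> ==> open (cimg c)"
 and openin_cdom: "c \<in> \<A> ==> openin X (cdom c)"
 and homeo: "c \<in> \<A> ==> homeomorphic_map (subtopology X (cdom c)) (top_of_set (cimg c)) (coord c)"
 using chart unfolding is_chart_def by auto

lemma cdom_topspace: "c \<in> \<A> ==> cdom c \<subseteq> topspace X"
 by (rule openin_subset) (rule openin_cdom)

lemma cdom_points: "c \<in> \<A> ==> x \<in> cdom c ==> x \<in> pts"
 unfolding points_def by auto

lemma inj_coord: "c \<in> \<A> ==> inj_on (coord c) (cdom c)"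
 using homeomorphic_imp_injective_map[OF homeo, of c] cdom_topspace[of c] by (simp add: inf.absorb2)

lemma cinv_coord [simp]: "c \<in> \<A> ==> x \<in> cdom c ==> cinv c (coord c x) = x"
 by (simp add: inj_coord)

lemma coord_cinv [simp]: "y \<in> cimg c ==> coord c (cinv c y) = y"
 by (rule f_inv_into_f)

lemma cinv_in: "y \<in> cimg c ==> cinv c y \<in> cdom c"
 by (rule inv_into_into)

lemma open_coord_image:
 assumes "c \<in> \<A>" "openin X W" "W \<subseteq> cdom c"
 shows "open (coord c ` W)"
proof -
 have "openin (subtopology X (cdom c)) W"
  using assms openin_open_subtopology[OF openin_cdom[OF assms(1)]] by blast
 then have "openin (top_of_set (cimg c)) (coord c ` W)"
  using homeomorphic_imp_open_map[OF homeo[OF assms(1)]] unfolding open_map_def by blast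
 then show ?thesis using oc[OF assms(1)] openin_open_trans by blast
qed

lemma open_ov: "c \<in> \<A> ==> c' \<in> \<A> ==> open (ov c c')"
 by (rule open_coord_image) (auto intro: openin_Int openin_cdom)

lemma ov_cimg: "y \<in> ov c c' ==> y \<in> cimg c"
 by auto

lemma ov_iff: "c \<in> \<A> ==> y \<in> cimg c ==> y \<in> ov c c' \<longleftrightarrow> cinv c y \<in> cdom c'"
 using cinv_in[of y c] coord_cinv[of y c] by (auto simp: image_iff)

lemma tr_in: "c \<in> \<A> ==> y \<in> ov c c' ==> tr c c' y \<in> ov c' c"
 by auto

lemma tr_cimg: "c \<in> \<A> ==> y \<in> ov c c' ==> tr c c' y \<in> cimg c'"
 by auto

lemma tr_tr: "c \<in> \<A> ==> c' \<in> \<A> ==> y \<in> ov c c' ==> tr c' c (tr c c' y) = y"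
 by auto

lemma cinv_tr: "c \<in> \<A> ==> c' \<in> \<A> ==> y \<in> ov c c' ==> cinv c' (tr c c' y) = cinv c y"
 by auto

lemma sm_transition: "c \<in> \<A> ==> c' \<in> \<A> ==> Sm (ov c c') (transition c c' j)"
 using compat[of c c'] unfolding compatible_def by blast

lemma smooth_Jac: "c \<in> \<A> ==> c' \<in> \<A> ==> Sm (ov c c') (%y. Jac c c' y i j)"
 using sm_pd[OF sm_transition] by simp

lemma sm_tr:
 assumes "c \<in> \<A>" "c' \<in> \<A>" "open S" "S \<subseteq> ov c c'" "open T" "!!y. y \<in> S ==> tr c c' y \<in> T" "Sm T g"
 shows "Sm S (%y. g (tr c c' y))"
proof -
 have "Sm S (%y. g (\<chi> j. transition c c' j y))"
  by (rule sm_compose[OF assms(3,5) _ _ assms(7)])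
   (use assms sm_subset[OF open_ov[OF assms(1,2)] assms(4) sm_transition[OF assms(1,2)]]
    in "auto simp: tr_vec")
 then show ?thesis by (simp add: tr_vec)
qed

lemma pd_tr:
 assumes "c \<in> \<A>" "c' \<in> \<A>" "y \<in> ov c c'" "g differentiable (at (tr c c' y))"
 shows "pd i (%z. g (tr c c' z)) y = (SU m. Jac c c' y i m * pd m g (tr c c' y))"
 using chain_rule_pd(2)[of "transition c c'" y g i] assms
  sm_diffble[OF sm_transition[OF assms(1,2)] open_ov[OF assms(1,2)] assms(3)]
 by (simp add: tr_vec)

lemma sm_tr_ov:
 "c \<in> \<A> ==> c' \<in> \<A> ==> Sm (cimg c') g ==> Sm (ov c c') (%y. g (tr c c' y))"
 by (rule sm_tr[of c c' _ "cimg c'"]) (auto simp: open_ov oc)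

lemma Jac_cocycle:
 assumes c: "c \<in> \<A>" "c' \<in> \<A>" "c'' \<in> \<A>" and x: "x \<in> cdom c" "x \<in> cdom c'" "x \<in> cdom c''"
 shows "Jac c c'' (coord c x) i j = (SU m. Jac c c' (coord c x) i m * Jac c' c'' (coord c' x) m j)"
proof -
 let ?N = "coord c ` (cdom c \<inter> cdom c' \<inter> cdom c'')"
 have N: "open ?N" using c by (intro open_coord_image openin_Int openin_cdom) auto
 have "Jac c c'' (coord c x) i j = pd i (%z. transition c' c'' j (tr c c' z)) (coord c x)"
  by (rule pd_cong[OF N]) (use x c in "auto simp: transition_def")
 also have "... = (SU m. Jac c c' (coord c x) i m * Jac c' c'' (tr c c' (coord c x)) m j)"
  by (rule pd_tr) (use c x in "auto intro!: sm_diffble[OF sm_transition open_ov]")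
 finally show ?thesis using c x by simp
qed

lemma Jac_self: "c \<in> \<A> ==> y \<in> cimg c ==> Jac c c y i j = (if i = j then 1 else 0)"
 using pd_cong[OF oc, of c y "transition c c j" "%y. y $ j" i] by (simp add: transition_def)

text \<open>The image of the ball is compact, hence closed since the manifold is Hausdorff. Its
  complement is then open in every other chart, which is what lets objects supported in the ball be
  extended by zero.\<close>

lemma closedin_chart_cball:
 assumes "c \<in> \<A>" "cball y r \<subseteq> cimg c"
 shows "closedin X (cinv c ` cball y r)"
proof -
 obtain g where g: "homeomorphic_maps (subtopology X (cdom c)) (top_of_set (cimg c)) (coord c) g"
  using homeo[OF assms(1)] unfolding homeomorphic_map_maps by blast
 have gc: "g z = cinv c z" if z: "z \<in> cimg c" for z
 proof -
  have "g (coord c (cinv c z)) = cinv c z"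
   using g cinv_in[OF z] cdom_topspace[OF assms(1)] unfolding homeomorphic_maps_def by auto
  then show ?thesis using z by simp
 qed
 have "compactin (top_of_set (cimg c)) (cball y r)"
  using assms(2) by (simp add: compactin_subtopology)
 then have "compactin (subtopology X (cdom c)) (g ` cball y r)"
  using g image_compactin unfolding homeomorphic_maps_def by blast
 moreover have "g ` cball y r = cinv c ` cball y r"
  by (rule image_cong[OF refl], rule gc) (use assms(2) in blast)
 ultimately have "compactin X (cinv c ` cball y r)" by (simp add: compactin_subtopology)
 then show ?thesis using mfd compactin_imp_closedin unfolding smooth_manifold_def by blast
qed

section \<open>Forms and vector fields in charts\<close>

lemma form_zero: "om \<in> Om p ==> c ~: \<A> \<or> y ~: cimg c ==> om c y I = 0"
proof -
 assume "om \<in> Om p" "c ~: \<A> \<or> y ~: cimg c"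
 then have "om c y = 0" unfolding forms_def by blast
 then show ?thesis by simp
qed

lemma form_alt: "om \<in> Om p ==> alternating p (om c y)"
 unfolding forms_def by blast

lemma form_smooth: "om \<in> Om p ==> c \<in> \<A> ==> Sm (cimg c) (%y. om c y I)"
 unfolding forms_def by auto

lemma form_pb:
 assumes "om \<in> Om p" "c \<in> \<A>" "c' \<in> \<A>" "x \<in> cdom c" "x \<in> cdom c'"
 shows "om c (coord c x) = pb p (Jac c c' (coord c x)) (om c' (coord c' x))"
proof
 fix I show "om c (coord c x) I = pb p (Jac c c' (coord c x)) (om c' (coord c' x)) I"
 proof (cases "length I = p")
  case True
  have "om c (coord c x) I = (\<Sum>J\<in>Ls p.
    (\<Prod>s<p. Jac c c' (coord c x) (I ! s) (J ! s)) * om c' (coord c' x) J)"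
   by (rule assms(1)[unfolded forms_def mem_Collect_eq, THEN conjunct2, THEN conjunct2, THEN conjunct2,
     rule_format, OF assms(2,3) _ True]) (use assms(4,5) in blast)
  then show ?thesis by (simp only: pb_def True if_True simp_thms)
 qed (simp add: pb_def alt_length[OF form_alt[OF assms(1)]])
qed

lemma form_tr:
 assumes "om \<in> Om p" "c \<in> \<A>" "c' \<in> \<A>" "y \<in> ov c c'"
 shows "om c y = pb p (Jac c c' y) (om c' (tr c c' y))"
 using form_pb[OF assms(1-3), of "cinv c y"] assms by auto

lemma formsI:
 assumes "!!c y. c ~: \<A> \<or> y ~: cimg c ==> om c y = 0" "!!c y. alternating p (om c y)"
  "!!c I. c \<in> \<A> ==> Sm (cimg c) (%y. om c y I)"
  "!!c c' x. c \<in> \<A> ==> c' \<in> \<A> ==> x \<in> cdom c ==> x \<in> cdom c' ==>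
   om c (coord c x) = pb p (Jac c c' (coord c x)) (om c' (coord c' x))"
 shows "om \<in> Om p"
 using assms unfolding forms_def pb_def by auto

lemma vf_smooth: "V \<in> Vect ==> c \<in> \<A> ==> Sm (cimg c) (%y. V c y $ j)"
 unfolding vector_fields_def by auto

lemma vf_tr:
 "V \<in> Vect ==> c \<in> \<A> ==> c' \<in> \<A> ==> y \<in> ov c c' ==>
  V c' (tr c c' y) $ j = (SU i. Jac c c' y i j * V c y $ i)"
 unfolding vector_fields_def by auto

text \<open>The product rule on the transformation law, in the shape of the hypothesis
  \<open>DW\<close> of \<open>pb_lie\<close> and \<open>pb_dform\<close>.\<close>

lemma form_pd_tr:
 assumes om: "om \<in> Om p" and c: "c \<in> \<A>" "c' \<in> \<A>" and y: "y \<in> ov c c'" and I: "length I = p"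
 shows "pd i (%z. om c z I) y = (\<Sum>J\<in>Ls p.
   (\<Sum>s<p. pd i (%z. Jac c c' z (I ! s) (J ! s)) y * (\<Prod>q\<in>{..<p} - {s}. Jac c c' y (I ! q) (J ! q))) * om c' (tr c c' y) J +
   (\<Prod>s<p. Jac c c' y (I ! s) (J ! s)) * (SU m. Jac c c' y i m * pd m (%z. om c' z J) (tr c c' y)))"
proof -
 note d = sm_diffble[OF _ open_ov[OF c] y]
 have dJ: "(%z. Jac c c' z i j) differentiable at y" for i j by (rule d) (rule smooth_Jac[OF c])
 have dP: "(%z. \<Prod>s\<in>Q. Jac c c' z (I ! s) (J ! s)) differentiable at y" for Q J
  by (intro d smooth_intros open_ov c sm_transition)
 have dw: "(%z. om c' (tr c c' z) J) differentiable at y" for J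
  by (intro d sm_tr_ov c form_smooth[OF om])
 have pdprod: "pd i (%z. \<Prod>s\<in>Q. Jac c c' z (I ! s) (J ! s)) y =
   (\<Sum>s\<in>Q. pd i (%z. Jac c c' z (I ! s) (J ! s)) y * (\<Prod>q\<in>Q - {s}. Jac c c' y (I ! q) (J ! q)))"
  if "finite Q" for Q J using that
 proof (induction Q rule: finite_induct)
  case (insert s Q)
  have "(\<Sum>r\<in>Q. pd i (%z. Jac c c' z (I ! r) (J ! r)) y * (\<Prod>q\<in>insert s Q - {r}. Jac c c' y (I ! q) (J ! q))) =
    (\<Sum>r\<in>Q. Jac c c' y (I ! s) (J ! s) * (pd i (%z. Jac c c' z (I ! r) (J ! r)) y * (\<Prod>q\<in>Q - {r}. Jac c c' y (I ! q) (J ! q))))"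
  proof (rule scong)
   fix r assume "r \<in> Q"
   then have "insert s Q - {r} = insert s (Q - {r})" "s ~: Q - {r}" using insert by auto
   then show "pd i (%z. Jac c c' z (I ! r) (J ! r)) y * (\<Prod>q\<in>insert s Q - {r}. Jac c c' y (I ! q) (J ! q)) =
    Jac c c' y (I ! s) (J ! s) * (pd i (%z. Jac c c' z (I ! r) (J ! r)) y * (\<Prod>q\<in>Q - {r}. Jac c c' y (I ! q) (J ! q)))"
    using insert by simp
  qed
  moreover have "insert s Q - {s} = Q" using insert by auto
  ultimately show ?case using insert dJ dP
   by (simp add: pd_mult sum_distrib_left del: prod.insert add: prod.insert[OF insert(1,2)])
 qed simp
 have "pd i (%z. om c z I) y = pd i (%z. \<Sum>J\<in>Ls p. (\<Prod>s<p. Jac c c' z (I ! s) (J ! s)) * om c' (tr c c' z) J) y"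
  by (rule pd_cong[OF open_ov[OF c] y]) (use form_tr[OF om c] I in "simp add: pb_def")
 also have "... = (\<Sum>J\<in>Ls p. pd i (%z. (\<Prod>s<p. Jac c c' z (I ! s) (J ! s)) * om c' (tr c c' z) J) y)"
  using dP dw by (intro pd_sum differentiable_mult) auto
 also have "... = (\<Sum>J\<in>Ls p. pd i (%z. \<Prod>s<p. Jac c c' z (I ! s) (J ! s)) y * om c' (tr c c' y) J +
   (\<Prod>s<p. Jac c c' y (I ! s) (J ! s)) * pd i (%z. om c' (tr c c' z) J) y)"
  using pd_mult[OF dP dw] by (intro sum.cong) auto
 also have "... = (\<Sum>J\<in>Ls p.
   (\<Sum>s<p. pd i (%z. Jac c c' z (I ! s) (J ! s)) y * (\<Prod>q\<in>{..<p} - {s}. Jac c c' y (I ! q) (J ! q))) * om c' (tr c c' y) J +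
   (\<Prod>s<p. Jac c c' y (I ! s) (J ! s)) * (SU m. Jac c c' y i m * pd m (%z. om c' z J) (tr c c' y)))"
 proof (rule scong)
  fix J
  have "pd i (%z. om c' (tr c c' z) J) y = (SU m. Jac c c' y i m * pd m (%z. om c' z J) (tr c c' y))"
   by (rule pd_tr[OF c y])
    (rule sm_diffble[OF form_smooth[OF om c(2)] oc[OF c(2)] tr_cimg[OF c(1) y]])
  then show "pd i (%z. \<Prod>s<p. Jac c c' z (I ! s) (J ! s)) y * om c' (tr c c' y) J +
   (\<Prod>s<p. Jac c c' y (I ! s) (J ! s)) * pd i (%z. om c' (tr c c' z) J) y =
   (\<Sum>s<p. pd i (%z. Jac c c' z (I ! s) (J ! s)) y * (\<Prod>q\<in>{..<p} - {s}. Jac c c' y (I ! q) (J ! q))) * om c' (tr c c' y) J +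
   (\<Prod>s<p. Jac c c' y (I ! s) (J ! s)) * (SU m. Jac c c' y i m * pd m (%z. om c' z J) (tr c c' y))"
   using pdprod[of "{..<p}"] by simp
 qed
 finally show ?thesis .
qed

lemma pd_Jac_commute:
 assumes "c \<in> \<A>" "c' \<in> \<A>" "y \<in> ov c c'"
 shows "pd i (%z. Jac c c' z j k) y = pd j (%z. Jac c c' z i k) y"
 using pd_commute[OF open_ov[OF assms(1,2)] sm_transition[OF assms(1,2)] assms(3)] by simp

text \<open>Both sides are \<open>pd j\<close> of the component \<open>k\<close> of the field in the
  second chart, pulled back to the first: once by the chain rule and once by the transformation law.
  Symmetry of the second derivatives of the transition puts the result in the form used by
  \<open>pb_lie\<close>.\<close>

lemma vf_pd_tr:
 assumes V: "V \<in> Vect" and c: "c \<in> \<A>" "c' \<in> \<A>" and y: "y \<in> ov c c'"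
 shows "(SU i. V c y $ i * pd i (%z. Jac c c' z j k) y + pd j (%z. V c z $ i) y * Jac c c' y i k) =
  (SU m. Jac c c' y j m * pd m (%z. V c' z $ k) (tr c c' y))"
proof -
 note d = sm_diffble[OF _ open_ov[OF c] y]
 have dJ: "(%z. Jac c c' z i j) differentiable at y" for i j by (rule d) (rule smooth_Jac[OF c])
 have dV: "(%z. V c z $ i) differentiable at y" for i
  by (rule sm_diffble[OF vf_smooth[OF V c(1)] oc[OF c(1)] ov_cimg[OF y]])
 have "pd j (%z. V c' (tr c c' z) $ k) y = (SU m. Jac c c' y j m * pd m (%z. V c' z $ k) (tr c c' y))"
  by (rule pd_tr[OF c y])
   (rule sm_diffble[OF vf_smooth[OF V c(2)] oc[OF c(2)] tr_cimg[OF c(1) y]])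
 moreover have "pd j (%z. V c' (tr c c' z) $ k) y = pd j (%z. SU i. Jac c c' z i k * V c z $ i) y"
  by (rule pd_cong[OF open_ov[OF c] y]) (rule vf_tr[OF V c])
 moreover have "... = (SU i. pd j (%z. Jac c c' z i k * V c z $ i) y)"
  using dJ dV by (intro pd_sum differentiable_mult) auto
 moreover have "... = (SU i. V c y $ i * pd i (%z. Jac c c' z j k) y + pd j (%z. V c z $ i) y * Jac c c' y i k)"
  by (rule scong)
   (simp only: pd_mult[OF dJ dV], simp add: pd_Jac_commute[OF c y, of j] mult_ac)
 ultimately show ?thesis by simp
qed

lemma lie_form_chart:
 assumes "om \<in> Om p" "c \<in> \<A>" "y \<in> cimg c" "length I = p"
 shows "LF V om c y I = (SU i. V c y $ i * pd i (%z. om c z I) y) +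
  (\<Sum>s<p. SU j. pd (I ! s) (%z. V c z $ j) y * om c y (I[s := j]))"
 using assms unfolding lie_form_def on_charts_def restrict0_def by simp

lemma pd_form_alt:
 assumes om: "om \<in> Om p" and c: "c \<in> \<A>" and y: "y \<in> cimg c"
 shows "alternating p (%I. pd i (%z. om c z I) y)"
 unfolding alt_swp
proof (intro conjI allI impI)
 fix I :: "'n list" assume "length I ~= p"
 then show "pd i (%z. om c z I) y = 0" using alt_length[OF form_alt[OF om]] by simp
next
 fix I :: "'n list" and s t assume *: "length I = p" "s < p" "t < p" "s ~= t"
 have "(%z. om c z (swp s t I)) = (%z. - om c z I)"
  using alternatingD[OF form_alt[OF om] *] by blast
 then show "pd i (%z. om c z (swp s t I)) y = - pd i (%z. om c z I) y"
  using pd_minus[OF sm_diffble[OF form_smooth[OF om c] oc[OF c] y]] by simp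
qed

lemma alt_derivation:
 fixes w :: "'n::finite list => real"
 assumes "alternating p w"
 shows "alternating p (%I. \<Sum>s<length I. SU j. M (I ! s) j * w (I[s := j]))"
 unfolding alt_swp
proof (intro conjI allI impI)
 fix I :: "'n list" assume "length I ~= p"
 then show "(\<Sum>s<length I. SU j. M (I ! s) j * w (I[s := j])) = 0"
  using alt_length[OF assms] by simp
next
 fix I :: "'n list" and s t assume *: "length I = p" "s < p" "t < p" "s ~= t"
 have "(\<Sum>r<p. SU j. M (swp s t I ! r) j * w ((swp s t I)[r := j])) =
   (\<Sum>r<p. SU j. - (M (I ! tps s t r) j * w (I[tps s t r := j])))"
 proof (intro sum.cong refl)
  fix r j assume "r \<in> {..<p}"
  then have r: "r < p" by simp
  have "(swp s t I)[r := j] = swp s t (I[tps s t r := j])" using * r by (intro swp_update) auto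
  then show "M (swp s t I ! r) j * w ((swp s t I)[r := j]) = - (M (I ! tps s t r) j * w (I[tps s t r := j]))"
   using alternatingD[OF assms, of "I[tps s t r := j]" s t] * r by (simp add: nth_swp)
 qed
 also have "... = (\<Sum>r<p. SU j. - (M (I ! r) j * w (I[r := j])))"
  by (rule sum.reindex_bij_witness[of _ "tps s t" "tps s t"]) (use * in "auto simp: tps_def")
 finally show "(\<Sum>r<length (swp s t I). SU j. M (swp s t I ! r) j * w ((swp s t I)[r := j])) =
   - (\<Sum>r<length I. SU j. M (I ! r) j * w (I[r := j]))"
  using * by (simp add: sum_negf)
qed

lemma lie_forms:
 assumes om: "om \<in> Om p" and V: "V \<in> Vect"
 shows "LF V om \<in> Om p"
proof (rule formsI)
 show "LF V om c y = 0" if "c ~: \<A> \<or> y ~: cimg c" for c y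
  using that by (auto simp: lie_form_def on_charts_def restrict0_def)
 show alt: "alternating p (LF V om c y)" for c y
 proof (cases "c \<in> \<A> & y \<in> cimg c")
  case True
  have "alternating p (%I. (SU i. V c y $ i * pd i (%z. om c z I) y) +
   (\<Sum>s<length I. SU j. pd (I ! s) (%z. V c z $ j) y * om c y (I[s := j])))"
   using True by (intro alt_add alt_sum alt_cmult pd_form_alt[OF om]
     alt_derivation form_alt[OF om]) auto
  then show ?thesis using True by (simp add: lie_form_def on_charts_def restrict0_def)
 qed (auto simp: lie_form_def on_charts_def restrict0_def zero_fun_def)
 show "Sm (cimg c) (%y. LF V om c y I)" if c: "c \<in> \<A>" for c I
 proof (rule sm_cong[OF oc[OF c]])
  show "Sm (cimg c) (%y. (SU i. V c y $ i * pd i (%z. om c z I) y) +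
   (\<Sum>s<length I. SU j. pd (I ! s) (%z. V c z $ j) y * om c y (I[s := j])))"
   by (intro smooth_intros oc[OF c] vf_smooth[OF V c] form_smooth[OF om c])
 qed (use c in "simp add: lie_form_def on_charts_def restrict0_def")
 fix c c' x assume c: "c \<in> \<A>" "c' \<in> \<A>" and x: "x \<in> cdom c" "x \<in> cdom c'"
 let ?y = "coord c x"
 have y: "?y \<in> ov c c'" "?y \<in> cimg c" and t: "tr c c' ?y = coord c' x" and y': "coord c' x \<in> cimg c'"
  using c x by auto
 show "LF V om c ?y = pb p (Jac c c' ?y) (LF V om c' (coord c' x))"
 proof
  fix I :: "'n list"
  show "LF V om c ?y I = pb p (Jac c c' ?y) (LF V om c' (coord c' x)) I"
  proof (cases "length I = p")
   case False
   then show ?thesis using alt_length[OF alt] by (simp add: pb_def)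
  next
   case True
   have "(SU i. V c ?y $ i * pd i (%z. om c z I) ?y) +
     (\<Sum>s<p. SU j. pd (I ! s) (%z. V c z $ j) ?y * om c ?y (I[s := j])) =
    pb p (Jac c c' ?y) (%J. (SU m. V c' (coord c' x) $ m * pd m (%z. om c' z J) (coord c' x)) +
     (\<Sum>s<p. SU j. pd (J ! s) (%z. V c' z $ j) (coord c' x) * om c' (coord c' x) (J[s := j]))) I"
   proof (rule pb_lie[OF True, where W = "om c ?y" and DW = "%i I. pd i (%z. om c z I) ?y" and
      H = "%i j k. pd i (%z. Jac c c' z j k) ?y"])
    show "om c ?y I = (\<Sum>J\<in>Ls p. (\<Prod>s<p. Jac c c' ?y (I ! s) (J ! s)) * om c' (coord c' x) J)"
     if "length I = p" for I using form_pb[OF om c x] that by (simp add: pb_def)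
    show "pd i (%z. om c z I) ?y = (\<Sum>J\<in>Ls p.
     (\<Sum>s<p. pd i (%z. Jac c c' z (I ! s) (J ! s)) ?y * (\<Prod>q\<in>{..<p} - {s}. Jac c c' ?y (I ! q) (J ! q))) * om c' (coord c' x) J +
     (\<Prod>s<p. Jac c c' ?y (I ! s) (J ! s)) * (SU m. Jac c c' ?y i m * pd m (%z. om c' z J) (coord c' x)))"
     if "length I = p" for i I using form_pd_tr[OF om c y(1) that] unfolding t .
    show "V c' (coord c' x) $ m = (SU i. Jac c c' ?y i m * V c ?y $ i)" for m
     using vf_tr[OF V c y(1)] unfolding t .
    show "(SU i. V c ?y $ i * pd i (%z. Jac c c' z j k) ?y + pd j (%z. V c z $ i) ?y * Jac c c' ?y i k) =
     (SU m. Jac c c' ?y j m * pd m (%z. V c' z $ k) (coord c' x))" for j k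
     using vf_pd_tr[OF V c y(1)] unfolding t .
   qed
   then show ?thesis
    using lie_form_chart[OF om c(1) y(2) True] True by (simp add: lie_form_chart[OF om c(2) y'] pb_def)
  qed
 qed
qed

lemma ext_d_chart:
 assumes om: "om \<in> Om p" and c: "c \<in> \<A>" and y: "y \<in> cimg c"
 shows "Ed om c y I = dform (%i b. pd i (%z. om c z b) y) I"
 using dform_omit[OF pd_form_alt[OF om c y]] c y unfolding ext_d_def on_charts_def restrict0_def by simp

lemma sm_dform:
 assumes "open S" "!!i b. Sm S (%y. A y i b)"
 shows "Sm S (%y. dform (A y) I)"
 by (cases I) (auto simp: dform_def intro!: sm_diff sm_sum assms)

lemma d_forms:
 assumes om: "om \<in> Om p"
 shows "Ed om \<in> Om (Suc p)"
proof (rule formsI)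
 show "Ed om c y = 0" if "c ~: \<A> \<or> y ~: cimg c" for c y
  using that by (auto simp: ext_d_def on_charts_def restrict0_def)
 show alt: "alternating (Suc p) (Ed om c y)" for c y
 proof (cases "c \<in> \<A> & y \<in> cimg c")
  case True
  then have "Ed om c y = dform (%i b. pd i (%z. om c z b) y)"
   using ext_d_chart[OF om] by blast
  then show ?thesis using True alt_dform[OF pd_form_alt[OF om]] by simp
 qed (auto simp: ext_d_def on_charts_def restrict0_def zero_fun_def)
 show "Sm (cimg c) (%y. Ed om c y I)" if c: "c \<in> \<A>" for c I
 proof (rule sm_cong[OF oc[OF c]])
  show "dform (%i b. pd i (%z. om c z b) y) I = Ed om c y I" if "y \<in> cimg c" for y
   using ext_d_chart[OF om c that] by simp
  show "Sm (cimg c) (%y. dform (%i b. pd i (%z. om c z b) y) I)"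
   by (intro sm_dform sm_pd form_smooth[OF om c] oc[OF c])
 qed
 fix c c' x assume c: "c \<in> \<A>" "c' \<in> \<A>" and x: "x \<in> cdom c" "x \<in> cdom c'"
 let ?y = "coord c x"
 have y: "?y \<in> ov c c'" "?y \<in> cimg c" and t: "tr c c' ?y = coord c' x" and y': "coord c' x \<in> cimg c'"
  using c x by auto
 show "Ed om c ?y = pb (Suc p) (Jac c c' ?y) (Ed om c' (coord c' x))"
 proof
  fix I :: "'n list"
  show "Ed om c ?y I = pb (Suc p) (Jac c c' ?y) (Ed om c' (coord c' x)) I"
  proof (cases "length I = Suc p")
   case False
   then show ?thesis using alt_length[OF alt] by (simp add: pb_def)
  next
   case True
   then obtain i b where I: "I = i # b" "length b = p" by (auto simp: length_Suc_conv)
   have "dform (%i b. pd i (%z. om c z b) ?y) (i # b) =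
     pb (Suc p) (Jac c c' ?y) (dform (%i b. pd i (%z. om c' z b) (coord c' x))) (i # b)"
   proof (rule pb_dform[OF I(2) form_alt[OF om, of c' "coord c' x"]])
    show "pd i (%z. Jac c c' z j k) ?y = pd j (%z. Jac c c' z i k) ?y" for i j k
     by (rule pd_Jac_commute[OF c y(1)])
    show "pd i (%z. om c z I) ?y = (\<Sum>J\<in>Ls p.
     (\<Sum>s<p. pd i (%z. Jac c c' z (I ! s) (J ! s)) ?y * (\<Prod>q\<in>{..<p} - {s}. Jac c c' ?y (I ! q) (J ! q))) * om c' (coord c' x) J +
     (\<Prod>s<p. Jac c c' ?y (I ! s) (J ! s)) * (SU m. Jac c c' ?y i m * pd m (%z. om c' z J) (coord c' x)))"
     if "length I = p" for i I using form_pd_tr[OF om c y(1) that] unfolding t .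
   qed
   then show ?thesis unfolding I(1) using ext_d_chart[OF om c(1) y(2)] ext_d_chart[OF om c(2) y']
    by (simp add: pb_def)
  qed
 qed
qed

section \<open>The Lie derivative of functions and operators in charts\<close>

text \<open>\<open>glue\<close> evaluates in one selected chart around the point. The chain rule for
  the function and the transformation law of the field carry the expression to any other
  chart.\<close>

lemma lie_fun_chart:
 assumes V: "V \<in> Vect" and f: "f \<in> smooth_functions \<A>" and c: "c \<in> \<A>" and y: "y \<in> cimg c"
 shows "lie_fun \<A> V f (cinv c y) = (SU i. V c y $ i * pd i (f \<circ> cinv c) y)"
proof -
 let ?x = "cinv c y"
 define c' where "c' = (SOME c. c \<in> \<A> & ?x \<in> cdom c)"
 have "c' \<in> \<A> & ?x \<in> cdom c'" unfolding c'_def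
  by (rule someI_ex, rule exI[of _ c]) (use c cinv_in[OF y] in simp)
 then have c': "c' \<in> \<A>" and xc': "?x \<in> cdom c'" by auto
 have yo: "y \<in> ov c c'" using ov_iff[OF c y] xc' by simp
 have sf: "Sm (cimg c') (f \<circ> cinv c')" using f c' unfolding smooth_functions_def by auto
 have "(SU i. V c y $ i * pd i (f \<circ> cinv c) y) = (SU i. V c y $ i * pd i (%z. (f \<circ> cinv c') (tr c c' z)) y)"
 proof -
  have "pd i (f \<circ> cinv c) y = pd i (%z. (f \<circ> cinv c') (tr c c' z)) y" for i
   by (rule pd_cong[OF open_ov[OF c c'] yo]) (simp only: o_def cinv_tr[OF c c'])
  then show ?thesis by simp
 qed
 also have "... = (SU i. V c y $ i * (SU m. Jac c c' y i m * pd m (f \<circ> cinv c') (tr c c' y)))"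
  using pd_tr[OF c c' yo sm_diffble[OF sf oc[OF c'] tr_cimg[OF c yo]]] by simp
 also have "... = (SU m. V c' (tr c c' y) $ m * pd m (f \<circ> cinv c') (tr c c' y))"
  unfolding vf_tr[OF V c c' yo] sum_distrib_left sum_distrib_right
  by (subst sum.swap) (simp add: mult_ac)
 also have "... = lie_fun \<A> V f ?x"
  using cdom_points[OF c cinv_in[OF y]]
  by (simp add: lie_fun_def glue_def restrict0_def c'_def[symmetric] Let_def)
 finally show ?thesis ..
qed

lemma lie_fun_outside: "x ~: pts ==> lie_fun \<A> V f x = 0"
 by (simp add: lie_fun_def glue_def restrict0_def)

end

section \<open>Alternating basis tensors\<close>

text \<open>The components of \<open>dx\<^sup>b\<^sup>1 \<and> \<dots> \<and> dx\<^sup>b\<^sup>p\<close>.\<close>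

definition eps :: "nat => 'n list => 'n list => real" where
 "eps p b I = (if length b = p & length I = p then
  \<Sum>pm | pm permutes {..<p}. of_int (sign pm) * (\<Prod>s<p. if I ! s = b ! pm s then 1 else 0) else 0)"

lemma permutes_lessThan_permutation: "pm permutes {..<p::nat} ==> permutation pm"
 unfolding permutation_permutes by blast

lemma eps_length: "length I ~= p ==> eps p b I = 0"
 by (simp add: eps_def)

lemma eps_sym: "eps p b I = eps p I b"
proof (cases "length b = p & length I = p")
 case True
 have "(\<Prod>s<p. if I ! s = b ! inv pm s then 1 else (0::real)) = (\<Prod>s<p. if b ! s = I ! pm s then 1 else 0)"
  if pm: "pm permutes {..<p}" for pm
  by (rule prod.reindex_bij_witness[of _ pm "inv pm"])
   (use pm permutes_in_image[OF pm] permutes_in_image[OF permutes_inv[OF pm]] in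
    \<open>auto simp: permutes_inverses[OF pm]\<close>)
 then have "eps p b I = (\<Sum>pm | pm permutes {..<p}. of_int (sign (inv pm)) * (\<Prod>s<p. if b ! s = I ! pm s then 1 else 0))"
  using True unfolding eps_def by (subst sum_permutations_inverse) (auto intro!: sum.cong)
 also have "... = eps p I b"
  using True unfolding eps_def
  by (auto intro!: sum.cong simp: sign_inverse[OF permutes_lessThan_permutation])
 finally show ?thesis .
qed (auto simp: eps_def)

lemma eps_swp:
 assumes "s < p" "t < p" "s ~= t" "length I = p"
 shows "eps p b (swp s t I) = - eps p b I"
proof (cases "length b = p")
 case True
 let ?ta = "Transposition.transpose s t"
 have ta: "?ta permutes {..<p}" using assms by (simp add: permutes_swap_id)
 have tps: "tps s t = ?ta" by (auto simp: tps_def Transposition.transpose_def fun_eq_iff)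
 have e: "eps p b (swp s t I) = (\<Sum>pm | pm permutes {..<p}. of_int (sign (pm \<circ> ?ta)) *
   (\<Prod>r<p. if swp s t I ! r = b ! (pm \<circ> ?ta) r then 1 else 0))"
  using assms True unfolding eps_def
  by (simp, intro sum.reindex_bij_witness[of _ "%pm. pm \<circ> ?ta" "%pm. pm \<circ> ?ta"])
   (auto simp: o_assoc[symmetric] intro!: permutes_compose permutes_swap_id)
 also have "... = (\<Sum>pm | pm permutes {..<p}. - (of_int (sign pm) * (\<Prod>r<p. if I ! r = b ! pm r then 1 else 0)))"
 proof (rule scong)
  fix pm assume "pm \<in> {pm. pm permutes {..<p}}"
  then have pm: "permutation pm" by (auto intro: permutes_lessThan_permutation)
  have "(\<Prod>r<p. if swp s t I ! r = b ! (pm \<circ> ?ta) r then 1 else (0::real)) = (\<Prod>r<p. if I ! ?ta r = b ! pm (?ta r) then 1 else 0)"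
   using assms by (intro prod.cong) (auto simp: nth_swp tps)
  also have "... = (\<Prod>r<p. if I ! r = b ! pm r then 1 else 0)"
   by (rule prod.reindex_bij_witness[of _ ?ta ?ta]) (use assms in "auto simp: Transposition.transpose_def")
  finally show "of_int (sign (pm \<circ> ?ta)) * (\<Prod>r<p. if swp s t I ! r = b ! (pm \<circ> ?ta) r then 1 else 0) =
    - (of_int (sign pm) * (\<Prod>r<p. if I ! r = b ! pm r then 1 else (0::real)))"
   using assms by (simp add: sign_compose pm permutation_swap_id sign_swap_id)
 qed
 finally show ?thesis using assms True by (simp add: eps_def sum_negf)
qed (simp add: eps_def)

lemma alt_eps: "alternating p (eps p b)"
 unfolding alt_swp by (intro conjI allI impI) (simp_all add: eps_length eps_swp)

lemma alt_permute:
 assumes w: "alternating p w" and pm: "pm permutes {..<p}"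
 shows "length b = p ==> w (map (%s. b ! pm s) [0..<p]) = of_int (sign pm) * w b"
proof -
 have "finite {..<p}" by simp
 with pm show "length b = p ==> w (map (%s. b ! pm s) [0..<p]) = of_int (sign pm) * w b"
 proof (induction pm arbitrary: b rule: permutes_induct)
  case id
  then show ?case using map_nth[of b] by simp
 next
  case (swap a c pm)
  show ?case
  proof (cases "a = c")
   case True
   then show ?thesis using swap by simp
  next
   case False
   have ac: "a < p" "c < p" using swap by auto
   have eq: "map (%s. b ! (Transposition.transpose a c \<circ> pm) s) [0..<p] = map (%s. swp a c b ! pm s) [0..<p]"
    using swap ac permutes_in_image[OF `pm permutes {..<p}`]
    by (auto simp: nth_swp tps_def Transposition.transpose_def)
   have A: "w (map (%s. b ! (Transposition.transpose a c \<circ> pm) s) [0..<p]) = of_int (sign pm) * w (swp a c b)"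
    unfolding eq by (rule swap.IH) (simp add: swap.prems)
   have "permutation pm" using swap by (auto intro: permutes_lessThan_permutation)
   then have B: "sign (Transposition.transpose a c \<circ> pm) = - sign pm"
    using False by (simp add: sign_compose permutation_swap_id sign_swap_id)
   show ?thesis
    unfolding A B alternatingD[OF w swap.prems ac False] by simp
  qed
 qed
qed

text \<open>Each of the p! permutations contributes \<open>w b\<close>, since the sign in
  \<open>eps\<close> meets that of \<open>w\<close>; the normalisation of \<open>pairing\<close>
  removes p!. Hence evaluation at a single component is a pairing with an alternating
  tensor.\<close>

lemma pairing_eps:
 assumes w: "alternating p w" and b: "length b = p"
 shows "pairing p (eps p b) w = w b"
proof -
 have "(\<Sum>I\<in>Ls p. eps p b I * w I) = (\<Sum>I\<in>Ls p. \<Sum>pm | pm permutes {..<p}.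
   of_int (sign pm) * (\<Prod>s<p. if I ! s = map (%s. b ! pm s) [0..<p] ! s then 1 else 0) * w I)"
  using b by (auto simp: eps_def sum_distrib_right intro!: sum.cong)
 also have "... = (\<Sum>pm | pm permutes {..<p}. \<Sum>I\<in>Ls p.
   of_int (sign pm) * (\<Prod>s<p. if I ! s = map (%s. b ! pm s) [0..<p] ! s then 1 else 0) * w I)"
  by (rule sum.swap)
 also have "... = (\<Sum>pm | pm permutes {..<p}. w b)"
 proof (rule scong)
  fix pm assume "pm \<in> {pm. pm permutes {..<p}}"
  then have pm: "pm permutes {..<p}" by simp
  have "(\<Sum>I\<in>Ls p. of_int (sign pm) * (\<Prod>s<p. if I ! s = map (%s. b ! pm s) [0..<p] ! s then 1 else 0) * w I) =
    (\<Sum>I\<in>Ls p. if I = map (%s. b ! pm s) [0..<p] then of_int (sign pm) * w I else 0)"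
   by (rule scong, subst prod_delta_lists) auto
  also have "... = of_int (sign pm) * w (map (%s. b ! pm s) [0..<p])"
   by (simp add: sum.delta')
  also have "... = of_int (sign pm) * (of_int (sign pm) * w b)" unfolding alt_permute[OF w pm b] ..
  finally show "(\<Sum>I\<in>Ls p. of_int (sign pm) * (\<Prod>s<p. if I ! s = map (%s. b ! pm s) [0..<p] ! s then 1 else 0) * w I) = w b"
   by (simp add: sign_def)
 qed
 also have "... = fact p * w b" by (simp add: card_permutations)
 finally show ?thesis by (simp add: pairing_def)
qed

lemma eps_self:
 assumes "distinct b" "length b = p"
 shows "eps p b b = 1"
proof -
 have *: "(\<Prod>s<p. if b ! s = b ! pm s then 1 else (0::real)) = (if pm = id then 1 else 0)"
  if pm: "pm permutes {..<p}" for pm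
 proof (cases "pm = id")
  case False
  then obtain s where s: "pm s ~= s" by (auto simp: fun_eq_iff)
  then have "s < p" "pm s < p" using pm permutes_in_image[OF pm] unfolding permutes_def by auto
  then have "b ! s ~= b ! pm s" using assms s by (simp add: nth_eq_iff_index_eq)
  then show ?thesis using False `s < p` by (auto intro: bexI[of _ s])
 qed simp
 have "(\<Sum>pm | pm permutes {..<p}. of_int (sign pm) * (\<Prod>s<p. if b ! s = b ! pm s then 1 else 0)) =
   (\<Sum>pm | pm permutes {..<p}. if pm = id then of_int (sign pm) else (0::real))"
  by (rule scong) (simp only: mem_Collect_eq *, auto simp: id_def)
 then have "eps p b b = (\<Sum>pm | pm permutes {..<p}. if pm = id then of_int (sign pm) else 0)"
  using assms by (simp only: eps_def if_True simp_thms)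
 also have "... = 1" by (simp add: sum.delta' finite_permutations permutes_id)
 finally show ?thesis .
qed

text \<open>A derivation acting on the arguments of \<open>eps\<close> is transposed into one acting
  on its label \<open>b\<close>. This keeps Lie derivatives of basis forms inside the span of basis
  forms.\<close>

lemma eps_lie:
 fixes b :: "'n::finite list"
 assumes "length b = p" "length I = p"
 shows "(\<Sum>s<p. a (I ! s) * eps p b (I[s := i])) =
  (\<Sum>q<p. if b ! q = i then SU j. a j * eps p (b[q := j]) I else (0::real))"
proof -
 let ?R = "%pm s. \<Prod>q\<in>{..<p} - {s}. if I ! q = b ! pm q then 1 else (0::real)"
 have "(\<Sum>s<p. a (I ! s) * eps p b (I[s := i])) = (\<Sum>s<p. \<Sum>pm | pm permutes {..<p}.
   of_int (sign pm) * a (I ! s) * ((if i = b ! pm s then 1 else 0) * ?R pm s))"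
 proof (rule scong)
  fix s assume "s \<in> {..<p}"
  then have s: "s < p" by simp
  have "(\<Prod>q<p. if I[s := i] ! q = b ! pm q then 1 else (0::real)) = (if i = b ! pm s then 1 else 0) * ?R pm s" for pm
   using s assms by (subst prod.remove[of "{..<p}" s]) (auto intro!: prod.cong)
  then show "a (I ! s) * eps p b (I[s := i]) = (\<Sum>pm | pm permutes {..<p}.
   of_int (sign pm) * a (I ! s) * ((if i = b ! pm s then 1 else 0) * ?R pm s))"
   using assms by (simp add: eps_def sum_distrib_left mult_ac)
 qed
 also have "... = (\<Sum>pm | pm permutes {..<p}. \<Sum>s<p.
   of_int (sign pm) * a (I ! s) * ((if i = b ! pm s then 1 else 0) * ?R pm s))" by (rule sum.swap)
 also have "... = (\<Sum>pm | pm permutes {..<p}. \<Sum>q<p. if b ! q = i then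
   of_int (sign pm) * a (I ! inv pm q) * ?R pm (inv pm q) else 0)"
 proof (rule scong)
  fix pm assume "pm \<in> {pm. pm permutes {..<p}}"
  then have pm: "pm permutes {..<p}" by simp
  show "(\<Sum>s<p. of_int (sign pm) * a (I ! s) * ((if i = b ! pm s then 1 else 0) * ?R pm s)) =
    (\<Sum>q<p. if b ! q = i then of_int (sign pm) * a (I ! inv pm q) * ?R pm (inv pm q) else 0)"
   by (rule sum.reindex_bij_witness[of _ "inv pm" pm])
    (use permutes_in_image[OF pm] permutes_in_image[OF permutes_inv[OF pm]] in "auto simp: permutes_inverses[OF pm]")
 qed
 also have "... = (\<Sum>q<p. \<Sum>pm | pm permutes {..<p}. if b ! q = i then
   of_int (sign pm) * a (I ! inv pm q) * ?R pm (inv pm q) else 0)" by (rule sum.swap)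
 also have "... = (\<Sum>q<p. if b ! q = i then SU j. a j * eps p (b[q := j]) I else 0)"
 proof (rule scong)
  fix q assume "q \<in> {..<p}"
  then have q: "q < p" by simp
  have prod: "(\<Prod>s<p. if I ! s = b[q := j] ! pm s then 1 else (0::real)) = (if I ! inv pm q = j then 1 else 0) * ?R pm (inv pm q)"
   if pm: "pm permutes {..<p}" for pm j
  proof -
   have iq: "inv pm q < p" using permutes_in_image[OF permutes_inv[OF pm]] q by simp
   have "pm s ~= q" if "s ~= inv pm q" for s using that permutes_inverses[OF pm] by metis
   then have "b[q := j] ! pm s = b ! pm s" if "s ~= inv pm q" for s
    using that by (metis nth_list_update_neq)
   then have "(\<Prod>s\<in>{..<p} - {inv pm q}. if I ! s = b[q := j] ! pm s then 1 else (0::real)) = ?R pm (inv pm q)"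
    by (intro prod.cong) auto
   then show ?thesis
    using iq assms q by (subst prod.remove[of "{..<p}" "inv pm q"]) (auto simp: permutes_inverses[OF pm])
  qed
  have "(SU j. a j * eps p (b[q := j]) I) = (SU j. \<Sum>pm | pm permutes {..<p}.
    of_int (sign pm) * a j * ((if I ! inv pm q = j then 1 else 0) * ?R pm (inv pm q)))"
   using assms prod by (auto simp: eps_def sum_distrib_left mult_ac intro!: sum.cong)
  also have "... = (\<Sum>pm | pm permutes {..<p}. SU j.
    of_int (sign pm) * a j * ((if I ! inv pm q = j then 1 else 0) * ?R pm (inv pm q)))" by (rule sum.swap)
  also have "... = (\<Sum>pm | pm permutes {..<p}. of_int (sign pm) * a (I ! inv pm q) * ?R pm (inv pm q))"
  proof (rule scong)
   fix pm
   have "(SU j. of_int (sign pm) * a j * ((if I ! inv pm q = j then 1 else 0) * ?R pm (inv pm q))) =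
     (SU j. if j = I ! inv pm q then of_int (sign pm) * a j * ?R pm (inv pm q) else 0)"
    by (intro sum.cong) auto
   then show "(SU j. of_int (sign pm) * a j * ((if I ! inv pm q = j then 1 else 0) * ?R pm (inv pm q))) =
     of_int (sign pm) * a (I ! inv pm q) * ?R pm (inv pm q)"
    by (simp only: sum.delta finite_class.finite_UNIV UNIV_I if_True)
  qed
  finally show "(\<Sum>pm | pm permutes {..<p}. if b ! q = i then of_int (sign pm) * a (I ! inv pm q) * ?R pm (inv pm q) else 0) =
    (if b ! q = i then SU j. a j * eps p (b[q := j]) I else 0)" by simp
 qed
 finally show ?thesis .
qed

text \<open>The sign is that of the permutation carrying \<open>b\<close> to \<open>b'\<close>. It
  is chosen before \<open>w\<close>, so that one sign serves forms, coefficients and values of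
  operators simultaneously.\<close>

lemma same_set_sign:
 assumes "distinct b" "distinct b'" "set b = set b'" "length b = p"
 shows "\<exists>si::real. si * si = 1 & (\<forall>w. alternating p w --> w b' = si * w b)"
proof -
 have "mset b' = mset b" using assms set_eq_iff_mset_eq_distinct by blast
 then obtain pm where pm: "pm permutes {..<length b}" "permute_list pm b = b'"
  using mset_eq_permutation by metis
 have "b' = map (%s. b ! pm s) [0..<p]" using pm assms by (simp add: permute_list_def)
 then have "w b' = of_int (sign pm) * w b" if "alternating p w" for w
  using alt_permute[OF that, of pm b] pm assms by simp
 moreover have "of_int (sign pm) * of_int (sign pm) = (1::real)" by (simp add: sign_def)
 ultimately show ?thesis by blast
qed

section \<open>Monomials\<close>

definition mon :: "real^'n::finite => 'n multiset => real^'n => real" where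
 "mon y0 al y = (\<Prod>i\<in>#al. y $ i - y0 $ i)"

definition mfact :: "'n::finite multiset => real" where
 "mfact al = (\<Prod>i\<in>UNIV. fact (count al i))"

lemma mfact_pos: "mfact al > 0"
 unfolding mfact_def by (intro prod_pos) auto

lemma mfact_add: "mfact (am i al) = real (Suc (count al i)) * mfact al"
proof -
 have "mfact (am i al) = fact (Suc (count al i)) * (\<Prod>j\<in>UNIV - {i}. fact (count (am i al) j))"
  unfolding mfact_def by (subst prod.remove[of UNIV i]) auto
 also have "(\<Prod>j\<in>UNIV - {i}. fact (count (am i al) j)) = (\<Prod>j\<in>UNIV - {i}. fact (count al j) :: real)"
  by (intro prod.cong) auto
 finally show ?thesis unfolding mfact_def by (subst (2) prod.remove[of UNIV i]) (auto simp: algebra_simps)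
qed

lemma sm_mon [intro]: "open S ==> Sm S (mon y0 al)"
 unfolding mon_def by (intro smooth_intros)

lemma mon_empty [simp]: "mon y0 {#} = (%_. 1)"
 by (simp add: mon_def fun_eq_iff)

lemma mon_add_mset: "mon y0 (am i al) y = (y $ i - y0 $ i) * mon y0 al y"
 by (simp add: mon_def)

lemma pd_coord_shift: "pd i (%y. y $ j - y0 $ j) y = (if i = j then 1 else 0)"
proof -
 have "(%z. z $ j) differentiable at y"
  using sm_diffble[of UNIV "%z. z $ j"] sm_coord by blast
 then show ?thesis by (simp add: pd_diff)
qed

lemma pd_mon: "pd i (mon y0 al) y = count al i * mon y0 (al - {#i#}) y"
proof (induction al)
 case (add j al)
 have d: "(%y. y $ j - y0 $ j) differentiable at y" "mon y0 al differentiable at y"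
  by (rule sm_diffble[of UNIV]; (intro smooth_intros sm_mon open_UNIV UNIV_I)?)+
 have "pd i (mon y0 (am j al)) y = pd i (%y. (y $ j - y0 $ j) * mon y0 al y) y"
  by (simp add: mon_add_mset[abs_def])
 also have "... = (y $ j - y0 $ j) * (count al i * mon y0 (al - {#i#}) y) + (if i = j then 1 else 0) * mon y0 al y"
  by (simp add: pd_mult[OF d] pd_coord_shift add)
 also have "... = count (am j al) i * mon y0 (am j al - {#i#}) y"
 proof (cases "i = j")
  case True
  show ?thesis
  proof (cases "j \<in># al")
   case True
   then obtain be where "al = am j be" by (meson multi_member_split)
   then show ?thesis using `i = j` by (simp add: mon_add_mset algebra_simps)
  qed (use True in "simp add: not_in_iff")
 next
  case False
  show ?thesis
  proof (cases "i \<in># al")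
   case True
   then obtain be where "al = am i be" by (meson multi_member_split)
   then show ?thesis using False by (simp add: mon_add_mset algebra_simps add_mset_commute[of j i])
  qed (use False in "simp add: not_in_iff")
 qed
 finally show ?case .
qed simp

text \<open>Monomials centred at \<open>y0\<close> are dual to the derivatives at \<open>y0\<close>;
  this is how values on monomial forms recover coefficients.\<close>

lemma mpd_mon: "mpd be (mon y0 al) y0 = (if be = al then mfact al else 0)"
proof (induction be arbitrary: al)
 case empty
 show ?case
 proof (cases al)
  case (add i ga)
  then show ?thesis by (simp add: mon_add_mset)
 qed (simp add: mfact_def)
next
 case (add i be)
 have "mpd (am i be) (mon y0 al) y0 = mpd be (pd i (mon y0 al)) y0"
  by (simp add: mpd_add_mset[OF open_UNIV sm_mon[OF open_UNIV]]
    mpd_pd[OF open_UNIV sm_mon[OF open_UNIV]])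
 also have "pd i (mon y0 al) = (%y. count al i * mon y0 (al - {#i#}) y)"
  by (rule ext) (rule pd_mon)
 also have "mpd be ... y0 = count al i * (if be = al - {#i#} then mfact (al - {#i#}) else 0)"
  by (simp only: mpd_cmult[OF open_UNIV sm_mon[OF open_UNIV] UNIV_I] add)
 also have "... = (if am i be = al then mfact al else 0)"
 proof (cases "i \<in># al")
  case True
  then obtain ga where "al = am i ga" by (meson multi_member_split)
  then show ?thesis by (simp add: mfact_add)
 qed (auto simp: not_in_iff)
 finally show ?case .
qed

lemma mpd_mult_coord:
 assumes S: "open S" and f: "Sm S f" and y: "y \<in> S"
 shows "mpd al (%z. (z $ l - y0 $ l) * f z) y =
  (y $ l - y0 $ l) * mpd al f y + count al l * mpd (al - {#l#}) f y"
 using y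
proof (induction al arbitrary: y)
 case (add i al)
 note y = add.prems
 have s: "Sm S (%z. z $ l - y0 $ l)" by (intro smooth_intros S)
 note d = sm_diffble[OF _ S y]
 have d1: "(%z. (z $ l - y0 $ l) * mpd al f z) differentiable at y"
  "(%z. count al l * mpd (al - {#l#}) f z) differentiable at y" "(%z. z $ l - y0 $ l) differentiable at y"
  "mpd al f differentiable at y" "mpd (al - {#l#}) f differentiable at y"
  by (intro d smooth_intros s S sm_mpd f)+
 have "mpd (am i al) (%z. (z $ l - y0 $ l) * f z) y =
   pd i (%z. (z $ l - y0 $ l) * mpd al f z + count al l * mpd (al - {#l#}) f z) y"
  unfolding mpd_add_mset[OF S sm_mult[OF S s f] y] using add.IH by (intro pd_cong[OF S y])
 also have "... = (y $ l - y0 $ l) * mpd (am i al) f y + (if i = l then 1 else 0) * mpd al f y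
   + count al l * mpd (am i (al - {#l#})) f y"
  using d1 by (simp add: pd_add pd_mult pd_cmult pd_coord_shift mpd_add_mset[OF S f y])
 also have "... = (y $ l - y0 $ l) * mpd (am i al) f y + count (am i al) l * mpd (am i al - {#l#}) f y"
 proof (cases "l \<in># al")
  case True
  then obtain ga where "al = am l ga" by (meson multi_member_split)
  then show ?thesis by (auto simp: algebra_simps add_mset_commute)
 qed (auto simp: not_in_iff)
 finally show ?case .
qed simp

section \<open>Differential operators in charts\<close>

lemma pairing_sum: "pairing p (%I. \<Sum>x\<in>S. a x I) w = (\<Sum>x\<in>S. pairing p (a x) w)"
 unfolding pairing_def sum_divide_distrib[symmetric]
 by (subst sum.swap) (simp add: sum_distrib_right)

lemma pairing_cmult: "pairing p (%I. c * a I) w = c * pairing p a w"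
 unfolding pairing_def by (simp add: sum_distrib_left mult.assoc)

context mfd
begin

lemma jets_forms:
 assumes "c \<in> \<A>" "open S" "S \<subseteq> cimg c"
 shows "jets (Om p) (%om b z. om c z b) (Ls p) S"
 by unfold_locales (use assms form_smooth sm_subset[OF oc] in auto)

abbreviation lop :: "('a, 'n) chart => (real^'n) set => nat => nat => (('a, 'n) form => real^'n => real) => bool" where
 "lop c S m p \<equiv> jets.dop (Om p) (%om b z. om c z b) (Ls p) S m"

lemma mpd_form_alt:
 assumes om: "om \<in> Om p" and c: "c \<in> \<A>" and y: "y \<in> cimg c"
 shows "alternating p (%I. mpd al (%z. om c z I) y)"
 unfolding alt_swp
proof (intro conjI allI impI)
 fix I :: "'n list" assume "length I ~= p"
 then show "mpd al (%z. om c z I) y = 0" using alt_length[OF form_alt[OF om]] by simp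
next
 fix I :: "'n list" and s t assume *: "length I = p" "s < p" "t < p" "s ~= t"
 have "(%z. om c z (swp s t I)) = (%z. -1 * om c z I)"
  using alternatingD[OF form_alt[OF om] *] by simp
 then show "mpd al (%z. om c z (swp s t I)) y = - mpd al (%z. om c z I) y"
  using mpd_cmult[OF oc[OF c] form_smooth[OF om c] y, of al "-1"] by simp
qed

lemma coeffs_lop:
 assumes c: "c \<in> \<A>" and A: "Lc k p D c A"
 shows "lop c (cimg c) (Suc k) p (%om y. D om (cinv c y))"
proof -
 interpret jets "Om p" "%om b z. om c z b" "(Ls p)" "cimg c"
  by (rule jets_forms[OF c oc[OF c]]) simp
 show ?thesis unfolding dop_def
 proof (intro exI conjI ballI allI)
  let ?e = "%al I y. if size al \<le> k then A al y I * (1 / fact p) else 0"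
  show "Sm (cimg c) (?e al I)" for al I
  proof (cases "size al \<le> k")
   case True
   then have "Sm (cimg c) (%y. A al y I)" using A unfolding local_coeffs_def by blast
   then show ?thesis unfolding if_P[OF True] by (intro smooth_intros oc[OF c])
  qed simp
  fix om y assume "om \<in> Om p" "y \<in> cimg c"
  then have "D om (cinv c y) = (\<Sum>al | size al \<le> k. pairing p (A al y) (%I. mpd al (%z. om c z I) y))"
   using A unfolding local_coeffs_def by blast
  also have "... = (\<Sum>al | size al < Suc k. \<Sum>b\<in>(Ls p). ?e al b y * mpd al (%z. om c z b) y)"
   by (rule sum.cong) (auto simp: pairing_def sum_divide_distrib)
  finally show "D om (cinv c y) = (\<Sum>al | size al < Suc k. \<Sum>b\<in>(Ls p). ?e al b y * mpd al (%z. om c z b) y)" .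
 qed
qed

text \<open>\<open>dop\<close> allows any coefficients, \<open>local_coeffs\<close> only alternating
  ones. Replacing the coefficient of the component \<open>b\<close> by a multiple of
  \<open>eps p b\<close> leaves the operator unchanged by \<open>pairing_eps\<close>.\<close>

lemma lop_local_coeffs:
 assumes c: "c \<in> \<A>" and L: "lop c (cimg c) (Suc k) p (%om y. D om (cinv c y))"
 shows "\<exists>A. Lc k p D c A"
proof -
 interpret jets "Om p" "%om b z. om c z b" "(Ls p)" "cimg c"
  by (rule jets_forms[OF c oc[OF c]]) simp
 obtain e where e: "\<forall>al b. Sm (cimg c) (e al b)"
  "!!om y. om \<in> Om p ==> y \<in> cimg c ==>
   D om (cinv c y) = (\<Sum>al | size al < Suc k. \<Sum>b\<in>(Ls p). e al b y * mpd al (%z. om c z b) y)"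
  using L unfolding dop_def by blast
 let ?A = "%al y I. \<Sum>b\<in>Ls p. e al b y * eps p b I"
 have "Lc k p D c ?A"
  unfolding local_coeffs_def
 proof (intro conjI allI impI ballI)
  show "alternating p (?A al y)" for al y
   by (intro alt_sum alt_cmult alt_eps)
  show "Sm (cimg c) (%y. ?A al y I)" for al I
   using e(1) by (intro smooth_intros oc[OF c]) auto
  fix om y assume om: "om \<in> Om p" and y: "y \<in> cimg c"
  have "pairing p (?A al y) (%I. mpd al (%z. om c z I) y) = (\<Sum>b\<in>Ls p. e al b y * mpd al (%z. om c z b) y)" for al
   unfolding pairing_sum pairing_cmult
   by (rule scong) (simp add: pairing_eps[OF mpd_form_alt[OF om c y]])
  then show "D om (cinv c y) = (\<Sum>al | size al \<le> k. pairing p (?A al y) (%I. mpd al (%z. om c z I) y))"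
   unfolding e(2)[OF om y] by (simp add: less_Suc_eq_le)
 qed
 then show ?thesis by blast
qed

lemma diffops_leI:
 assumes "!!om. om ~: Om p ==> D om = 0" "!!om x. x ~: pts ==> D om x = 0"
  "!!c. c \<in> \<A> ==> lop c (cimg c) (Suc k) p (%om y. D om (cinv c y))"
 shows "D \<in> DO k p"
proof -
 have "Sm (cimg c) (D om \<circ> cinv c)" if c: "c \<in> \<A>" and om: "om \<in> Om p" for c om
  using jets.sm_dop[OF jets_forms[OF c oc[OF c] order.refl] assms(3)[OF c] om]
  by (simp add: o_def)
 then show ?thesis unfolding diffops_le_def smooth_functions_def
  using assms lop_local_coeffs by auto
qed

lemma diffops_leD:
 assumes "D \<in> DO k p"
 shows "om ~: Om p ==> D om = 0" "x ~: pts ==> D om x = 0"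
  "c \<in> \<A> ==> lop c (cimg c) (Suc k) p (%om y. D om (cinv c y))"
  "om \<in> Om p ==> D om \<in> smooth_functions \<A>"
proof -
 show 1: "om ~: Om p ==> D om = 0" for om using assms unfolding diffops_le_def by blast
 show 2: "om \<in> Om p ==> D om \<in> smooth_functions \<A>" for om using assms unfolding diffops_le_def by blast
 show "x ~: pts ==> D om x = 0"
  using 1[of om] 2[of om] unfolding smooth_functions_def by (cases "om \<in> Om p") auto
 show "c \<in> \<A> ==> lop c (cimg c) (Suc k) p (%om y. D om (cinv c y))"
  using assms coeffs_lop unfolding diffops_le_def by blast
qed

lemma DO_zero: "0 \<in> DO k p"
 by (rule diffops_leI) (auto simp: zero_fun_def intro: jets.dop_zero[OF jets_forms[OF _ oc]])

lemma DO_add: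
 assumes "D \<in> DO k p" "E \<in> DO k p"
 shows "D + E \<in> DO k p"
proof (rule diffops_leI)
 show "lop c (cimg c) (Suc k) p (%om y. (D + E) om (cinv c y))" if "c \<in> \<A>" for c
  using jets.dop_add[OF jets_forms[OF that oc[OF that] order.refl] diffops_leD(3)[OF assms(1) that]
    diffops_leD(3)[OF assms(2) that]] by simp
qed (use diffops_leD(1,2)[OF assms(1)] diffops_leD(1,2)[OF assms(2)] in "auto simp: zero_fun_def")

lemma DO_scale:
 assumes "D \<in> DO k p"
 shows "(%om x. t * D om x) \<in> DO k p"
proof (rule diffops_leI)
 show "lop c (cimg c) (Suc k) p (%om y. t * D om (cinv c y))" if "c \<in> \<A>" for c
  using jets.dop_mult[OF jets_forms[OF that oc[OF that] order.refl] sm_const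
    diffops_leD(3)[OF assms that]] .
qed (use diffops_leD(1,2)[OF assms] in "auto simp: zero_fun_def")

lemma DO_mono:
 assumes "D \<in> DO k p" "k \<le> k'"
 shows "D \<in> DO k' p"
proof (rule diffops_leI)
 show "lop c (cimg c) (Suc k') p (%om y. D om (cinv c y))" if "c \<in> \<A>" for c
  by (rule jets.dop_mono[OF jets_forms[OF that oc[OF that] order.refl] _ diffops_leD(3)[OF assms(1) that]])
   (use assms(2) in simp)
qed (use diffops_leD(1,2)[OF assms(1)] in auto)

lemma diffop_local:
 assumes D: "D \<in> DO k p" and c: "c \<in> \<A>" and N: "open N" "y \<in> N" "N \<subseteq> cimg c"
  and om: "om \<in> Om p" "om' \<in> Om p" "!!z I. z \<in> N ==> om c z I = om' c z I"
 shows "D om (cinv c y) = D om' (cinv c y)"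
proof -
 obtain A where A: "Lc k p D c A" using D c unfolding diffops_le_def by blast
 have "mpd al (%z. om c z I) y = mpd al (%z. om' c z I) y" for al I
  by (rule mpd_cong[OF N(1,2)]) (rule om(3))
 then show ?thesis using A N om(1,2) unfolding local_coeffs_def by auto
qed

text \<open>Commuting the Lie derivative past the word given by \<open>al\<close> and
  \<open>b\<close> replaces its letters one at a time by means of the first derivatives of
  \<open>V\<close>. Everything else involves second or higher derivatives of \<open>V\<close> and
  loses at least one order.\<close>

lemma lie_word:
 assumes V: "V \<in> Vect" and c: "c \<in> \<A>" and b: "length b = p"
 shows "lop c (cimg c) (size al) p (%om y.
  (SU i. V c y $ i * pd i (mpd al (%z. om c z b)) y) - mpd al (%z. LF V om c z b) y +
  (\<Sum>x\<in>#al. SU i. pd x (%z. V c z $ i) y * mpd (am i (al - {#x#})) (%z. om c z b) y) +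
  (\<Sum>s<p. SU j. pd (b ! s) (%z. V c z $ j) y * mpd al (%z. om c z (b[s := j])) y))"
proof -
 let ?S = "cimg c"
 note S = oc[OF c]
 interpret jets "Om p" "%om b z. om c z b" "(Ls p)" ?S
  by (rule jets_forms[OF c S]) simp
 note Vs = vf_smooth[OF V c]
 have "\<forall>i. \<exists>e. (\<forall>be. Sm ?S (e be)) & (\<forall>f y. Sm ?S f --> y \<in> ?S -->
  mpd al (%z. V c z $ i * f z) y = V c y $ i * mpd al f y +
   (\<Sum>x\<in>#al. pd x (%z. V c z $ i) y * mpd (al - {#x#}) f y) + (\<Sum>be | size be < size al - 1. e be y * mpd be f y))"
  (is "\<forall>i. \<exists>e. ?P i e")
  by (intro allI Leibniz_expansion S Vs)
 then obtain e where "\<forall>i. ?P i (e i)" unfolding choice_iff by (elim exE)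
 then have e: "!!i be. Sm ?S (e i be)" "!!i f y. Sm ?S f ==> y \<in> ?S ==>
  mpd al (%z. V c z $ i * f z) y = V c y $ i * mpd al f y +
   (\<Sum>x\<in>#al. pd x (%z. V c z $ i) y * mpd (al - {#x#}) f y) + (\<Sum>be | size be < size al - 1. e i be y * mpd be f y)"
  by blast+
 have "\<forall>s j. \<exists>e. (\<forall>be. Sm ?S (e be)) & (\<forall>f y. Sm ?S f --> y \<in> ?S -->
  mpd al (%z. pd (b ! s) (%z. V c z $ j) z * f z) y = pd (b ! s) (%z. V c z $ j) y * mpd al f y +
   (\<Sum>x\<in>#al. pd x (pd (b ! s) (%z. V c z $ j)) y * mpd (al - {#x#}) f y) + (\<Sum>be | size be < size al - 1. e be y * mpd be f y))"
  (is "\<forall>s j. \<exists>e. ?Q s j e")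
  by (intro allI Leibniz_expansion S sm_pd Vs)
 then obtain e' where "\<forall>s j. ?Q s j (e' s j)" unfolding choice_iff by (elim exE)
 then have e': "!!s j be. Sm ?S (e' s j be)" "!!s j f y. Sm ?S f ==> y \<in> ?S ==>
  mpd al (%z. pd (b ! s) (%z. V c z $ j) z * f z) y = pd (b ! s) (%z. V c z $ j) y * mpd al f y +
   (\<Sum>x\<in>#al. pd x (pd (b ! s) (%z. V c z $ j)) y * mpd (al - {#x#}) f y) + (\<Sum>be | size be < size al - 1. e' s j be y * mpd be f y)"
  by blast+
 have "dop (size al) (%om y. - (SU i. \<Sum>be | size be < size al - 1. e i be y * mpd (am i be) (%z. om c z b) y) -
   (\<Sum>s<p. SU j. (\<Sum>x\<in>#al. pd x (pd (b ! s) (%z. V c z $ j)) y * mpd (al - {#x#}) (%z. om c z (b[s := j])) y)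
    + (\<Sum>be | size be < size al - 1. e' s j be y * mpd be (%z. om c z (b[s := j])) y)))"
  using b by (intro dop_diff dop_minus dop_sum dop_add dop_sum_mset dop_word e e' sm_pd Vs)
   (auto simp: size_Diff_singleton nonempty_has_size dest: multi_member_split)
 then show ?thesis
 proof (rule dop_cong)
  fix om y assume om: "om \<in> Om p" and y: "y \<in> ?S"
  note f = form_smooth[OF om c]
  have pdf: "mpd be (pd i (%z. om c z b)) y = mpd (am i be) (%z. om c z b) y" for be i
   using mpd_pd[OF S f y] mpd_add_mset[OF S f y] by simp
  have "mpd al (%z. LF V om c z b) y = mpd al (%z. (SU i. V c z $ i * pd i (%z. om c z b) z) +
   (\<Sum>s<p. SU j. pd (b ! s) (%z. V c z $ j) z * om c z (b[s := j]))) y"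
   by (rule mpd_cong[OF S y]) (rule lie_form_chart[OF om c _ b])
  also have "... = (SU i. mpd al (%z. V c z $ i * pd i (%z. om c z b) z) y) +
   (\<Sum>s<p. SU j. mpd al (%z. pd (b ! s) (%z. V c z $ j) z * om c z (b[s := j])) y)"
   by (simp add: mpd_add[OF S _ _ y] mpd_sum[OF S _ _ y] sm_sum sm_mult S sm_pd Vs f)
  also have "... = (SU i. V c y $ i * mpd (am i al) (%z. om c z b) y +
    (\<Sum>x\<in>#al. pd x (%z. V c z $ i) y * mpd (am i (al - {#x#})) (%z. om c z b) y) +
    (\<Sum>be | size be < size al - 1. e i be y * mpd (am i be) (%z. om c z b) y)) +
   (\<Sum>s<p. SU j. pd (b ! s) (%z. V c z $ j) y * mpd al (%z. om c z (b[s := j])) y +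
    (\<Sum>x\<in>#al. pd x (pd (b ! s) (%z. V c z $ j)) y * mpd (al - {#x#}) (%z. om c z (b[s := j])) y) +
    (\<Sum>be | size be < size al - 1. e' s j be y * mpd be (%z. om c z (b[s := j])) y))"
   by (simp only: e(2)[OF sm_pd[OF f] y] e'(2)[OF f y] pdf)
  finally have L: "mpd al (%z. LF V om c z b) y = ..." .
  have sw: "(SU i. \<Sum>x\<in>#al. F i x) = (\<Sum>x\<in>#al. SU i. F i x)" for F :: "'n => 'n => real"
   by (induction al) (auto simp: sum.distrib)
  show "(SU i. V c y $ i * pd i (mpd al (%z. om c z b)) y) - mpd al (%z. LF V om c z b) y +
   (\<Sum>x\<in>#al. SU i. pd x (%z. V c z $ i) y * mpd (am i (al - {#x#})) (%z. om c z b) y) +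
   (\<Sum>s<p. SU j. pd (b ! s) (%z. V c z $ j) y * mpd al (%z. om c z (b[s := j])) y) =
   - (SU i. \<Sum>be | size be < size al - 1. e i be y * mpd (am i be) (%z. om c z b) y) -
   (\<Sum>s<p. SU j. (\<Sum>x\<in>#al. pd x (pd (b ! s) (%z. V c z $ j)) y * mpd (al - {#x#}) (%z. om c z (b[s := j])) y)
    + (\<Sum>be | size be < size al - 1. e' s j be y * mpd be (%z. om c z (b[s := j])) y))"
   unfolding L sum.distrib sw by (simp add: mpd_add_mset[OF S f y])
 qed
qed

lemma lie_op_chart:
 assumes D: "D \<in> DO k p" and V: "V \<in> Vect" and c: "c \<in> \<A>"
  and om: "om \<in> Om p" and y: "y \<in> cimg c"
 shows "LO p V D om (cinv c y) =
  (SU i. V c y $ i * pd i (%z. D om (cinv c z)) y) - D (LF V om) (cinv c y)"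
 using lie_fun_chart[OF V diffops_leD(4)[OF D om] c y] om
 by (simp add: lie_op_def restrict0_def o_def)

text \<open>The terms of order \<open>k + 1\<close> of the Lie derivative cancel.\<close>

lemma lie_op_diffops_le:
 assumes D: "D \<in> DO k p" and V: "V \<in> Vect"
 shows "LO p V D \<in> DO k p"
proof (rule diffops_leI)
 show "LO p V D om = 0" if "om ~: Om p" for om
  using that by (simp add: lie_op_def restrict0_def)
 show "LO p V D om x = 0" if "x ~: pts" for om x
  using that diffops_leD(2)[OF D that] lie_fun_outside[OF that]
  by (simp add: lie_op_def restrict0_def)
 fix c assume c: "c \<in> \<A>"
 let ?S = "cimg c"
 note S = oc[OF c]
 interpret jets "Om p" "%om b z. om c z b" "(Ls p)" ?S
  by (rule jets_forms[OF c S]) simp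
 note Vs = vf_smooth[OF V c]
 obtain e where e: "!!al b. Sm ?S (e al b)"
  "!!om y. om \<in> Om p ==> y \<in> ?S ==>
   D om (cinv c y) = (\<Sum>al | size al < Suc k. \<Sum>b\<in>(Ls p). e al b y * mpd al (%z. om c z b) y)"
  using diffops_leD(3)[OF D c] unfolding dop_def by blast
 have W: "dop (Suc k) (%om y. (SU i. V c y $ i * pd i (mpd al (%z. om c z b)) y) - mpd al (%z. LF V om c z b) y)"
  if "size al < Suc k" "length b = p" for al b
 proof (rule dop_cong)
  show "dop (Suc k) (%om y. ((SU i. V c y $ i * pd i (mpd al (%z. om c z b)) y) - mpd al (%z. LF V om c z b) y +
  (\<Sum>x\<in>#al. SU i. pd x (%z. V c z $ i) y * mpd (am i (al - {#x#})) (%z. om c z b) y) +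
  (\<Sum>s<p. SU j. pd (b ! s) (%z. V c z $ j) y * mpd al (%z. om c z (b[s := j])) y)) -
   ((\<Sum>x\<in>#al. SU i. pd x (%z. V c z $ i) y * mpd (am i (al - {#x#})) (%z. om c z b) y) +
  (\<Sum>s<p. SU j. pd (b ! s) (%z. V c z $ j) y * mpd al (%z. om c z (b[s := j])) y)))"
   using that by (intro dop_diff[OF dop_mono[OF _ lie_word[OF V c that(2)]]] dop_sum dop_add dop_sum_mset dop_word
     sm_pd Vs) (auto simp: size_Diff_singleton nonempty_has_size dest: multi_member_split)
 qed simp
 have "dop (Suc k) (%om y. \<Sum>al | size al < Suc k. \<Sum>b\<in>(Ls p).
   (e al b y * ((SU i. V c y $ i * pd i (mpd al (%z. om c z b)) y) - mpd al (%z. LF V om c z b) y)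
   + (SU i. V c y $ i * pd i (e al b) y) * mpd al (%z. om c z b) y))"
  using W by (intro dop_sum dop_add dop_mult e dop_word smooth_intros Vs S) auto
 then show "dop (Suc k) (%om y. LO p V D om (cinv c y))"
 proof (rule dop_cong)
  fix om y assume om: "om \<in> Om p" and y: "y \<in> ?S"
  note d = sm_diffble[OF _ S y]
  have d1: "e al b differentiable at y" "mpd al (%z. om c z b) differentiable at y"
   "(%z. e al b z * mpd al (%z. om c z b) z) differentiable at y" for al b
   by (intro d e(1) sm_mult S sm_mpd form_smooth[OF om c])+
  have "pd i (%z. D om (cinv c z)) y = (\<Sum>al | size al < Suc k. \<Sum>b\<in>Ls p.
    e al b y * pd i (mpd al (%z. om c z b)) y + pd i (e al b) y * mpd al (%z. om c z b) y)" for i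
  proof -
   have "pd i (%z. D om (cinv c z)) y =
     pd i (%z. \<Sum>al | size al < Suc k. \<Sum>b\<in>(Ls p). e al b z * mpd al (%z. om c z b) z) y"
    by (rule pd_cong[OF S y]) (rule e(2)[OF om])
   also have "... = (\<Sum>al | size al < Suc k. pd i (%z. \<Sum>b\<in>(Ls p). e al b z * mpd al (%z. om c z b) z) y)"
    using d1 by (intro pd_sum differentiable_sum) auto
   also have "... = (\<Sum>al | size al < Suc k. \<Sum>b\<in>Ls p. pd i (%z. e al b z * mpd al (%z. om c z b) z) y)"
    using d1 by (intro sum.cong refl pd_sum) auto
   finally show ?thesis using pd_mult[OF d1(1,2)] by simp
  qed
  then have "(SU i. V c y $ i * pd i (%z. D om (cinv c z)) y) = (SU i. \<Sum>al | size al < Suc k. \<Sum>b\<in>Ls p.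
    V c y $ i * (e al b y * pd i (mpd al (%z. om c z b)) y + pd i (e al b) y * mpd al (%z. om c z b) y))"
   by (simp add: sum_distrib_left)
  also have "... = (\<Sum>al | size al < Suc k. SU i. \<Sum>b\<in>Ls p.
    V c y $ i * (e al b y * pd i (mpd al (%z. om c z b)) y + pd i (e al b) y * mpd al (%z. om c z b) y))"
   by (rule sum.swap)
  also have "... = (\<Sum>al | size al < Suc k. \<Sum>b\<in>Ls p. SU i.
    V c y $ i * (e al b y * pd i (mpd al (%z. om c z b)) y + pd i (e al b) y * mpd al (%z. om c z b) y))"
   by (rule scong) (rule sum.swap)
  also have "... = (\<Sum>al | size al < Suc k. \<Sum>b\<in>Ls p. e al b y * (SU i. V c y $ i * pd i (mpd al (%z. om c z b)) y)
    + (SU i. V c y $ i * pd i (e al b) y) * mpd al (%z. om c z b) y)"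
   by (simp add: sum_distrib_left sum_distrib_right sum.distrib algebra_simps)
  finally show "LO p V D om (cinv c y) = (\<Sum>al | size al < Suc k. \<Sum>b\<in>(Ls p).
   (e al b y * ((SU i. V c y $ i * pd i (mpd al (%z. om c z b)) y) - mpd al (%z. LF V om c z b) y)
   + (SU i. V c y $ i * pd i (e al b) y) * mpd al (%z. om c z b) y))"
   unfolding lie_op_chart[OF D V c om y] e(2)[OF lie_forms[OF om V] y]
   by (simp add: sum.distrib sum_subtractf right_diff_distrib)
 qed
qed

end

section \<open>Extension of local objects\<close>

text \<open>A point with a coordinate ball whose closure stays in the chart image, and a cutoff
  \<open>rh\<close>. Global objects are made by multiplying local ones by \<open>rh\<close>; they
  agree with the local ones on the half ball, called \<open>U0\<close> below.\<close>

locale mpt = mfd X \<A> for X :: "'a topology" and \<A> :: "('a, 'n::finite) chart set" +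
 fixes c0 :: "('a, 'n) chart" and y0 :: "real^'n" and r :: real and rh :: "real^'n => real"
 assumes c0: "c0 \<in> \<A>" and r: "r > 0" and cball: "cball y0 r \<subseteq> cimg c0"
  and rh_smooth: "Sm UNIV rh" and rh_1: "!!y. y \<in> ball y0 (r / 2) ==> rh y = 1"
  and rh_0: "!!y. y ~: ball y0 r ==> rh y = 0"

lemma (in mfd) mpt_exists:
 assumes "c \<in> \<A>" "y \<in> cimg c"
 shows "\<exists>r rh. mpt X \<A> c y r rh"
proof -
 obtain r where r: "r > 0" "cball y r \<subseteq> cimg c"
  using oc[OF assms(1)] assms(2) open_contains_cball by metis
 obtain rh where "Sm UNIV rh" "\<forall>z\<in>ball y (r / 2). rh z = 1" "\<forall>z. z ~: ball y r --> rh z = 0"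
  using bump_function[OF r(1)] by blast
 then have "mpt X \<A> c y r rh" using assms r by unfold_locales auto
 then show ?thesis by blast
qed

context mpt
begin

abbreviation "S0 == cimg c0"
abbreviation U0 :: "(real^'n) set" where "U0 \<equiv> ball y0 (r / 2)"

abbreviation x0 :: 'a where "x0 \<equiv> cinv c0 y0"

lemma U0: "open U0" "y0 \<in> U0" "U0 \<subseteq> cimg c0" "y \<in> U0 ==> y \<in> cimg c0"
proof -
 have "U0 \<subseteq> cball y0 r" using r by (auto simp: subset_iff)
 then show "U0 \<subseteq> cimg c0" using cball by blast
 then show "y \<in> U0 ==> y \<in> cimg c0" by blast
qed (use r in auto)

lemma y0: "y0 \<in> cimg c0"
 using U0(2,3) by blast

lemma rh_smooth_on: "open S ==> Sm S rh"
 by (rule sm_subset[OF open_UNIV subset_UNIV rh_smooth])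

text \<open>Smoothness is local: on the overlap with \<open>c0\<close> it is assumed, and any other
  point has a neighbourhood missing the compact image of the closed ball, on which \<open>F\<close>
  vanishes.\<close>

lemma ext_smooth:
 assumes c: "c \<in> \<A>" and F: "Sm (ov c c0) F"
  and 0: "!!y. y \<in> cimg c ==> y ~: ov c c0 \<or> tr c c0 y ~: ball y0 r ==> F y = 0"
 shows "Sm (cimg c) F"
proof (rule sm_local[OF oc[OF c]])
 fix y assume y: "y \<in> cimg c"
 let ?K = "cinv c0 ` cball y0 r"
 have K: "closedin X ?K" by (rule closedin_chart_cball[OF c0 cball])
 show "\<exists>N. open N & y \<in> N & Sm (cimg c \<inter> N) F"
 proof (cases "y \<in> ov c c0")
  case True
  moreover have "cimg c \<inter> ov c c0 = ov c c0" by auto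
  ultimately show ?thesis using F open_ov[OF c c0] by (intro exI[of _ "ov c c0"]) simp
 next
  case False
  let ?N = "coord c ` (cdom c - ?K)"
  have "openin X (cdom c - ?K)" by (rule openin_diff[OF openin_cdom[OF c] K])
  then have N: "open ?N" by (intro open_coord_image[OF c]) auto
  have "cinv c y ~: ?K"
  proof
   assume "cinv c y \<in> ?K"
   then obtain z where "z \<in> cball y0 r" "cinv c y = cinv c0 z" by blast
   then have "cinv c y \<in> cdom c0" using cball cinv_in[of z c0] by (simp only: subset_iff simp_thms)
   then show False using False ov_iff[OF c y] by simp
  qed
  then have "cinv c y \<in> cdom c - ?K" using cinv_in[OF y] by simp
  then have "coord c (cinv c y) \<in> ?N" by (rule imageI)
  then have yN: "y \<in> ?N" using y by simp
  have "F z = 0" if zN: "z \<in> ?N" for z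
  proof -
   obtain x where x: "x \<in> cdom c" "x ~: ?K" "z = coord c x" using zN by blast
   have "z ~: ov c c0 \<or> tr c c0 z ~: ball y0 r"
   proof (rule ccontr)
    assume "\<not> ?thesis"
    then have "x \<in> cdom c0" "coord c0 x \<in> cball y0 r" using x c ov_iff[OF c, of z] by auto
    then have "x \<in> ?K" using cinv_coord[OF c0] by (metis imageI)
    then show False using x by blast
   qed
   then show ?thesis using 0 x by blast
  qed
  then have "Sm (cimg c \<inter> ?N) F"
   using sm_cong[of "cimg c \<inter> ?N" "%_. 0" F] oc[OF c] N by auto
  then show ?thesis using N yN by blast
 qed
qed

definition fext :: "nat => (real^'n => 'n list => real) => ('a, 'n) form" where
 "fext p et c y = (if c \<in> \<A> & y \<in> ov c c0 then
  pb p (Jac c c0 y) (%J. rh (tr c c0 y) * et (tr c c0 y) J) else 0)"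

lemma fext_forms:
 assumes alt: "!!y. y \<in> cimg c0 ==> alternating p (et y)"
  and sm: "!!I. Sm S0 (%y. et y I)"
 shows "fext p et \<in> Om p"
proof (rule formsI)
 show "fext p et c y = 0" if "c ~: \<A> \<or> y ~: cimg c" for c y
  using that by (auto simp: fext_def)
 show "alternating p (fext p et c y)" for c y
 proof (cases "c \<in> \<A> & y \<in> ov c c0")
  case True
  then have "tr c c0 y \<in> cimg c0" by auto
  then show ?thesis using True by (simp only: fext_def if_True simp_thms)
    (intro alt_pb alt_cmult alt)
 qed (auto simp: fext_def zero_fun_def)
 show "Sm (cimg c) (%y. fext p et c y I)" if c: "c \<in> \<A>" for c I
 proof (cases "length I = p")
  case True
  show ?thesis
  proof (rule ext_smooth[OF c])
   show "Sm (ov c c0) (%y. fext p et c y I)"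
   proof (rule sm_cong[OF open_ov[OF c c0]])
    show "(\<Sum>J\<in>Ls p. (\<Prod>s<p. Jac c c0 y (I ! s) (J ! s)) * (rh (tr c c0 y) * et (tr c c0 y) J)) = fext p et c y I"
     if "y \<in> ov c c0" for y using that c True by (simp add: fext_def pb_def)
    show "Sm (ov c c0) (%y. \<Sum>J\<in>Ls p. (\<Prod>s<p. Jac c c0 y (I ! s) (J ! s)) * (rh (tr c c0 y) * et (tr c c0 y) J))"
     by (intro sm_sum sm_mult sm_prod open_ov[OF c c0] smooth_Jac[OF c c0]
       sm_tr_ov[OF c c0] rh_smooth_on[OF oc[OF c0]] sm)
   qed
   show "fext p et c y I = 0" if "y ~: ov c c0 \<or> tr c c0 y ~: ball y0 r" for y
    using that rh_0[of "tr c c0 y"] by (auto simp: fext_def pb_def)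
  qed
 next
  case False
  then have "(%y. fext p et c y I) = (%_. 0)" by (auto simp: fext_def pb_def fun_eq_iff)
  then show ?thesis by simp
 qed
 fix c c' x assume c: "c \<in> \<A>" "c' \<in> \<A>" and x: "x \<in> cdom c" "x \<in> cdom c'"
 show "fext p et c (coord c x) = pb p (Jac c c' (coord c x)) (fext p et c' (coord c' x))"
 proof (cases "x \<in> cdom c0")
  case True
  have "coord c x \<in> ov c c0" "coord c' x \<in> ov c' c0" using x True by auto
  moreover have "tr c c0 (coord c x) = coord c0 x" "tr c' c0 (coord c' x) = coord c0 x" using c x by auto
  moreover have "Jac c c0 (coord c x) = (%i j. SU m. Jac c c' (coord c x) i m * Jac c' c0 (coord c' x) m j)"
   using Jac_cocycle[OF c c0 x True] by (intro ext)
  ultimately show ?thesis using c by (simp only: fext_def pb_pb simp_thms if_True)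
 next
  case False
  then have "coord c x ~: ov c c0" "coord c' x ~: ov c' c0" using c x ov_iff[of c "coord c x" c0] ov_iff[of c' "coord c' x" c0] by auto
  then show ?thesis by (simp add: fext_def pb_def fun_eq_iff)
 qed
qed

lemma fext_near:
 assumes alt: "!!y. y \<in> cimg c0 ==> alternating p (et y)" and y: "y \<in> U0"
 shows "fext p et c0 y = et y"
proof -
 have y': "y \<in> cimg c0" "y \<in> ov c0 c0" "tr c0 c0 y = y" using U0(4)[OF y] by auto
 have "fext p et c0 y = pb p (%i j. if i = j then 1 else 0) (et y)"
  using y' c0 rh_1[OF y] by (simp add: fext_def Jac_self)
 also have "... = et y" by (rule pb_id) (rule alt_length[OF alt[OF y'(1)]])
 finally show ?thesis .
qed

definition vext :: "(real^'n => 'n => real) => ('a, 'n) vfield" where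
 "vext v c y = (if c \<in> \<A> & y \<in> ov c c0 then
  \<chi> j. SU i. Jac c0 c (tr c c0 y) i j * (rh (tr c c0 y) * v (tr c c0 y) i) else 0)"

lemma vext_vector_fields:
 assumes sm: "!!i. Sm S0 (%y. v y i)"
 shows "vext v \<in> Vect"
proof -
 have "Sm (cimg c) (%y. vext v c y $ j)" if c: "c \<in> \<A>" for c j
 proof (rule ext_smooth[OF c])
  show "Sm (ov c c0) (%y. vext v c y $ j)"
  proof (rule sm_cong[OF open_ov[OF c c0]])
   show "(SU i. Jac c0 c (tr c c0 y) i j * (rh (tr c c0 y) * v (tr c c0 y) i)) = vext v c y $ j"
    if "y \<in> ov c c0" for y using that c by (simp add: vext_def)
   have "Sm (ov c c0) (%y. Jac c0 c (tr c c0 y) i j)" for i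
    by (rule sm_tr[OF c c0 open_ov[OF c c0] order.refl open_ov[OF c0 c] _ smooth_Jac[OF c0 c]])
     (rule tr_in[OF c])
   then show "Sm (ov c c0) (%y. SU i. Jac c0 c (tr c c0 y) i j * (rh (tr c c0 y) * v (tr c c0 y) i))"
    by (intro sm_sum[OF open_ov[OF c c0]] sm_mult[OF open_ov[OF c c0] _ sm_mult[OF open_ov[OF c c0]
      sm_tr_ov[OF c c0 rh_smooth_on[OF oc[OF c0]]] sm_tr_ov[OF c c0 sm]]])
  qed
  show "vext v c y $ j = 0" if "y ~: ov c c0 \<or> tr c c0 y ~: ball y0 r" for y
   using that rh_0[of "tr c c0 y"] by (auto simp: vext_def)
 qed
 moreover have "vext v c' (coord c' x) $ j = (SU i. Jac c c' (coord c x) i j * vext v c (coord c x) $ i)"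
  if c: "c \<in> \<A>" "c' \<in> \<A>" and x: "x \<in> cdom c" "x \<in> cdom c'" for c c' x j
 proof (cases "x \<in> cdom c0")
  case True
  let ?v = "%i. rh (coord c0 x) * v (coord c0 x) i"
  have o: "coord c x \<in> ov c c0" "coord c' x \<in> ov c' c0" using x True by auto
  have t: "tr c c0 (coord c x) = coord c0 x" "tr c' c0 (coord c' x) = coord c0 x" using c x by auto
  have "vext v c' (coord c' x) $ j = (SU i. (SU m. Jac c0 c (coord c0 x) i m * Jac c c' (coord c x) m j) * ?v i)"
   using c o Jac_cocycle[OF c0 c True x] by (simp add: vext_def t)
  also have "... = (SU m i. Jac c c' (coord c x) m j * (Jac c0 c (coord c0 x) i m * ?v i))"
   unfolding sum_distrib_right by (subst sum.swap) (simp add: mult_ac)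
  also have "... = (SU i. Jac c c' (coord c x) i j * vext v c (coord c x) $ i)"
   using c o by (simp add: vext_def t sum_distrib_left)
  finally show ?thesis .
 next
  case False
  then have "coord c x ~: ov c c0" "coord c' x ~: ov c' c0" using c x ov_iff[of c "coord c x" c0] ov_iff[of c' "coord c' x" c0] by auto
  then show ?thesis by (simp add: vext_def)
 qed
 moreover have "vext v c y = 0" if "c ~: \<A> \<or> y ~: cimg c" for c y using that by (auto simp: vext_def)
 ultimately show ?thesis unfolding vector_fields_def by blast
qed

lemma vext_near: "y \<in> U0 ==> vext v c0 y $ j = v y j"
proof -
 assume y: "y \<in> U0"
 have y': "y \<in> cimg c0" "y \<in> ov c0 c0" "tr c0 c0 y = y" using U0(4)[OF y] by auto
 then have "vext v c0 y $ j = (SU i. (if i = j then 1 else 0) * v y i)"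
  using c0 rh_1[OF y] by (simp add: vext_def Jac_self)
 also have "... = (SU i. if i = j then v y i else 0)" by (rule sum.cong) auto
 also have "... = v y j" by simp
 finally show ?thesis .
qed

text \<open>A globally defined operator that equals \<open>\<omega> \<mapsto> g \<partial>\<^sup>\<alpha> \<omega>\<^sub>b\<close> near \<open>x0\<close>.\<close>

definition wop :: "nat => (real^'n => real) => 'n multiset => 'n list => ('a, 'n) operator" where
 "wop p g al b om x = (if om \<in> Om p & x \<in> cdom c0 then
  rh (coord c0 x) * g (coord c0 x) * mpd al (%z. om c0 z b) (coord c0 x) else 0)"

text \<open>A word in the coordinates of \<open>c0\<close> must be a differential operator in every
  chart for \<open>wop\<close> to be one globally. The transformation law of forms starts an
  induction on \<open>al\<close>, and each further derivative is a combination of derivatives in the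
  other chart.\<close>

lemma lop_tr:
 assumes c: "c \<in> \<A>" and b: "length b = p"
 shows "lop c (ov c c0) (Suc (size al)) p (%om y. mpd al (%z. om c0 z b) (tr c c0 y))"
proof -
 note S = open_ov[OF c c0]
 interpret jets "Om p" "%om b z. om c z b" "(Ls p)" "ov c c0"
  by (rule jets_forms[OF c S]) auto
 have JJ: "Sm (ov c c0) (%y. Jac c0 c (tr c c0 y) i j)" for i j
  by (rule sm_tr[OF c c0 S order.refl open_ov[OF c0 c] _ smooth_Jac[OF c0 c]]) (rule tr_in[OF c])
 show ?thesis
 proof (induction al)
  case empty
  have "Sm (ov c c0) (%y. \<Prod>s<p. Jac c0 c (tr c c0 y) (b ! s) (J ! s))" for J
   by (intro sm_prod S JJ)
  then have "dop (Suc 0) (%om y. \<Sum>J\<in>Ls p. (\<Prod>s<p. Jac c0 c (tr c c0 y) (b ! s) (J ! s)) * mpd {#} (%z. om c z J) y)"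
   by (intro dop_sum dop_word) auto
  then have "dop (Suc 0) (%om y. mpd {#} (%z. om c0 z b) (tr c c0 y))"
  proof (rule dop_cong)
   fix om y assume om: "om \<in> Om p" and y: "y \<in> ov c c0"
   show "mpd {#} (%z. om c0 z b) (tr c c0 y) =
     (\<Sum>J\<in>Ls p. (\<Prod>s<p. Jac c0 c (tr c c0 y) (b ! s) (J ! s)) * mpd {#} (%z. om c z J) y)"
    using form_tr[OF om c0 c tr_in[OF c y]] tr_tr[OF c c0 y] b by (simp add: pb_def)
  qed
  then show ?case unfolding size_empty .
 next
  case (add i al)
  have "dop (Suc (Suc (size al))) (%om y. SU m. Jac c0 c (tr c c0 y) i m * pd m (%y. mpd al (%z. om c0 z b) (tr c c0 y)) y)"
   by (intro dop_sum dop_mult JJ dop_pd_Suc add.IH)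
  then have "dop (Suc (Suc (size al))) (%om y. mpd (am i al) (%z. om c0 z b) (tr c c0 y))"
  proof (rule dop_cong)
   fix om y assume om: "om \<in> Om p" and y: "y \<in> ov c c0"
   let ?G = "%y. mpd al (%z. om c0 z b) (tr c c0 y)"
   have ty: "tr c c0 y \<in> ov c0 c" "tr c c0 y \<in> cimg c0" using tr_in[OF c y] by auto
   have "mpd (am i al) (%z. om c0 z b) (tr c c0 y) = pd i (mpd al (%z. om c0 z b)) (tr c c0 y)"
    by (rule mpd_add_mset[OF oc[OF c0] form_smooth[OF om c0] ty(2)])
   also have "... = pd i (%z. ?G (tr c0 c z)) (tr c c0 y)"
    by (rule pd_cong[OF open_ov[OF c0 c] ty(1)]) (simp only: tr_tr[OF c0 c])
   also have "... = (SU m. Jac c0 c (tr c c0 y) i m * pd m ?G (tr c0 c (tr c c0 y)))"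
    by (rule pd_tr[OF c0 c ty(1)])
     (rule sm_diffble[OF sm_dop[OF add.IH om] S], simp only: tr_tr[OF c c0 y] y)
   finally show "mpd (am i al) (%z. om c0 z b) (tr c c0 y) =
     (SU m. Jac c0 c (tr c c0 y) i m * pd m ?G y)" by (simp only: tr_tr[OF c c0 y])
  qed
  then show ?case by simp
 qed
qed

lemma wop_diffops_le:
 assumes g: "Sm S0 g" and b: "length b = p"
 shows "wop p g al b \<in> DO (size al) p"
proof (rule diffops_leI)
 show "wop p g al b om = 0" if "om ~: Om p" for om using that by (simp add: wop_def fun_eq_iff)
 show "wop p g al b om x = 0" if "x ~: pts" for om x
  using that cdom_points[OF c0] by (auto simp: wop_def)
 fix c assume c: "c \<in> \<A>"
 note S = open_ov[OF c c0]
 have j: "jets (Om p) (%om b z. om c z b) (Ls p) (ov c c0)"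
  by (rule jets_forms[OF c S]) auto
 obtain e where e: "\<forall>be b. Sm (ov c c0) (e be b)"
  "!!om y. om \<in> Om p ==> y \<in> ov c c0 ==> mpd al (%z. om c0 z b) (tr c c0 y) =
   (\<Sum>be | size be < Suc (size al). \<Sum>b\<in>(Ls p). e be b y * mpd be (%z. om c z b) y)"
  using lop_tr[OF c b, of al] unfolding jets.dop_def[OF j] by blast
 let ?e = "%be b y. if y \<in> ov c c0 then rh (tr c c0 y) * g (tr c c0 y) * e be b y else 0"
 have "Sm (cimg c) (?e be b)" for be b
 proof (rule ext_smooth[OF c])
  have "Sm (ov c c0) (%y. rh (tr c c0 y) * g (tr c c0 y) * e be b y)"
   using e(1) by (intro sm_mult S sm_tr_ov[OF c c0] rh_smooth_on[OF oc[OF c0]] g) auto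
  then show "Sm (ov c c0) (?e be b)" by (rule sm_cong[OF S, rotated]) simp
  show "?e be b y = 0" if "y ~: ov c c0 \<or> tr c c0 y ~: ball y0 r" for y using that rh_0 by auto
 qed
 moreover have "wop p g al b om (cinv c y) =
   (\<Sum>be | size be < Suc (size al). \<Sum>b\<in>(Ls p). ?e be b y * mpd be (%z. om c z b) y)"
  if om: "om \<in> Om p" and y: "y \<in> cimg c" for om y
 proof (cases "y \<in> ov c c0")
  case True
  then have "wop p g al b om (cinv c y) = rh (tr c c0 y) * g (tr c c0 y) * mpd al (%z. om c0 z b) (tr c c0 y)"
   using om ov_iff[OF c y] by (simp add: wop_def)
  then show ?thesis unfolding e(2)[OF om True] using True by (simp add: sum_distrib_left mult.assoc)
 next
  case False
  then show ?thesis using ov_iff[OF c y] by (simp add: wop_def)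
 qed
 ultimately show "lop c (cimg c) (Suc (size al)) p (%om y. wop p g al b om (cinv c y))"
  unfolding jets.dop_def[OF jets_forms[OF c oc[OF c] order.refl]]
  by (intro exI[of _ ?e] conjI allI ballI)
qed

lemma wop_near:
 "om \<in> Om p ==> y \<in> U0 ==> wop p g al b om (cinv c0 y) = g y * mpd al (%z. om c0 z b) y"
 using U0(4)[of y] rh_1[of y] cinv_in[of y c0] by (simp add: wop_def)

definition near :: "nat => ('a, 'n) operator => ('a, 'n) operator => bool" where
 "near p D E \<longleftrightarrow> (\<exists>N. open N & y0 \<in> N & N \<subseteq> U0 & (\<forall>om\<in>Om p. \<forall>y\<in>N. D om (cinv c0 y) = E om (cinv c0 y)))"

lemma nearI: "(!!om y. om \<in> Om p ==> y \<in> U0 ==> D om (cinv c0 y) = E om (cinv c0 y)) ==> near p D E"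
 unfolding near_def using U0 by blast

lemma lie_wop_near:
 assumes h: "!!i. Sm S0 (%y. v y i)" and b: "length b = p"
  and g: "Sm S0 g" and om: "om \<in> Om p" and y: "y \<in> U0"
 shows "LO p (vext v) (wop p g al b) om (cinv c0 y) =
  (SU i. v y i * (g y * mpd (am i al) (%z. om c0 z b) y + pd i g y * mpd al (%z. om c0 z b) y)) -
  g y * mpd al (%z. (SU i. v z i * pd i (%z. om c0 z b) z) + (\<Sum>s<p. SU j. pd (b ! s) (%z. v z j) z * om c0 z (b[s := j]))) y"
proof -
 note V = vext_vector_fields[of v, OF h] and W = wop_diffops_le[OF g b, of al]
 note yc = U0(4)[OF y] and S = oc[OF c0]
 note d = sm_diffble[OF _ S yc]
 have "pd i (%z. wop p g al b om (cinv c0 z)) y = pd i (%z. g z * mpd al (%z. om c0 z b) z) y" for i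
  by (rule pd_cong[OF U0(1) y]) (rule wop_near[OF om])
 also have "pd i (%z. g z * mpd al (%z. om c0 z b) z) y =
   g y * mpd (am i al) (%z. om c0 z b) y + pd i g y * mpd al (%z. om c0 z b) y" for i
  using d[OF g] d[OF sm_mpd[OF form_smooth[OF om c0]]]
  by (simp add: pd_mult mpd_add_mset[OF S form_smooth[OF om c0] yc])
 finally have 1: "pd i (%z. wop p g al b om (cinv c0 z)) y =
   g y * mpd (am i al) (%z. om c0 z b) y + pd i g y * mpd al (%z. om c0 z b) y" for i .
 have 2: "mpd al (%z. LF (vext v) om c0 z b) y = mpd al (%z. (SU i. v z i * pd i (%z. om c0 z b) z) +
   (\<Sum>s<p. SU j. pd (b ! s) (%z. v z j) z * om c0 z (b[s := j]))) y"
 proof (rule mpd_cong[OF U0(1) y])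
  fix z assume z: "z \<in> U0"
  have "pd (b ! s) (%z. vext v c0 z $ j) z = pd (b ! s) (%z. v z j) z" for s j
   by (rule pd_cong[OF U0(1) z]) (rule vext_near)
  then show "LF (vext v) om c0 z b = (SU i. v z i * pd i (%z. om c0 z b) z) +
   (\<Sum>s<p. SU j. pd (b ! s) (%z. v z j) z * om c0 z (b[s := j]))"
   by (simp add: lie_form_chart[OF om c0 U0(4)[OF z] b] vext_near[OF z])
 qed
 show ?thesis
  unfolding lie_op_chart[OF W V c0 om yc] 1 wop_near[OF lie_forms[OF om V] y] 2 vext_near[OF y] ..
qed

text \<open>The form f dx^b near \<open>x0\<close>, cut off to be global.\<close>

definition mform :: "nat => (real^'n => real) => 'n list => ('a, 'n) form" where
 "mform p f b = fext p (%y I. f y * eps p b I)"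

lemma mform_forms: "Sm S0 f ==> mform p f b \<in> Om p"
 unfolding mform_def
 by (intro fext_forms alt_cmult alt_eps sm_mult oc[OF c0] sm_const)

lemma mform_near: "y \<in> U0 ==> mform p f b c0 y I = f y * eps p b I"
 unfolding mform_def by (subst fext_near) (auto intro: alt_cmult alt_eps)

lemma mpd_mform:
 assumes "Sm S0 f" "y \<in> U0"
 shows "mpd al (%z. mform p f b c0 z I) y = eps p b I * mpd al f y"
proof -
 have "mpd al (%z. mform p f b c0 z I) y = mpd al (%z. eps p b I * f z) y"
  by (rule mpd_cong[OF U0(1) assms(2)]) (simp add: mform_near)
 also have "... = eps p b I * mpd al f y"
  by (rule mpd_cmult[OF oc[OF c0] assms(1) U0(4)[OF assms(2)]])
 finally show ?thesis .
qed

lemma coeffs_mform: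
 assumes A: "Lc k p D c0 A" and al: "size al \<le> k" and I: "length I = p"
 shows "D (mform p (mon y0 al) I) x0 = mfact al * A al y0 I"
proof -
 have f: "mform p (mon y0 al) I \<in> Om p"
  by (rule mform_forms) (rule sm_mon[OF oc[OF c0]])
 have "D (mform p (mon y0 al) I) x0 = (\<Sum>be | size be \<le> k. pairing p (A be y0) (%J. mpd be (%z. mform p (mon y0 al) I c0 z J) y0))"
  using A f y0 unfolding local_coeffs_def by blast
 also have "... = (\<Sum>be | size be \<le> k. if be = al then mfact al * pairing p (A be y0) (eps p I) else 0)"
 proof (rule scong)
  fix be
  have "(%J. mpd be (%z. mform p (mon y0 al) I c0 z J) y0) = (%J. eps p I J * (if be = al then mfact al else 0))"
   by (simp add: mpd_mform[OF sm_mon[OF oc[OF c0]] U0(2)] mpd_mon)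
  then show "pairing p (A be y0) (%J. mpd be (%z. mform p (mon y0 al) I c0 z J) y0) =
    (if be = al then mfact al * pairing p (A be y0) (eps p I) else 0)"
   by (simp add: pairing_def sum_distrib_left mult_ac)
 qed
 also have "... = mfact al * pairing p (A al y0) (eps p I)" using al by (simp add: sum.delta')
 also have "pairing p (A al y0) (eps p I) = pairing p (eps p I) (A al y0)" by (simp add: pairing_def mult.commute)
 also have "... = A al y0 I"
  using A al y0 I unfolding local_coeffs_def by (intro pairing_eps) auto
 finally show ?thesis .
qed

text \<open>On a monomial form exactly one coefficient at \<open>y0\<close> survives, with the
  nonzero factor \<open>mfact\<close>. Monomial forms thus determine an operator of finite order at
  the point.\<close>

lemma diffop_zero_at:
 assumes D: "D \<in> DO k p"
  and 0: "!!al I. size al \<le> k ==> length I = p ==> D (mform p (mon y0 al) I) x0 = 0"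
 shows "D om x0 = 0"
proof (cases "om \<in> Om p")
 case True
 obtain A where A: "Lc k p D c0 A" using D c0 unfolding diffops_le_def by blast
 have "A al y0 I = 0" if "size al \<le> k" "length I = p" for al I
  using coeffs_mform[OF A that] 0[OF that] mfact_pos[of al] by simp
 then have "pairing p (A al y0) w = 0" if "size al \<le> k" for al w using that by (simp add: pairing_def)
 moreover have "D om x0 = (\<Sum>be | size be \<le> k. pairing p (A be y0) (%J. mpd be (%z. om c0 z J) y0))"
  using A True y0 unfolding local_coeffs_def by blast
 ultimately show ?thesis by simp
qed (use diffops_leD(1)[OF D] in simp)

end

lemma (in mfd) coeffs_unique:
 assumes A: "Lc k p D c A" "Lc k p D c B" and c: "c \<in> \<A>"
  and y: "y \<in> cimg c" and al: "size al \<le> k"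
 shows "A al y = B al y"
proof
 fix I
 obtain r rh where "mpt X \<A> c y r rh" using mpt_exists[OF c y] by blast
 then interpret mpt X \<A> c y r rh .
 show "A al y I = B al y I"
 proof (cases "length I = p")
  case True
  then show ?thesis using coeffs_mform[OF A(1) al True] coeffs_mform[OF A(2) al True] mfact_pos[of al] by simp
 next
  case False
  have "alternating p (A al y)" "alternating p (B al y)" using A al y unfolding local_coeffs_def by blast+
  then show ?thesis using False alt_length by metis
 qed
qed

section \<open>Invariant operators at a point\<close>

text \<open>Operators are linear and local through their coefficients, so only the local expressions
  near the point have to be related. Forms extended by means of cutoffs satisfy linear relations
  near the point and not globally, whence this version.\<close>

lemma (in mfd) diffop_linear:
 assumes D: "D \<in> DO k p" and c: "c \<in> \<A>" and N: "open N" "y \<in> N" "N \<subseteq> cimg c" and S: "finite S"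
  and om: "om \<in> Om p" "!!i. i \<in> S ==> om' i \<in> Om p"
   "!!z I. z \<in> N ==> length I = p ==> om c z I = (\<Sum>i\<in>S. a i * om' i c z I)"
 shows "D om (cinv c y) = (\<Sum>i\<in>S. a i * D (om' i) (cinv c y))"
proof -
 have yc: "y \<in> cimg c" using N by blast
 obtain A where A: "Lc k p D c A" using D c unfolding diffops_le_def by blast
 have m: "mpd al (%z. om c z I) y = (\<Sum>i\<in>S. a i * mpd al (%z. om' i c z I) y)" if "length I = p" for al I
 proof -
  have s: "Sm (cimg c) (%z. om' i c z I)" if "i \<in> S" for i by (rule form_smooth[OF om(2)[OF that] c])
  have "mpd al (%z. om c z I) y = mpd al (%z. \<Sum>i\<in>S. a i * om' i c z I) y"
   by (rule mpd_cong[OF N(1,2)]) (rule om(3)[OF _ that])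
  also have "... = (\<Sum>i\<in>S. mpd al (%z. a i * om' i c z I) y)"
   by (rule mpd_sum[OF oc[OF c] S _ yc]) (intro sm_mult oc[OF c] sm_const s)
  also have "... = (\<Sum>i\<in>S. a i * mpd al (%z. om' i c z I) y)"
   by (rule scong) (rule mpd_cmult[OF oc[OF c] s yc])
  finally show ?thesis .
 qed
 have pr: "pairing p (A al y) (%I. mpd al (%z. om c z I) y) = (\<Sum>i\<in>S. a i * pairing p (A al y) (%I. mpd al (%z. om' i c z I) y))" for al
 proof -
  have "(\<Sum>I\<in>Ls p. A al y I * mpd al (%z. om c z I) y) = (\<Sum>I\<in>Ls p. \<Sum>i\<in>S. a i * (A al y I * mpd al (%z. om' i c z I) y))"
   by (rule scong) (simp add: m sum_distrib_left mult_ac)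
  also have "... = (\<Sum>i\<in>S. a i * (\<Sum>I\<in>Ls p. A al y I * mpd al (%z. om' i c z I) y))"
   by (subst sum.swap) (simp add: sum_distrib_left)
  finally show ?thesis
   by (simp only: pairing_def times_divide_eq_right sum_divide_distrib[symmetric])
 qed
 have "D om (cinv c y) = (\<Sum>al | size al \<le> k. pairing p (A al y) (%I. mpd al (%z. om c z I) y))"
  using A om(1) yc unfolding local_coeffs_def by blast
 also have "... = (\<Sum>i\<in>S. a i * (\<Sum>al | size al \<le> k. pairing p (A al y) (%I. mpd al (%z. om' i c z I) y)))"
  unfolding pr by (subst sum.swap) (simp add: sum_distrib_left)
 also have "... = (\<Sum>i\<in>S. a i * D (om' i) (cinv c y))"
  using A om(2) yc unfolding local_coeffs_def by (intro sum.cong refl arg_cong2[where f = "(*)"]) auto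
 finally show ?thesis .
qed

section \<open>Locality of invariant operators\<close>

context mpt
begin

lemma smooth_extend:
 assumes f: "Sm (ball y0 r) f"
 shows "\<exists>f'. Sm UNIV f' & (\<forall>y\<in>ball y0 (r / 4). f' y = f y)"
proof -
 obtain rh' where b: "Sm UNIV rh'" "\<forall>y\<in>ball y0 (r / 2 / 2). rh' y = 1" "\<forall>y. y ~: ball y0 (r / 2) --> rh' y = 0"
  using bump_function[of "r / 2" y0] r by auto
 let ?f = "%y. if y \<in> ball y0 r then rh' y * f y else 0"
 have "Sm UNIV ?f"
 proof (rule sm_local[OF open_UNIV])
  fix y
  show "\<exists>N. open N & y \<in> N & Sm (UNIV \<inter> N) ?f"
  proof (cases "y \<in> ball y0 r")
   case True
   have "Sm (ball y0 r) (%y. rh' y * f y)"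
    by (intro sm_mult open_ball f sm_subset[OF open_UNIV subset_UNIV b(1)])
   then have "Sm (ball y0 r) ?f" by (rule sm_cong[OF open_ball, rotated]) simp
   then show ?thesis using True by (intro exI[of _ "ball y0 r"]) simp
  next
   case False
   have "Sm (- cball y0 (r / 2)) ?f"
    by (rule sm_cong[of _ "%_. 0"]) (use b(3) in auto)
   moreover have "y \<in> - cball y0 (r / 2)" using False r by auto
   ultimately show ?thesis by (intro exI[of _ "- cball y0 (r / 2)"]) auto
  qed
 qed
 moreover have "?f y = f y" if "y \<in> ball y0 (r / 4)" for y
 proof -
  have "y \<in> ball y0 r" using that r by auto
  then show ?thesis using b(2) that by simp
 qed
 ultimately show ?thesis by (intro exI[of _ ?f]) auto
qed

lemma lie_mform_near:
 assumes v: "!!i. Sm S0 (%y. v y i)" and f: "Sm S0 f" and b: "length b = p"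
  and y: "y \<in> U0" and I: "length I = p"
 shows "LF (vext v) (mform p f b) c0 y I =
  (SU i. v y i * pd i f y) * eps p b I +
  f y * (\<Sum>q<p. SU l. pd l (%z. v z (b ! q)) y * eps p (b[q := l]) I)"
proof -
 note yc = U0(4)[OF y]
 have "pd i (%z. mform p f b c0 z I) y = eps p b I * pd i f y" for i
  using mpd_mform[OF f y, where al = "{#i#}" and p = p and b = b and I = I] by (simp add: mpd_single)
 moreover have "pd l (%z. vext v c0 z $ j) y = pd l (%z. v z j) y" for l j
  by (rule pd_cong[OF U0(1) y]) (rule vext_near)
 ultimately have "LF (vext v) (mform p f b) c0 y I = (SU i. v y i * (eps p b I * pd i f y)) +
   (\<Sum>s<p. SU j. pd (I ! s) (%z. v z j) y * (f y * eps p b (I[s := j])))"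
  by (simp add: lie_form_chart[OF mform_forms[OF f] c0 yc I] vext_near[OF y] mform_near[OF y])
 also have "(\<Sum>s<p. SU j. pd (I ! s) (%z. v z j) y * (f y * eps p b (I[s := j]))) =
   f y * (SU j. \<Sum>s<p. pd (I ! s) (%z. v z j) y * eps p b (I[s := j]))"
  by (subst sum.swap) (simp add: sum_distrib_left mult_ac)
 also have "(SU j. \<Sum>s<p. pd (I ! s) (%z. v z j) y * eps p b (I[s := j])) =
   (SU j. \<Sum>q<p. if b ! q = j then SU l. pd l (%z. v z j) y * eps p (b[q := l]) I else 0)"
  by (rule scong) (rule eps_lie[OF b I])
 also have "... = (\<Sum>q<p. SU j. if b ! q = j then SU l. pd l (%z. v z j) y * eps p (b[q := l]) I else 0)"
  by (rule sum.swap)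
 also have "... = (\<Sum>q<p. SU l. pd l (%z. v z (b ! q)) y * eps p (b[q := l]) I)"
  by (rule scong) (simp add: sum.delta)
 finally show ?thesis by (simp add: sum_distrib_left mult_ac)
qed

text \<open>Vanishing near \<open>x0\<close> leaves room for vector fields whose Lie derivatives vanish identically.\<close>

lemma near_zero_lie:
 assumes D: "D \<in> DO k p" and n: "near p D 0"
 shows "\<exists>r' rh'. mpt X \<A> c0 y0 r' rh' &
  (\<forall>v. (\<forall>i. Sm S0 (%y. v y i)) --> LO p (mpt.vext \<A> c0 rh' v) D = 0)"
proof -
 obtain N where N: "open N" "y0 \<in> N" "N \<subseteq> U0" "!!om y. om \<in> Om p ==> y \<in> N ==> D om (cinv c0 y) = 0"
  using n unfolding near_def by auto
 have Nc: "N \<subseteq> cimg c0" using N(3) U0(3) by blast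
 obtain r' where r': "r' > 0" "cball y0 r' \<subseteq> N" using N(1,2) open_contains_cball by metis
 obtain rh' where "Sm UNIV rh'" "\<forall>z\<in>ball y0 (r' / 2). rh' z = 1" "\<forall>z. z ~: ball y0 r' --> rh' z = 0"
  using bump_function[OF r'(1)] by blast
 \<comment> \<open>A smaller cutoff at the same point: all fields built with it are supported where
   \<open>D\<close> is known to vanish.\<close>
 then have M: "mpt X \<A> c0 y0 r' rh'" using c0 r' Nc by unfold_locales auto
 interpret M: mpt X \<A> c0 y0 r' rh' by (rule M)
 have "LO p (M.vext v) D = 0" if v: "\<forall>i. Sm S0 (%y. v y i)" for v
 proof (intro ext)
  fix om x
  note V = M.vext_vector_fields[of v, OF v[rule_format]]
  note L = lie_op_diffops_le[OF D V]
  consider "om ~: Om p" | "x ~: pts" | "om \<in> Om p" "x \<in> pts" by blast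
  then have "LO p (M.vext v) D om x = 0"
  proof cases
   case 3
   note om = 3(1)
   show ?thesis
   \<comment> \<open>On the coordinate neighbourhood \<open>N\<close> the operator vanishes on every
     form. Off it the field vanishes near the point, hence so does the Lie derivative of the
     form.\<close>
   proof (cases "x \<in> cinv c0 ` N")
    case True
    then obtain y where y: "y \<in> N" "x = cinv c0 y" by blast
    have yc: "y \<in> cimg c0" using y Nc by blast
    have "pd i (%z. D om (cinv c0 z)) y = pd i (%z. 0) y" for i
     by (rule pd_cong[OF N(1) y(1)]) (rule N(4)[OF om])
    then show ?thesis
     using lie_op_chart[OF D V c0 om yc] N(4)[OF lie_forms[OF om V] y(1)] y(2) by simp
   next
    case False
    obtain c where c: "c \<in> \<A>" "x \<in> cdom c" using 3(2) unfolding points_def by blast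
    let ?K = "cinv c0 ` cball y0 r'" and ?W = "coord c ` (cdom c - cinv c0 ` cball y0 r')"
    have K: "closedin X ?K" by (rule closedin_chart_cball[OF c0 M.cball])
    have "openin X (cdom c - ?K)" by (rule openin_diff[OF openin_cdom[OF c(1)] K])
    then have W: "open ?W" by (intro open_coord_image[OF c(1)]) auto
    have "x ~: ?K" using False r'(2) by blast
    then have y: "coord c x \<in> ?W" using c by blast
    have yc: "coord c x \<in> cimg c" using c by blast
    have Wc: "?W \<subseteq> cimg c" by blast
    have V0: "M.vext v c z = 0" if zW: "z \<in> ?W" for z
    proof -
     obtain x' where x': "x' \<in> cdom c" "x' ~: ?K" "z = coord c x'" using zW by blast
     have "rh' (tr c c0 z) = 0" if "z \<in> ov c c0"
     proof (rule M.rh_0)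
      have "x' \<in> cdom c0" using that x' c(1) ov_iff[OF c(1), of z c0] by auto
      then show "tr c c0 z ~: ball y0 r'"
       using x' c(1) cinv_coord[OF c0, of x'] imageI[of "coord c0 x'" "cball y0 r'" "cinv c0"] by auto
     qed
     then show ?thesis unfolding M.vext_def by (auto simp: vec_eq_iff)
    qed
    have z: "(0 :: ('a, 'n) form) \<in> Om p" unfolding forms_def by (auto simp: zero_fun_def)
    have "D (LF (M.vext v) om) (cinv c (coord c x)) = D 0 (cinv c (coord c x))"
    proof (rule diffop_local[OF D c(1) W y Wc lie_forms[OF om V] z])
     fix z I assume z: "z \<in> ?W"
     have "pd s (%z. M.vext v c z $ j) z = pd s (%z. 0) z" for s j
      by (rule pd_cong[OF W z]) (simp add: V0)
     then show "LF (M.vext v) om c z I = (0 :: ('a, 'n) form) c z I"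
      using z Wc c(1) V0[OF z] by (auto simp: lie_form_def on_charts_def restrict0_def)
    qed
    also have "D 0 (cinv c (coord c x)) = (\<Sum>i\<in>{}. 0 * D 0 (cinv c (coord c x)))"
     by (rule diffop_linear[OF D c(1) W y Wc finite.emptyI z]) auto
    finally show ?thesis using lie_op_chart[OF D V c(1) om yc] V0[OF y] c by simp
   qed
  qed (use diffops_leD(1,2)[OF L] in simp_all)
  then show "LO p (M.vext v) D om x = (0 :: ('a, 'n) operator) om x" by simp
 qed
 then show ?thesis using M by blast
qed

text \<open>The Euler field at \<open>y0\<close> acts on monomial forms by a positive scalar.\<close>

lemma euler_kills:
 assumes p: "p \<ge> 1" and E: "E \<in> DO k p" and L: "LO p (vext (%y i. y $ i - y0 $ i)) E = 0"
 shows "E om x0 = 0"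
proof (rule diffop_zero_at[OF E])
 fix al and I :: "'n list" assume I: "length I = p"
 let ?v = "%y i. y $ i - y0 $ i" and ?om = "mform p (mon y0 al) I"
 have v: "Sm S0 (%y. ?v y i)" for i by (intro smooth_intros oc[OF c0])
 note V = vext_vector_fields[of ?v, OF v]
 have f: "Sm S0 (mon y0 al)" by (rule sm_mon[OF oc[OF c0]])
 note om = mform_forms[OF f, of p I]
 \<comment> \<open>The monomial form is an eigenvector near the point with eigenvalue
   \<open>size al + p\<close>. As the field vanishes at \<open>y0\<close>, the hypothesis says that
   \<open>E\<close> kills this multiple at \<open>x0\<close>; p \<ge> 1 makes the eigenvalue nonzero
   even for constant coefficients.\<close>
 have "E (LF (vext ?v) ?om) x0 = (\<Sum>i\<in>{()}. real (size al + p) * E ?om x0)"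
 proof (rule diffop_linear[OF E c0 U0(1-3) _ lie_forms[OF om V] om])
  fix z :: "real^'n" and J :: "'n list" assume z: "z \<in> U0" and J: "length J = p"
  have "(SU i. ?v z i * pd i (mon y0 al) z) = size al * mon y0 al z"
  proof -
   have "?v z i * pd i (mon y0 al) z = count al i * mon y0 al z" for i
   proof (cases "i \<in># al")
    case True
    then obtain be where "al = am i be" by (meson multi_member_split)
    then show ?thesis by (simp add: pd_mon mon_add_mset)
   qed (simp add: pd_mon not_in_iff)
   then have "(SU i. ?v z i * pd i (mon y0 al) z) = (SU i. real (count al i)) * mon y0 al z"
    by (simp add: sum_distrib_right)
   also have "(SU i. real (count al i)) = size al"
    by (simp add: size_multiset_overloaded_eq flip: of_nat_sum)
     (rule sum.mono_neutral_right; auto simp: not_in_iff)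
   finally show ?thesis .
  qed
  moreover have "(\<Sum>q<p. SU l. pd l (%z. ?v z (I ! q)) z * eps p (I[q := l]) J) = p * eps p I J"
  proof -
   have "(SU l. pd l (%z. ?v z (I ! q)) z * eps p (I[q := l]) J) = eps p I J" for q
   proof -
    have "(SU l. pd l (%z. ?v z (I ! q)) z * eps p (I[q := l]) J) =
      (SU l. if l = I ! q then eps p (I[q := l]) J else 0)"
     by (rule scong) (simp add: pd_coord_shift)
    then show ?thesis by simp
   qed
   then show ?thesis by simp
  qed
  ultimately show "LF (vext ?v) ?om c0 z J = (\<Sum>i\<in>{()}. real (size al + p) * ?om c0 z J)"
   by (simp add: lie_mform_near[OF v f I z J] mform_near[OF z] algebra_simps)
 qed auto
 moreover have "E (LF (vext ?v) ?om) x0 = 0"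
  using lie_op_chart[OF E V c0 om y0] L by (simp add: vext_near[OF U0(2)])
 ultimately show "E ?om x0 = 0" using p by simp
qed

end

locale inv = mpt X \<A> c0 y0 r rh
 for X :: "'a topology" and \<A> :: "('a, 'n::finite) chart set" and c0 y0 r rh +
 fixes k p :: nat and T :: "('a, 'n) operator => ('a, 'n) operator"
 assumes T: "T \<in> Inv k p p" and p: "p \<ge> 1"
begin

lemma T_diffops: "D \<in> DO k p ==> \<exists>K. T D \<in> DO K p"
 using T unfolding invariant_ops_def diffops_def by blast

lemma T_add: "D \<in> DO k p ==> E \<in> DO k p ==> T (D + E) = T D + T E"
 using T unfolding invariant_ops_def by blast

lemma T_scale: "D \<in> DO k p ==> T (%om x. t * D om x) = (%om x. t * T D om x)"
 using T unfolding invariant_ops_def by blast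

lemma T_lie: "V \<in> Vect ==> D \<in> DO k p ==> T (LO p V D) = LO p V (T D)"
 using T unfolding invariant_ops_def by blast

lemma T_0: "T 0 = 0"
 using T_add[OF DO_zero DO_zero] by simp

lemma comb_diffops:
 assumes "finite S" "!!i. i \<in> S ==> D i \<in> DO k p"
 shows "(%om x. \<Sum>i\<in>S. a i * D i om x) \<in> DO k p"
  "T (%om x. \<Sum>i\<in>S. a i * D i om x) = (%om x. \<Sum>i\<in>S. a i * T (D i) om x)"
proof -
 have "(%om x. \<Sum>i\<in>S. a i * D i om x) \<in> DO k p &
  T (%om x. \<Sum>i\<in>S. a i * D i om x) = (%om x. \<Sum>i\<in>S. a i * T (D i) om x)"
  using assms
 proof (induction S rule: finite_induct)
  case empty
  then show ?case using DO_zero T_0 by (simp add: zero_fun_def)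
 next
  case (insert j S)
  have eq: "(%om x. \<Sum>i\<in>insert j S. a i * D i om x) = (%om x. a j * D j om x) + (%om x. \<Sum>i\<in>S. a i * D i om x)"
   using insert by (simp add: fun_eq_iff)
  have j: "(%om x. a j * D j om x) \<in> DO k p" using insert by (intro DO_scale) auto
  show ?case unfolding eq using insert j DO_add T_add[OF j] T_scale[of "D j" "a j"]
   by (simp add: fun_eq_iff)
 qed
 then show "(%om x. \<Sum>i\<in>S. a i * D i om x) \<in> DO k p"
  "T (%om x. \<Sum>i\<in>S. a i * D i om x) = (%om x. \<Sum>i\<in>S. a i * T (D i) om x)" by auto
qed

lemma T_local_0:
 assumes D: "D \<in> DO k p" and n: "near p D 0"
 shows "T D om x0 = 0"
proof -
 obtain r' rh' where M: "mpt X \<A> c0 y0 r' rh'"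
  and L: "\<forall>v. (\<forall>i. Sm S0 (%y. v y i)) --> LO p (mpt.vext \<A> c0 rh' v) D = 0"
  using near_zero_lie[OF D n] by blast
 interpret M: mpt X \<A> c0 y0 r' rh' by (rule M)
 obtain K where K: "T D \<in> DO K p" using T_diffops[OF D] by blast
 let ?v = "%y i. y $ i - y0 $ i"
 have v: "\<forall>i. Sm S0 (%y. ?v y i)" by (intro allI smooth_intros oc[OF c0])
 \<comment> \<open>Invariance carries the vanishing Lie derivative from \<open>D\<close> to
   \<open>T D\<close>, whose order \<open>K\<close> is finite and may exceed
   \<open>k\<close>.\<close>
 have "LO p (M.vext ?v) (T D) = 0"
  using T_lie[OF M.vext_vector_fields[of ?v, OF v[rule_format]] D] L[rule_format, of ?v] v T_0 by simp
 then show ?thesis by (rule M.euler_kills[OF p K])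
qed

lemma T_near:
 assumes D: "D \<in> DO k p" "E \<in> DO k p" and n: "near p D E"
 shows "T D om x0 = T E om x0"
proof -
 have E': "(%om x. -1 * E om x) \<in> DO k p" by (rule DO_scale[OF D(2)])
 have "near p (D + (%om x. -1 * E om x)) 0" using n unfolding near_def by auto
 from T_local_0[OF DO_add[OF D(1) E'] this]
 show ?thesis unfolding T_add[OF D(1) E'] T_scale[OF D(2)] by simp
qed

text \<open>By locality a linear relation among operators near \<open>x0\<close> is enough; the
  cutoffs in the global words spoil it elsewhere.\<close>

lemma T_comb:
 assumes "D \<in> DO k p" "finite S" "!!i. i \<in> S ==> E i \<in> DO k p"
  and "near p D (%om x. \<Sum>i\<in>S. a i * E i om x)"
 shows "T D om x0 = (\<Sum>i\<in>S. a i * T (E i) om x0)"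
 using T_near[OF assms(1) comb_diffops(1)[OF assms(2,3)] assms(4)] comb_diffops(2)[OF assms(2,3)] by simp

text \<open>For a fixed word and coefficient this is a functional of a finite jet of
  \<open>om\<close> at \<open>x0\<close>. The classification is a computation with these
  functionals.\<close>

definition Tw :: "(real^'n => real) => 'n multiset => 'n list => ('a, 'n) form => real" where
 "Tw g al b om = T (wop p g al b) om x0"

abbreviation tw :: "'n multiset => 'n list => ('a, 'n) form => real" where
 "tw \<equiv> Tw (%_. 1)"

definition vf :: "(real^'n => real) => 'n => ('a, 'n) vfield" where
 "vf h i = vext (%y j. if j = i then h y else 0)"

lemma vf_fields: "Sm S0 h ==> vf h i \<in> Vect"
 unfolding vf_def by (rule vext_vector_fields) (auto intro: sm_if)

lemma wop_in: "Sm S0 g ==> length b = p ==> size al \<le> k ==> wop p g al b \<in> DO k p"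
 using DO_mono[OF wop_diffops_le] by blast

text \<open>The field vanishes at \<open>y0\<close>, so in the Lie derivative of \<open>T D\<close>
  at that point only the action on the form is left.\<close>

lemma T_lie_x0:
 assumes D: "D \<in> DO k p" and h: "Sm S0 h" "h y0 = 0" and om: "om \<in> Om p"
 shows "T (LO p (vf h i) D) om x0 = - T D (LF (vf h i) om) x0"
proof -
 obtain K where K: "T D \<in> DO K p" using T_diffops[OF D] by blast
 have "vf h i c0 y0 $ j = 0" for j unfolding vf_def using vext_near[OF U0(2)] h(2) by simp
 then show ?thesis unfolding T_lie[OF vf_fields[OF h(1)] D] using lie_op_chart[OF K vf_fields[OF h(1)] c0 om y0]
  by simp
qed

lemma Tw_cong:
 assumes "Sm S0 g" "Sm S0 g'" "length b = p" "size al \<le> k"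
  and N: "open N" "y0 \<in> N" "!!y. y \<in> N ==> g y = g' y"
 shows "Tw g al b om = Tw g' al b om"
 unfolding Tw_def
proof (rule T_near[OF wop_in[OF assms(1,3,4)] wop_in[OF assms(2-4)]])
 show "near p (wop p g al b) (wop p g' al b)"
  unfolding near_def by (rule exI[of _ "N \<inter> U0"]) (use N U0 in "auto simp: wop_near")
qed

lemma Tw_outside: "om ~: Om p ==> Sm S0 g ==> length b = p ==> size al \<le> k ==> Tw g al b om = 0"
 unfolding Tw_def using T_diffops[OF wop_in] diffops_leD(1) by (metis zero_fun_apply)

lemma Tw_alt:
 assumes g: "Sm S0 g" and al: "size al \<le> k"
 shows "alternating p (%b. if length b = p then Tw g al b om else 0)"
 unfolding alt_swp
proof (intro conjI allI impI)
 fix b :: "'n list" and s t assume b: "length b = p" and st: "s < p" "t < p" "s ~= t"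
 have "T (wop p g al (swp s t b)) om x0 = (\<Sum>i\<in>{()}. -1 * T (wop p g al b) om x0)"
 proof (rule T_comb[OF wop_in[OF g _ al]])
  show "near p (wop p g al (swp s t b)) (%om x. \<Sum>i\<in>{()}. -1 * wop p g al b om x)"
  proof (rule nearI)
   fix om' y assume om: "om' \<in> Om p" and y: "y \<in> U0"
   show "wop p g al (swp s t b) om' (cinv c0 y) = (\<Sum>i\<in>{()}. -1 * wop p g al b om' (cinv c0 y))"
    using alternatingD[OF mpd_form_alt[OF om c0 U0(4)[OF y]] b st] by (simp add: wop_near[OF om y])
  qed
 qed (use b wop_in[OF g _ al] in auto)
 then show "(if length (swp s t b) = p then Tw g al (swp s t b) om else 0) = - (if length b = p then Tw g al b om else 0)"
  using b by (simp add: Tw_def)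
qed simp

lemma Tw_sign:
 assumes g: "Sm S0 g" and al: "size al \<le> k"
  and b: "distinct b" "distinct b'" "set b = set b'" "length b = p"
 shows "\<exists>si::real. si * si = 1 & (\<forall>om. Tw g al b' om = si * Tw g al b om) & (\<forall>w. alternating p w --> w b' = si * w b)"
proof -
 obtain si :: real where si: "si * si = 1" "\<forall>w. alternating p w --> w b' = si * w b"
  using same_set_sign[OF b] by blast
 have l: "length b' = p" using b distinct_card by metis
 have "Tw g al b' om = si * Tw g al b om" for om
  using si(2)[rule_format, OF Tw_alt[OF g al, of om]] b(4) l by simp
 then show ?thesis using si by blast
qed

end

context inv
begin

section \<open>Relations between the values of an invariant operator\<close>

abbreviation sc :: "'n => real^'n => real" where "sc l \<equiv> %y. y $ l - y0 $ l"

lemma smooth_sc: "Sm S0 (sc l)"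
 by (intro smooth_intros oc[OF c0])

lemma vf_sum: "(SU j. (if j = (i :: 'n) then h else 0) * F j) = h * (F i :: real)"
 by (simp add: mult_if cong: if_cong)

lemma pd_vf: "pd l (%z. if j = i then h z else 0) y = (if j = i then pd l h y else 0)"
 by simp

lemma lie_vf_wop:
 assumes h: "Sm S0 h" and b: "length b = p" and g: "Sm S0 g"
  and om: "om \<in> Om p" and y: "y \<in> U0"
 shows "LO p (vf h i) (wop p g al b) om (cinv c0 y) =
  h y * (g y * mpd (am i al) (%z. om c0 z b) y + pd i g y * mpd al (%z. om c0 z b) y) -
  g y * (mpd al (%z. h z * pd i (%z. om c0 z b) z) y +
   (\<Sum>s<p. mpd al (%z. pd (b ! s) h z * om c0 z (b[s := i])) y))"
proof -
 note S = oc[OF c0] and yc = U0(4)[OF y] and f = form_smooth[OF om c0]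
 have v: "Sm S0 (%y. if j = i then h y else 0)" for j using h by (auto intro: sm_if)
 have "(SU j. pd x (%z. if j = i then h z else 0) z * om c0 z (b[s := j])) = pd x h z * om c0 z (b[s := i])" for x s z
  unfolding pd_vf vf_sum ..
 moreover have "mpd al (%z. h z * pd i (%z. om c0 z b) z + (\<Sum>s<p. pd (b ! s) h z * om c0 z (b[s := i]))) y =
  mpd al (%z. h z * pd i (%z. om c0 z b) z) y + (\<Sum>s<p. mpd al (%z. pd (b ! s) h z * om c0 z (b[s := i])) y)"
  using h f by (simp add: mpd_add[OF S _ _ yc] mpd_sum[OF S _ _ yc] sm_sum sm_mult S sm_pd)
 ultimately show ?thesis
  unfolding vf_def lie_wop_near[OF v b g om y] vf_sum by simp
qed

lemma lie_vf_mform: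
 assumes h: "Sm S0 h" and f: "Sm S0 f" and b: "length b = p"
  and y: "y \<in> U0" and I: "length I = p"
 shows "LF (vf h i) (mform p f b) c0 y I = h y * pd i f y * eps p b I +
  f y * (\<Sum>q<p. if b ! q = i then SU l. pd l h y * eps p (b[q := l]) I else 0)"
proof -
 have v: "Sm S0 (%y. if j = i then h y else 0)" for j using h by (auto intro: sm_if)
 have "(\<Sum>q<p. SU l. pd l (%z. if b ! q = i then h z else 0) y * eps p (b[q := l]) I) =
   (\<Sum>q<p. if b ! q = i then SU l. pd l h y * eps p (b[q := l]) I else 0)"
  by (rule scong) simp
 then show ?thesis unfolding vf_def lie_mform_near[OF v f b y I] vf_sum by simp
qed

text \<open>For a linear field the Lie derivative of a word with constant coefficient is exactly,
  with a minus sign, the sum over replacements of one letter \<open>l\<close> by \<open>i\<close>.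
  This sign and that of \<open>T_lie_x0\<close> cancel.\<close>

lemma tw_linear_field:
 assumes b: "length b = p" and al: "size al \<le> k" and om: "om \<in> Om p"
 shows "count al l * tw (am i (al - {#l#})) b om + (\<Sum>s<p. if b ! s = l then tw al (b[s := i]) om else 0) =
  tw al b (LF (vf (sc l) i) om)"
proof -
 note S = oc[OF c0]
 let ?C = "wop p (%_. 1)"
 \<comment> \<open>The index \<open>p\<close> stands for replacing a derivative, an index
   \<open>s < p\<close> for replacing the exterior index at position \<open>s\<close>.\<close>
 define E where "E s = (if s = p then ?C (am i (al - {#l#})) b else ?C al (b[s := i]))" for s
 define a where "a s = (if s = p then - real (count al l) else if b ! s = l then -1 else 0)" for s
 \<comment> \<open>If \<open>l\<close> does not occur in \<open>al\<close>, the word with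
   \<open>i\<close> added may be longer than allowed. Its coefficient is then zero, and the zero
   operator takes its place so that all summands have order at most \<open>k\<close>.\<close>
 define E' where "E' s = (if a s = 0 then 0 else E s)" for s
 have E': "E' s \<in> DO k p" for s
  unfolding E'_def E_def a_def
  using b al wop_in[of "%_. 1"] DO_zero
  by (auto simp: size_Diff_singleton count_greater_zero_iff Suc_le_eq dest: multi_member_split split: if_splits)
 have "T (LO p (vf (sc l) i) (?C al b)) om x0 = (\<Sum>s\<in>insert p {..<p}. a s * T (E' s) om x0)"
 proof (rule T_comb)
  show "LO p (vf (sc l) i) (?C al b) \<in> DO k p"
   by (intro lie_op_diffops_le wop_in vf_fields smooth_sc b al sm_const)
  show "near p (LO p (vf (sc l) i) (?C al b)) (%om x. \<Sum>s\<in>insert p {..<p}. a s * E' s om x)"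
  proof (rule nearI)
   fix om y assume om: "om \<in> Om p" and y: "y \<in> U0"
   note f = form_smooth[OF om c0] and yc = U0(4)[OF y]
   have 1: "mpd al (%z. sc l z * pd i (%z. om c0 z b) z) y =
     sc l y * mpd (am i al) (%z. om c0 z b) y + count al l * mpd (am i (al - {#l#})) (%z. om c0 z b) y"
    using mpd_mult_coord[OF S sm_pd[OF f] yc, of al l y0 i b] mpd_pd[OF S f yc] mpd_add_mset[OF S f yc] by simp
   have 2: "mpd al (%z. pd x (sc l) z * om c0 z b') y = (if x = l then mpd al (%z. om c0 z b') y else 0)" for x b'
    by (simp add: pd_coord_shift)
   have 3: "a s * E' s om x = a s * E s om x" for s x by (simp add: E'_def)
   have "LO p (vf (sc l) i) (?C al b) om (cinv c0 y) =
    - (count al l * mpd (am i (al - {#l#})) (%z. om c0 z b) y) -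
    (\<Sum>s<p. if b ! s = l then mpd al (%z. om c0 z (b[s := i])) y else 0)"
    unfolding lie_vf_wop[OF smooth_sc b sm_const om y] 1 2 by simp
   also have "... = (\<Sum>s\<in>insert p {..<p}. a s * E s om (cinv c0 y))"
    by (simp add: a_def E_def wop_near[OF om y] sum_negf[symmetric] mult_if cong: if_cong)
     (rule sum.cong; simp)
   finally show "LO p (vf (sc l) i) (?C al b) om (cinv c0 y) = (\<Sum>s\<in>insert p {..<p}. a s * E' s om (cinv c0 y))"
    unfolding 3 .
  qed
 qed (use E' in auto)
 moreover have "T (LO p (vf (sc l) i) (?C al b)) om x0 = - tw al b (LF (vf (sc l) i) om)"
  unfolding Tw_def by (rule T_lie_x0[OF wop_in[OF sm_const b al] smooth_sc _ om]) simp
 moreover have "a s * T (E' s) om x0 = a s * T (E s) om x0" for s by (simp add: E'_def)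
 moreover have "(\<Sum>s\<in>insert p {..<p}. a s * T (E s) om x0) =
   - (count al l * tw (am i (al - {#l#})) b om) - (\<Sum>s<p. if b ! s = l then tw al (b[s := i]) om else 0)"
  by (simp add: a_def E_def Tw_def sum_negf[symmetric] mult_if cong: if_cong)
   (rule sum.cong; simp)
 ultimately show ?thesis by simp
qed

abbreviation sq :: "'n => real^'n => real" where "sq l \<equiv> %y. 1/2 * (sc l y * sc l y)"

lemma smooth_sq: "Sm S0 (sq l)"
 by (intro smooth_intros oc[OF c0])

lemma pd_sq: "pd x (sq l) y = (if x = l then sc l y else 0)"
proof -
 have d: "sc l differentiable at y"
  by (rule sm_diffble[of UNIV]; (intro smooth_intros open_UNIV UNIV_I)?)
 show ?thesis unfolding pd_cmult[OF differentiable_mult[OF d d]] pd_mult[OF d d] pd_coord_shift by simp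
qed

lemma mpd_sq:
 assumes f: "Sm S0 f" and y: "y \<in> cimg c0"
 shows "mpd al (%z. sq l z * f z) y = sq l y * mpd al f y + count al l * (sc l y * mpd (al - {#l#}) f y) +
  real (count al l) * (real (count al l) - 1) / 2 * mpd (al - {#l#} - {#l#}) f y"
proof -
 note S = oc[OF c0]
 have s: "Sm S0 (%z. sc l z * f z)" by (intro sm_mult S smooth_sc f)
 have "mpd al (%z. sq l z * f z) y = mpd al (%z. 1/2 * (sc l z * (sc l z * f z))) y"
  by (simp add: mult.assoc)
 also have "... = 1/2 * mpd al (%z. sc l z * (sc l z * f z)) y"
  by (rule mpd_cmult[OF S sm_mult[OF S smooth_sc s] y])
 also have "... = sq l y * mpd al f y + count al l * (sc l y * mpd (al - {#l#}) f y) +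
  real (count al l) * real (count (al - {#l#}) l) / 2 * mpd (al - {#l#} - {#l#}) f y"
  unfolding mpd_mult_coord[OF S s y] mpd_mult_coord[OF S f y] by (simp add: field_simps)
 also have "real (count al l) * real (count (al - {#l#}) l) = real (count al l) * (real (count al l) - 1)"
  by (cases "count al l") auto
 finally show ?thesis .
qed

text \<open>A quadratic field yields words with the coefficient \<open>sc l\<close> next to words
  one order lower. The former are unknown; relations between different orders arise by eliminating
  them among several such identities.\<close>

lemma tw_quadratic_field:
 assumes b: "length b = p" and al: "size al \<le> k" and om: "om \<in> Om p"
 shows "tw al b (LF (vf (sq l) i) om) = count al l * Tw (sc l) (am i (al - {#l#})) b om +
  real (count al l) * (real (count al l) - 1) / 2 * tw (am i (al - {#l#} - {#l#})) b om +
  (\<Sum>s<p. if b ! s = l then Tw (sc l) al (b[s := i]) om + count al l * tw (al - {#l#}) (b[s := i]) om else 0)"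
proof -
 note S = oc[OF c0]
 let ?C = "wop p (%_. 1)" and ?c = "real (count al l)"
 \<comment> \<open>The second index separates words with coefficient \<open>sc l\<close> (0) from
   those with constant coefficient (1); the first is as in the linear case.\<close>
 define E where "E q = (case q of (s, (0::nat)) => (if s = p then wop p (sc l) (am i (al - {#l#})) b else wop p (sc l) al (b[s := i]))
  | (s, _) => (if s = p then ?C (am i (al - {#l#} - {#l#})) b else ?C (al - {#l#}) (b[s := i])))" for q
 define a where "a q = (case q of (s, (0::nat)) => (if s = p then - ?c else if b ! s = l then -1 else 0)
  | (s, _) => (if s = p then - (?c * (?c - 1) / 2) else if b ! s = l then - ?c else 0))" for q
 define E' where "E' s = (if a s = 0 then 0 else E s)" for s
 have sz2: "size (al - {#l#}) \<le> k" "size (al - {#l#} - {#l#}) \<le> size (al - {#l#})"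
  using al size_mset_mono[OF diff_subset_eq_self[of al "{#l#}"]]
   size_mset_mono[OF diff_subset_eq_self[of "al - {#l#}" "{#l#}"]] by linarith+
 have sz1: "size (am i (al - {#l#})) \<le> k" if "count al l > 0"
 proof -
  have "l \<in># al" using that by simp
  then obtain be where "al = am l be" by (meson multi_member_split)
  then show ?thesis using al by simp
 qed
 have sz: "count al l > 0 ==> size (am i (al - {#l#})) \<le> k" "size (al - {#l#}) \<le> k"
  "count al l > 0 ==> size (am i (al - {#l#} - {#l#})) \<le> k"
  using sz1 sz2 by auto
 have W: "wop p g al' b \<in> DO k p" "wop p g al' (b[s := i]) \<in> DO k p"
  if "Sm S0 g" "size al' \<le> k" for g al' s
  by (rule wop_in; simp add: that b)+
 have E': "E' q \<in> DO k p" for q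
 proof (cases "a q = 0")
  case False
  obtain s t where q: "q = (s, t)" by (cases q)
  show ?thesis using False sz al unfolding E'_def
   by (cases t) (auto simp: q E_def a_def intro!: W smooth_sc sm_const split: if_splits)
 qed (simp add: E'_def DO_zero)
 let ?S = "insert p {..<p} \<times> {0, 1::nat}"
 have split: "(\<Sum>q\<in>?S. F q) = F (p, 0) + F (p, 1) + (\<Sum>s<p. F (s, 0) + F (s, 1))" for F :: "nat \<times> nat => real"
 proof -
  have "(\<Sum>q\<in>?S. F q) = (\<Sum>s\<in>insert p {..<p}. \<Sum>t\<in>{0, 1}. F (s, t))" by (simp only: sum.cartesian_product case_prod_eta)
  then show ?thesis by simp
 qed
 have "T (LO p (vf (sq l) i) (?C al b)) om x0 = (\<Sum>q\<in>?S. a q * T (E' q) om x0)"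
 proof (rule T_comb)
  show "LO p (vf (sq l) i) (?C al b) \<in> DO k p"
   by (intro lie_op_diffops_le wop_in vf_fields smooth_sq b al sm_const)
  show "near p (LO p (vf (sq l) i) (?C al b)) (%om x. \<Sum>q\<in>?S. a q * E' q om x)"
  proof (rule nearI)
   fix om y assume om: "om \<in> Om p" and y: "y \<in> U0"
   note f = form_smooth[OF om c0] and yc = U0(4)[OF y]
   have 1: "mpd al (%z. sq l z * pd i (%z. om c0 z b) z) y =
     sq l y * mpd (am i al) (%z. om c0 z b) y + ?c * (sc l y * mpd (am i (al - {#l#})) (%z. om c0 z b) y)
     + ?c * (?c - 1) / 2 * mpd (am i (al - {#l#} - {#l#})) (%z. om c0 z b) y"
    unfolding mpd_sq[OF sm_pd[OF f] yc] mpd_pd[OF S f yc] mpd_add_mset[OF S f yc] ..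
   have 2: "mpd al (%z. pd x (sq l) z * om c0 z b') y = (if x = l then sc l y * mpd al (%z. om c0 z b') y +
     ?c * mpd (al - {#l#}) (%z. om c0 z b') y else 0)" for x b'
    unfolding pd_sq using mpd_mult_coord[OF S f yc, of al l y0 b'] by simp
   have 3: "a q * E' q om x = a q * E q om x" for q x by (simp add: E'_def)
   have "LO p (vf (sq l) i) (?C al b) om (cinv c0 y) =
    - (?c * (sc l y * mpd (am i (al - {#l#})) (%z. om c0 z b) y)
     + ?c * (?c - 1) / 2 * mpd (am i (al - {#l#} - {#l#})) (%z. om c0 z b) y) -
    (\<Sum>s<p. if b ! s = l then sc l y * mpd al (%z. om c0 z (b[s := i])) y +
     ?c * mpd (al - {#l#}) (%z. om c0 z (b[s := i])) y else 0)"
    unfolding lie_vf_wop[OF smooth_sq b sm_const om y] 1 2 by (simp add: algebra_simps)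
   also have "... = (\<Sum>q\<in>?S. a q * E q om (cinv c0 y))"
    unfolding split
    by (simp add: a_def E_def wop_near[OF om y] sum_negf[symmetric])
     (rule sum.cong; simp)
   finally show "LO p (vf (sq l) i) (?C al b) om (cinv c0 y) = (\<Sum>q\<in>?S. a q * E' q om (cinv c0 y))"
    unfolding 3 .
  qed
 qed (use E' in auto)
 moreover have "T (LO p (vf (sq l) i) (?C al b)) om x0 = - tw al b (LF (vf (sq l) i) om)"
  unfolding Tw_def by (rule T_lie_x0[OF wop_in[OF sm_const b al] smooth_sq _ om]) simp
 moreover have "a s * T (E' s) om x0 = a s * T (E s) om x0" for s by (simp add: E'_def)
 moreover have "(\<Sum>q\<in>?S. a q * T (E q) om x0) =
  - (?c * Tw (sc l) (am i (al - {#l#})) b om + ?c * (?c - 1) / 2 * tw (am i (al - {#l#} - {#l#})) b om) -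
  (\<Sum>s<p. if b ! s = l then Tw (sc l) al (b[s := i]) om + ?c * tw (al - {#l#}) (b[s := i]) om else 0)"
  unfolding split by (simp add: a_def E_def Tw_def sum_negf[symmetric]) (rule sum.cong; simp add: Tw_def)
 ultimately show ?thesis by simp
qed

text \<open>For an arbitrary field the Lie derivative of a word also contains words of lower order
  with uncontrolled coefficients. The assumption \<open>low\<close> removes their contribution, and
  what is left has the simple form of the linear case, plus one term in which \<open>g\<close> is
  differentiated.\<close>

lemma Tw_general_field:
 assumes b: "length b = p" and al: "size al \<le> k" and om: "om \<in> Om p"
  and h: "Sm UNIV h" "h y0 = 0" and g: "Sm UNIV g"
  and low: "!!be b' e. size be < size al ==> length b' = p ==> Sm S0 e ==> Tw e be b' om = 0"
 shows "Tw g al b (LF (vf h i) om) = - Tw (%y. h y * pd i g y) al b om +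
  (\<Sum>x\<in>#al. Tw (%y. g y * pd x h y) (am i (al - {#x#})) b om) +
  (\<Sum>s<p. Tw (%y. g y * pd (b ! s) h y) al (b[s := i]) om)"
proof -
 note S = oc[OF c0]
 note hc = sm_subset[OF open_UNIV subset_UNIV h(1), of "cimg c0"]
  and gc = sm_subset[OF open_UNIV subset_UNIV g, of "cimg c0"]
 note V = vf_fields[OF hc, of i]
 interpret jets "Om p" "%om b z. om c0 z b" "(Ls p)" "cimg c0"
  by (rule jets_forms[OF c0 S]) simp
 obtain e where e: "\<forall>be b. Sm S0 (e be b)"
  "!!om y. om \<in> Om p ==> y \<in> cimg c0 ==>
  (\<Sum>i'\<in>UNIV. vf h i c0 y $ i' * pd i' (mpd al (%z. om c0 z b)) y) - mpd al (%z. LF (vf h i) om c0 z b) y +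
  (\<Sum>x\<in>#al. \<Sum>i'\<in>UNIV. pd x (%z. vf h i c0 z $ i') y * mpd (am i' (al - {#x#})) (%z. om c0 z b) y) +
  (\<Sum>s<p. SU j. pd (b ! s) (%z. vf h i c0 z $ j) y * mpd al (%z. om c0 z (b[s := j])) y) =
   (\<Sum>be | size be < size al. \<Sum>b\<in>(Ls p). e be b y * mpd be (%z. om c0 z b) y)"
  using lie_word[OF V c0 b, of al] unfolding dop_def by blast
 obtain l where l: "mset l = al" using ex_mset by blast
 have len: "length l = size al" using l by auto
 have summ: "(\<Sum>x\<in>#al. F x) = (\<Sum>t<length l. F (l ! t))" for F :: "'n => real"
  unfolding l[symmetric] mset_map[symmetric] sum_mset_sum_list by (simp add: sum_list_sum_nth atLeast0LessThan)
 have lm: "t < length l ==> l ! t \<in># al" for t using l by auto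
 \<comment> \<open>Four kinds of summands: a derivative replaced, an exterior index replaced, a word
   of lower order, and the term in which the coefficient \<open>g\<close> is differentiated.
   Derivatives are numbered along the list \<open>l\<close>, as a letter may occur several times in
   \<open>al\<close>.\<close>
 define I where "I = ({..<size al} <+> ({..<p} <+> ({be :: 'n multiset. size be < size al} \<times> {b :: 'n list. length b = p}))) <+> {()}"
 have fin1: "finite ({be :: 'n multiset. size be < size al} \<times> {b :: 'n list. length b = p})"
  by (intro finite_cartesian_product) auto
 define E where "E q = (case q of Inl (Inl t) => wop p (%y. g y * pd (l ! t) h y) (am i (al - {#l ! t#})) b
  | Inl (Inr (Inl s)) => wop p (%y. g y * pd (b ! s) h y) al (b[s := i])
  | Inl (Inr (Inr (be, b'))) => wop p (%y. g y * e be b' y) be b'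
  | Inr (u::unit) => wop p (%y. h y * pd i g y) al b)" for q
 define a where "a q = (case q of Inl (Inl (t::nat)) => -1 | Inl (Inr (Inl (s::nat))) => -1
  | Inl (Inr (Inr (v :: 'n multiset \<times> 'n list))) => 1 | Inr (u::unit) => (1::real))" for q
 have fin: "finite I" unfolding I_def using fin1 by (intro finite_Plus) auto
 have split: "(\<Sum>q\<in>I. F q) = (\<Sum>t<size al. F (Inl (Inl t))) + ((\<Sum>s<p. F (Inl (Inr (Inl s)))) +
   (\<Sum>be | size be < size al. \<Sum>b\<in>Ls p. F (Inl (Inr (Inr (be, b)))))) + F (Inr ())"
  for F :: "_ => real"
  unfolding I_def using fin1 by (simp add: sum.Plus sum.cartesian_product case_prod_beta)
 have sm: "Sm S0 (%y. g y * pd x h y)" "Sm S0 (%y. g y * e be b' y)"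
  "Sm S0 (%y. h y * pd i g y)" for x be b'
  using e(1) by (intro sm_mult S gc hc sm_pd; simp)+
 have Ein: "E q \<in> DO k p" if "q \<in> I" for q
 proof -
  have W: "wop p g al' b \<in> DO k p" "wop p g al' (b[s := i]) \<in> DO k p"
   if "Sm S0 g" "size al' \<le> k" for g al' s
   by (rule wop_in; simp add: that b)+
  have W': "wop (length b') (%y. g y * e be b' y) be b' \<in> DO k (length b')"
   if "p = length b'" "size be \<le> k" for be b'
   unfolding that(1)[symmetric] by (rule wop_in[OF sm(2) that(1)[symmetric] that(2)])
  have sz: "size (am i (al - {#l ! t#})) \<le> k" if "t < size al" for t
  proof -
   have "l ! t \<in># al" using lm[of t] that len by simp
   then obtain be where "al = am (l ! t) be" by (meson multi_member_split)
   then show ?thesis using al by simp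
  qed
  show ?thesis
   using that al unfolding I_def E_def by (auto intro!: W W' sz sm)
 qed
 have "T (LO p (vf h i) (wop p g al b)) om x0 = (\<Sum>q\<in>I. a q * T (E q) om x0)"
 proof (rule T_comb[OF _ fin Ein])
  show "LO p (vf h i) (wop p g al b) \<in> DO k p"
   by (intro lie_op_diffops_le wop_in V gc b al)
  show "near p (LO p (vf h i) (wop p g al b)) (%om x. \<Sum>q\<in>I. a q * E q om x)"
  proof (rule nearI)
   fix om y assume om: "om \<in> Om p" and y: "y \<in> U0"
   note f = form_smooth[OF om c0] and yc = U0(4)[OF y]
   have vn: "vf h i c0 y $ j = (if j = i then h y else 0)" for j unfolding vf_def by (rule vext_near[OF y])
   have pn: "pd x (%z. vf h i c0 z $ j) y = (if j = i then pd x h y else 0)" for x j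
    unfolding pd_vf[symmetric] by (rule pd_cong[OF U0(1) y]) (simp add: vf_def vext_near)
   have "LO p (vf h i) (wop p g al b) om (cinv c0 y) =
    h y * (g y * mpd (am i al) (%z. om c0 z b) y + pd i g y * mpd al (%z. om c0 z b) y) -
    g y * mpd al (%z. LF (vf h i) om c0 z b) y"
   proof -
    have d: "g differentiable at y" "mpd al (%z. om c0 z b) differentiable at y"
     using sm_diffble[OF gc S yc] sm_diffble[OF sm_mpd[OF f] S yc] by auto
    have "pd i (%z. wop p g al b om (cinv c0 z)) y = pd i (%z. g z * mpd al (%z. om c0 z b) z) y"
     by (rule pd_cong[OF U0(1) y]) (rule wop_near[OF om])
    then show ?thesis
     unfolding lie_op_chart[OF wop_in[OF gc b al] V c0 om yc] wop_near[OF lie_forms[OF om V] y] vn vf_sum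
     by (simp add: pd_mult[OF d] mpd_add_mset[OF S f yc])
   qed
   moreover have "g y * mpd al (%z. LF (vf h i) om c0 z b) y = h y * (g y * mpd (am i al) (%z. om c0 z b) y)
     + g y * (\<Sum>x\<in>#al. pd x h y * mpd (am i (al - {#x#})) (%z. om c0 z b) y)
     + g y * (\<Sum>s<p. pd (b ! s) h y * mpd al (%z. om c0 z (b[s := i])) y)
     - g y * (\<Sum>be | size be < size al. \<Sum>b\<in>(Ls p). e be b y * mpd be (%z. om c0 z b) y)"
   proof -
    have "mpd al (%z. LF (vf h i) om c0 z b) y = h y * mpd (am i al) (%z. om c0 z b) y
     + (\<Sum>x\<in>#al. pd x h y * mpd (am i (al - {#x#})) (%z. om c0 z b) y)
     + (\<Sum>s<p. pd (b ! s) h y * mpd al (%z. om c0 z (b[s := i])) y)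
     - (\<Sum>be | size be < size al. \<Sum>b\<in>(Ls p). e be b y * mpd be (%z. om c0 z b) y)"
     unfolding mpd_add_mset[OF S f[of b] yc, of i al]
     using e(2)[OF om yc, unfolded vn pn vf_sum] by linarith
    then show ?thesis by (simp only: distrib_left right_diff_distrib mult.left_commute)
   qed
   ultimately show "LO p (vf h i) (wop p g al b) om (cinv c0 y) = (\<Sum>q\<in>I. a q * E q om (cinv c0 y))"
    unfolding split
    by (simp add: a_def E_def wop_near[OF om y] sum_negf summ len sum_distrib_left mult.assoc algebra_simps)
  qed
 qed
 moreover have "T (LO p (vf h i) (wop p g al b)) om x0 = - Tw g al b (LF (vf h i) om)"
  unfolding Tw_def by (rule T_lie_x0[OF wop_in[OF gc b al] hc h(2) om])
 moreover have "(\<Sum>q\<in>I. a q * T (E q) om x0) = Tw (%y. h y * pd i g y) al b om -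
  (\<Sum>x\<in>#al. Tw (%y. g y * pd x h y) (am i (al - {#x#})) b om) -
  (\<Sum>s<p. Tw (%y. g y * pd (b ! s) h y) al (b[s := i]) om)"
 proof -
  have "T (wop p (%y. g y * e be b' y) be b') om x0 = 0" if "size be < size al" "length b' = p" for be b'
   using low[OF that sm(2)] unfolding Tw_def .
  then have "(\<Sum>be | size be < size al. \<Sum>b\<in>Ls p. a (Inl (Inr (Inr (be, b)))) * T (E (Inl (Inr (Inr (be, b))))) om x0) = 0"
   by (intro sum.neutral ballI) (simp add: E_def)
  then show ?thesis unfolding split
   by (simp add: a_def E_def Tw_def sum_negf summ len)
 qed
 ultimately show ?thesis by simp
qed

end

section \<open>Reduction to one word of each order\<close>

context inv
begin

lemma smooth_mon: "Sm S0 (mon y0 al)"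
 by (rule sm_mon[OF oc[OF c0]])

lemma Tw_zero: "Tw (%_. 0) al b om = 0"
proof -
 have "wop p (%_. 0) al b = 0" by (simp add: wop_def fun_eq_iff)
 then show ?thesis unfolding Tw_def using T_0 by simp
qed

lemma tw_outside: "om ~: Om p ==> length b = p ==> size al \<le> k ==> tw al b om = 0"
 by (rule Tw_outside) auto

lemma tw_not_distinct: "\<not> distinct b ==> length b = p ==> size al \<le> k ==> tw al b om = 0"
 using alt_not_distinct[OF Tw_alt[OF sm_const[where c = 1], where al = al and om = om], of b] by simp

text \<open>The right-hand side of \<open>tw_linear_field\<close> is the same functional at another
  form. If it vanishes identically, so does the sum of the replacements of letters in the
  word.\<close>

lemma tw_linear_field_0:
 assumes b: "length b = p" and al: "size al \<le> k" and z: "!!om. tw al b om = 0"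
 shows "count al l * tw (am i (al - {#l#})) b om + (\<Sum>s<p. if b ! s = l then tw al (b[s := i]) om else 0) = 0"
proof (cases "om \<in> Om p")
 case True
 then show ?thesis using tw_linear_field[OF b al True, of l i] z by simp
next
 case False
 have "count al l * tw (am i (al - {#l#})) b om = 0"
 proof (cases "count al l = 0")
  case False
  then have "size (am i (al - {#l#})) \<le> k"
   using al by (auto simp: count_greater_zero_iff dest!: multi_member_split)
  then show ?thesis using tw_outside[OF `om ~: _` b] by simp
 qed simp
 moreover have "tw al (b[s := i]) om = 0" for s using tw_outside[OF False _ al] b by simp
 ultimately show ?thesis by (simp only: if_cancel sum.neutral_const add_0)
qed

lemma sum_distinct_update:
 assumes "distinct b" "length b = p" "q < p"
 shows "(\<Sum>s<p. if b ! s = b ! q then F s else 0) = (F q :: real)"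
proof -
 have "(\<Sum>s<p. if b ! s = b ! q then F s else 0) = (\<Sum>s<p. if s = q then F s else 0)"
  by (rule scong) (use assms in "auto simp: nth_eq_iff_index_eq")
 then show ?thesis using assms by simp
qed

text \<open>The operator \<open>\<partial>\<^sub>1\<^sup>j \<omega>\<^sub>b\<^sub>0\<close> with \<open>1 \<notin> b\<^sub>0\<close> is cyclic under linear vector fields.\<close>

lemma tw_cyclic_b:
 assumes b0: "distinct b0" "length b0 = p" "l1 ~: set b0" and j: "j \<le> k"
  and z: "!!om. tw (rp j l1) b0 om = 0" and b: "length b = p"
 shows "tw (rp j l1) b om = 0"
proof -
 have sz: "size (rp j l1) \<le> k" using j by simp
 have "tw (rp j l1) b om = 0" if "distinct b" "length b = p" "card (set b - set b0) = m" for b m om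
  using that
 proof (induction m arbitrary: b om)
  case 0
  then have "set b \<subseteq> set b0" by simp
  then have "set b0 = set b" using 0 b0 by (metis card_subset_eq distinct_card finite_set)
  then obtain si :: real where "\<forall>om. tw (rp j l1) b om = si * tw (rp j l1) b0 om"
   using Tw_sign[OF sm_const[where c = 1] sz b0(1) 0(1) _ b0(2)] by blast
  then show ?case using z by simp
 next
  case (Suc m)
  then have "set b - set b0 ~= {}" by (metis card.empty nat.distinct(1))
  then obtain x where x: "x \<in> set b" "x ~: set b0" by blast
  have "\<not> set b0 \<subseteq> set b"
  proof
   assume "set b0 \<subseteq> set b"
   then have "set b0 = set b" using Suc.prems b0 by (metis card_subset_eq distinct_card finite_set)
   then show False using x by simp
  qed
  then obtain y where y: "y \<in> set b0" "y ~: set b" by blast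
  obtain q where q: "q < p" "b ! q = x" using x Suc.prems by (metis in_set_conv_nth)
  \<comment> \<open>A foreign letter \<open>x\<close> of \<open>b\<close> is traded for a letter
    \<open>y\<close> of \<open>b0\<close> missing in \<open>b\<close>; the induction hypothesis
    covers the new word, and replacing \<open>y\<close> by \<open>x\<close> leads back. As
    \<open>y\<close> differs from \<open>l1\<close>, the derivatives take no part.\<close>
  let ?b = "b[q := y]"
  have set: "set ?b = insert y (set b - {x})" using q Suc.prems by (simp add: set_update_distinct)
  have d: "distinct ?b" using Suc.prems y by (simp add: distinct_list_update)
  have l: "length ?b = p" using Suc.prems by simp
  have "set ?b - set b0 = (set b - set b0) - {x}" unfolding set using x y by auto
  then have "card (set ?b - set b0) = m" using Suc.prems x by simp
  then have z': "!!om. tw (rp j l1) ?b om = 0" using Suc.IH[OF d l] by blast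
  have "?b ! q = y" "y ~= l1" using q Suc.prems y b0 by auto
  then have "(\<Sum>s<p. if ?b ! s = ?b ! q then tw (rp j l1) (?b[s := x]) om else 0) = 0"
   using tw_linear_field_0[OF l sz z', of y x om] by simp
  then have "tw (rp j l1) (?b[q := x]) om = 0"
   unfolding sum_distinct_update[OF d l q(1)] .
  moreover have "?b[q := x] = b" using q by (metis list_update_id list_update_overwrite)
  ultimately show ?case by simp
 qed
 then show ?thesis using tw_not_distinct[OF _ b sz] b by (cases "distinct b") auto
qed

text \<open>Derivatives are changed after the exterior indices: since every exterior part is covered
  at once, the replacements in \<open>b\<close> contribute zero and only a positive multiple of the
  wanted word remains.\<close>

lemma tw_cyclic:
 assumes b0: "distinct b0" "length b0 = p" "l1 ~: set b0" and j: "j \<le> k"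
  and z: "!!om. tw (rp j l1) b0 om = 0" and al: "size al = j" and b: "length b = p"
 shows "tw al b om = 0"
proof -
 have "tw al b om = 0" if "size al = j" "length b = p" "size (filter_mset (%x. x ~= l1) al) = m" for al b m om
  using that
 proof (induction m arbitrary: al b om)
  case 0
  then have "set_mset (filter_mset (%x. x ~= l1) al) = {}" by simp
  then have "set_mset al \<subseteq> {l1}" unfolding set_mset_filter by blast
  from set_mset_subset_singletonD[OF this] have "al = rp j l1" using 0 by simp
  then show ?case using tw_cyclic_b[OF b0 j z 0(2)] by simp
 next
  case (Suc m)
  then have "filter_mset (%x. x ~= l1) al ~= {#}" by (metis size_empty nat.distinct(1))
  then obtain i where "i \<in># filter_mset (%x. x ~= l1) al" by blast
  then have i: "i \<in># al" "i ~= l1" by auto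
  then obtain al' where al': "al = am i al'" by (meson multi_member_split)
  let ?be = "am l1 al'"
  have be: "size ?be = j" "size (filter_mset (%x. x ~= l1) ?be) = m" using Suc.prems al' i by auto
  have sz: "size ?be \<le> k" using be j by simp
  have z': "!!b om. length b = p ==> tw ?be b om = 0" using Suc.IH[OF be(1) _ be(2)] by blast
  have "(\<Sum>s<p. if b ! s = l1 then tw ?be (b[s := i]) om else 0) = 0"
   using z' Suc.prems(2) by (intro sum.neutral) auto
  then have "real (count ?be l1) * tw (am i (?be - {#l1#})) b om = 0"
   using tw_linear_field_0[OF Suc.prems(2) sz z'[OF Suc.prems(2)], of l1 i om] by simp
  then show ?case using al' by simp
 qed
 then show ?thesis using al b by blast
qed

text \<open>Variable coefficients are reached by choosing \<open>h\<close> with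
  \<open>pd l1 h = g\<close> near the point. In the relation for the field with component
  \<open>h\<close> in direction \<open>l1\<close>, every occurrence of \<open>l1\<close> in the word
  gives the wanted value, and every other letter gives a word with one more \<open>l1\<close>. Hence
  the induction on the number of letters different from \<open>l1\<close>.\<close>

lemma Tw_span_step:
 fixes l1 :: 'n
 assumes m: "m \<le> k" and z: "!!al b om. size al = m ==> length b = p ==> tw al b om = 0"
  and low: "!!al b g om. size al < m ==> length b = p ==> Sm S0 g ==> Tw g al b om = 0"
  and al: "size al = m" and b: "length b = p" and g: "Sm S0 g"
 shows "Tw g al b om = 0"
proof (cases "om \<in> Om p")
 case False
 then show ?thesis using Tw_outside[OF _ g b] al m by simp
next
 case om: True
 note un = sm_subset[OF open_UNIV subset_UNIV]
 have anti: "\<exists>h. Sm UNIV h & h y0 = 0 & (\<forall>be b'. size be = m --> length b' = p --> Tw (pd l1 h) be b' om = Tw g be b' om)"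
  if g: "Sm S0 g" for g
 proof -
  have "ball y0 r \<subseteq> cimg c0" using cball ball_subset_cball by blast
  then have "Sm (ball y0 r) g" using sm_subset[OF oc[OF c0] _ g] by blast
  then obtain h0 where h0: "Sm (ball y0 r) h0" "\<forall>y\<in>ball y0 r. pd l1 h0 y = g y" "h0 y0 = 0"
   using smooth_antiderivative[of y0 r g l1] by blast
  obtain h where h: "Sm UNIV h" "\<forall>y\<in>ball y0 (r / 4). h y = h0 y" using smooth_extend[OF h0(1)] by blast
  have e: "pd l1 h y = g y" if "y \<in> ball y0 (r / 4)" for y
  proof -
   have "pd l1 h y = pd l1 h0 y" by (rule pd_cong[OF open_ball that]) (use h in blast)
   moreover have "y \<in> ball y0 r" using that r by auto
   ultimately show ?thesis using h0 by simp
  qed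
  have "Tw (pd l1 h) be b' om = Tw g be b' om" if "size be = m" "length b' = p" for be b'
   by (rule Tw_cong[OF un[OF sm_pd[OF h(1)]] g that(2) _ open_ball[of y0 "r / 4"]])
    (use that m r e in auto)
  moreover have "h y0 = 0" using h(2) h0(3) r by simp
  ultimately show ?thesis using h(1) by blast
 qed
 have rel: "(\<Sum>x\<in>#al. Tw (pd x h) (am i (al - {#x#})) b om) + (\<Sum>s<p. Tw (pd (b ! s) h) al (b[s := i]) om) = 0"
  if "size al = m" "length b = p" "Sm UNIV h" "h y0 = 0" for al b h i
  using Tw_general_field[OF that(2) _ om that(3,4) sm_const[of UNIV 1], of al i] that(1) m z[OF that(1,2)] low Tw_zero
  by simp
 have ph1: "Tw g al b om = 0"
  if "size al = m" "length b = p" "l1 \<in># al \<or> l1 \<in> set b" "Sm S0 g"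
   "size (filter_mset (%x. x ~= l1) al) + length (filter (%x. x ~= l1) b) = n" for n al b g
  using that
 proof (induction n arbitrary: al b g rule: less_induct)
  case (less n)
  obtain h where h: "Sm UNIV h" "h y0 = 0" and hg: "Tw (pd l1 h) al b om = Tw g al b om"
   using anti[OF less.prems(4)] less.prems(1,2) by blast
  have t1: "Tw (pd x h) (am l1 (al - {#x#})) b om = (if x = l1 then Tw g al b om else 0)" if x: "x \<in># al" for x
  proof (cases "x = l1")
   case True
   then show ?thesis using x hg by simp
  next
   case False
   obtain al' where al': "al = am x al'" using x by (meson multi_member_split)
   have "Tw (pd x h) (am l1 al') b om = 0"
    by (rule less.IH[OF _ _ less.prems(2) _ un[OF sm_pd[OF h(1)]] refl]) (use less.prems al' False in auto)
   then show ?thesis using al' False by simp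
  qed
  have t2: "Tw (pd (b ! s) h) al (b[s := l1]) om = (if b ! s = l1 then Tw g al b om else 0)" if s: "s < p" for s
  proof (cases "b ! s = l1")
   case True
   then show ?thesis using hg by simp (metis list_update_id)
  next
   case False
   have "length (filter (%x. x ~= l1) (b[s := l1])) < length (filter (%x. x ~= l1) b)"
   proof -
    have bs: "b = take s b @ b ! s # drop (Suc s) b" using s less.prems(2) by (simp add: id_take_nth_drop)
    have "b[s := l1] = take s b @ l1 # drop (Suc s) b" using s less.prems(2) by (simp add: upd_conv_take_nth_drop)
    then show ?thesis using False by (subst (2) bs) simp
   qed
   moreover have "l1 \<in> set (b[s := l1])" using s less.prems(2) by (simp add: set_update_memI)
   ultimately have "Tw (pd (b ! s) h) al (b[s := l1]) om = 0"
    by (intro less.IH[OF _ less.prems(1) _ _ un[OF sm_pd[OF h(1)]] refl]) (use less.prems in auto)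
   then show ?thesis using False by simp
  qed
  have "(\<Sum>x\<in>#al. if x = l1 then Tw g al b om else 0) + (\<Sum>s<p. if b ! s = l1 then Tw g al b om else 0) = 0"
   using rel[OF less.prems(1,2) h, of l1] t1 t2 by (simp cong: image_mset_cong)
  moreover have "(\<Sum>s<p. if b ! s = l1 then Tw g al b om else 0) = card {s. s < p & b ! s = l1} * Tw g al b om"
   by (simp add: sum.If_cases lessThan_def Collect_conj_eq)
  moreover have "(\<Sum>x\<in>#al. if x = l1 then c else 0) = count al l1 * c" for c :: real
   by (induction al) (auto simp: algebra_simps)
  \<comment> \<open>The factor counts the letter \<open>l1\<close> in the word, as derivative and as
    exterior index together, and is positive since \<open>l1\<close> occurs.\<close>
  ultimately have "(real (count al l1) + card {s. s < p & b ! s = l1}) * Tw g al b om = 0"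
   by (simp add: algebra_simps)
  moreover have "real (count al l1) + card {s. s < p & b ! s = l1} > 0"
  proof (cases "l1 \<in># al")
   case True
   then show ?thesis by (simp add: add_pos_nonneg)
  next
   case False
   then obtain s where "s < p" "b ! s = l1" using less.prems(2,3) by (metis in_set_conv_nth)
   then have "card {s. s < p & b ! s = l1} > 0" by (auto simp: card_gt_0_iff)
   then show ?thesis by simp
  qed
  ultimately show ?case by simp
 qed
 show ?thesis
 proof (cases "l1 \<in># al \<or> l1 \<in> set b")
  case True
  then show ?thesis using ph1[OF al b True g refl] by simp
 next
  case False
  \<comment> \<open>A word without \<open>l1\<close> is reached from one in which \<open>l1\<close>
    replaces the first exterior index: putting that index back at position 0 gives the word itself,
    while all other terms still contain \<open>l1\<close> and vanish. A first exterior index exists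
    because p \<ge> 1.\<close>
  let ?b = "b[0 := l1]" and ?i = "b ! 0"
  have lb: "length ?b = p" "0 < p" using b p by auto
  obtain h where h: "Sm UNIV h" "h y0 = 0" and hg: "Tw (pd l1 h) al b om = Tw g al b om"
   using anti[OF g] al b by blast
  note hs = un[OF sm_pd[OF h(1)]]
  have l1b: "l1 \<in> set ?b" using lb b by (simp add: set_update_memI)
  have "Tw (pd x h) (am ?i (al - {#x#})) ?b om = 0" if "x \<in># al" for x
   by (rule ph1[OF _ lb(1) _ hs refl]) (use al that l1b in "auto simp: size_Diff_singleton dest: multi_member_split")
  moreover have "Tw (pd (?b ! s) h) al (?b[s := ?i]) om = (if s = 0 then Tw g al b om else 0)" if s: "s < p" for s
  proof (cases "s = 0")
   case True
   then show ?thesis using lb b hg by simp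
  next
   case False
   then have "?b[s := ?i] ! 0 = l1" using lb b by simp
   then have "l1 \<in> set (?b[s := ?i])" using lb b by (metis length_list_update nth_mem)
   then have "Tw (pd (?b ! s) h) al (?b[s := ?i]) om = 0" using ph1[OF al _ _ hs refl] b by simp
   then show ?thesis using False by simp
  qed
  ultimately have "(\<Sum>x\<in>#al. (0::real)) + (\<Sum>s<p. if s = 0 then Tw g al b om else 0) = 0"
   using rel[OF al lb(1) h, of ?i] by (simp cong: image_mset_cong)
  then show ?thesis using lb by simp
 qed
qed

lemma Tw_span:
 assumes j: "j \<le> k" and z: "!!al b om. size al \<le> j ==> length b = p ==> tw al b om = 0"
 shows "size al \<le> j ==> length b = p ==> Sm S0 g ==> Tw g al b om = 0"
proof (induction "size al" arbitrary: al b g om rule: less_induct)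
 case less
 show ?case
  by (rule Tw_span_step[where m = "size al", OF _ _ _ refl less.prems(2,3)])
   (use less z j in auto)
qed

lemma T_kills:
 assumes j: "j \<le> k" and z: "!!al b om. size al \<le> j ==> length b = p ==> tw al b om = 0"
  and D: "D \<in> DO j p"
 shows "T D om x0 = 0"
proof -
 interpret jets "Om p" "%om b z. om c0 z b" "(Ls p)" "cimg c0"
  by (rule jets_forms[OF c0 oc[OF c0]]) simp
 obtain e where e: "\<forall>be b. Sm S0 (e be b)"
  "!!om y. om \<in> Om p ==> y \<in> cimg c0 ==>
  D om (cinv c0 y) = (\<Sum>be | size be < Suc j. \<Sum>b\<in>(Ls p). e be b y * mpd be (%z. om c0 z b) y)"
  using diffops_leD(3)[OF D c0] unfolding dop_def by blast
 let ?I = "{be :: 'n multiset. size be < Suc j} \<times> {b :: 'n list. length b = p}"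
 have "T D om x0 = (\<Sum>q\<in>?I. 1 * T (wop p (e (fst q) (snd q)) (fst q) (snd q)) om x0)"
 proof (rule T_comb)
  show "D \<in> DO k p" by (rule DO_mono[OF D j])
  show "finite ?I" by (intro finite_cartesian_product finite_multisets_less finite_lists_length)
  show "wop p (e (fst q) (snd q)) (fst q) (snd q) \<in> DO k p" if "q \<in> ?I" for q
   using that e(1) j by (intro wop_in) auto
  show "near p D (%om x. \<Sum>q\<in>?I. 1 * wop p (e (fst q) (snd q)) (fst q) (snd q) om x)"
   by (rule nearI) (simp add: wop_near e(2) U0(4) sum.cartesian_product case_prod_beta)
 qed
 also have "... = 0"
 proof (rule sum.neutral, rule ballI)
  fix q assume q: "q \<in> ?I"
  have "Tw (e (fst q) (snd q)) (fst q) (snd q) om = 0"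
   by (rule Tw_span[OF j z]) (use q e(1) in auto)
  then show "1 * T (wop p (e (fst q) (snd q)) (fst q) (snd q)) om x0 = 0" unfolding Tw_def by simp
 qed
 finally show ?thesis .
qed

section \<open>Weights\<close>

lemma tw_lin:
 assumes b: "length b = p" and al: "size al \<le> k" and S: "finite S"
  and om: "om \<in> Om p" "!!i. i \<in> S ==> om' i \<in> Om p"
   "!!z I. z \<in> U0 ==> length I = p ==> om c0 z I = (\<Sum>i\<in>S. a i * om' i c0 z I)"
 shows "tw al b om = (\<Sum>i\<in>S. a i * tw al b (om' i))"
proof -
 obtain K where K: "T (wop p (%_. 1) al b) \<in> DO K p"
  using T_diffops[OF wop_in[OF sm_const b al]] by blast
 show ?thesis unfolding Tw_def by (rule diffop_linear[OF K c0 U0(1-3) S om])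
qed

lemma eps_same_set:
 assumes "distinct b" "distinct b'" "set b = set b'" "length b = p"
 shows "\<exists>si::real. si * si = 1 & (\<forall>w. alternating p w --> w b' = si * w b) & (\<forall>I. eps p b' I = si * eps p b I)"
proof -
 obtain si :: real where si: "si * si = 1" "\<forall>w. alternating p w --> w b' = si * w b"
  using same_set_sign[OF assms] by blast
 have "eps p b' I = si * eps p b I" for I
  using si(2)[rule_format, OF alt_eps[of p I]] by (simp add: eps_sym[of p _ I])
 then show ?thesis using si by blast
qed

text \<open>The sign of the reordering enters once through the word and once through the form, and
  its square is 1.\<close>

lemma tw_same_set:
 assumes b: "distinct b" "distinct b'" "set b = set b'" "length b = p" and al: "size al \<le> k"
  and f: "Sm S0 f"
 shows "tw al b' (mform p f b') = tw al b (mform p f b)"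
proof -
 obtain si :: real where si: "si * si = 1" "\<forall>w. alternating p w --> w b' = si * w b" "\<forall>I. eps p b' I = si * eps p b I"
  using eps_same_set[OF b] by blast
 have l: "length b' = p" using b distinct_card by metis
 have "tw al b' (mform p f b') = (\<Sum>i\<in>{()}. si * tw al b' (mform p f b))"
  by (rule tw_lin[OF l al]) (auto simp: mform_forms[OF f] mform_near si(3))
 moreover have "tw al b' (mform p f b) = si * tw al b (mform p f b)"
  using si(2)[rule_format, OF Tw_alt[OF sm_const al, of 1 "mform p f b"]] b(4) l by simp
 ultimately show ?thesis using si(1) by (simp flip: mult.assoc)
qed

text \<open>For the diagonal field with component \<open>sc l\<close> in direction \<open>l\<close>,
  both the word and the monomial form are eigenvectors, with the number of their letters
  \<open>l\<close> as eigenvalue. A nonzero matrix entry forces equal weights for every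
  \<open>l\<close>.\<close>

lemma tw_weight:
 assumes b0: "distinct b0" "length b0 = p" and j: "size al0 \<le> k" and I: "distinct I" "length I = p"
  and ne: "tw al0 b0 (mform p (mon y0 al) I) ~= 0"
 shows "count al0 l + count (mset b0) l = count al l + count (mset I) l"
proof -
 let ?mu = "mform p (mon y0 al) I"
 note mu = mform_forms[OF smooth_mon, of p al I]
 have dc: "(\<Sum>s<p. if b ! s = l then tw al0 (b[s := l]) om else 0) = count (mset b) l * tw al0 b om"
  if b: "distinct b" "length b = p" for b om
 proof (cases "l \<in> set b")
  case True
  then obtain q where q: "q < p" "b ! q = l" using b by (metis in_set_conv_nth)
  have "(\<Sum>s<p. if b ! s = b ! q then tw al0 (b[s := l]) om else 0) = tw al0 (b[q := l]) om"
   by (rule sum_distinct_update[OF b q(1)])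
  moreover have "b[q := l] = b" using q by auto
  moreover have "count (mset b) l = 1" using True b distinct_count_atmost_1 by metis
  ultimately show ?thesis using q by simp
 next
  case False
  then have "b ! s ~= l" if "s < p" for s using that b by auto
  moreover have "count (mset b) l = 0" using False by simp
  ultimately show ?thesis by simp
 qed
 have e1: "real (count al0 l) * tw (am l (al0 - {#l#})) b0 ?mu = real (count al0 l) * tw al0 b0 ?mu"
  by (cases "l \<in># al0") (auto simp: not_in_iff)
 have "(real (count al0 l) + real (count (mset b0) l)) * tw al0 b0 ?mu = tw al0 b0 (LF (vf (sc l) l) ?mu)"
  unfolding distrib_right using tw_linear_field[OF b0(2) j mu, of l l] dc[OF b0, of ?mu] e1 by linarith
 also have "... = (\<Sum>i\<in>{()}. (real (count al l) + real (count (mset I) l)) * tw al0 b0 ?mu)"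
 proof (rule tw_lin[OF b0(2) j _ lie_forms[OF mu vf_fields[OF smooth_sc]] mu])
  fix z :: "real^'n" and J :: "'n list" assume z: "z \<in> U0" and J: "length J = p"
  have "sc l z * pd l (mon y0 al) z = count al l * mon y0 al z"
  proof (cases "l \<in># al")
   case True
   then obtain be where "al = am l be" by (meson multi_member_split)
   then show ?thesis by (simp add: pd_mon mon_add_mset)
  qed (simp add: pd_mon not_in_iff)
  moreover have "(\<Sum>q<p. if I ! q = l then SU i. pd i (sc l) z * eps p (I[q := i]) J else 0) =
    count (mset I) l * eps p I J"
  proof -
   have "(SU i. pd i (sc l) z * eps p (I[q := i]) J) = eps p (I[q := l]) J" for q
    by (simp add: pd_coord_shift mult_if cong: if_cong)
   then have "(\<Sum>q<p. if I ! q = l then SU i. pd i (sc l) z * eps p (I[q := i]) J else 0) =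
     (\<Sum>q<p. if I ! q = l then eps p I J else 0)"
    by (intro sum.cong) (auto simp: list_update_same_conv)
   also have "... = count (mset I) l * eps p I J"
   proof (cases "l \<in> set I")
    case True
    then obtain q where q: "q < p" "I ! q = l" using I by (metis in_set_conv_nth)
    have "(\<Sum>s<p. if I ! s = I ! q then eps p I J else 0) = eps p I J"
     by (rule sum_distinct_update[OF I q(1)])
    moreover have "count (mset I) l = 1" using True I distinct_count_atmost_1 by metis
    ultimately show ?thesis using q by simp
   next
    case False
    then have "I ! s ~= l" if "s < p" for s using that I by auto
    moreover have "count (mset I) l = 0" using False by simp
    ultimately show ?thesis by simp
   qed
   finally show ?thesis .
  qed
  ultimately show "LF (vf (sc l) l) ?mu c0 z J =
    (\<Sum>i\<in>{()}. (real (count al l) + real (count (mset I) l)) * ?mu c0 z J)"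
   by (simp add: lie_vf_mform[OF smooth_sc smooth_mon I(2) z J] mform_near[OF z] algebra_simps)
 qed auto
 finally have "real (count al0 l) + real (count (mset b0) l) = real (count al l) + real (count (mset I) l)"
  using ne by simp
 then show ?thesis by linarith
qed

text \<open>Equality of weights leaves two kinds of monomial forms, up to order: the one matching
  the word itself, and those in which \<open>l1\<close> has become an exterior index and a letter
  \<open>x\<close> of \<open>b0\<close> a variable. Their values are the scalars called
  \<open>aa\<close> and \<open>bb\<close> below, up to factorials.\<close>

lemma tw_cyclic_vector_zero:
 assumes b0: "distinct b0" "length b0 = p" "l1 ~: set b0" and j: "j \<le> k"
  and z1: "tw (rp j l1) b0 (mform p (mon y0 (rp j l1)) b0) = 0"
  and z2: "!!x b j'. j = Suc j' ==> distinct (x # b) ==> set (x # b) = set b0 ==>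
   tw (rp j l1) (x # b) (mform p (mon y0 (am x (rp j' l1))) (l1 # b)) = 0"
 shows "tw (rp j l1) b0 om = 0"
proof -
 let ?al0 = "rp j l1"
 have sz: "size ?al0 \<le> k" using j by simp
 obtain K where K: "T (wop p (%_. 1) ?al0 b0) \<in> DO K p"
  using T_diffops[OF wop_in[OF sm_const b0(2) sz]] by blast
 obtain A where A: "Lc K p (T (wop p (%_. 1) ?al0 b0)) c0 A"
  using K c0 unfolding diffops_le_def by blast
 have co: "tw ?al0 b0 (mform p (mon y0 al) I) = mfact al * A al y0 I" if "size al \<le> K" "length I = p" for al I
  unfolding Tw_def by (rule coeffs_mform[OF A that])
 have alt: "alternating p (A al y0)" if "size al \<le> K" for al using A that y0 unfolding local_coeffs_def by blast
 have main: "tw ?al0 b0 (mform p (mon y0 al) I) = 0" if al: "size al \<le> K" and I: "length I = p" "distinct I" for al I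
 proof (rule ccontr)
  assume ne: "tw ?al0 b0 (mform p (mon y0 al) I) ~= 0"
  note w = tw_weight[OF b0(1,2) sz I(2,1) ne]
  have ms: "?al0 + mset b0 = al + mset I" 
  proof (rule multiset_eqI)
   show "count (?al0 + mset b0) x = count (al + mset I) x" for x using w[of x] by (simp only: count_union)
  qed
  have l1b: "count (mset b0) l1 = 0" using b0(3) by simp
  show False
  proof (cases "l1 \<in> set I")
   case False
   have "size ?al0 = size al" using arg_cong[OF ms, of size] b0 I by simp
   moreover have "count al l1 = j" using w[of l1] False l1b by simp
   moreover have "rp (count al l1) l1 \<subseteq># al" by (simp flip: count_le_replicate_mset_subset_eq)
   then obtain ga where "al = ga + rp (count al l1) l1" by (metis subset_mset.diff_add)
   ultimately have "al = ?al0" by (metis add_cancel_left_left add_cancel_right_left size_eq_0_iff_empty size_replicate_mset size_union)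
   then have "mset I = mset b0" using ms by simp
   then have "set b0 = set I" by (metis set_mset_mset)
   then have "\<exists>si::real. si * si = 1 & (\<forall>w. alternating p w --> w I = si * w b0)"
    using same_set_sign[OF b0(1) I(2) _ b0(2)] by blast
   then obtain si :: real where "\<forall>w. alternating p w --> w I = si * w b0" by blast
   then have "A al y0 I = si * A al y0 b0" using alt[OF al] by blast
   moreover have "A al y0 b0 = 0"
    using co[OF al b0(2)] z1 mfact_pos[of al] `al = ?al0` by simp
   ultimately show False using ne co[OF al I(1)] by simp
  next
   case True
   then have c1: "count (mset I) l1 = 1" using I distinct_count_atmost_1 by metis
   have sal: "size al = j" using arg_cong[OF ms, of size] b0 I by simp
   have cal: "Suc (count al l1) = j" using w[of l1] l1b c1 by simp
   then obtain j' where j': "j = Suc j'" "count al l1 = j'" by auto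
   have "rp j' l1 \<subseteq># al" using j' by (simp flip: count_le_replicate_mset_subset_eq)
   then obtain ga where ga: "al = ga + rp j' l1" by (metis subset_mset.diff_add)
   then have "size ga = 1" using sal j' by simp
   then obtain x where x: "ga = {#x#}" using size_1_singleton_mset by blast
   have al': "al = am x (rp j' l1)" using ga x by simp
   have xl: "x ~= l1" using al' j' by auto
   have "mset b0 + {#l1#} = mset I + {#x#}" using ms al' j' by simp
   then have "x \<in># mset b0 + {#l1#}" by simp
   then have xb: "x \<in> set b0" using xl by simp
   \<comment> \<open>The single letter \<open>x\<close> that left the exterior part is put first, so
     that the second hypothesis applies with the common tail \<open>b\<close>.\<close>
   define b where "b = remove1 x b0"
   have mb: "mset b0 = am x (mset b)" using xb by (simp add: b_def)
   have sb: "set (x # b) = set b0" using mb by (metis list.set(2) set_mset_add_mset_insert set_mset_mset)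
   have db: "distinct (x # b)" using b0(1) xb by (simp add: b_def set_remove1_eq)
   have lb: "length (x # b) = p" using mb b0(2) by (metis length_Cons size_add_mset size_mset)
   have mI: "mset I = am l1 (mset b)" using `mset b0 + {#l1#} = mset I + {#x#}` mb by simp
   then have sI: "set (l1 # b) = set I" by (metis list.set(2) set_mset_add_mset_insert set_mset_mset)
   have dI: "distinct (l1 # b)" using db sb b0(3) by auto
   obtain si :: real where si: "\<forall>w. alternating p w --> w I = si * w (l1 # b)"
    using same_set_sign[OF dI I(2) sI] lb by auto
   obtain si' :: real where si': "si' * si' = 1" "\<forall>om. tw ?al0 (x # b) om = si' * tw ?al0 b0 om"
    using Tw_sign[OF sm_const[where c = 1] sz b0(1) db sb[symmetric] b0(2)] by blast
   have "si' * tw ?al0 b0 (mform p (mon y0 al) (l1 # b)) = 0"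
    using z2[OF j'(1) db sb] si'(2) al' by simp
   then have "mfact al * A al y0 (l1 # b) = 0"
    using si'(1) co[OF al, of "l1 # b"] lb by auto
   then have "A al y0 (l1 # b) = 0" using mfact_pos[of al] by simp
   then have "A al y0 I = 0" using si[rule_format, OF alt[OF al]] by simp
   then show False using ne co[OF al I(1)] by simp
  qed
 qed
 show ?thesis unfolding Tw_def
 proof (rule diffop_zero_at[OF K])
  fix al :: "'n multiset" and I :: "'n list" assume *: "size al \<le> K" "length I = p"
  show "T (wop p (%_. 1) ?al0 b0) (mform p (mon y0 al) I) x0 = 0"
  proof (cases "distinct I")
   case True
   then show ?thesis using main[OF *] unfolding Tw_def by simp
  next
   case False
   then show ?thesis
    using coeffs_mform[OF A *] alt_not_distinct[OF alt[OF *(1)]] by simp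
  qed
 qed
qed

end

section \<open>Words in two letters\<close>

locale inv2 = inv X \<A> c0 y0 r rh k p T
 for X :: "'a topology" and \<A> :: "('a, 'n::finite) chart set" and c0 y0 r rh k p T +
 fixes l1 l2 :: 'n and b :: "'n list"
 assumes dist: "distinct (l1 # l2 # b)" and len: "Suc (length b) = p"
begin

definition mm :: "nat => nat => real^'n => real" where
 "mm x y = mon y0 (rp x l1 + rp y l2)"

abbreviation wd :: "nat => nat => 'n multiset" where
 "wd x y \<equiv> rp x l1 + rp y l2"

text \<open>Matrix entries between words and monomial forms in the letters \<open>l1\<close> and
  \<open>l2\<close>: unprimed arguments describe the word, primed ones the form, and
  \<open>e\<close>, \<open>e'\<close> are the first exterior indices. The tail \<open>b\<close> is
  common to both.\<close>

definition ta :: "nat => nat => 'n => nat => nat => 'n => real" where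
 "ta x y e x' y' e' = tw (wd x y) (e # b) (mform p (mm x' y') (e' # b))"

lemma ll: "l1 ~= l2" "l2 ~= l1" "l1 ~: set b" "l2 ~: set b"
 using dist by auto

lemma smooth_mm: "Sm S0 (mm x y)"
 unfolding mm_def by (rule smooth_mon)

lemma pd_mm1: "pd l1 (mm x y) z = x * mm (x - 1) y z"
 unfolding mm_def pd_mon using ll by (cases x) auto

lemma pd_mm2: "pd l2 (mm x y) z = y * mm x (y - 1) z"
 unfolding mm_def pd_mon using ll by (cases y) auto

lemma sc_mm1: "sc l1 z * mm x y z = mm (Suc x) y z"
 by (simp add: mm_def mon_add_mset)

text \<open>A field along \<open>l1\<close> or \<open>l2\<close> whose component depends on these
  two coordinates only keeps the form within two letters: the exterior indices in \<open>b\<close>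
  are not touched.\<close>

lemma tw_lie:
 assumes b': "length b' = p" and al: "size al \<le> k" and h: "Sm S0 h" and f: "Sm S0 f"
  and h0: "!!l z. l ~= l1 ==> l ~= l2 ==> pd l h z = 0" and i: "i \<in> {l1, l2}" and e: "e \<in> {l1, l2}"
 shows "tw al b' (LF (vf h i) (mform p f (e # b))) =
  tw al b' (mform p (%z. h z * pd i f z) (e # b)) +
  (if e = i then tw al b' (mform p (%z. f z * pd l1 h z) (l1 # b)) + tw al b' (mform p (%z. f z * pd l2 h z) (l2 # b)) else 0)"
proof -
 note S = oc[OF c0]
 have s: "Sm S0 (%z. h z * pd i f z)" "Sm S0 (%z. f z * pd l h z)" for l
  by (intro sm_mult S h f sm_pd)+
 define W where "W q = (case q of 0 => mform p (%z. h z * pd i f z) (e # b)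
  | Suc 0 => mform p (%z. f z * pd l1 h z) (l1 # b) | _ => mform p (%z. f z * pd l2 h z) (l2 # b))" for q :: nat
 define a where "a q = (case q of 0 => 1 | Suc _ => if e = i then 1 else (0::real))" for q :: nat
 have "tw al b' (LF (vf h i) (mform p f (e # b))) = (\<Sum>q\<in>{0, 1, 2}. a q * tw al b' (W q))"
 proof (rule tw_lin[OF b' al])
  show "LF (vf h i) (mform p f (e # b)) \<in> Om p"
   by (intro lie_forms mform_forms vf_fields h f)
  show "W q \<in> Om p" for q unfolding W_def using s by (auto intro!: mform_forms split: nat.split)
  fix z :: "real^'n" and I :: "'n list" assume z: "z \<in> U0" and I: "length I = p"
  have eb: "length (e # b) = p" using len by simp
  have "(\<Sum>q<p. if (e # b) ! q = i then SU l. pd l h z * eps p ((e # b)[q := l]) I else 0) =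
    (if e = i then SU l. pd l h z * eps p (l # b) I else 0)"
  proof -
   have "i ~: set b" using i ll by auto
   then have "b ! q ~= i" if "q < length b" for q using that nth_mem by blast
   then show ?thesis unfolding len[symmetric] sum.lessThan_Suc_shift by simp
  qed
  also have "(SU l. pd l h z * eps p (l # b) I) = (\<Sum>l\<in>{l1, l2}. pd l h z * eps p (l # b) I)"
   by (rule sum.mono_neutral_right) (use h0 in auto)
  also have "... = pd l1 h z * eps p (l1 # b) I + pd l2 h z * eps p (l2 # b) I" using ll by simp
  finally show "LF (vf h i) (mform p f (e # b)) c0 z I = (\<Sum>q\<in>{0, 1, 2}. a q * W q c0 z I)"
   unfolding lie_vf_mform[OF h f eb z I]
   by (simp add: a_def W_def mform_near[OF z] numeral_2_eq_2 distrib_left mult_ac)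
 qed simp
 then show ?thesis by (simp add: a_def W_def numeral_2_eq_2)
qed

lemma tw_scale:
 assumes b': "length b' = p" and al: "size al \<le> k" and f: "Sm S0 f" and g: "!!z. g z = c * f z"
 shows "tw al b' (mform p g B) = c * tw al b' (mform p f B)"
proof -
 have g': "Sm S0 g"
  by (rule sm_cong[OF oc[OF c0] _ sm_mult[OF oc[OF c0] sm_const[of _ c] f]]) (simp add: g)
 have "tw al b' (mform p g B) = (\<Sum>i\<in>{()}. c * tw al b' (mform p f B))"
  by (rule tw_lin[OF b' al]) (auto simp: mform_forms[OF f] mform_forms[OF g'] mform_near g)
 then show ?thesis by simp
qed

lemma sum_head:
 assumes "l ~: set b"
 shows "(\<Sum>s<p. if (e # b) ! s = l then F ((e # b)[s := i]) else 0) = (if e = l then F (i # b) else (0::real))"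
proof -
 have "b ! q ~= l" if "q < length b" for q using assms that nth_mem by blast
 then show ?thesis unfolding len[symmetric] sum.lessThan_Suc_shift by simp
qed

lemma wd_simps: "count (wd x y) l1 = x" "count (wd x y) l2 = y"
 "am l2 (wd (Suc x) y - {#l1#}) = wd x (Suc y)" "am l1 (wd x (Suc y) - {#l2#}) = wd (Suc x) y"
 "am l1 (wd (Suc x) y - {#l1#}) = wd (Suc x) y" "wd (Suc x) y - {#l1#} = wd x y"
 "size (wd x y) = x + y"
 using ll by auto

lemma eb: "length (e # b) = p"
 using len by simp

lemma mform_in: "mform p (mm x y) B \<in> Om p"
 by (rule mform_forms[OF smooth_mm])

lemma pd_sc: "pd x (sc l) z = (if x = l then 1 else 0)"
 by (rule pd_coord_shift)

text \<open>The field with component \<open>sc l1\<close> in direction \<open>l2\<close> turns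
  \<open>l1\<close> into \<open>l2\<close> in words, and the variable of \<open>l2\<close> into that
  of \<open>l1\<close> in forms. The truncated \<open>x - 1\<close> and \<open>y' - 1\<close> come
  with the factor \<open>x\<close> or \<open>y'\<close>, so that their value at zero is
  harmless.\<close>

lemma e21:
 assumes "x + y \<le> k" and e: "e \<in> {l1, l2}" "e' \<in> {l1, l2}"
 shows "x * ta (x - 1) (Suc y) e x' y' e' + (if e = l1 then ta x y l2 x' y' e' else 0) =
  y' * ta x y e (Suc x') (y' - 1) e' + (if e' = l2 then ta x y e x' y' l1 else 0)"
proof -
 have sz: "size (wd x y) \<le> k" using assms(1) by simp
 have L: "tw (wd x y) (e # b) (LF (vf (sc l1) l2) (mform p (mm x' y') (e' # b))) =
  y' * ta x y e (Suc x') (y' - 1) e' + (if e' = l2 then ta x y e x' y' l1 else 0)"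
 proof -
  have 1: "tw (wd x y) (e # b) (mform p (%z. sc l1 z * pd l2 (mm x' y') z) (e' # b)) = y' * ta x y e (Suc x') (y' - 1) e'"
   unfolding ta_def by (rule tw_scale[OF eb sz smooth_mm]) (simp add: pd_mm2 sc_mm1[symmetric])
  have 2: "tw (wd x y) (e # b) (mform p (%z. mm x' y' z * pd l1 (sc l1) z) (l1 # b)) = 1 * ta x y e x' y' l1"
   unfolding ta_def by (rule tw_scale[OF eb sz smooth_mm]) (simp add: pd_sc)
  have 3: "tw (wd x y) (e # b) (mform p (%z. mm x' y' z * pd l2 (sc l1) z) (l2 # b)) = 0 * ta x y e x' y' l2"
   unfolding ta_def by (rule tw_scale[OF eb sz smooth_mm]) (use ll in "simp add: pd_sc")
  have h: "!!l z. l ~= l1 ==> l ~= l2 ==> pd l (sc l1) z = 0" by (simp add: pd_sc)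
  have i: "l2 \<in> {l1, l2}" by simp
  show ?thesis
   using tw_lie[OF eb[of e] sz smooth_sc smooth_mm[of x' y'] h i e(2)] unfolding 1 2 3 by simp
 qed
 have G: "x * tw (am l2 (wd x y - {#l1#})) (e # b) (mform p (mm x' y') (e' # b)) = x * ta (x - 1) (Suc y) e x' y' e'"
  unfolding ta_def by (cases x) (simp_all add: wd_simps)
 show ?thesis
  using tw_linear_field[OF eb[of e] sz mform_in[of x' y' "e' # b"], of l1 l2]
  unfolding L sum_head[OF ll(3), where F = "%B. tw (wd x y) B (mform p (mm x' y') (e' # b))" and i = l2 and e = e] wd_simps(1) G
  by (simp only: ta_def)
qed

lemma e12:
 assumes "x + y \<le> k" and e: "e \<in> {l1, l2}" "e' \<in> {l1, l2}"
 shows "y * ta (Suc x) (y - 1) e x' y' e' + (if e = l2 then ta x y l1 x' y' e' else 0) =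
  x' * ta x y e (x' - 1) (Suc y') e' + (if e' = l1 then ta x y e x' y' l2 else 0)"
proof -
 interpret sw: inv2 X \<A> c0 y0 r rh k p T l2 l1 b
  by unfold_locales (use dist len in auto)
 have t: "sw.ta y x e y' x' e' = ta x y e x' y' e'" for x y e x' y' e'
  by (simp add: sw.ta_def ta_def sw.mm_def mm_def add.commute)
 show ?thesis using sw.e21[of y x e e' y' x'] assms unfolding t by (simp add: add.commute insert_commute)
qed

text \<open>On operators of order \<open>j\<close>, an invariant operator acts on the words considered here as
  \<open>a + bZ\<close>, where \<open>Z\<close> exchanges the first exterior index with each of the derivatives.\<close>

definition aa :: "nat => real" where "aa j = ta j 0 l2 j 0 l2 / fact j"

definition bb :: "nat => real" where "bb j = (if j = 0 then 0 else ta j 0 l2 (j - 1) 1 l1 / fact j)"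

text \<open>Induction along \<open>e21\<close>, which moves one derivative from \<open>l1\<close> to
  \<open>l2\<close>. In the diagonal entry the factor \<open>y\<close> of \<open>bb j\<close> counts
  the exchanges of the exterior index \<open>l2\<close> with a derivative \<open>l2\<close>, which
  return the same word; the factorials are the values of derivatives on their monomials.\<close>

lemma ta_2:
 assumes "j \<le> k"
 shows "x + y = j ==> ta x y l2 x y l2 = fact x * fact y * (aa j + bb j * y) &
  (x \<ge> 1 --> ta x y l2 (x - 1) (Suc y) l1 = bb j * fact x * fact (Suc y))"
proof (induction y arbitrary: x)
 case 0
 then show ?case by (auto simp: aa_def bb_def)
next
 case (Suc y)
 then have xy: "Suc x + y = j" "Suc x + y \<le> k" using assms by auto
 note IH = Suc.IH[OF xy(1)]
 have A: "ta (Suc x) y l2 (Suc x) y l2 = fact (Suc x) * fact y * (aa j + bb j * y)"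
  and B: "ta (Suc x) y l2 x (Suc y) l1 = bb j * fact (Suc x) * fact (Suc y)" using IH by auto
 have "Suc x * ta x (Suc y) l2 x (Suc y) l2 = Suc y * ta (Suc x) y l2 (Suc x) y l2 + ta (Suc x) y l2 x (Suc y) l1"
  using e21[OF xy(2), of l2 l2 x "Suc y"] ll by simp
 also have "... = Suc x * (fact x * fact (Suc y) * (aa j + bb j * Suc y))"
  unfolding A B by (simp add: algebra_simps)
 finally have 1: "ta x (Suc y) l2 x (Suc y) l2 = fact x * fact (Suc y) * (aa j + bb j * Suc y)"
  by (simp only: mult_cancel_left of_nat_eq_0_iff nat.distinct simp_thms)
 have "ta x (Suc y) l2 (x - 1) (Suc (Suc y)) l1 = bb j * fact x * fact (Suc (Suc y))" if "x \<ge> 1"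
 proof -
  obtain x' where x': "x = Suc x'" using `x \<ge> 1` by (cases x) auto
  have "Suc x * ta x (Suc y) l2 x' (Suc (Suc y)) l1 = Suc (Suc y) * ta (Suc x) y l2 x (Suc y) l1"
   using e21[OF xy(2), of l2 l1 x' "Suc (Suc y)"] ll x' by simp
  also have "... = Suc x * (bb j * fact x * fact (Suc (Suc y)))" unfolding B by (simp add: algebra_simps)
  finally show ?thesis unfolding x' by (simp only: mult_cancel_left of_nat_eq_0_iff nat.distinct simp_thms diff_Suc_1)
 qed
 then show ?case using 1 by blast
qed

text \<open>The values for the exterior index \<open>l1\<close> follow from those for
  \<open>l2\<close> through the opposite field: no new scalar appears.\<close>

lemma ta_1:
 assumes j: "j \<le> k" and xy: "x + y = j"
 shows "ta x y l1 x y l1 = fact x * fact y * (aa j + bb j * x)"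
  "y \<ge> 1 ==> ta x y l1 (Suc x) (y - 1) l2 = bb j * fact (Suc x) * fact y"
proof -
 have xk: "x + y \<le> k" using assms by simp
 have D: "ta x y l2 x y l2 = fact x * fact y * (aa j + bb j * y)" using ta_2[OF j xy] by simp
 have 1: "y * ta (Suc x) (y - 1) l2 x y l1 + ta x y l1 x y l1 = x * ta x y l2 (x - 1) (Suc y) l1 + ta x y l2 x y l2"
  using e12[OF xk, of l2 l1 x y] ll by simp
 have "y * ta (Suc x) (y - 1) l2 x y l1 = y * (bb j * fact (Suc x) * fact y)"
 proof (cases y)
  case (Suc y')
  then show ?thesis using ta_2[OF j, of "Suc x" y'] xy by simp
 qed simp
 moreover have "x * ta x y l2 (x - 1) (Suc y) l1 = x * (bb j * fact x * fact (Suc y))"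
  using ta_2[OF j xy] by (cases x) auto
 ultimately have "ta x y l1 x y l1 = x * (bb j * fact x * fact (Suc y)) + fact x * fact y * (aa j + bb j * y)
   - y * (bb j * fact (Suc x) * fact y)"
  using 1 D by linarith
 then show "ta x y l1 x y l1 = fact x * fact y * (aa j + bb j * x)" by (simp add: algebra_simps)
 assume "y \<ge> 1"
 then obtain y' where y': "y = Suc y'" by (cases y) auto
 have "y * ta (Suc x) y' l2 (Suc x) y' l2 + ta x y l1 (Suc x) y' l2 = Suc x * ta x y l2 x y l2"
  using e12[OF xk, of l2 l2 "Suc x" y'] ll y' by simp
 moreover have "ta (Suc x) y' l2 (Suc x) y' l2 = fact (Suc x) * fact y' * (aa j + bb j * y')"
  using ta_2[OF j, of "Suc x" y'] xy y' by simp
 ultimately have "ta x y l1 (Suc x) y' l2 = Suc x * (fact x * fact y * (aa j + bb j * y))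
   - y * (fact (Suc x) * fact y' * (aa j + bb j * y'))"
  using D by simp
 then show "ta x y l1 (Suc x) (y - 1) l2 = bb j * fact (Suc x) * fact y"
  by (simp add: y' algebra_simps)
qed

section \<open>Relations between different orders\<close>

lemma tw_sq_lie:
 assumes sz: "size al \<le> k" and e: "e \<in> {l1, l2}" and i: "i \<in> {l1, l2}" and B: "length B = p"
 shows "tw al B (LF (vf (sq l1) i) (mform p (mm x y) (e # b))) =
  (if i = l1 then x / 2 * tw al B (mform p (mm (Suc x) y) (e # b)) else y / 2 * tw al B (mform p (mm (Suc (Suc x)) (y - 1)) (e # b))) +
  (if e = i then tw al B (mform p (mm (Suc x) y) (l1 # b)) else 0)"
proof -
 have 1: "tw al B (mform p (%z. sq l1 z * pd i (mm x y) z) (e # b)) =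
  (if i = l1 then x / 2 * tw al B (mform p (mm (Suc x) y) (e # b)) else y / 2 * tw al B (mform p (mm (Suc (Suc x)) (y - 1)) (e # b)))"
 proof (cases "i = l1")
  case True
  have "sq l1 z * pd i (mm x y) z = x / 2 * mm (Suc x) y z" for z
  proof (cases x)
   case (Suc x')
   have "sq l1 z * pd l1 (mm x y) z = x / 2 * (sc l1 z * (sc l1 z * mm x' y z))" by (simp add: Suc pd_mm1)
   also have "... = x / 2 * mm (Suc x) y z" unfolding sc_mm1 Suc ..
   finally show ?thesis using True by simp
  qed (simp add: True pd_mm1)
  from tw_scale[OF B sz smooth_mm this] show ?thesis by (simp only: True if_True simp_thms)
 next
  case False
  then have i2: "i = l2" using i by simp
  have "sq l1 z * pd i (mm x y) z = y / 2 * mm (Suc (Suc x)) (y - 1) z" for z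
  proof -
   have "sq l1 z * pd l2 (mm x y) z = y / 2 * (sc l1 z * (sc l1 z * mm x (y - 1) z))" by (simp add: pd_mm2)
   also have "... = y / 2 * mm (Suc (Suc x)) (y - 1) z" unfolding sc_mm1 ..
   finally show ?thesis using i2 by simp
  qed
  from tw_scale[OF B sz smooth_mm this] show ?thesis by (simp only: False if_False)
 qed
 have 2: "tw al B (mform p (%z. mm x y z * pd l1 (sq l1) z) (l1 # b)) = 1 * tw al B (mform p (mm (Suc x) y) (l1 # b))"
  by (rule tw_scale[OF B sz smooth_mm]) (unfold pd_sq, simp add: sc_mm1[symmetric])
 have 3: "tw al B (mform p (%z. mm x y z * pd l2 (sq l1) z) (l2 # b)) = 0 * tw al B (mform p (mm x y) (l2 # b))"
  by (rule tw_scale[OF B sz smooth_mm]) (unfold pd_sq, use ll in simp)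
 have "tw al B (LF (vf (sq l1) i) (mform p (mm x y) (e # b))) =
  tw al B (mform p (%z. sq l1 z * pd i (mm x y) z) (e # b)) +
  (if e = i then tw al B (mform p (%z. mm x y z * pd l1 (sq l1) z) (l1 # b)) + tw al B (mform p (%z. mm x y z * pd l2 (sq l1) z) (l2 # b)) else 0)"
  by (rule tw_lie[OF B sz smooth_sq smooth_mm _ i e]) (unfold pd_sq, simp)
 then show ?thesis unfolding 1 2 3 by simp
qed

lemma quad:
 assumes "x + y \<le> k" "e \<in> {l1, l2}" and om: "om \<in> Om p"
 shows "tw (wd x y) (e # b) (LF (vf (sq l1) i) om) =
  real x * Tw (sc l1) (am i (wd x y - {#l1#})) (e # b) om +
  real x * (real x - 1) / 2 * tw (am i (wd x y - {#l1#} - {#l1#})) (e # b) om +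
  (if e = l1 then Tw (sc l1) (wd x y) (i # b) om + real x * tw (wd x y - {#l1#}) (i # b) om else 0)"
proof -
 have "size (wd x y) \<le> k" using assms(1) by simp
 from tw_quadratic_field[OF eb[of e] this om, of l1 i] show ?thesis
  unfolding sum_head[OF ll(3), where F = "%B. Tw (sc l1) (wd x y) B om + real (count (wd x y) l1) * tw (wd x y - {#l1#}) B om" and i = i and e = e]
  unfolding wd_simps(1) .
qed

text \<open>Up to a factorial, \<open>aa j + j * bb j\<close> is the value on a word with
  \<open>j\<close> derivatives all equal to its exterior index. The field with component
  \<open>sq l1\<close> in direction \<open>l2\<close> produces two unknown values with coefficient
  \<open>sc l1\<close>; the same function in direction \<open>l1\<close>, applied to the two words
  concerned, shows that both vanish on the chosen form.\<close>

lemma order_relation: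
 assumes "Suc m \<le> k"
 shows "aa (Suc m) + Suc m * bb (Suc m) = aa m + m * bb m"
proof -
 let ?om = "mform p (mm 0 m) (l2 # b)"
 have 1: "tw (wd 1 m) (l1 # b) (LF (vf (sq l1) l2) ?om) =
   Tw (sc l1) (wd 0 (Suc m)) (l1 # b) ?om + Tw (sc l1) (wd 1 m) (l2 # b) ?om + tw (wd 0 m) (l2 # b) ?om"
  using quad[of 1 m l1 ?om l2] assms mform_in ll by simp
 have 2: "tw (wd 0 (Suc m)) (l1 # b) (LF (vf (sq l1) l1) ?om) = Tw (sc l1) (wd 0 (Suc m)) (l1 # b) ?om"
  using quad[of 0 "Suc m" l1 ?om l1] assms mform_in by simp
 have 3: "tw (wd 1 m) (l2 # b) (LF (vf (sq l1) l1) ?om) = Tw (sc l1) (wd 1 m) (l2 # b) ?om"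
  using quad[of 1 m l2 ?om l1] assms mform_in ll by simp
 have L1: "tw (wd 1 m) (l1 # b) (LF (vf (sq l1) l2) ?om) = m / 2 * ta 1 m l1 2 (m - 1) l2 + ta 1 m l1 1 m l1"
  using tw_sq_lie[of "wd 1 m" l2 l2 "l1 # b" 0 m] assms ll eb unfolding ta_def by (simp add: numeral_2_eq_2)
 have L2: "tw al (e # b) (LF (vf (sq l1) l1) ?om) = 0" if "size al \<le> k" for al e
  using tw_sq_lie[OF that, of l2 l1 "e # b" 0 m] ll eb by simp
 have "m / 2 * ta 1 m l1 2 (m - 1) l2 + ta 1 m l1 1 m l1 = ta 0 m l2 0 m l2"
  using 1 2 3 L1 L2[of "wd 0 (Suc m)" l1] L2[of "wd 1 m" l2] assms unfolding ta_def by simp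
 moreover have "m * ta 1 m l1 2 (m - 1) l2 = m * (bb (Suc m) * 2 * fact m)"
  using ta_1(2)[OF assms, of 1 m] by (cases "m = 0") (auto simp: numeral_2_eq_2)
 moreover have "ta 1 m l1 1 m l1 = fact m * (aa (Suc m) + bb (Suc m))" using ta_1(1)[OF assms, of 1 m] by simp
 moreover have "ta 0 m l2 0 m l2 = fact m * (aa m + bb m * m)" using ta_2[of m 0 m] assms by simp
 ultimately have "fact m * (aa (Suc m) + Suc m * bb (Suc m)) = fact m * (aa m + m * bb m)"
  by (auto simp add: algebra_simps)
 then show ?thesis by simp
qed

text \<open>The elimination of \<open>order_relation\<close> one degree higher, with a form whose
  exterior index is \<open>l1\<close>. Entries of orders m + 2 and m + 1 occur, but the scalars of
  order m + 2 drop out identically, which leaves a multiple of \<open>bb\<close> of the lower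
  order.\<close>

lemma bb_zero:
 assumes "Suc (Suc m) \<le> k"
 shows "bb (Suc m) = 0"
proof -
 let ?om = "mform p (mm 0 (Suc m)) (l1 # b)" and ?j = "Suc (Suc m)"
 have s2: "wd 2 m - {#l1#} = wd 1 m" "wd 2 m - {#l1#} - {#l1#} = wd 0 m" "am l2 (wd 1 m) = wd 1 (Suc m)"
  "am l1 (wd 1 m) = wd 2 m" "am l2 (wd 0 m) = wd 0 (Suc m)" "am l1 (wd 0 m) = wd 1 m"
  "wd 1 (Suc m) - {#l1#} = wd 0 (Suc m)" "am l1 (wd 0 (Suc m)) = wd 1 (Suc m)"
  using ll by (auto simp: numeral_2_eq_2)
 have 1: "tw (wd 2 m) (l1 # b) (LF (vf (sq l1) l2) ?om) =
   2 * Tw (sc l1) (wd 1 (Suc m)) (l1 # b) ?om + tw (wd 0 (Suc m)) (l1 # b) ?om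
   + Tw (sc l1) (wd 2 m) (l2 # b) ?om + 2 * tw (wd 1 m) (l2 # b) ?om"
  using quad[of 2 m l1 ?om l2] assms mform_in unfolding s2 by simp
 have 2: "tw (wd 1 (Suc m)) (l1 # b) (LF (vf (sq l1) l1) ?om) =
   2 * Tw (sc l1) (wd 1 (Suc m)) (l1 # b) ?om + tw (wd 0 (Suc m)) (l1 # b) ?om"
  using quad[of 1 "Suc m" l1 ?om l1] assms mform_in unfolding s2 by simp
 have 3: "tw (wd 2 m) (l2 # b) (LF (vf (sq l1) l1) ?om) = 2 * Tw (sc l1) (wd 2 m) (l2 # b) ?om + tw (wd 1 m) (l2 # b) ?om"
  using quad[of 2 m l2 ?om l1] assms mform_in ll unfolding s2 by simp
 have L1: "tw (wd 2 m) (l1 # b) (LF (vf (sq l1) l2) ?om) = Suc m / 2 * ta 2 m l1 2 m l1"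
  using tw_sq_lie[of "wd 2 m" l1 l2 "l1 # b" 0 "Suc m"] assms ll eb unfolding ta_def by (simp add: numeral_2_eq_2)
 have L2: "tw (wd 1 (Suc m)) (l1 # b) (LF (vf (sq l1) l1) ?om) = ta 1 (Suc m) l1 1 (Suc m) l1"
  using tw_sq_lie[of "wd 1 (Suc m)" l1 l1 "l1 # b" 0 "Suc m"] assms ll eb unfolding ta_def by simp
 have L3: "tw (wd 2 m) (l2 # b) (LF (vf (sq l1) l1) ?om) = ta 2 m l2 1 (Suc m) l1"
  using tw_sq_lie[of "wd 2 m" l1 l1 "l2 # b" 0 "Suc m"] assms ll eb unfolding ta_def by simp
 have L4: "tw (wd 1 m) (l2 # b) ?om = ta 1 m l2 0 (Suc m) l1" unfolding ta_def ..
 have "Suc m / 2 * ta 2 m l1 2 m l1 - ta 1 (Suc m) l1 1 (Suc m) l1 - 1/2 * ta 2 m l2 1 (Suc m) l1 = 3/2 * ta 1 m l2 0 (Suc m) l1"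
  using 1 2 3 unfolding L1 L2 L3 L4 by linarith
 moreover have "ta 2 m l1 2 m l1 = 2 * fact m * (aa ?j + bb ?j * 2)" using ta_1(1)[OF assms, of 2 m] by simp
 moreover have "ta 1 (Suc m) l1 1 (Suc m) l1 = fact (Suc m) * (aa ?j + bb ?j)" using ta_1(1)[OF assms, of 1 "Suc m"] by simp
 moreover have "ta 2 m l2 1 (Suc m) l1 = bb ?j * 2 * fact (Suc m)" using ta_2[OF assms, of 2 m] by simp
 moreover have "ta 1 m l2 0 (Suc m) l1 = bb (Suc m) * fact (Suc m)" using ta_2[of "Suc m" 1 m] assms by simp
 ultimately have "fact (Suc m) * bb (Suc m) = 0" by (simp add: field_simps)
 then show ?thesis by simp
qed

text \<open>A direction \<open>l3\<close> outside the word lets the quadratic field convert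
  derivatives \<open>l1\<close> without touching the exterior indices. When all values of order at
  most 1 vanish, the diagonal entry of order 2 is left alone and must be zero.\<close>

lemma aa_zero_of_third_letter:
 assumes k: "k = 2" and l3: "l3 ~: set (l1 # l2 # b)" and z: "!!al B om. size al \<le> 1 ==> length B = p ==> tw al B om = 0"
 shows "aa 2 = 0"
proof -
 let ?B = "l2 # b" and ?om = "mform p (mon y0 {#l3#}) (l2 # b)"
 have om: "?om \<in> Om p" by (rule mform_forms[OF smooth_mon])
 have B: "length ?B = p" by (rule eb)
 have nB: "(\<Sum>s<p. if ?B ! s = l then F s else 0) = (0::real)" if "l ~: set ?B" for l F
 proof (rule sum.neutral, rule ballI)
  fix s assume "s \<in> {..<p}"
  then have "?B ! s \<in> set ?B" using B by (simp only: lessThan_iff nth_mem)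
  then show "(if ?B ! s = l then F s else 0) = 0" using that by auto
 qed
 have l: "l1 ~: set ?B" "l3 ~: set ?B" "l3 ~= l1" using l3 dist by auto
 have 1: "tw {#l1, l1#} ?B (LF (vf (sq l1) l3) ?om) = 2 * Tw (sc l1) {#l3, l1#} ?B ?om + tw {#l3#} ?B ?om"
  using tw_quadratic_field[OF B _ om, of "{#l1, l1#}" l1 l3] k unfolding nB[OF l(1)] by simp
 have 2: "tw {#l3, l1#} ?B (LF (vf (sq l1) l1) ?om) = Tw (sc l1) {#l3, l1#} ?B ?om"
  using tw_quadratic_field[OF B _ om, of "{#l3, l1#}" l1 l1] k l(3) unfolding nB[OF l(1)] by (simp add: add_mset_commute)
 have 3: "tw {#l3, l1#} ?B (LF (vf (sq l1) l1) ?om) = 0"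
 proof -
  have "tw {#l3, l1#} ?B (LF (vf (sq l1) l1) ?om) = (\<Sum>i\<in>{()}. 0 * tw {#l3, l1#} ?B ?om)"
  proof (rule tw_lin[OF B _ _ lie_forms[OF om vf_fields[OF smooth_sq]] om])
   fix z :: "real^'n" and I :: "'n list" assume z: "z \<in> U0" and I: "length I = p"
   show "LF (vf (sq l1) l1) ?om c0 z I = (\<Sum>i\<in>{()}. 0 * ?om c0 z I)"
    unfolding lie_vf_mform[OF smooth_sq smooth_mon B z I] nB[OF l(1)] using l by (simp add: pd_mon)
  qed (use k in auto)
  then show ?thesis by simp
 qed
 have 4: "tw {#l1, l1#} ?B (LF (vf (sq l1) l3) ?om) = 1/2 * ta 2 0 l2 2 0 l2"
 proof -
  have f: "mform p (mm 2 0) ?B \<in> Om p" by (rule mform_in)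
  have "tw {#l1, l1#} ?B (LF (vf (sq l1) l3) ?om) = (\<Sum>i\<in>{()}. 1/2 * tw {#l1, l1#} ?B (mform p (mm 2 0) ?B))"
  proof (rule tw_lin[OF B _ _ lie_forms[OF om vf_fields[OF smooth_sq]] f])
   fix z :: "real^'n" and I :: "'n list" assume z: "z \<in> U0" and I: "length I = p"
   show "LF (vf (sq l1) l3) ?om c0 z I = (\<Sum>i\<in>{()}. 1/2 * mform p (mm 2 0) ?B c0 z I)"
    unfolding lie_vf_mform[OF smooth_sq smooth_mon B z I] nB[OF l(2)] mform_near[OF z]
    by (simp add: pd_mon mm_def numeral_2_eq_2 mon_add_mset)
  qed (use k in auto)
  then show ?thesis by (simp add: ta_def numeral_2_eq_2)
 qed
 have "tw {#l3#} ?B ?om = 0" by (rule z) (use B in auto)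
 then have "ta 2 0 l2 2 0 l2 = 0" using 1 2 3 4 by simp
 then show ?thesis unfolding aa_def by simp
qed

text \<open>With the values of lower order gone, fields may have components of degree three.
  Together with \<open>rel\<close> they give four relations for three unknown values with quadratic
  coefficients, and these are consistent only if \<open>bb k\<close> vanishes.\<close>

lemma bb_zero_top:
 assumes k: "k \<ge> 3" and z: "!!al B g om. size al < k ==> length B = p ==> Sm S0 g ==> Tw g al B om = 0"
  and rel: "aa k + k * bb k = 0"
 shows "bb k = 0"
proof -
 obtain m where m: "k = Suc (Suc m)" "m \<ge> 1" using k by (cases k; cases "k - 1") auto
 let ?s1 = "sc l1" and ?s2 = "sc l2"
 \<comment> \<open>Products of divided powers, so that partial derivatives are again of this
   kind.\<close>
 define h2 where "h2 z = 1/2 * mm 2 0 z" for z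
 define h3 where "h3 z = 1/6 * mm 3 0 z" for z
 define h4 where "h4 z = 1/2 * mm 2 1 z" for z
 have mmU: "Sm UNIV (mm x y)" for x y unfolding mm_def by (rule sm_mon[OF open_UNIV])
 have U: "Sm UNIV h2" "Sm UNIV h3" "Sm UNIV h4" "Sm UNIV (mm x y)" for x y
  unfolding h2_def h3_def h4_def by (intro sm_mult open_UNIV sm_const mmU)+
 note uc = sm_subset[OF open_UNIV subset_UNIV]
 have d: "mm x y differentiable at z" for x y z
  by (rule sm_diffble[OF mmU open_UNIV UNIV_I])
 have pdm: "pd l (mm x y) z = 0" if "l ~= l1" "l ~= l2" for l x y z
  unfolding mm_def pd_mon using that by simp
 have z0: "mm x y y0 = 0" if "x + y > 0" for x y using that by (cases x; cases y) (auto simp: mm_def mon_add_mset)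
 have h0: "h2 y0 = 0" "h3 y0 = 0" "h4 y0 = 0" by (simp_all add: h2_def h3_def h4_def z0)
 have pdh: "pd l1 h2 z = mm 1 0 z" "pd l2 h2 z = 0" "pd l1 h3 z = 1/2 * mm 2 0 z" "pd l2 h3 z = 0"
  "pd l1 h4 z = mm 1 1 z" "pd l2 h4 z = 1/2 * mm 2 0 z" for z
  unfolding h2_def[abs_def] h3_def[abs_def] h4_def[abs_def] pd_cmult[OF d] pd_mm1 pd_mm2 by (simp_all add: numeral_2_eq_2 numeral_3_eq_3)
 have pdh0: "pd l h2 z = 0" "pd l h3 z = 0" "pd l h4 z = 0" if "l ~= l1" "l ~= l2" for l z
  unfolding h2_def[abs_def] h3_def[abs_def] h4_def[abs_def] pd_cmult[OF d] pdm[OF that] by simp_all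
 have ext: "(%z. 1 * F z) = F" "(%z. F z * pd l (%_. 1::real) z) = (%_. 0)" for F :: "real^'n => real" and l
  by (simp_all add: fun_eq_iff)
 have G: "Tw g al (e # b) (LF (vf h i) om) = - Tw (%y. h y * pd i g y) al (e # b) om +
  (\<Sum>x\<in>#al. Tw (%y. g y * pd x h y) (am i (al - {#x#})) (e # b) om) +
  (if e = i' then Tw (%y. g y * pd i' h y) al (i # b) om else 0)"
  if "size al = k" "om \<in> Om p" "Sm UNIV h" "h y0 = 0" "Sm UNIV g" "e = i'"
   "!!l z. l \<in> set b ==> pd l h z = 0"
  for g al e h i om i'
 proof -
  have H: "(\<Sum>s<p. Tw (%y. g y * pd ((e # b) ! s) h y) al ((e # b)[s := i]) om) = Tw (%y. g y * pd e h y) al (i # b) om"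
  proof -
   have "Tw (%y. g y * pd (b ! s) h y) al (e # b[s := i]) om = 0" if "s < length b" for s
    using that `!!l z. l \<in> set b ==> pd l h z = 0`[OF nth_mem[OF that]] Tw_zero by simp
   then show ?thesis unfolding len[symmetric] sum.lessThan_Suc_shift by simp
  qed
  have sz: "size al \<le> k" using that(1) by simp
  have low: "Tw q be b' om = 0" if "size be < size al" "length b' = p" "Sm S0 q" for be b' q
   using z that `size al = k` by simp
  show ?thesis using Tw_general_field[OF eb[of e] sz that(2-5) low, of i] that(6) unfolding H by simp
 qed
 have lb: "pd l h2 z = 0" "pd l h3 z = 0" "pd l h4 z = 0" "pd l (mm x y) z = 0" if "l \<in> set b" for l z x y
  using that ll pdh0[of l z] pdm[of l x y z] by metis+
 have sums: "(\<Sum>x\<in>#wd x y. F x) = x * F l1 + y * F l2" for x y and F :: "'n => real"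
  by (simp add: image_replicate_mset)
 let ?mu = "mform p (mm m 0) (l2 # b)"
 note mu = mform_in[of m 0 "l2 # b"]
 have eqs: "am l1 (wd (Suc x) y - {#l1#}) = wd (Suc x) y" "am l2 (wd (Suc x) y - {#l1#}) = wd x (Suc y)"
  "am l1 (wd x (Suc y) - {#l2#}) = wd (Suc x) y" for x y
  by (rule wd_simps)+
 \<comment> \<open>The three unknowns: values on words of order \<open>k\<close> with a quadratic
   coefficient.\<close>
 let ?C = "Tw (%z. 1/2 * mm 2 0 z) (wd k 0) (l2 # b)" and ?C'' = "Tw (%z. 1/2 * mm 2 0 z) (wd (Suc m) 1) (l1 # b)"
  and ?C' = "Tw (mm 1 1) (wd (Suc m) 1) (l2 # b)"
 have one: "Tw (%y. 1 * f y) = Tw f" for f :: "real^'n => real" by simp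
 have a: "tw (wd k 0) (l2 # b) (LF (vf (mm 1 1) l1) om) = k * Tw (mm 0 1) (wd k 0) (l2 # b) om + Tw (mm 1 0) (wd k 0) (l1 # b) om"
  if "om \<in> Om p" for om
  using G[of "wd k 0" om "mm 1 1" "%_. 1" l2 l2 l1, OF _ that U(4) z0 sm_const refl lb(4)]
  unfolding sums pd_mm1 pd_mm2 m(1) eqs by (simp add: Tw_zero)
 have b2: "tw (wd k 0) (l1 # b) (LF (vf h2 l1) om) = (k + 1) * Tw (mm 1 0) (wd k 0) (l1 # b) om"
  if "om \<in> Om p" for om
  using G[of "wd k 0" om h2 "%_. 1" l1 l1 l1, OF _ that U(1) h0(1) sm_const refl lb(1)]
  unfolding sums pdh m(1) eqs by (simp add: Tw_zero algebra_simps)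
 have c: "Tw (mm 0 1) (wd k 0) (l2 # b) (LF (vf h2 l2) ?mu) = - ?C ?mu + k * ?C' ?mu"
 proof -
  have "(%y. h2 y * pd l2 (mm 0 1) y) = (%z. 1/2 * mm 2 0 z)"
   unfolding pd_mm2 h2_def[abs_def] by (simp add: mm_def)
  moreover have "(%y. mm 0 1 y * mm 1 0 y) = mm 1 1"
   by (simp add: mm_def mon_add_mset fun_eq_iff)
  ultimately show ?thesis
   using G[of "wd k 0" ?mu h2 "mm 0 1" l2 l2 l2, OF _ mu U(1) h0(1) U(4) refl lb(1)]
   unfolding sums pdh m(1) eqs by (simp add: Tw_zero)
 qed
 have dd: "tw (wd k 0) (l2 # b) (LF (vf h3 l1) ?mu) = k * ?C ?mu"
  using G[of "wd k 0" ?mu h3 "%_. 1" l2 l2 l1, OF _ mu U(2) h0(2) sm_const refl lb(2)]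
  unfolding sums pdh m(1) eqs by (simp add: Tw_zero)
 have ee: "tw (wd (Suc m) 1) (l1 # b) (LF (vf h3 l1) ?mu) = k * ?C'' ?mu"
  using G[of "wd (Suc m) 1" ?mu h3 "%_. 1" l1 l1 l1, OF _ mu U(2) h0(2) sm_const refl lb(2)]
  unfolding sums pdh m(1) eqs by (simp add: Tw_zero algebra_simps)
 have ff: "tw (wd (Suc m) 1) (l2 # b) (LF (vf h4 l1) ?mu) = Suc m * ?C' ?mu + ?C ?mu + ?C'' ?mu"
  using G[of "wd (Suc m) 1" ?mu h4 "%_. 1" l2 l2 l1, OF _ mu U(3) h0(3) sm_const refl lb(3)]
  unfolding sums pdh m(1) One_nat_def eqs by (simp add: Tw_zero algebra_simps)
 have sz: "size (wd x y) \<le> k" if "x + y = k" for x y using that by simp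
 have lieY: "tw al (e # b) (LF (vf h l1) (mform p (mm x 0) (l2 # b))) = c * tw al (e # b) (mform p (mm x' y') (l2 # b))"
  if "size al \<le> k" "Sm S0 h" "!!l z. l ~= l1 ==> l ~= l2 ==> pd l h z = 0" "!!z. h z * pd l1 (mm x 0) z = c * mm x' y' z"
  for al e h x c x' y'
 proof -
  have "tw al (e # b) (LF (vf h l1) (mform p (mm x 0) (l2 # b))) = tw al (e # b) (mform p (%z. h z * pd l1 (mm x 0) z) (l2 # b))"
   using tw_lie[OF eb that(1,2) smooth_mm that(3), of l1 l2 e x 0] ll by simp
  also have "... = c * tw al (e # b) (mform p (mm x' y') (l2 # b))"
   by (rule tw_scale[OF eb that(1) smooth_mm that(4)])
  finally show ?thesis .
 qed
 have mmul: "mm x y z * mm x' y' z = mm (x + x') (y + y') z" for x y x' y' z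
  by (simp add: mm_def mon_def image_replicate_mset power_add)
 have dd': "tw (wd k 0) (l2 # b) (LF (vf h3 l1) ?mu) = m / 6 * ta k 0 l2 k 0 l2"
  unfolding ta_def
 proof (rule lieY[OF sz uc[OF U(2)] pdh0(2)])
  show "h3 z * pd l1 (mm m 0) z = m / 6 * mm k 0 z" for z
   using m by (cases m) (simp_all add: h3_def pd_mm1 mmul numeral_3_eq_3)
 qed auto
 have ee': "tw (wd (Suc m) 1) (l1 # b) (LF (vf h3 l1) ?mu) = m / 6 * ta (Suc m) 1 l1 k 0 l2"
  unfolding ta_def
 proof (rule lieY[OF sz uc[OF U(2)] pdh0(2)])
  show "h3 z * pd l1 (mm m 0) z = m / 6 * mm k 0 z" for z
   using m by (cases m) (simp_all add: h3_def pd_mm1 mmul numeral_3_eq_3)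
 qed (use m in auto)
 have ff': "tw (wd (Suc m) 1) (l2 # b) (LF (vf h4 l1) ?mu) = m / 2 * ta (Suc m) 1 l2 (Suc m) 1 l2"
  unfolding ta_def
 proof (rule lieY[OF sz uc[OF U(3)] pdh0(3)])
  show "h4 z * pd l1 (mm m 0) z = m / 2 * mm (Suc m) 1 z" for z
   using m by (cases m) (simp_all add: h4_def pd_mm1 mmul numeral_2_eq_2)
 qed (use m in auto)
 \<comment> \<open>The relation \<open>c\<close> is evaluated by applying \<open>a\<close> and
   \<open>b2\<close> to this form, which near the point is the monomial form with power
   \<open>Suc m\<close> of the first variable and first exterior index \<open>l1\<close>.\<close>
 let ?L = "LF (vf h2 l2) ?mu"
 have Lf: "?L \<in> Om p" by (rule lie_forms[OF mu vf_fields[OF uc[OF U(1)]]])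
 have fn: "(%z. mm m 0 z * pd l1 h2 z) = mm (Suc m) 0" "(%z. mm m 0 z * pd l2 h2 z) = (%z. 0 * mm m 0 z)"
  "(%z. h2 z * pd l2 (mm m 0) z) = (%z. 0 * mm m 0 z)"
  by (simp_all add: pdh mmul pd_mm2 fun_eq_iff)
 have Lmf: "?L c0 z I = mform p (mm (Suc m) 0) (l1 # b) c0 z I" if "z \<in> U0" "length I = p" for z I
 proof -
  have "(\<Sum>q<p. if (l2 # b) ! q = l2 then SU l. pd l h2 z * eps p ((l2 # b)[q := l]) I else 0) = mm 1 0 z * eps p (l1 # b) I"
  proof -
   have "b ! q ~= l2" if "q < length b" for q using that ll nth_mem by blast
   then have "(\<Sum>q<p. if (l2 # b) ! q = l2 then SU l. pd l h2 z * eps p ((l2 # b)[q := l]) I else 0)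
     = (SU l. pd l h2 z * eps p (l # b) I)"
    unfolding len[symmetric] sum.lessThan_Suc_shift by simp
   also have "... = (\<Sum>l\<in>{l1}. pd l h2 z * eps p (l # b) I)"
    by (rule sum.mono_neutral_right) (use pdh0(1) pdh(2) in force)+
   finally show ?thesis by (simp add: pdh)
  qed
  then show ?thesis
   unfolding lie_vf_mform[OF uc[OF U(1)] smooth_mm eb that] mform_near[OF that(1)]
   using mmul[of m 0 z 1 0] by (simp add: pd_mm2)
 qed
 have szk: "size (wd k 0) \<le> k" by simp
 have Y1: "tw (wd k 0) (l2 # b) (LF (vf (mm 1 1) l1) ?L) = k * ta k 0 l2 (Suc m) 1 l1 + ta k 0 l2 k 0 l2"
 proof -
  have Leq: "tw al B (LF (vf h i) ?L) = tw al B (LF (vf h i) (mform p (mm (Suc m) 0) (l1 # b)))"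
   if al: "size al \<le> k" "length B = p" "Sm S0 h" for al B h i
  proof -
   note f = mform_in[of "Suc m" 0 "l1 # b"]
   have "tw al B (LF (vf h i) ?L) = (\<Sum>i'\<in>{()}. 1 * tw al B (LF (vf h i) (mform p (mm (Suc m) 0) (l1 # b))))"
   proof (rule tw_lin[OF that(2,1) _ lie_forms[OF Lf vf_fields[OF that(3)]] lie_forms[OF f vf_fields[OF that(3)]]])
    fix z :: "real^'n" and I :: "'n list" assume z: "z \<in> U0" and I: "length I = p"
    have "pd j (%z. ?L c0 z I) z = pd j (%z. mform p (mm (Suc m) 0) (l1 # b) c0 z I) z" for j
     by (rule pd_cong[OF U0(1) z]) (rule Lmf[OF _ I])
    then show "LF (vf h i) ?L c0 z I = (\<Sum>i'\<in>{()}. 1 * LF (vf h i) (mform p (mm (Suc m) 0) (l1 # b)) c0 z I)"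
     unfolding lie_form_chart[OF Lf c0 U0(4)[OF z] I] lie_form_chart[OF f c0 U0(4)[OF z] I]
     by (simp add: Lmf[OF z] I)
   qed auto
   then show ?thesis by simp
  qed
  have 1: "tw (wd k 0) (l2 # b) (mform p (%z. mm 1 1 z * pd l1 (mm (Suc m) 0) z) (l1 # b)) = Suc m * ta k 0 l2 (Suc m) 1 l1"
   unfolding ta_def by (rule tw_scale[OF eb sz smooth_mm]) (simp_all add: pd_mm1 mmul)
  have 2: "tw (wd k 0) (l2 # b) (mform p (%z. mm (Suc m) 0 z * pd l1 (mm 1 1) z) (l1 # b)) = 1 * ta k 0 l2 (Suc m) 1 l1"
   unfolding ta_def by (rule tw_scale[OF eb sz smooth_mm]) (simp_all add: pd_mm1 mmul)
  have 3: "tw (wd k 0) (l2 # b) (mform p (%z. mm (Suc m) 0 z * pd l2 (mm 1 1) z) (l2 # b)) = 1 * ta k 0 l2 k 0 l2"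
   unfolding ta_def by (rule tw_scale[OF eb sz smooth_mm]) (simp_all add: pd_mm2 mmul m)
  show ?thesis
   unfolding Leq[OF szk eb smooth_mm]
   using tw_lie[OF eb[of l2] szk smooth_mm[of 1 1] smooth_mm[of "Suc m" 0] pdm insertI1 insertI1]
   unfolding 1 2 3 by (simp add: m algebra_simps)
 qed
 have Y2: "tw (wd k 0) (l1 # b) (LF (vf h2 l1) ?L) = 0"
 proof -
  have "tw (wd k 0) (l1 # b) (LF (vf h2 l1) ?L) = (\<Sum>i'\<in>{()}. (real (Suc m) / 2 + 1) * tw (wd k 0) (l1 # b) (mform p (mm k 0) (l1 # b)))"
  proof (rule tw_lin[OF eb _ _ lie_forms[OF Lf vf_fields[OF uc[OF U(1)]]] mform_in])
   fix z :: "real^'n" and I :: "'n list" assume z: "z \<in> U0" and I: "length I = p"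
   note f = mform_in[of "Suc m" 0 "l1 # b"]
   have pL: "pd j (%z. ?L c0 z I) z = pd j (%z. mform p (mm (Suc m) 0) (l1 # b) c0 z I) z" for j
    by (rule pd_cong[OF U0(1) z]) (rule Lmf[OF _ I])
   have "LF (vf h2 l1) ?L c0 z I = LF (vf h2 l1) (mform p (mm (Suc m) 0) (l1 # b)) c0 z I"
    unfolding lie_form_chart[OF Lf c0 U0(4)[OF z] I] lie_form_chart[OF f c0 U0(4)[OF z] I]
    by (simp add: Lmf[OF z] I pL)
   also have "... = h2 z * pd l1 (mm (Suc m) 0) z * eps p (l1 # b) I + mm (Suc m) 0 z * (mm 1 0 z * eps p (l1 # b) I)"
   proof -
    have "b ! q ~= l1" if "q < length b" for q using that ll nth_mem by blast
    then have "(\<Sum>q<p. if (l1 # b) ! q = l1 then SU l. pd l h2 z * eps p ((l1 # b)[q := l]) I else 0)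
      = (SU l. pd l h2 z * eps p (l # b) I)"
     unfolding len[symmetric] sum.lessThan_Suc_shift by simp
    also have "... = (\<Sum>l\<in>{l1}. pd l h2 z * eps p (l # b) I)"
     by (rule sum.mono_neutral_right) (use pdh0(1) pdh(2) in force)+
    finally show ?thesis unfolding lie_vf_mform[OF uc[OF U(1)] smooth_mm eb z I] by (simp add: pdh)
   qed
   also have "... = (real (Suc m) / 2 + 1) * mm k 0 z * eps p (l1 # b) I"
    using mmul[of 2 0 z m 0] mmul[of "Suc m" 0 z 1 0] by (simp add: h2_def pd_mm1 m field_simps)
   finally show "LF (vf h2 l1) ?L c0 z I = (\<Sum>i'\<in>{()}. (real (Suc m) / 2 + 1) * mform p (mm k 0) (l1 # b) c0 z I)"
    by (simp add: mform_near[OF z])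
  qed auto
  also have "tw (wd k 0) (l1 # b) (mform p (mm k 0) (l1 # b)) = 0"
   using ta_1(1)[OF order.refl, of k 0] rel unfolding ta_def by (simp add: algebra_simps)
  finally show ?thesis by simp
 qed
 have t1: "ta k 0 l2 k 0 l2 = fact k * aa k" using ta_2[OF order.refl, of k 0] by simp
 have t2: "ta k 0 l2 (Suc m) 1 l1 = bb k * fact k" using ta_2[OF order.refl, of k 0] m by simp
 have t3: "ta (Suc m) 1 l1 k 0 l2 = bb k * fact k" using ta_1(2)[OF order.refl, of "Suc m" 1] m by simp
 have t4: "ta (Suc m) 1 l2 (Suc m) 1 l2 = fact (Suc m) * (aa k + bb k)" using ta_2[OF order.refl, of "Suc m" 1] m by simp
 have akb: "aa k = - (k * bb k)" using rel by simp
 \<comment> \<open>By \<open>rel\<close> both evaluations vanish: \<open>Y1\<close> is a multiple of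
   \<open>aa k + k * bb k\<close>, and so is the diagonal entry with exterior index
   \<open>l1\<close> behind \<open>Y2\<close>.\<close>
 have "k * Tw (mm 0 1) (wd k 0) (l2 # b) ?L = 0"
 proof -
  have "(real k + 1) * Tw (mm 1 0) (wd k 0) (l1 # b) ?L = 0" using b2[OF Lf] unfolding Y2 by simp
  then have "Tw (mm 1 0) (wd k 0) (l1 # b) ?L = 0" by (metis mult_eq_0_iff add_nonneg_eq_0_iff of_nat_0_le_iff zero_le_one zero_neq_one)
  then show ?thesis using a[OF Lf] unfolding Y1 t1 t2 akb by (simp add: algebra_simps)
 qed
 then have e1: "?C ?mu = k * ?C' ?mu" using c m by simp
 have fk: "fact k = real k * fact (Suc m)" using m by simp
 have e2: "real k * ?C ?mu = m / 6 * (real k * fact (Suc m) * (- (k * bb k)))" using dd dd' unfolding t1 akb fk by simp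
 have e3: "real k * ?C'' ?mu = m / 6 * (bb k * (real k * fact (Suc m)))" using ee ee' unfolding t3 fk by simp
 have e4: "Suc m * ?C' ?mu + ?C ?mu + ?C'' ?mu = m / 2 * (fact (Suc m) * (- (k * bb k) + bb k))" using ff ff' unfolding t4 akb by simp
 have kp: "real k > 0" using m by simp
 have C: "?C ?mu = - (m / 6 * fact (Suc m) * (k * bb k))"
 proof (rule mult_left_cancel[THEN iffD1])
  show "real k * ?C ?mu = real k * - (m / 6 * fact (Suc m) * (k * bb k))"
   unfolding e2 by (simp only: mult_ac mult_minus_right mult_minus_left)
 qed (use kp in simp)
 have C2: "?C'' ?mu = m / 6 * fact (Suc m) * bb k"
 proof (rule mult_left_cancel[THEN iffD1])
  show "real k * ?C'' ?mu = real k * (m / 6 * fact (Suc m) * bb k)"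
   unfolding e3 by (simp only: mult_ac)
 qed (use kp in simp)
 have C1: "?C' ?mu = - (m / 6 * fact (Suc m) * bb k)"
 proof (rule mult_left_cancel[THEN iffD1])
  show "real k * ?C' ?mu = real k * - (m / 6 * fact (Suc m) * bb k)"
   unfolding e1[symmetric] C by (simp only: mult_ac mult_minus_right mult_minus_left)
 qed (use kp in simp)
 \<comment> \<open>Substitution gives -1/3 on the left and -1/2 on the right as multiples of the
   same product, which must therefore be zero. The factor \<open>m\<close> is nonzero because k
   \<ge> 3.\<close>
 have "real (Suc m) * (m * fact (Suc m) * bb k) = 0"
  using e4[unfolded C C1 C2] unfolding m(1) by (simp add: field_simps)
 then show ?thesis using m(2) fact_nonzero[of "Suc m", where 'a = real] by (auto simp del: fact_Suc)
qed

end

section \<open>The invariant operator `d* \<circ> K`\<close>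

text \<open>Wedging with a basis vector is adjoint to inserting it in the first slot. Each of the p
  + 1 positions of \<open>j\<close> gives the same contribution, as its sign is cancelled by moving
  \<open>j\<close> to the front in \<open>th\<close>, and the factor p + 1 turns (p + 1)! into
  p!.\<close>

lemma pairing_wedge:
 assumes La: "alternating p La" and th: "alternating (Suc p) th"
 shows "pairing (Suc p) (wedge j La) th = pairing p La (%b. th (j # b))"
proof -
 have ins: "(\<Sum>I | length I = Suc p. if I ! s = j then (-1) ^ s * La (omit s I) * th I else 0) =
   (\<Sum>b\<in>Ls p. La b * th (j # b))" if s: "s \<le> p" for s
 proof -
  have "(\<Sum>I | length I = Suc p. if I ! s = j then (-1) ^ s * La (omit s I) * th I else 0) =
    (\<Sum>I | length I = Suc p & I ! s = j. (-1) ^ s * La (omit s I) * th I)"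
   by (rule sum.mono_neutral_cong_right) auto
  also have "... = (\<Sum>b\<in>Ls p. (-1) ^ s * La b * th (take s b @ j # drop s b))"
   by (rule sum.reindex_bij_witness[of _ "%b. take s b @ j # drop s b" "omit s"])
    (use s in "auto simp: omit_def nth_append id_take_nth_drop[symmetric] min_def Cons_nth_drop_Suc
     append_take_drop_id take_Cons' drop_Cons'")
  also have "... = (\<Sum>b\<in>Ls p. La b * th (j # b))"
  proof (rule scong)
   fix b assume "b \<in> {b :: 'a list. length b = p}"
   then have "th (take s b @ j # drop s b) = (-1) ^ s * th (j # b)"
    using alt_cycle[OF th, of j b s] s by simp
   then show "(-1) ^ s * La b * th (take s b @ j # drop s b) = La b * th (j # b)"
    by (simp add: power_add[symmetric] mult_ac flip: power_mult_distrib)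
  qed
  finally show ?thesis .
 qed
 have "(\<Sum>I | length I = Suc p. wedge j La I * th I) =
   (\<Sum>I | length I = Suc p. \<Sum>s<Suc p. if I ! s = j then (-1) ^ s * La (omit s I) * th I else 0)"
  by (rule scong, simp del: sum.lessThan_Suc add: wedge_def sum_distrib_right mult_if cong: if_cong)
 also have "... = (\<Sum>s<Suc p. \<Sum>I | length I = Suc p. if I ! s = j then (-1) ^ s * La (omit s I) * th I else 0)"
  by (rule sum.swap)
 also have "... = (\<Sum>s<Suc p. \<Sum>b\<in>Ls p. La b * th (j # b))"
  by (rule scong) (use ins in auto)
 also have "... = Suc p * (\<Sum>b\<in>Ls p. La b * th (j # b))" by simp
 finally have e: "(\<Sum>I | length I = Suc p. wedge j La I * th I) = real (Suc p) * (\<Sum>b\<in>Ls p. La b * th (j # b))" .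
 show ?thesis unfolding pairing_def e fact_Suc by (simp del: of_nat_Suc)
qed

lemma wedge_linear:
 "wedge j (%J. \<Sum>i\<in>S. c i * a i J) I = (\<Sum>i\<in>S. c i * wedge j (a i) I)"
proof -
 have "wedge j (%J. \<Sum>i\<in>S. c i * a i J) I = (\<Sum>s<length I. \<Sum>i\<in>S. if I ! s = j then (-1) ^ s * (c i * a i (omit s I)) else 0)"
  unfolding wedge_def by (rule scong) (simp add: sum_distrib_left)
 also have "... = (\<Sum>i\<in>S. \<Sum>s<length I. if I ! s = j then (-1) ^ s * (c i * a i (omit s I)) else 0)" by (rule sum.swap)
 also have "... = (\<Sum>i\<in>S. c i * wedge j (a i) I)"
  unfolding wedge_def sum_distrib_left by (intro sum.cong refl) auto
 finally show ?thesis .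
qed

section \<open>Koszul differential of the symbol in a chart\<close>

context mfd
begin

lemma principal_symbol_eq:
 assumes "c \<in> \<A>" "y \<in> cimg c" "Lc k p D c A"
 shows "principal_symbol \<A> k p D c y xi I = (\<Sum>al | size al = k. (\<Prod>i\<in>#al. xi $ i) * A al y I)"
proof -
 have "Lc k p D c (SOME A. Lc k p D c A)"
  by (rule someI[where P = "Lc k p D c", OF assms(3)])
 from coeffs_unique[OF this assms(3,1,2)]
 show ?thesis unfolding principal_symbol_def Let_def by (intro sum.cong refl) auto
qed

lemma xi_mon: "(\<Prod>i\<in>#al. xi $ i) = mon 0 al xi"
 by (simp add: mon_def)

lemma koszul_eq:
 assumes c: "c \<in> \<A>" "y \<in> cimg c" "Lc k p D c A"
 shows "koszul (principal_symbol \<A> k p D) c y xi I =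
  (SU j. \<Sum>al | size al = k. count al j * mon 0 (al - {#j#}) xi * wedge j (A al y) I)"
proof -
 have "pd j (%et. principal_symbol \<A> k p D c y et J) xi = (\<Sum>al | size al = k. (count al j * mon 0 (al - {#j#}) xi) * A al y J)" for j J
 proof -
  have d: "mon 0 al differentiable at xi" for al
   by (rule sm_diffble[OF sm_mon[OF open_UNIV] open_UNIV UNIV_I])
  have "(%et. principal_symbol \<A> k p D c y et J) = (%et. \<Sum>al | size al = k. A al y J * mon 0 al et)"
   by (simp add: principal_symbol_eq[OF c] xi_mon mult.commute)
  moreover have "pd j (%et. \<Sum>al | size al = k. A al y J * mon 0 al et) xi = (\<Sum>al | size al = k. pd j (%et. A al y J * mon 0 al et) xi)"
   using d by (intro pd_sum) (auto intro: differentiable_mult)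
  moreover have "pd j (%et. A al y J * mon 0 al et) xi = (count al j * mon 0 (al - {#j#}) xi) * A al y J" for al
   by (simp add: pd_cmult[OF d] pd_mon)
  ultimately show ?thesis by simp
 qed
 then show ?thesis unfolding koszul_def by (simp add: wedge_linear)
qed

text \<open>The chart that \<open>glue\<close> selects at a point, named so that it can be compared
  with a given one.\<close>

definition idx :: "'a => ('a, 'n) chart" where
 "idx x = (SOME c. c \<in> \<A> & x \<in> cdom c)"

lemma idx: "x \<in> pts ==> idx x \<in> \<A> & x \<in> cdom (idx x)"
 unfolding idx_def points_def by (rule someI_ex) auto

lemma glue_eq: "glue \<A> F x = (if x \<in> pts then F (idx x) (coord (idx x) x) else 0)"
 by (simp add: glue_def restrict0_def idx_def Let_def)

end

lemma sum_size_1: "(\<Sum>al | size al = 1. F al) = (SU i. F {#i#})" for F :: "'n::finite multiset => real"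
proof -
 have "{al :: 'n multiset. size al = 1} = (%i. {#i#}) ` UNIV"
  using size_1_singleton_mset by (auto simp del: One_nat_def) 
 then show ?thesis by (simp add: sum.reindex inj_on_def)
qed

text \<open>Passing from multisets to ordered pairs counts off-diagonal pairs twice; the weight 2 on
  the diagonal makes the count uniform.\<close>

lemma sum_size_2: "(\<Sum>al | size al = 2. F al) = 1/2 * (SU i j. (if i = j then 2 else 1) * F {#i, j#})"
 for F :: "'n::finite multiset => real"
proof -
 let ?h = "%(i, j). (if i = j then 2 else 1) * F {#i, j#}"
 have "(SU i j. (if i = j then 2 else 1) * F {#i, j#}) = sum ?h UNIV"
  by (simp add: sum.cartesian_product)
 also have "... = (\<Sum>al | size al = 2. \<Sum>x | x \<in> UNIV & (case x of (i, j) => {#i, j#}) = al. ?h x)"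
  by (rule sum.group[symmetric]) auto
 also have "... = (\<Sum>al | size al = 2. 2 * F al)"
 proof (rule scong)
  fix al :: "'n multiset" assume "al \<in> {al. size al = 2}"
  then have s: "size al = Suc 1" by simp
  obtain x be where al': "al = am x be" using size_eq_Suc_imp_eq_union[OF s] by (elim exE)
  then have "size be = 1" using s by simp
  then obtain u where be: "be = {#u#}" using size_1_singleton_mset by blast
  have al: "al = {#x, u#}" using al' be by simp
  have "{q. q \<in> UNIV & (case q of (i, j) => {#i, j#}) = al} = {(x, u), (u, x)}"
   unfolding al by (auto simp: add_eq_conv_ex)
  then show "(\<Sum>x | x \<in> UNIV & (case x of (i, j) => {#i, j#}) = al. ?h x) = 2 * F al"
   unfolding al by (cases "x = u") (simp_all add: add_mset_commute)
 qed
 finally show ?thesis by (simp add: sum_distrib_left)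
qed

lemma alt_wedge:
 assumes "alternating p La"
 shows "alternating (Suc p) (wedge j La)"
proof -
 let ?A = "%i. if i = j then La else (%_. 0)"
 have a: "alternating p (?A i)" for i using assms by simp
 have "wedge j La I = dform ?A I" for I
  unfolding dform_omit[OF a, symmetric] wedge_def by (rule scong) simp
 then have "wedge j La = dform ?A" by (rule ext)
 then show ?thesis by (simp only: alt_dform[OF a])
qed

lemma sm_wedge: "open S ==> (!!I. Sm S (%y. La y I)) ==> Sm S (%y. wedge j (La y) I)"
 unfolding wedge_def by (intro sm_sum sm_if sm_mult) auto

lemma contr_alt:
 assumes "alternating (Suc p) th"
 shows "alternating p (%b. th (j # b))"
 unfolding alt_swp
proof (intro conjI allI impI)
 fix b :: "'a list" assume "length b ~= p"
 then show "th (j # b) = 0" using alt_length[OF assms] by simp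
next
 fix b :: "'a list" and s t assume b: "length b = p" "s < p" "t < p" "s ~= t"
 have "j # swp s t b = swp (Suc s) (Suc t) (j # b)" using b by (simp add: swp_Cons_Suc)
 then show "th (j # swp s t b) = - th (j # b)"
  using alternatingD[OF assms, of "j # b" "Suc s" "Suc t"] b by simp
qed

text \<open>Top degree is one-dimensional: a reordering of the indices has the same sign for
  \<open>w\<close> and for \<open>eps\<close>, and repeated indices give zero on both sides.\<close>

lemma top_component:
 assumes w: "alternating CARD('n) w" and I0: "distinct I0" "length I0 = CARD('n)"
 shows "w I = w I0 * eps CARD('n) I0 (I :: 'n::finite list)"
proof (cases "length I = CARD('n) & distinct I")
 case True
 then have "set I = UNIV" "set I0 = UNIV"
  using I0 card_subset_eq[OF finite_class.finite_UNIV subset_UNIV, of "set I"]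
   card_subset_eq[OF finite_class.finite_UNIV subset_UNIV, of "set I0"] by (auto simp: distinct_card)
 then obtain si where "!!w. alternating CARD('n) w ==> w I = si * w I0"
  using same_set_sign[of I0 I "CARD('n)"] True I0 by auto
 from this[OF w] this[OF alt_eps, of I0] show ?thesis using eps_self[OF I0] by simp
next
 case False
 then have "w I = 0" "eps CARD('n) I0 I = 0"
  using alt_length[OF w, of I] alt_not_distinct[OF w, of I]
   alt_not_distinct[OF alt_eps, of I "CARD('n)" I0] by (auto simp: eps_length)
 then show ?thesis by simp
qed

lemma pairing_top:
 assumes "alternating CARD('n) a" "alternating CARD('n) w" "distinct I0" "length (I0 :: 'n::finite list) = CARD('n)"
 shows "pairing CARD('n) a w = a I0 * w I0"
proof -
 have "a = (%I. a I0 * eps CARD('n) I0 I)" by (rule ext) (rule top_component[OF assms(1,3,4)])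
 then have "pairing CARD('n) a w = pairing CARD('n) (%I. a I0 * eps CARD('n) I0 I) w" by simp
 also have "... = a I0 * pairing CARD('n) (eps CARD('n) I0) w"
  by (simp add: pairing_def sum_distrib_left mult.assoc)
 finally show ?thesis by (simp add: pairing_eps[OF assms(2,4)])
qed

lemma derivation_swp:
 fixes w :: "'n::finite list => real"
 assumes "length I = p" "s < p" "t < p" "s ~= t"
 shows "(\<Sum>r<p. SU j. M (swp s t I ! r) j * w ((swp s t I)[r := j])) = (\<Sum>r<p. SU j. M (I ! r) j * w (swp s t (I[r := j])))"
proof -
 have "(\<Sum>r<p. SU j. M (swp s t I ! r) j * w ((swp s t I)[r := j])) =
   (\<Sum>r<p. SU j. M (I ! tps s t r) j * w (swp s t (I[tps s t r := j])))"
 proof (intro sum.cong refl)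
  fix r j assume "r \<in> {..<p}"
  then have r: "r < p" by simp
  have "(swp s t I)[r := j] = swp s t (I[tps s t r := j])" using assms r by (intro swp_update) auto
  then show "M (swp s t I ! r) j * w ((swp s t I)[r := j]) = M (I ! tps s t r) j * w (swp s t (I[tps s t r := j]))"
   using assms r by (simp add: nth_swp)
 qed
 also have "... = (\<Sum>r<p. SU j. M (I ! r) j * w (swp s t (I[r := j])))"
  by (rule sum.reindex_bij_witness[of _ "tps s t" "tps s t"]) (use assms in "auto simp: tps_def")
 finally show ?thesis .
qed

text \<open>The symmetric ordering prescribed by \<open>\<Q>\<close> in top degree is equivariant: \<open>b'\<close> below is the Lie derivative
  of the vector density \<open>b\<close>, and \<open>Lt\<close> that of the density \<open>t\<close>.\<close>

lemma quantization_commutes: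
 fixes v b :: "'n::finite => real^'n => real" and t :: "real^'n => real"
 assumes S: "open S" and y: "y \<in> S" and sm: "!!i. Sm S (v i)" "!!i. Sm S (b i)" "Sm S t"
  and b': "!!i z. z \<in> S ==> b' i z = (SU l. v l z * pd l (b i) z - b l z * pd l (v i) z - pd l (v l) z * b i z)"
  and Lt: "!!z. z \<in> S ==> Lt z = (SU l. v l z * pd l t z + pd l (v l) z * t z)"
 shows "(SU i. b' i y * pd i t y + 1/2 * (pd i (b' i) y * t y)) =
  (SU l. v l y * pd l (%z. SU i. b i z * pd i t z + 1/2 * (pd i (b i) z * t z)) y) -
  (SU i. b i y * pd i Lt y + 1/2 * (pd i (b i) y * Lt y))"
proof -
 note sp = sm_pd[OF sm(1)] sm_pd[OF sm(2)] sm_pd[OF sm(3)]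
  sm_pd[OF sm_pd[OF sm(1)]] sm_pd[OF sm_pd[OF sm(2)]]
 have d: "f differentiable at y" if "Sm S f" for f by (rule sm_diffble[OF that S y])
 note D = d[OF sm(1)] d[OF sm(2)] d[OF sm(3)] d[OF sp(1)] d[OF sp(2)] d[OF sp(3)]
 have c: "pd i (pd l (v m)) y = pd l (pd i (v m)) y" "pd i (pd l (b m)) y = pd l (pd i (b m)) y"
  "pd i (pd l t) y = pd l (pd i t) y" for i l m
  by (rule pd_commute[OF S sm(1) y] pd_commute[OF S sm(2) y] pd_commute[OF S sm(3) y])+
 have pb': "pd i (b' i) y = (SU l. (v l y * pd i (pd l (b i)) y + pd i (v l) y * pd l (b i) y)
   - (b l y * pd i (pd l (v i)) y + pd i (b l) y * pd l (v i) y)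
   - (pd l (v l) y * pd i (b i) y + pd i (pd l (v l)) y * b i y))" for i
 proof -
  have "pd i (b' i) y = pd i (%z. SU l. v l z * pd l (b i) z - b l z * pd l (v i) z - pd l (v l) z * b i z) y"
   by (rule pd_cong[OF S y]) (rule b')
  also have "... = (SU l. pd i (%z. v l z * pd l (b i) z - b l z * pd l (v i) z - pd l (v l) z * b i z) y)"
   by (intro pd_sum finite_class.finite_UNIV d sm_diff S sm_mult sm sp)
  also have "... = (SU l. (v l y * pd i (pd l (b i)) y + pd i (v l) y * pd l (b i) y)
   - (b l y * pd i (pd l (v i)) y + pd i (b l) y * pd l (v i) y)
   - (pd l (v l) y * pd i (b i) y + pd i (pd l (v l)) y * b i y))"
   by (simp add: pd_diff pd_mult D)
  finally show ?thesis .
 qed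
 have pq: "pd l (%z. SU i. b i z * pd i t z + 1/2 * (pd i (b i) z * t z)) y =
   (SU i. (b i y * pd l (pd i t) y + pd l (b i) y * pd i t y) + 1/2 * (pd i (b i) y * pd l t y + pd l (pd i (b i)) y * t y))" for l
 proof -
  have "pd l (%z. SU i. b i z * pd i t z + 1/2 * (pd i (b i) z * t z)) y =
    (SU i. pd l (%z. b i z * pd i t z + 1/2 * (pd i (b i) z * t z)) y)"
   by (intro pd_sum finite_class.finite_UNIV d sm_add S sm_mult sm sp sm_const)
  also have "... = (SU i. (b i y * pd l (pd i t) y + pd l (b i) y * pd i t y) + 1/2 * (pd i (b i) y * pd l t y + pd l (pd i (b i)) y * t y))"
  proof (rule scong)
   fix i
   have m: "(%z. b i z * pd i t z) differentiable at y" "(%z. pd i (b i) z * t z) differentiable at y"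
    by (intro d sm_mult S sm sp)+
   have "(%z. 1/2 * (pd i (b i) z * t z)) differentiable at y"
    by (intro d sm_mult S sm sp sm_const)
   then show "pd l (%z. b i z * pd i t z + 1/2 * (pd i (b i) z * t z)) y =
     (b i y * pd l (pd i t) y + pd l (b i) y * pd i t y) + 1/2 * (pd i (b i) y * pd l t y + pd l (pd i (b i)) y * t y)"
    by (subst pd_add[OF m(1)]) (simp_all only: pd_cmult[OF m(2)] pd_mult D)
  qed
  finally show ?thesis .
 qed
 have pL: "pd i Lt y = (SU l. (v l y * pd i (pd l t) y + pd i (v l) y * pd l t y) + (pd l (v l) y * pd i t y + pd i (pd l (v l)) y * t y))" for i
 proof -
  have "pd i Lt y = pd i (%z. SU l. v l z * pd l t z + pd l (v l) z * t z) y"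
   by (rule pd_cong[OF S y]) (rule Lt)
  also have "... = (SU l. pd i (%z. v l z * pd l t z + pd l (v l) z * t z) y)"
   by (intro pd_sum finite_class.finite_UNIV d sm_add S sm_mult sm sp)
  also have "... = (SU l. (v l y * pd i (pd l t) y + pd i (v l) y * pd l t y) + (pd l (v l) y * pd i t y + pd i (pd l (v l)) y * t y))"
  proof (rule scong)
   fix l
   have m: "(%z. v l z * pd l t z) differentiable at y" "(%z. pd l (v l) z * t z) differentiable at y"
    by (intro d sm_mult S sm sp)+
   show "pd i (%z. v l z * pd l t z + pd l (v l) z * t z) y =
    (v l y * pd i (pd l t) y + pd i (v l) y * pd l t y) + (pd l (v l) y * pd i t y + pd i (pd l (v l)) y * t y)"
    by (subst pd_add[OF m]) (simp add: pd_mult D)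
  qed
  finally show ?thesis .
 qed
 \<comment> \<open>The difference of the two sides is the sum of C i l - C l i over all pairs. Terms
   with the gradient of the divergence of the field balance because of the factor 1/2 in the
   ordering: they occur twice with it on the left and once without it on the right.\<close>
 define C where "C i l = b i y * pd i (v l) y * pd l t y + 1/2 * (pd i (v l) y * pd l (b i) y * t y) + 1/2 * (b i y * pd i (pd l (v l)) y * t y)" for i l
 have L: "(SU i. b' i y * pd i t y + 1/2 * (pd i (b' i) y * t y)) =
   (SU i l. (v l y * pd l (b i) y - b l y * pd l (v i) y - pd l (v l) y * b i y) * pd i t y
   + 1/2 * (((v l y * pd i (pd l (b i)) y + pd i (v l) y * pd l (b i) y)
   - (b l y * pd i (pd l (v i)) y + pd i (b l) y * pd l (v i) y)
   - (pd l (v l) y * pd i (b i) y + pd i (pd l (v l)) y * b i y)) * t y))"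
  unfolding pb' b'[OF y] sum_distrib_right sum_distrib_left sum.distrib ..
 have R1: "(SU l. v l y * pd l (%z. SU i. b i z * pd i t z + 1/2 * (pd i (b i) z * t z)) y) =
   (SU i l. v l y * ((b i y * pd l (pd i t) y + pd l (b i) y * pd i t y) + 1/2 * (pd i (b i) y * pd l t y + pd l (pd i (b i)) y * t y)))"
  unfolding pq sum_distrib_left by (rule sum.swap)
 have R2: "(SU i. b i y * pd i Lt y + 1/2 * (pd i (b i) y * Lt y)) =
   (SU i l. b i y * ((v l y * pd i (pd l t) y + pd i (v l) y * pd l t y) + (pd l (v l) y * pd i t y + pd i (pd l (v l)) y * t y))
   + 1/2 * (pd i (b i) y * (v l y * pd l t y + pd l (v l) y * t y)))"
  by (simp only: pL Lt[OF y] sum_distrib_left sum.distrib[symmetric])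
 have "(SU i l. C i l) = (SU i l. C l i)" by (rule sum.swap)
 then have C0: "(SU i l. C i l - C l i) = 0" by (simp add: sum_subtractf)
 have "(SU i. b' i y * pd i t y + 1/2 * (pd i (b' i) y * t y)) -
  ((SU l. v l y * pd l (%z. SU i. b i z * pd i t z + 1/2 * (pd i (b i) z * t z)) y) -
  (SU i. b i y * pd i Lt y + 1/2 * (pd i (b i) y * Lt y))) = (SU i l. C i l - C l i)"
  unfolding L R1 R2 sum_subtractf[symmetric] C_def
 proof (intro sum.cong refl, goal_cases)
  case (1 i l)
  show ?case using c(1)[of l i i] c(2)[of l i i] c(3)[of l i] by (simp add: field_simps)
 qed
 then show ?thesis unfolding C0 by simp
qed

section \<open>The Lie derivative commutes with the exterior derivative\<close>

context mfd
begin

text \<open>Both \<open>d\<close> and the derivation part of the Lie derivative act on the tensor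
  \<open>G\<close> of first derivatives: \<open>d\<close> as a signed sum of swaps with slot 0, the
  derivation slot by slot, so that they commute by \<open>derivation_swp\<close>. The remaining
  second derivatives of the field cancel, by their symmetry and the alternation of the form.\<close>

lemma ext_d_lie:
 assumes om: "om \<in> Om p" and V: "V \<in> Vect"
 shows "Ed (LF V om) = LF V (Ed om)"
proof (intro ext)
 fix c y I
 note Lom = lie_forms[OF om V] and dom = d_forms[OF om]
 note dL = d_forms[OF Lom] and Ld = lie_forms[OF dom V]
 show "Ed (LF V om) c y I = LF V (Ed om) c y I"
 proof (cases "c \<in> \<A> & y \<in> cimg c & length I = Suc p")
  case False
  then show ?thesis
   using form_zero[OF dL, of c y I] form_zero[OF Ld, of c y I] alt_length[OF form_alt[OF dL], of I c y]
    alt_length[OF form_alt[OF Ld], of I c y] by auto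
 next
  case True
  then have c: "c \<in> \<A>" and y: "y \<in> cimg c" by auto
  obtain i b where I: "I = i # b" and b: "length b = p" using True by (auto simp: length_Suc_conv)
  note S = oc[OF c]
  have f: "Sm (cimg c) (%z. om c z B)" for B by (rule form_smooth[OF om c])
  have v: "Sm (cimg c) (%z. V c z $ j)" for j by (rule vf_smooth[OF V c])
  have d: "F differentiable at y" if "Sm (cimg c) F" for F by (rule sm_diffble[OF that S y])
  note D = d[OF f] d[OF v] d[OF sm_pd[OF f]] d[OF sm_pd[OF v]]
  define M where "M i j = pd i (%z. V c z $ j) y" for i j
  define G where "G J = pd (hd J) (%z. om c z (tl J)) y" for J
  define H where "H i B = (\<Sum>s<p. SU j. pd i (pd (B ! s) (%z. V c z $ j)) y * om c y (B[s := j]))" for i B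
  define Q where "Q i B = (SU m. V c y $ m * pd m (pd i (%z. om c z B)) y)" for i B
  define der where "der J = (\<Sum>r<Suc p. SU j. M (J ! r) j * G (J[r := j]))" for J
  have pdL: "pd i (%z. LF V om c z B) y = Q i B + der (i # B) + H i B" if B: "length B = p" for i B
  proof -
   have "pd i (%z. LF V om c z B) y = pd i (%z. (SU m. V c z $ m * pd m (%z. om c z B) z) +
    (\<Sum>s<p. SU j. pd (B ! s) (%z. V c z $ j) z * om c z (B[s := j]))) y"
    by (rule pd_cong[OF S y]) (rule lie_form_chart[OF om c _ B])
   also have "... = pd i (%z. SU m. V c z $ m * pd m (%z. om c z B) z) y +
    pd i (%z. \<Sum>s<p. SU j. pd (B ! s) (%z. V c z $ j) z * om c z (B[s := j])) y"
    by (rule pd_add) (intro d sm_sum S sm_mult v f sm_pd)+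
   also have "pd i (%z. SU m. V c z $ m * pd m (%z. om c z B) z) y =
     (SU m. pd i (%z. V c z $ m * pd m (%z. om c z B) z) y)"
    by (intro pd_sum finite_class.finite_UNIV d sm_mult S v f sm_pd)
   also have "... = Q i B + (SU m. M i m * G (m # B))"
    unfolding Q_def M_def G_def sum.distrib[symmetric]
    by (rule scong) (simp add: pd_mult D pd_commute[OF S f y, of i])
   also have "pd i (%z. \<Sum>s<p. SU j. pd (B ! s) (%z. V c z $ j) z * om c z (B[s := j])) y =
     (\<Sum>s<p. pd i (%z. SU j. pd (B ! s) (%z. V c z $ j) z * om c z (B[s := j])) y)"
    by (intro pd_sum finite_lessThan d sm_sum sm_mult S v f sm_pd)
   also have "... = (\<Sum>s<p. SU j. pd i (%z. pd (B ! s) (%z. V c z $ j) z * om c z (B[s := j])) y)"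
    by (intro sum.cong refl pd_sum finite_class.finite_UNIV d sm_mult S v f sm_pd)
   also have "... = (\<Sum>s<p. SU j. M (B ! s) j * G (i # B[s := j])) + H i B"
    unfolding H_def M_def G_def sum.distrib[symmetric]
    by (intro sum.cong refl) (simp add: pd_mult D)
   finally show ?thesis unfolding der_def sum.lessThan_Suc_shift by simp
  qed
  \<comment> \<open>The terms in which the differentiated slot is the exchanged one add up to
    \<open>H i b\<close>; the cross terms \<open>F t s\<close> are antisymmetric in the two
    positions.\<close>
  have H0: "(\<Sum>t<p. H (b ! t) (b[t := i])) = H i b"
  proof -
   define F where "F t s = (SU j. pd (b ! t) (pd (b ! s) (%z. V c z $ j)) y * om c y (b[t := i, s := j]))" for t s
   have F: "F s t = - F t s" if "s < p" "t < p" "s ~= t" for s t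
    unfolding F_def sum_negf[symmetric]
   proof (rule scong)
    fix j
    have "b[s := i, t := j] = swp s t (b[t := i, s := j])"
     using that b by (auto simp: swp_def list_eq_iff_nth_eq nth_list_update)
    then show "pd (b ! s) (pd (b ! t) (%z. V c z $ j)) y * om c y (b[s := i, t := j]) =
      - (pd (b ! t) (pd (b ! s) (%z. V c z $ j)) y * om c y (b[t := i, s := j]))"
     using alternatingD[OF form_alt[OF om], of "b[t := i, s := j]" s t] that b pd_commute[OF S v y, of "b ! s" "b ! t"] by simp
   qed
   have "(\<Sum>t<p. H (b ! t) (b[t := i])) = (\<Sum>t<p. (SU j. pd i (pd (b ! t) (%z. V c z $ j)) y * om c y (b[t := j])) + (\<Sum>s\<in>{..<p} - {t}. F t s))"
   proof (rule scong)
    fix t assume t: "t \<in> {..<p}"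
    have "H (b ! t) (b[t := i]) = (SU j. pd (b ! t) (pd (b[t := i] ! t) (%z. V c z $ j)) y * om c y (b[t := i, t := j])) +
     (\<Sum>s\<in>{..<p} - {t}. SU j. pd (b ! t) (pd (b[t := i] ! s) (%z. V c z $ j)) y * om c y (b[t := i, s := j]))"
     unfolding H_def using t by (subst sum.remove[of _ t]) auto
    also have "(\<Sum>s\<in>{..<p} - {t}. SU j. pd (b ! t) (pd (b[t := i] ! s) (%z. V c z $ j)) y * om c y (b[t := i, s := j])) = (\<Sum>s\<in>{..<p} - {t}. F t s)"
     unfolding F_def by (intro sum.cong refl) auto
    finally show "H (b ! t) (b[t := i]) = (SU j. pd i (pd (b ! t) (%z. V c z $ j)) y * om c y (b[t := j])) + (\<Sum>s\<in>{..<p} - {t}. F t s)"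
     using t b pd_commute[OF S v y, of "b ! t" i] by simp
   qed
   also have "... = H i b + (\<Sum>t<p. \<Sum>s\<in>{..<p} - {t}. F t s)" by (simp add: sum.distrib H_def)
   also have "(\<Sum>t<p. \<Sum>s\<in>{..<p} - {t}. F t s) = (\<Sum>t<p. \<Sum>s<p. if s = t then 0 else F t s)"
    by (intro sum.cong refl sum.mono_neutral_cong_left) auto
   also have "... = 0"
   proof -
    have "(\<Sum>t<p. \<Sum>s<p. if s = t then 0 else F t s) = (\<Sum>t<p. \<Sum>s<p. if t = s then 0 else F s t)" by (rule sum.swap)
    also have "... = (\<Sum>t<p. \<Sum>s<p. - (if s = t then 0 else F t s))"
    proof (intro sum.cong refl)
     fix t s assume "t \<in> {..<p}" "s \<in> {..<p}"
     then show "(if t = s then 0 else F s t) = - (if s = t then 0 else F t s)" using F[of s t] by auto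
    qed
    also have "... = - (\<Sum>t<p. \<Sum>s<p. if s = t then 0 else F t s)" by (simp add: sum_negf)
    finally show ?thesis by simp
   qed
   finally show ?thesis by simp
  qed
  have dA: "Ed om c z (j # B) = pd j (%z. om c z B) z - (\<Sum>t<p. pd (B ! t) (%z. om c z (B[t := j])) z)"
   if "z \<in> cimg c" "length B = p" for z j B
   using that unfolding ext_d_chart[OF om c that(1)] by (simp add: dform_def)
  have dG: "Ed om c y J = G J - (\<Sum>t<p. G (swp 0 (Suc t) J))" if J: "length J = Suc p" for J
  proof -
   obtain j B where "J = j # B" "length B = p" using J by (auto simp: length_Suc_conv)
   then show ?thesis using dA[OF y, of B j] by (simp add: G_def swp_Cons_0)
  qed
  have L: "Ed (LF V om) c y I = Q i b - (\<Sum>t<p. Q (b ! t) (b[t := i])) + (der I - (\<Sum>t<p. der (swp 0 (Suc t) I)))"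
  proof -
   have "Ed (LF V om) c y I = pd i (%z. LF V om c z b) y - (\<Sum>t<p. pd (b ! t) (%z. LF V om c z (b[t := i])) y)"
    unfolding ext_d_chart[OF Lom c y] I by (simp add: dform_def b)
   also have "... = (Q i b + der (i # b) + H i b) - (\<Sum>t<p. Q (b ! t) (b[t := i]) + der (b ! t # b[t := i]) + H (b ! t) (b[t := i]))"
    using b by (simp add: pdL)
   also have "(\<Sum>t<p. Q (b ! t) (b[t := i]) + der (b ! t # b[t := i]) + H (b ! t) (b[t := i])) =
    (\<Sum>t<p. Q (b ! t) (b[t := i])) + (\<Sum>t<p. der (swp 0 (Suc t) I)) + H i b"
    unfolding sum.distrib H0 I using b by (simp add: swp_Cons_0)
   finally show ?thesis unfolding I by simp
  qed
  have lI: "length I = Suc p" using I b by simp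
  have "LF V (Ed om) c y I = (SU m. V c y $ m * pd m (%z. Ed om c z I) y) +
    (\<Sum>r<Suc p. SU j. M (I ! r) j * Ed om c y (I[r := j]))"
   unfolding M_def by (rule lie_form_chart[OF dom c y lI])
  also have "(SU m. V c y $ m * pd m (%z. Ed om c z I) y) = Q i b - (\<Sum>t<p. Q (b ! t) (b[t := i]))"
  proof -
   have "pd m (%z. Ed om c z I) y = pd m (pd i (%z. om c z b)) y - (\<Sum>t<p. pd m (pd (b ! t) (%z. om c z (b[t := i]))) y)" for m
   proof -
    have "pd m (%z. Ed om c z I) y = pd m (%z. pd i (%z. om c z b) z - (\<Sum>t<p. pd (b ! t) (%z. om c z (b[t := i])) z)) y"
     unfolding I by (rule pd_cong[OF S y]) (rule dA[OF _ b])
    also have "... = pd m (%z. pd i (%z. om c z b) z) y - pd m (%z. \<Sum>t<p. pd (b ! t) (%z. om c z (b[t := i])) z) y"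
     by (rule pd_diff) (intro d sm_sum S sm_pd f)+
    also have "pd m (%z. \<Sum>t<p. pd (b ! t) (%z. om c z (b[t := i])) z) y = (\<Sum>t<p. pd m (pd (b ! t) (%z. om c z (b[t := i]))) y)"
     by (intro pd_sum finite_lessThan d sm_pd f)
    finally show ?thesis by simp
   qed
   then have "(SU m. V c y $ m * pd m (%z. Ed om c z I) y) = Q i b - (SU m. \<Sum>t<p. V c y $ m * pd m (pd (b ! t) (%z. om c z (b[t := i]))) y)"
    by (simp add: Q_def right_diff_distrib sum_subtractf sum_distrib_left)
   moreover have "(SU m. \<Sum>t<p. V c y $ m * pd m (pd (b ! t) (%z. om c z (b[t := i]))) y) = (\<Sum>t<p. Q (b ! t) (b[t := i]))"
    unfolding Q_def by (rule sum.swap)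
   ultimately show ?thesis by simp
  qed
  also have "(\<Sum>r<Suc p. SU j. M (I ! r) j * Ed om c y (I[r := j])) = der I - (\<Sum>t<p. der (swp 0 (Suc t) I))"
  proof -
   have "(\<Sum>r<Suc p. SU j. M (I ! r) j * Ed om c y (I[r := j])) =
     der I - (\<Sum>r<Suc p. SU j. \<Sum>t<p. M (I ! r) j * G (swp 0 (Suc t) (I[r := j])))"
    using lI unfolding der_def by (simp add: dG right_diff_distrib sum_subtractf sum_distrib_left del: sum.lessThan_Suc)
   also have "(\<Sum>r<Suc p. SU j. \<Sum>t<p. M (I ! r) j * G (swp 0 (Suc t) (I[r := j]))) =
     (\<Sum>r<Suc p. \<Sum>t<p. SU j. M (I ! r) j * G (swp 0 (Suc t) (I[r := j])))"
    by (rule scong) (rule sum.swap)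
   also have "... = (\<Sum>t<p. \<Sum>r<Suc p. SU j. M (I ! r) j * G (swp 0 (Suc t) (I[r := j])))" by (rule sum.swap)
   also have "... = (\<Sum>t<p. der (swp 0 (Suc t) I))"
    unfolding der_def by (rule scong) (rule derivation_swp[OF lI, symmetric], auto)
   finally show ?thesis .
  qed
  finally show ?thesis unfolding L ..
 qed
qed

end

section \<open>Test forms that read off the symbol\<close>

context mpt
begin

text \<open>The contraction of a form with the Euler field of the chart \<open>c0\<close> centred at \<open>y0\<close>, and its product with
  a coordinate. Applying an operator of order 1 or 2 to them yields the contraction with its principal symbol.\<close>

definition e1 :: "nat => ('a, 'n) form => ('a, 'n) form" where
 "e1 p th = fext p (%y b. SU j. (y $ j - y0 $ j) * th c0 y (j # b))"

definition e2 :: "nat => 'n => ('a, 'n) form => ('a, 'n) form" where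
 "e2 p l th = fext p (%y b. (y $ l - y0 $ l) * (SU j. (y $ j - y0 $ j) * th c0 y (j # b)))"

lemma smooth_cs: "Sm S0 (%y. y $ j - y0 $ j)"
 by (intro smooth_intros oc[OF c0])

lemma e1_forms:
 assumes th: "th \<in> Om (Suc p)"
 shows "e1 p th \<in> Om p" "y \<in> U0 ==> e1 p th c0 y b = (SU j. (y $ j - y0 $ j) * th c0 y (j # b))"
proof -
 have alt: "alternating p (%b. SU j. (y $ j - y0 $ j) * th c0 y (j # b))" for y
  by (intro alt_sum alt_cmult contr_alt form_alt[OF th])
 show "e1 p th \<in> Om p" unfolding e1_def
  by (rule fext_forms[OF alt]) (intro sm_sum sm_mult oc[OF c0] smooth_cs form_smooth[OF th c0])
 show "e1 p th c0 y b = (SU j. (y $ j - y0 $ j) * th c0 y (j # b))" if "y \<in> U0"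
  unfolding e1_def using fext_near[OF alt that] by simp
qed

lemma e2_forms:
 assumes th: "th \<in> Om (Suc p)"
 shows "e2 p l th \<in> Om p" "y \<in> U0 ==> e2 p l th c0 y b = (y $ l - y0 $ l) * e1 p th c0 y b"
proof -
 have alt: "alternating p (%b. (y $ l - y0 $ l) * (SU j. (y $ j - y0 $ j) * th c0 y (j # b)))" for y
  by (intro alt_sum alt_cmult contr_alt form_alt[OF th])
 show "e2 p l th \<in> Om p" unfolding e2_def
  by (rule fext_forms[OF alt]) (intro sm_sum sm_mult oc[OF c0] smooth_cs form_smooth[OF th c0])
 show "e2 p l th c0 y b = (y $ l - y0 $ l) * e1 p th c0 y b" if "y \<in> U0"
  unfolding e2_def e1_forms(2)[OF th that] using fext_near[OF alt that] by simp
qed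

lemma x0_ov:
 assumes "c \<in> \<A>" "x0 \<in> cdom c"
 shows "coord c x0 \<in> ov c c0" "tr c c0 (coord c x0) = y0" "coord c x0 \<in> cimg c" "cinv c (coord c x0) = x0"
 using assms cinv_in[OF y0] coord_cinv[OF y0] cinv_coord[OF assms] by auto

text \<open>The form vanishes at \<open>x0\<close>, so its first derivatives there transform without
  derivatives of the Jacobian. The formula thus holds in every chart around the point and not only
  in the one used for the construction.\<close>

lemma e1_jet:
 assumes th: "th \<in> Om (Suc p)" and c: "c \<in> \<A>" "x0 \<in> cdom c" and b: "length b = p"
 shows "e1 p th c (coord c x0) b = 0" "pd i (%z. e1 p th c z b) (coord c x0) = th c (coord c x0) (i # b)"
proof -
 let ?y = "coord c x0"
 note y = x0_ov[OF c] and F = e1_forms[OF th]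
 note S = oc[OF c0]
 have 0: "e1 p th c0 y0 J = 0" for J using F(2)[OF U0(2)] by simp
 have 1: "pd m (%z. e1 p th c0 z J) y0 = th c0 y0 (m # J)" for m J
 proof -
  have f: "Sm S0 (%z. th c0 z (j # J))" for j by (rule form_smooth[OF th c0])
  note d = sm_diffble[OF _ S y0]
  have "pd m (%z. e1 p th c0 z J) y0 = pd m (%z. SU j. (z $ j - y0 $ j) * th c0 z (j # J)) y0"
   by (rule pd_cong[OF U0(1,2)]) (rule F(2))
  also have "... = (SU j. pd m (%z. (z $ j - y0 $ j) * th c0 z (j # J)) y0)"
   by (intro pd_sum finite_class.finite_UNIV d sm_mult S smooth_cs f)
  also have "... = (SU j. if m = j then th c0 y0 (j # J) else 0)"
   by (rule scong) (simp add: pd_mult[OF d[OF smooth_cs] d[OF f]] pd_coord_shift)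
  finally show ?thesis by simp
 qed
 have "e1 p th c ?y b = pb p (Jac c c0 ?y) (e1 p th c0 y0) b"
  using form_tr[OF F(1) c(1) c0 y(1)] unfolding y(2) by simp
 then show "e1 p th c ?y b = 0" by (simp add: pb_def 0)
 have "pd i (%z. e1 p th c z b) ?y = (\<Sum>J\<in>Ls p. (\<Prod>s<p. Jac c c0 ?y (b ! s) (J ! s)) * (SU m. Jac c c0 ?y i m * th c0 y0 (m # J)))"
  unfolding form_pd_tr[OF F(1) c(1) c0 y(1) b] y(2) 0 1 by simp
 also have "... = (\<Sum>J\<in>Ls p. SU m. Jac c c0 ?y i m * (\<Prod>s<p. Jac c c0 ?y (b ! s) (J ! s)) * th c0 y0 (m # J))"
  by (simp add: sum_distrib_left mult_ac)
 also have "... = (SU m. \<Sum>J\<in>Ls p. Jac c c0 ?y i m * (\<Prod>s<p. Jac c c0 ?y (b ! s) (J ! s)) * th c0 y0 (m # J))"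
  by (rule sum.swap)
 also have "... = pb (Suc p) (Jac c c0 ?y) (th c0 y0) (i # b)"
  unfolding pb_def sum_lists_Suc prod.lessThan_Suc_shift by (simp add: b del: prod.lessThan_Suc)
 also have "... = th c ?y (i # b)" using form_tr[OF th c(1) c0 y(1)] unfolding y(2) by simp
 finally show "pd i (%z. e1 p th c z b) ?y = th c ?y (i # b)" .
qed

text \<open>The same mechanism one order higher: the form is a product of a function and of
  \<open>e1\<close>, both vanishing at \<open>x0\<close>. The only trace of the chart
  \<open>c0\<close> is the coordinate function \<open>l\<close>, which enters by its
  differential.\<close>

lemma e2_jet:
 assumes th: "th \<in> Om (Suc p)" and c: "c \<in> \<A>" "x0 \<in> cdom c" and b: "length b = p"
 shows "e2 p l th c (coord c x0) b = 0" "pd i (%z. e2 p l th c z b) (coord c x0) = 0"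
  "pd i (pd j (%z. e2 p l th c z b)) (coord c x0) =
   Jac c c0 (coord c x0) i l * th c (coord c x0) (j # b) + Jac c c0 (coord c x0) j l * th c (coord c x0) (i # b)"
proof -
 let ?y = "coord c x0"
 note y = x0_ov[OF c] and F = e2_forms(1)[OF th, of l] and F1 = e1_forms(1)[OF th]
 \<comment> \<open>On this neighbourhood the cutoff equals 1, so the product formula for
   \<open>e2\<close> holds in the chart \<open>c\<close>.\<close>
 let ?N = "ov c c0 \<inter> tr c c0 -` U0"
 let ?f = "%z. transition c c0 l z - y0 $ l" and ?h = "%z. e1 p th c z b"
 have "continuous_on (ov c c0) (%z. \<chi> j. transition c c0 j z)"
  by (intro continuous_on_vec_lambda sm_continuous sm_transition c0 c(1))
 then have "continuous_on (ov c c0) (tr c c0)" unfolding tr_vec .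
 then have N: "open ?N" by (rule continuous_open_preimage[OF _ open_ov[OF c(1) c0] U0(1)])
 have yN: "?y \<in> ?N" using y U0(2) by simp
 have NS: "?N \<subseteq> ov c c0" "?N \<subseteq> cimg c" by auto
 have fs: "Sm ?N ?f"
  by (intro sm_diff N sm_const sm_subset[OF open_ov[OF c(1) c0] NS(1) sm_transition[OF c(1) c0]])
 have hs: "Sm ?N ?h" by (rule sm_subset[OF oc[OF c(1)] NS(2) form_smooth[OF F1 c(1)]])
 have e: "e2 p l th c z b = ?f z * ?h z" if "z \<in> ?N" for z
 proof -
  have z: "z \<in> ov c c0" "tr c c0 z \<in> U0" using that by auto
  have "e2 p l th c z b = pb p (Jac c c0 z) (e2 p l th c0 (tr c c0 z)) b"
   unfolding form_tr[OF F c(1) c0 z(1)] ..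
  also have "... = (\<Sum>J\<in>Ls p. (\<Prod>s<p. Jac c c0 z (b ! s) (J ! s)) * (?f z * e1 p th c0 (tr c c0 z) J))"
   unfolding pb_def e2_forms(2)[OF th z(2)] by (simp add: b transition_def)
  also have "... = ?f z * pb p (Jac c c0 z) (e1 p th c0 (tr c c0 z)) b"
   unfolding pb_def by (simp add: b sum_distrib_left mult_ac)
  also have "... = ?f z * ?h z" unfolding form_tr[OF F1 c(1) c0 z(1)] ..
  finally show ?thesis .
 qed
 have f0: "?f ?y = 0" using y(2) by (simp add: transition_def)
 note h0 = e1_jet[OF th c b]
 have J: "pd i ?f ?y = Jac c c0 ?y i l" for i
  using sm_diffble[OF sm_transition[OF c(1) c0] open_ov[OF c(1) c0] y(1)]
  by (simp add: pd_diff)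
 have p1: "pd j (%z. e2 p l th c z b) z = ?f z * pd j ?h z + pd j ?f z * ?h z" if z: "z \<in> ?N" for j z
 proof -
  have "pd j (%z. e2 p l th c z b) z = pd j (%z. ?f z * ?h z) z" by (rule pd_cong[OF N z e])
  then show ?thesis
   unfolding pd_mult[OF sm_diffble[OF fs N z] sm_diffble[OF hs N z]] .
 qed
 show "e2 p l th c ?y b = 0" unfolding e[OF yN] f0 by simp
 show "pd i (%z. e2 p l th c z b) ?y = 0" unfolding p1[OF yN] f0 h0 by simp
 have d: "g differentiable at ?y" if "Sm ?N g" for g by (rule sm_diffble[OF that N yN])
 have "pd i (pd j (%z. e2 p l th c z b)) ?y = pd i (%z. ?f z * pd j ?h z + pd j ?f z * ?h z) ?y"
  by (rule pd_cong[OF N yN p1])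
 also have "... = pd i (%z. ?f z * pd j ?h z) ?y + pd i (%z. pd j ?f z * ?h z) ?y"
  by (rule pd_add) (intro d sm_mult N fs hs sm_pd)+
 also have "... = Jac c c0 ?y i l * th c ?y (j # b) + Jac c c0 ?y j l * th c ?y (i # b)"
  unfolding pd_mult[OF d[OF fs] d[OF sm_pd[OF hs]]] pd_mult[OF d[OF sm_pd[OF fs]] d[OF hs]]
  unfolding f0 h0 J by simp
 finally show "pd i (pd j (%z. e2 p l th c z b)) ?y = Jac c c0 ?y i l * th c ?y (j # b) + Jac c c0 ?y j l * th c ?y (i # b)" .
qed

end

abbreviation mult2 :: "'n => 'n => real" where
 "mult2 i j \<equiv> (if i = j then 2 else 1)"

context mfd
begin

lemma coeffs_top:
 assumes A: "Lc k p D c A" and om: "om \<in> Om p" and y: "y \<in> cimg c"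
  and 0: "!!al b. size al < k ==> length b = p ==> mpd al (%z. om c z b) y = 0"
 shows "D om (cinv c y) = (\<Sum>al | size al = k. pairing p (A al y) (%b. mpd al (%z. om c z b) y))"
proof -
 have "D om (cinv c y) = (\<Sum>al | size al \<le> k. pairing p (A al y) (%I. mpd al (%z. om c z I) y))"
  using A om y unfolding local_coeffs_def by blast
 also have "... = (\<Sum>al | size al = k. pairing p (A al y) (%b. mpd al (%z. om c z b) y))"
  by (rule sum.mono_neutral_right) (auto simp: pairing_def 0)
 finally show ?thesis .
qed

text \<open>Pairing of the Koszul image of the symbol with coefficients \<open>a\<close> against a
  form \<open>w\<close> of one degree more, rewritten by \<open>pairing_wedge\<close> so that no
  wedge appears.\<close>

definition contr :: "nat => ('n => real^'n => 'n list => real) => (real^'n => 'n list => real) => real^'n => real" where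
 "contr p a w y = (SU i. pairing p (a i y) (%b. w y (i # b)))"

abbreviation co1 :: "('n multiset => real^'n => 'n list => real) => 'n => real^'n => 'n list => real" where
 "co1 A \<equiv> %i. A {#i#}"

text \<open>The coefficient of xi_l in the derivative of a quadratic symbol with respect to xi_i;
  the weight on the diagonal is the 2 from differentiating a square.\<close>

abbreviation co2 :: "('n multiset => real^'n => 'n list => real) => 'n => 'n => real^'n => 'n list => real" where
 "co2 A l \<equiv> %i y b. mult2 l i * A {#l, i#} y b"

lemma pairing_cmult_left: "pairing p (%b. r * a b) w = r * pairing p a w"
 by (simp add: pairing_def sum_distrib_left mult.assoc)

lemma pairing_cmult_right: "pairing p a (%b. r * w b) = r * pairing p a w"
 by (simp add: pairing_def sum_distrib_left mult_ac)

lemma pairing_add_right: "pairing p a (%b. w b + w' b) = pairing p a w + pairing p a w'"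
 by (simp add: pairing_def distrib_left sum.distrib add_divide_distrib)

lemma pairing_add_left: "pairing p (%b. a b + a' b) w = pairing p a w + pairing p a' w"
 by (simp add: pairing_def distrib_right sum.distrib add_divide_distrib)

end

context mpt
begin

text \<open>The left-hand side does not refer to the chart \<open>c\<close>, so the contracted
  symbol is the same in all charts around the point.\<close>

lemma e1_value:
 assumes th: "th \<in> Om (Suc p)" and c: "c \<in> \<A>" "x0 \<in> cdom c" and A: "Lc 1 p D c A"
 shows "D (e1 p th) x0 = contr p (co1 A) (th c) (coord c x0)"
proof -
 note y = x0_ov[OF c] and F = e1_forms(1)[OF th]
 have "D (e1 p th) (cinv c (coord c x0)) = (\<Sum>al | size al = 1. pairing p (A al (coord c x0)) (%b. mpd al (%z. e1 p th c z b) (coord c x0)))"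
  by (rule coeffs_top[OF A F y(3)]) (simp add: e1_jet[OF th c])
 also have "... = contr p (co1 A) (th c) (coord c x0)"
  unfolding sum_size_1 contr_def mpd_single
  by (rule scong) (simp add: pairing_def e1_jet[OF th c])
 finally show ?thesis unfolding y(4) .
qed

lemma mpd_size_2: 
 assumes "open S" "Sm S f" "y \<in> S"
 shows "mpd {#i, j#} f y = pd i (pd j f) y"
 using mpd_add_mset[OF assms, of i "{#j#}"] by (simp add: mpd_single)

lemma mpd_e2:
 assumes th: "th \<in> Om (Suc p)" and c: "c \<in> \<A>" "x0 \<in> cdom c" and b: "length b = p"
 shows "size al < 2 ==> mpd al (%z. e2 p l th c z b) (coord c x0) = 0"
  "mpd {#i, j#} (%z. e2 p l th c z b) (coord c x0) =
   Jac c c0 (coord c x0) i l * th c (coord c x0) (j # b) + Jac c c0 (coord c x0) j l * th c (coord c x0) (i # b)"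
proof -
 note F = e2_forms(1)[OF th, of l]
 assume "size al < 2"
 then have "al = {#} \<or> (\<exists>i. al = {#i#})" by (cases al) (auto simp: numeral_2_eq_2)
 then show "mpd al (%z. e2 p l th c z b) (coord c x0) = 0"
  using e2_jet(1,2)[OF th c b] by (auto simp: mpd_single)
next
 show "mpd {#i, j#} (%z. e2 p l th c z b) (coord c x0) =
   Jac c c0 (coord c x0) i l * th c (coord c x0) (j # b) + Jac c c0 (coord c x0) j l * th c (coord c x0) (i # b)"
  unfolding mpd_size_2[OF oc[OF c(1)] form_smooth[OF e2_forms(1)[OF th] c(1)] x0_ov(3)[OF c]]
  by (rule e2_jet(3)[OF th c b])
qed

text \<open>The chart \<open>c\<close> enters the right-hand side through a Jacobian in the index
  \<open>l\<close>. This is the transformation law of a vector: the contracted quadratic symbol is a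
  vector field.\<close>

lemma e2_value:
 assumes th: "th \<in> Om (Suc p)" and c: "c \<in> \<A>" "x0 \<in> cdom c" and A: "Lc 2 p D c A"
 shows "D (e2 p l th) x0 = (SU i. Jac c c0 (coord c x0) i l * contr p (co2 A i) (th c) (coord c x0))"
proof -
 note y = x0_ov[OF c] and F = e2_forms(1)[OF th, of l]
 let ?y = "coord c x0" and ?J = "Jac c c0 (coord c x0)"
 let ?P = "%i j. ?J i l * (mult2 i j * pairing p (A {#i, j#} ?y) (%b. th c ?y (j # b)))"
 have "D (e2 p l th) (cinv c ?y) = (\<Sum>al | size al = 2. pairing p (A al ?y) (%b. mpd al (%z. e2 p l th c z b) ?y))"
  by (rule coeffs_top[OF A F y(3)]) (rule mpd_e2(1)[OF th c])
 also have "... = 1/2 * (SU i j. ?P i j + ?P j i)"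
  unfolding sum_size_2
 proof (intro arg_cong2[where f = "(*)"] sum.cong refl)
  fix i j
  have "pairing p (A {#i, j#} ?y) (%b. mpd {#i, j#} (%z. e2 p l th c z b) ?y) =
    pairing p (A {#i, j#} ?y) (%b. ?J i l * th c ?y (j # b) + ?J j l * th c ?y (i # b))"
   unfolding pairing_def by (simp add: mpd_e2(2)[OF th c])
  then show "(if i = j then 2 else 1) * pairing p (A {#i, j#} ?y) (%b. mpd {#i, j#} (%z. e2 p l th c z b) ?y) = ?P i j + ?P j i"
   unfolding pairing_add_right pairing_cmult_right by (simp add: algebra_simps add_mset_commute)
 qed
 also have "... = (SU i j. ?P i j)"
  using sum.swap[of "%i j. ?P j i" UNIV UNIV] by (simp add: sum.distrib)
 also have "... = (SU i. ?J i l * contr p (co2 A i) (th c) ?y)"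
  unfolding contr_def pairing_cmult_left sum_distrib_left ..
 finally show ?thesis unfolding y(4) .
qed

lemma e2_value_self:
 assumes th: "th \<in> Om (Suc p)" and A: "Lc 2 p D c0 A"
 shows "D (e2 p l th) x0 = contr p (co2 A l) (th c0) y0"
 using e2_value[OF th c0 cinv_in[OF y0] A, of l] coord_cinv[OF y0] Jac_self[OF c0 y0]
 by (simp add: mult_if cong: if_cong)

end

context mfd
begin

lemma point_locale:
 assumes "c \<in> \<A>" "y \<in> cimg c"
 obtains r rh where "mpt X \<A> c y r rh"
 using mpt_exists[OF assms] by blast

lemma coeffs_exist:
 assumes "D \<in> DO k p" "c \<in> \<A>"
 obtains A where "Lc k p D c A"
 using assms unfolding diffops_le_def by blast

lemma contr_wedge:
 assumes a: "!!i. alternating p (a i y)" and w: "alternating (Suc p) (w y)"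
 shows "pairing (Suc p) (%I. SU i. wedge i (a i y) I) (w y) = contr p a w y"
 unfolding pairing_sum contr_def by (rule scong) (rule pairing_wedge[OF a w])

lemma koszul_1:
 assumes c: "c \<in> \<A>" "y \<in> cimg c" "Lc 1 p D c A"
 shows "koszul (principal_symbol \<A> 1 p D) c y 0 I = (SU i. wedge i (A {#i#} y) I)"
proof -
 have "(SU i. count {#i#} j * mon 0 ({#i#} - {#j#}) 0 * wedge j (A {#i#} y) I) = wedge j (A {#j#} y) I" for j
  by (subst sum.remove[of _ j]) auto
 then show ?thesis unfolding koszul_eq[OF c] sum_size_1 by simp
qed

lemma koszul_2:
 assumes c: "c \<in> \<A>" "y \<in> cimg c" "Lc 2 p D c A"
 shows "koszul (principal_symbol \<A> 2 p D) c y (axis l 1) I = (SU i. wedge i (co2 A l i y) I)"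
proof -
 have "(\<Sum>al | size al = 2. count al j * mon 0 (al - {#j#}) (axis l 1) * wedge j (A al y) I) = wedge j (co2 A l j y) I" for j
 proof -
  have z: "count al j * mon 0 (al - {#j#}) (axis l 1) * wedge j (A al y) I = 0"
   if s2: "size al = 2" and ne: "al ~= {#l, j#}" for al
  proof (cases "j \<in># al")
   case True
   then obtain be where "al = am j be" by (meson multi_member_split)
   moreover from this have "size be = 1" using s2 by simp
   then obtain u where "be = {#u#}" using size_1_singleton_mset by blast
   ultimately show ?thesis using ne by (auto simp: mon_def axis_def add_mset_commute)
  qed (simp add: not_in_iff)
  have "(\<Sum>al | size al = 2. count al j * mon 0 (al - {#j#}) (axis l 1) * wedge j (A al y) I) =
    (\<Sum>al\<in>{{#l, j#}}. count al j * mon 0 (al - {#j#}) (axis l 1) * wedge j (A al y) I)"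
   by (rule sum.mono_neutral_right) (use z in auto)
  also have "... = mult2 l j * wedge j (A {#l, j#} y) I"
   by (auto simp: mon_def axis_def)
  also have "... = wedge j (co2 A l j y) I"
   using wedge_linear[of j "%_::unit. mult2 l j" "%_. A {#l, j#} y" UNIV I] by (simp add: UNIV_unit)
  finally show ?thesis .
 qed
 then show ?thesis unfolding koszul_eq[OF c] by simp
qed

text \<open>The chart selected by \<open>glue\<close> is replaced by an arbitrary one: in both, the
  expression is the value of \<open>D\<close> on the test form \<open>e1 p th\<close>.\<close>

lemma K_map_1:
 assumes D: "D \<in> DO 1 p" and th: "th \<in> Om (Suc p)" and c: "c \<in> \<A>" and y: "y \<in> cimg c"
  and A: "Lc 1 p D c A"
 shows "Km 1 p D th (cinv c y) = contr p (co1 A) (th c) y"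
proof -
 let ?x = "cinv c y"
 have xp: "?x \<in> pts" by (rule cdom_points[OF c cinv_in[OF y]])
 let ?c = "idx ?x" and ?y = "coord (idx ?x) ?x"
 have c': "?c \<in> \<A>" "?x \<in> cdom ?c" using idx[OF xp] by auto
 have y': "?y \<in> cimg ?c" using c'(2) by (rule imageI)
 obtain r rh where "mpt X \<A> c y r rh" using point_locale[OF c y] .
 then interpret mpt X \<A> c y r rh .
 obtain A' where A': "Lc 1 p D ?c A'" using coeffs_exist[OF D c'(1)] .
 have alt: "alternating p (A' {#i#} ?y)" for i using A' y' unfolding local_coeffs_def by simp
 have "Km 1 p D th ?x = pairing (Suc p) (koszul (principal_symbol \<A> 1 p D) ?c ?y 0) (th ?c ?y)"
  using th xp by (simp add: K_map_def quantize0_def restrict0_def glue_eq)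
 also have "... = contr p (co1 A') (th ?c) ?y"
  unfolding koszul_1[OF c'(1) y' A', abs_def] by (rule contr_wedge[where a = "co1 A'" and w = "th ?c" and y = ?y, OF alt form_alt[OF th]])
 also have "... = D (e1 p th) ?x" by (rule e1_value[OF th c' A', symmetric])
 also have "... = contr p (co1 A) (th c) y"
  using e1_value[OF th c cinv_in[OF y] A] coord_cinv[OF y] by simp
 finally show ?thesis .
qed

end

section \<open>Lie derivative of the principal symbol\<close>

context mfd
begin

text \<open>On a form that vanishes to the order of \<open>D\<close> at a point, only the leading parts of \<open>D\<close> and of its Lie derivative are seen.\<close>

lemma lie_op_top:
 assumes D: "D \<in> DO k p" and V: "V \<in> Vect" and c: "c \<in> \<A>" and y: "y \<in> cimg c"
  and A: "Lc k p D c A" and om: "om \<in> Om p"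
  and 0: "!!al b. size al < k ==> length b = p ==> mpd al (%z. om c z b) y = 0"
 shows "LO p V D om (cinv c y) = (\<Sum>al | size al = k. (\<Sum>b\<in>Ls p.
  (SU m. V c y $ m * pd m (%z. A al z b) y) * mpd al (%z. om c z b) y -
  A al y b * ((\<Sum>x\<in>#al. SU i. pd x (%z. V c z $ i) y * mpd (am i (al - {#x#})) (%z. om c z b) y) +
  (\<Sum>s<p. SU j. pd (b ! s) (%z. V c z $ j) y * mpd al (%z. om c z (b[s := j])) y))) / fact p)"
proof -
 note S = oc[OF c] and Lom = lie_forms[OF om V]
 have As: "Sm (cimg c) (%z. A al z b)" if "size al \<le> k" for al b using A that unfolding local_coeffs_def by blast
 have d: "f differentiable at y" if "Sm (cimg c) f" for f by (rule sm_diffble[OF that S y])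
 have f: "Sm (cimg c) (mpd al (%z. om c z b))" for al b by (rule sm_mpd[OF form_smooth[OF om c]])
 have E: "D th (cinv c z) = (\<Sum>al | size al \<le> k. (\<Sum>b\<in>Ls p. A al z b * mpd al (%z. th c z b) z) / fact p)"
  if "th \<in> Om p" "z \<in> cimg c" for th z
  using A that unfolding local_coeffs_def pairing_def by blast
 let ?X = "%al b. \<Sum>x\<in>#al. SU i. pd x (%z. V c z $ i) y * mpd (am i (al - {#x#})) (%z. om c z b) y"
 let ?Y = "%al b. \<Sum>s<p. SU j. pd (b ! s) (%z. V c z $ j) y * mpd al (%z. om c z (b[s := j])) y"
 let ?VA = "%al b. SU m. V c y $ m * pd m (%z. A al z b) y"
 \<comment> \<open>This is \<open>lie_word\<close>; its remainder involves only derivatives of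
   \<open>om\<close> of order below \<open>k\<close>, which vanish at \<open>y\<close>.\<close>
 have w: "(SU i. V c y $ i * pd i (mpd al (%z. om c z b)) y) - mpd al (%z. LF V om c z b) y = - (?X al b + ?Y al b)"
  if al: "size al \<le> k" and b: "length b = p" for al b
 proof -
  interpret jets "Om p" "%om b z. om c z b" "(Ls p)" "cimg c"
   by (rule jets_forms[OF c S]) simp
  obtain e where "!!w z. w \<in> Om p ==> z \<in> cimg c ==>
    (SU i. V c z $ i * pd i (mpd al (%z. w c z b)) z) - mpd al (%z. LF V w c z b) z +
    (\<Sum>x\<in>#al. SU i. pd x (%z. V c z $ i) z * mpd (am i (al - {#x#})) (%z. w c z b) z) +
    (\<Sum>s<p. SU j. pd (b ! s) (%z. V c z $ j) z * mpd al (%z. w c z (b[s := j])) z) =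
    (\<Sum>be | size be < size al. \<Sum>b\<in>(Ls p). e be b z * mpd be (%z. w c z b) z)"
   using lie_word[OF V c b, of al] unfolding dop_def by blast
  from this[OF om y] have "(SU i. V c y $ i * pd i (mpd al (%z. om c z b)) y) - mpd al (%z. LF V om c z b) y + ?X al b + ?Y al b =
    (\<Sum>be | size be < size al. \<Sum>b\<in>(Ls p). e be b y * mpd be (%z. om c z b) y)" .
  also have "... = 0" by (intro sum.neutral ballI) (use al 0 in auto)
  finally show ?thesis by linarith
 qed
 have pD: "pd m (%z. D om (cinv c z)) y = (\<Sum>al | size al \<le> k. (\<Sum>b\<in>Ls p.
   A al y b * pd m (mpd al (%z. om c z b)) y + pd m (%z. A al z b) y * mpd al (%z. om c z b) y) / fact p)" for m
 proof -
  have "pd m (%z. D om (cinv c z)) y = pd m (%z. \<Sum>al | size al \<le> k. 1 / fact p * (\<Sum>b\<in>Ls p. A al z b * mpd al (%z. om c z b) z)) y"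
   by (rule pd_cong[OF S y]) (simp add: E[OF om])
  also have "... = (\<Sum>al | size al \<le> k. pd m (%z. 1 / fact p * (\<Sum>b\<in>Ls p. A al z b * mpd al (%z. om c z b) z)) y)"
   by (rule pd_sum[OF finite_multisets_le]) (intro d sm_mult S sm_const sm_sum As f, simp)
  also have "... = (\<Sum>al | size al \<le> k. 1 / fact p * (\<Sum>b\<in>Ls p. pd m (%z. A al z b * mpd al (%z. om c z b) z) y))"
  proof (rule scong)
   fix al :: "'n multiset" assume "al \<in> {al. size al \<le> k}"
   then have al: "size al \<le> k" by simp
   have "pd m (%z. 1 / fact p * (\<Sum>b\<in>Ls p. A al z b * mpd al (%z. om c z b) z)) y =
     1 / fact p * pd m (%z. \<Sum>b\<in>Ls p. A al z b * mpd al (%z. om c z b) z) y"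
    by (rule pd_cmult) (intro d sm_sum sm_mult S As[OF al] f)
   also have "pd m (%z. \<Sum>b\<in>Ls p. A al z b * mpd al (%z. om c z b) z) y = (\<Sum>b\<in>Ls p. pd m (%z. A al z b * mpd al (%z. om c z b) z) y)"
    by (rule pd_sum) (auto intro!: d sm_mult S As[OF al] f)
   finally show "pd m (%z. 1 / fact p * (\<Sum>b\<in>Ls p. A al z b * mpd al (%z. om c z b) z)) y =
     1 / fact p * (\<Sum>b\<in>Ls p. pd m (%z. A al z b * mpd al (%z. om c z b) z) y)" .
  qed
  also have "... = (\<Sum>al | size al \<le> k. (\<Sum>b\<in>Ls p.
   A al y b * pd m (mpd al (%z. om c z b)) y + pd m (%z. A al z b) y * mpd al (%z. om c z b) y) / fact p)"
   by (intro sum.cong refl) (simp add: pd_mult[OF d[OF As] d[OF f]])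
  finally show ?thesis .
 qed
 have "LO p V D om (cinv c y) = (SU m. V c y $ m * pd m (%z. D om (cinv c z)) y) - D (LF V om) (cinv c y)"
  by (rule lie_op_chart[OF D V c om y])
 also have "(SU m. V c y $ m * pd m (%z. D om (cinv c z)) y) = (\<Sum>al | size al \<le> k. (\<Sum>b\<in>Ls p.
   A al y b * (SU m. V c y $ m * pd m (mpd al (%z. om c z b)) y) + ?VA al b * mpd al (%z. om c z b) y) / fact p)"
 proof -
  have "(SU m. V c y $ m * pd m (%z. D om (cinv c z)) y) = (SU m. \<Sum>al | size al \<le> k. \<Sum>b\<in>Ls p.
   V c y $ m * (A al y b * pd m (mpd al (%z. om c z b)) y + pd m (%z. A al z b) y * mpd al (%z. om c z b) y) / fact p)"
   unfolding pD by (simp add: sum_distrib_left sum_divide_distrib)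
  also have "... = (\<Sum>al | size al \<le> k. SU m. \<Sum>b\<in>Ls p.
   V c y $ m * (A al y b * pd m (mpd al (%z. om c z b)) y + pd m (%z. A al z b) y * mpd al (%z. om c z b) y) / fact p)"
   by (rule sum.swap)
  also have "... = (\<Sum>al | size al \<le> k. \<Sum>b\<in>Ls p. SU m.
   V c y $ m * (A al y b * pd m (mpd al (%z. om c z b)) y + pd m (%z. A al z b) y * mpd al (%z. om c z b) y) / fact p)"
   by (rule scong) (rule sum.swap)
  also have "... = (\<Sum>al | size al \<le> k. (\<Sum>b\<in>Ls p.
   A al y b * (SU m. V c y $ m * pd m (mpd al (%z. om c z b)) y) + ?VA al b * mpd al (%z. om c z b) y) / fact p)"
   unfolding sum_divide_distrib
   by (intro sum.cong refl) (simp add: sum_distrib_left sum_distrib_right sum_divide_distrib sum.distrib distrib_left add_divide_distrib mult_ac)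
  finally show ?thesis .
 qed
 also have "... - D (LF V om) (cinv c y) = (\<Sum>al | size al \<le> k. (\<Sum>b\<in>Ls p.
   ?VA al b * mpd al (%z. om c z b) y - A al y b * (?X al b + ?Y al b)) / fact p)"
  unfolding E[OF Lom y] sum_subtractf[symmetric] diff_divide_distrib[symmetric]
 proof (intro sum.cong refl arg_cong2[where f = "(/)"], goal_cases)
  case (1 al b)
  then have "size al \<le> k" "length b = p" by auto
  from w[OF this] have w': "(SU i. V c y $ i * pd i (mpd al (%z. om c z b)) y) = mpd al (%z. LF V om c z b) y - (?X al b + ?Y al b)"
   by linarith
  show ?case unfolding w' by (simp only: algebra_simps)
 qed
 also have "... = (\<Sum>al | size al = k. (\<Sum>b\<in>Ls p.
   ?VA al b * mpd al (%z. om c z b) y - A al y b * (?X al b + ?Y al b)) / fact p)"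
 proof (rule sum.mono_neutral_right)
  show "\<forall>al\<in>{al. size al \<le> k} - {al. size al = k}. (\<Sum>b\<in>Ls p.
   ?VA al b * mpd al (%z. om c z b) y - A al y b * (?X al b + ?Y al b)) / fact p = 0"
  proof
   fix al :: "'n multiset" assume "al \<in> {al. size al \<le> k} - {al. size al = k}"
   then have al: "size al < k" by auto
   have "?X al b = 0" if b: "length b = p" for b
   proof -
    have "mpd (am i (al - {#x#})) (%z. om c z b) y = 0" if "x \<in># al" for x i
     using 0[of "am i (al - {#x#})" b] al b that by (metis insert_DiffM size_add_mset)
    then have "(\<Sum>x\<in>#al. SU i. pd x (%z. V c z $ i) y * mpd (am i (al - {#x#})) (%z. om c z b) y) = (\<Sum>x\<in>#al. 0)"
     by (intro arg_cong[where f = sum_mset] image_mset_cong) simp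
    then show ?thesis by simp
   qed
   moreover have "?Y al b = 0" if "length b = p" for b
    by (intro sum.neutral ballI) (simp add: 0[OF al] that)
   moreover have "mpd al (%z. om c z b) y = 0" if "length b = p" for b by (rule 0[OF al that])
   ultimately have "(\<Sum>b\<in>Ls p. ?VA al b * mpd al (%z. om c z b) y - A al y b * (?X al b + ?Y al b)) = 0"
    by (intro sum.neutral ballI) simp
   then show "(\<Sum>b\<in>Ls p. ?VA al b * mpd al (%z. om c z b) y - A al y b * (?X al b + ?Y al b)) / fact p = 0" by simp
  qed
 qed auto
 finally show ?thesis .
qed

text \<open>The Lie derivative of the tensor field \<open>a\<close> contracted with
  \<open>th\<close>, with the derivations of the field moved from the upper indices of
  \<open>a\<close> to the slots of \<open>th\<close>.\<close>

definition clie :: "('a, 'n) vfield => nat => ('n => real^'n => 'n list => real) => ('a, 'n) form => ('a, 'n) chart => real^'n => real" where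
 "clie V p a th c y = (SU i. (\<Sum>b\<in>Ls p. (SU m. V c y $ m * pd m (%z. a i z b) y) * th c y (i # b) -
  a i y b * ((SU l. pd i (%z. V c z $ l) y * th c y (l # b)) +
  (\<Sum>s<p. SU j. pd (b ! s) (%z. V c z $ j) y * th c y (i # b[s := j])))) / fact p)"

text \<open>The Leibniz rule for the contraction: the derivatives of \<open>th\<close> cancel, and
  only derivatives of \<open>a\<close> and of \<open>V\<close> stay.\<close>

lemma contr_lie:
 assumes th: "th \<in> Om (Suc p)" and V: "V \<in> Vect" and c: "c \<in> \<A>" and y: "y \<in> cimg c"
  and a: "!!i b. Sm (cimg c) (%z. a i z b)"
 shows "(SU m. V c y $ m * pd m (%z. contr p a (th c) z) y) - contr p a (LF V th c) y = clie V p a th c y"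
proof -
 note S = oc[OF c]
 have d: "f differentiable at y" if "Sm (cimg c) f" for f by (rule sm_diffble[OF that S y])
 have f: "Sm (cimg c) (%z. th c z B)" for B by (rule form_smooth[OF th c])
 have pc: "pd m (%z. contr p a (th c) z) y = (SU i. (\<Sum>b\<in>Ls p. a i y b * pd m (%z. th c z (i # b)) y + pd m (%z. a i z b) y * th c y (i # b)) / fact p)" for m
 proof -
  have "pd m (%z. contr p a (th c) z) y = pd m (%z. SU i. 1 / fact p * (\<Sum>b\<in>Ls p. a i z b * th c z (i # b))) y"
   by (simp add: contr_def pairing_def)
  also have "... = (SU i. pd m (%z. 1 / fact p * (\<Sum>b\<in>Ls p. a i z b * th c z (i # b))) y)"
   by (intro pd_sum finite_class.finite_UNIV d sm_mult S sm_const sm_sum a f)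
  also have "... = (SU i. 1 / fact p * pd m (%z. \<Sum>b\<in>Ls p. a i z b * th c z (i # b)) y)"
   by (intro sum.cong refl pd_cmult d sm_mult S sm_sum a f)
  also have "... = (SU i. 1 / fact p * (\<Sum>b\<in>Ls p. pd m (%z. a i z b * th c z (i # b)) y))"
   by (intro sum.cong refl arg_cong2[where f = "(*)"] pd_sum finite_lists_length d sm_mult S a f)
  finally show ?thesis by (simp add: pd_mult[OF d[OF a] d[OF f]])
 qed
 have L: "LF V th c y (i # b) = (SU m. V c y $ m * pd m (%z. th c z (i # b)) y) + ((SU l. pd i (%z. V c z $ l) y * th c y (l # b)) +
  (\<Sum>s<p. SU j. pd (b ! s) (%z. V c z $ j) y * th c y (i # b[s := j])))" if "length b = p" for i b
 proof -
  have "length (i # b) = Suc p" using that by simp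
  from lie_form_chart[OF th c y this, of V] show ?thesis unfolding sum.lessThan_Suc_shift by simp
 qed
 have "(SU m. V c y $ m * pd m (%z. contr p a (th c) z) y) = (SU m i. \<Sum>b\<in>Ls p.
   V c y $ m * (a i y b * pd m (%z. th c z (i # b)) y + pd m (%z. a i z b) y * th c y (i # b)) / fact p)"
  unfolding pc by (simp add: sum_distrib_left sum_divide_distrib)
 also have "... = (SU i m. \<Sum>b\<in>Ls p.
   V c y $ m * (a i y b * pd m (%z. th c z (i # b)) y + pd m (%z. a i z b) y * th c y (i # b)) / fact p)" by (rule sum.swap)
 also have "... = (SU i. \<Sum>b\<in>Ls p. SU m.
   V c y $ m * (a i y b * pd m (%z. th c z (i # b)) y + pd m (%z. a i z b) y * th c y (i # b)) / fact p)"
  by (rule scong) (rule sum.swap)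
 also have "... - contr p a (LF V th c) y = clie V p a th c y"
  unfolding contr_def pairing_def clie_def sum_divide_distrib sum_subtractf[symmetric]
 proof (intro sum.cong refl, goal_cases)
  case (1 i b)
  then have b: "length b = p" by simp
  show ?case unfolding L[OF b]
   by (simp add: sum_distrib_left sum_distrib_right sum_divide_distrib sum.distrib distrib_left right_diff_distrib add_divide_distrib diff_divide_distrib mult_ac)
 qed
 finally show ?thesis .
qed

lemma coeffs_smooth: "Lc k p D c A ==> size al \<le> k ==> Sm (cimg c) (%z. A al z b)"
 and coeffs_alt: "Lc k p D c A ==> size al \<le> k ==> y \<in> cimg c ==> alternating p (A al y)"
 unfolding local_coeffs_def by blast+

text \<open>The symbol of the Lie derivative is read off by applying \<open>lie_op_top\<close> to
  the test form \<open>e1\<close>, whose jet is known; this avoids computing the coefficients of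
  \<open>LO p V D\<close>.\<close>

lemma contr_lie_1:
 assumes D: "D \<in> DO 1 p" and V: "V \<in> Vect" and th: "th \<in> Om (Suc p)" and c: "c \<in> \<A>" and y: "y \<in> cimg c"
  and A: "Lc 1 p D c A" "Lc 1 p (LO p V D) c A'"
 shows "contr p (co1 A') (th c) y = clie V p (co1 A) th c y"
proof -
 obtain r rh where "mpt X \<A> c y r rh" using point_locale[OF c y] .
 then interpret mpt X \<A> c y r rh .
 have x: "x0 \<in> cdom c" "coord c x0 = y" using cinv_in[OF y] coord_cinv[OF y] by auto
 note J = e1_jet[OF th c x(1), unfolded x(2)]
 have "contr p (co1 A') (th c) y = LO p V D (e1 p th) x0"
  using e1_value[OF th c x(1) A(2)] unfolding x(2) by simp
 also have "... = clie V p (co1 A) th c y"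
  by (subst lie_op_top[OF D V c y A(1) e1_forms(1)[OF th]], simp add: J)
   (simp only: sum_size_1 clie_def, intro sum.cong refl arg_cong2[where f = "(/)"], simp add: mpd_single J)
 finally show ?thesis .
qed

text \<open>A quadratic symbol keeps one free index \<open>l\<close> after the Koszul differential.
  The additional term is the Lie derivative acting on this vector index.\<close>

lemma contr_lie_2:
 assumes D: "D \<in> DO 2 p" and V: "V \<in> Vect" and th: "th \<in> Om (Suc p)" and c: "c \<in> \<A>" and y: "y \<in> cimg c"
  and A: "Lc 2 p D c A" "Lc 2 p (LO p V D) c A'"
 shows "contr p (co2 A' l) (th c) y = clie V p (co2 A l) th c y - (SU u. pd u (%z. V c z $ l) y * contr p (co2 A u) (th c) y)"
proof -
 obtain r rh where "mpt X \<A> c y r rh" using point_locale[OF c y] .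
 then interpret mpt X \<A> c y r rh .
 have x: "x0 \<in> cdom c" "coord c x0 = y" using cinv_in[OF y] coord_cinv[OF y] by auto
 note S = oc[OF c]
 note F = e2_forms(1)[OF th, of l]
 define E where "E u v b = (if u = l then th c y (v # b) else 0)" for u v b
 have m1: "mpd al (%z. e2 p l th c z b) y = 0" if "size al < 2" "length b = p" for al b
  using mpd_e2(1)[OF th c x(1) that(2,1)] unfolding x(2) .
 have m2: "mpd {#u, v#} (%z. e2 p l th c z b) y = E u v b + E v u b" if "length b = p" for u v b
  using mpd_e2(2)[OF th c x(1) that, of u v] unfolding x(2) by (simp add: E_def Jac_self[OF c y])
 let ?VA = "%al b. SU m. V c y $ m * pd m (%z. A al z b) y"
 let ?Y = "%v b. \<Sum>s<p. SU j. pd (b ! s) (%z. V c z $ j) y * th c y (v # b[s := j])"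
 let ?dV = "%u i. pd u (%z. V c z $ i) y"
 let ?H = "%u v b. mult2 u v * (?VA {#u, v#} b * th c y (v # b) -
  A {#u, v#} y b * ((SU i. ?dV v i * th c y (i # b)) + ?Y v b))"
 \<comment> \<open>The sum over multisets of size two is half the sum over ordered pairs, taken in
   both orders. Collecting by the first index \<open>u\<close> separates the part with
   \<open>u = l\<close>, which is \<open>clie\<close>, from the action on the free index.\<close>
 define F' where "F' u v = ((\<Sum>b\<in>Ls p. (if u = l then ?H u v b else 0) - mult2 u v * A {#u, v#} y b * (?dV u l * th c y (v # b))) / fact p)" for u v
 have "contr p (co2 A' l) (th c) y = LO p V D (e2 p l th) x0"
  by (rule e2_value_self[OF th A(2), symmetric])
 also have "... = 1/2 * (SU u v. F' u v + F' v u)"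
 proof (subst lie_op_top[OF D V c y A(1) F m1], assumption, assumption, subst sum_size_2,
   intro arg_cong2[where f = "(*)"] sum.cong refl, goal_cases)
  case (1 u v)
  have vu: "{#v, u#} = {#u, v#}" "mult2 v u = mult2 u v" by (auto simp: add_mset_commute)
  have sE: "(SU i. ?dV w i * E i w' b) = ?dV w l * th c y (w' # b)"
   "(SU i. ?dV w i * E w' i b) = (if w' = l then SU i. ?dV w i * th c y (i # b) else 0)" for w w' b
   by (simp_all add: E_def if_distrib[of "%x. _ * x"] cong: if_cong)
  have Xe: "(\<Sum>x\<in>#{#u, v#}. SU i. ?dV x i * mpd (am i ({#u, v#} - {#x#})) (%z. e2 p l th c z b) y) =
   ?dV u l * th c y (v # b) + (if v = l then SU i. ?dV u i * th c y (i # b) else 0) +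
   (?dV v l * th c y (u # b) + (if u = l then SU i. ?dV v i * th c y (i # b) else 0))" if "length b = p" for b
  proof -
   have e: "{#u, v#} - {#u#} = {#v#}" "{#u, v#} - {#v#} = {#u#}" by auto
   show ?thesis by (simp only: image_mset_add_mset sum_mset.add_mset image_mset_empty sum_mset.empty e m2[OF that]
    distrib_left sum.distrib sE add_0_right)
  qed
  have Ye: "(\<Sum>s<p. SU j. pd (b ! s) (%z. V c z $ j) y * mpd {#u, v#} (%z. e2 p l th c z (b[s := j])) y) =
   (if u = l then ?Y v b else 0) + (if v = l then ?Y u b else 0)" if "length b = p" for b
   using that by (simp add: m2 E_def distrib_left sum.distrib if_distrib[of "%x. _ * x"] cong: if_cong)
  show ?case
   unfolding F'_def vu add_divide_distrib[symmetric] sum.distrib[symmetric] times_divide_eq_right sum_distrib_left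
  proof (intro arg_cong2[where f = "(/)"] sum.cong refl, goal_cases)
   case (1 b)
   then have b: "length b = p" by simp
   show ?case unfolding Xe[OF b] Ye[OF b] m2[OF b] E_def by (simp add: algebra_simps)
  qed
 qed
 also have "... = (SU u v. F' u v)"
  using sum.swap[of "%u v. F' v u" UNIV UNIV] by (simp add: sum.distrib)
 also have "... = (SU u. if u = l then clie V p (co2 A l) th c y else 0) - (SU u. ?dV u l * contr p (co2 A u) (th c) y)"
  unfolding sum_subtractf[symmetric]
 proof (rule scong)
  fix u
  have dA: "(%z. A {#u, v#} z b) differentiable at y" for v b
   by (rule sm_diffble[OF coeffs_smooth[OF A(1)] S y]) simp
  have "(SU v. F' u v) = (SU v. (\<Sum>b\<in>Ls p. (if u = l then ?H u v b else 0)) / fact p) - (SU v. ?dV u l * pairing p (co2 A u v y) (%b. th c y (v # b)))"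
   unfolding F'_def sum_subtractf diff_divide_distrib pairing_def by (simp add: sum_distrib_left mult_ac)
  also have "(SU v. (\<Sum>b\<in>Ls p. (if u = l then ?H u v b else 0)) / fact p) = (if u = l then clie V p (co2 A l) th c y else 0)"
  proof (cases "u = l")
   case True
   have P: "pd m (%z. co2 A u v z b) y = mult2 u v * pd m (%z. A {#u, v#} z b) y" for m v b by (rule pd_cmult[OF dA])
   have P': "(SU m. V c y $ m * pd m (%z. co2 A u v z b) y) = mult2 u v * ?VA {#u, v#} b" for v b
    unfolding P sum_distrib_left by (rule scong) (simp only: mult_ac)
   show ?thesis unfolding clie_def True[symmetric] simp_thms if_True P'
    by (intro sum.cong refl arg_cong2[where f = "(/)"]) (simp only: algebra_simps)
  qed simp
  finally show "(SU v. F' u v) = (if u = l then clie V p (co2 A l) th c y else 0) - ?dV u l * contr p (co2 A u) (th c) y"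
   by (simp add: contr_def sum_distrib_left)
 qed
 finally show ?thesis by simp
qed

end

context mfd
begin

lemma forms_add:
 assumes "om \<in> Om p" "om' \<in> Om p"
 shows "(%c y I. om c y I + om' c y I) \<in> Om p"
proof (rule formsI)
 show "(%I. om c y I + om' c y I) = 0" if "c ~: \<A> \<or> y ~: cimg c" for c y
  using form_zero[OF assms(1) that] form_zero[OF assms(2) that] by (simp add: fun_eq_iff)
 show "alternating p (%I. om c y I + om' c y I)" for c y
  by (rule alt_add[OF form_alt[OF assms(1)] form_alt[OF assms(2)]])
 show "Sm (cimg c) (%y. om c y I + om' c y I)" if "c \<in> \<A>" for c I
  by (rule sm_add[OF oc[OF that] form_smooth[OF assms(1) that] form_smooth[OF assms(2) that]])
 show "(%I. om c (coord c x) I + om' c (coord c x) I) = pb p (Jac c c' (coord c x)) (%I. om c' (coord c' x) I + om' c' (coord c' x) I)"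
  if "c \<in> \<A>" "c' \<in> \<A>" "x \<in> cdom c" "x \<in> cdom c'" for c c' x
  unfolding form_pb[OF assms(1) that] form_pb[OF assms(2) that]
  by (rule ext) (simp add: pb_def distrib_left sum.distrib)
qed

lemma coeffs_eval: "Lc k p D c A ==> om \<in> Om p ==> y \<in> cimg c ==>
  D om (cinv c y) = (\<Sum>al | size al \<le> k. pairing p (A al y) (%I. mpd al (%z. om c z I) y))"
 unfolding local_coeffs_def by blast

lemma coeffs_add:
 assumes "Lc k p D c A" "Lc k p E c B" "c \<in> \<A>"
 shows "Lc k p (D + E) c (%al y b. A al y b + B al y b)"
 unfolding local_coeffs_def
proof (intro conjI allI impI ballI)
 fix om y assume "om \<in> Om p" "y \<in> cimg c"
 then show "(D + E) om (cinv c y) = (\<Sum>al | size al \<le> k. pairing p (%b. A al y b + B al y b) (%I. mpd al (%z. om c z I) y))"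
  unfolding pairing_add_left sum.distrib plus_fun_apply by (simp only: coeffs_eval[OF assms(1)] coeffs_eval[OF assms(2)])
qed (auto intro: alt_add coeffs_alt[OF assms(1)] coeffs_alt[OF assms(2)] sm_add[OF oc[OF assms(3)]]
 coeffs_smooth[OF assms(1)] coeffs_smooth[OF assms(2)])

lemma coeffs_scale:
 assumes "Lc k p D c A" "c \<in> \<A>"
 shows "Lc k p (%om x. t * D om x) c (%al y b. t * A al y b)"
 unfolding local_coeffs_def
proof (intro conjI allI impI ballI)
 fix om y assume "om \<in> Om p" "y \<in> cimg c"
 then show "t * D om (cinv c y) = (\<Sum>al | size al \<le> k. pairing p (%b. t * A al y b) (%I. mpd al (%z. om c z I) y))"
  unfolding pairing_cmult_left sum_distrib_left[symmetric] by (simp only: coeffs_eval[OF assms(1)])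
qed (auto intro: alt_cmult coeffs_alt[OF assms(1)] sm_mult[OF oc[OF assms(2)] sm_const]
 coeffs_smooth[OF assms(1)])

end

section \<open>Ordering in top degree\<close>

locale top_degree = mfd X \<A> for X :: "'a topology" and \<A> :: "('a, 'n::finite) chart set" +
 fixes p :: nat and I0 :: "'n list"
 assumes I0: "distinct I0" "length I0 = CARD('n)" and p: "Suc p = CARD('n)"
begin

text \<open>The component at \<open>I0\<close> of the coefficient of xi_l in the Koszul image. In
  top degree this is one number for each \<open>l\<close>, and together they are the components of a
  vector density.\<close>

definition qb :: "('n multiset => real^'n => 'n list => real) => 'n => real^'n => real" where
 "qb A l y = (SU i. wedge i (co2 A l i y) I0)"

text \<open>The operator assigned by the symmetric ordering, as it looks in the chart
  \<open>c\<close> on the single component of a top form.\<close>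

definition qz :: "('n multiset => real^'n => 'n list => real) => ('a, 'n) form => ('a, 'n) chart => real^'n => real" where
 "qz A th c y = (SU i. qb A i y * pd i (%z. th c z I0) y + 1/2 * (pd i (qb A i) y * th c y I0))"

lemma set_I0: "set I0 = UNIV"
 using card_subset_eq[OF finite_class.finite_UNIV subset_UNIV, of "set I0"] I0 by (simp add: distinct_card)

lemma co2_alt: "Lc 2 p D c A ==> y \<in> cimg c ==> alternating p (co2 A l i y)"
 by (rule alt_cmult) (rule coeffs_alt, auto)

lemma contr_top:
 assumes A: "Lc 2 p D c A" and y: "y \<in> cimg c" and th: "th \<in> Om (Suc p)"
 shows "contr p (co2 A l) (th c) y = qb A l y * th c y I0"
proof -
 have w: "alternating CARD('n) (%I. SU i. wedge i (co2 A l i y) I)"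
  unfolding p[symmetric] by (intro alt_sum alt_wedge co2_alt[OF A y])
 have "contr p (co2 A l) (th c) y = pairing (Suc p) (%I. SU i. wedge i (co2 A l i y) I) (th c y)"
  by (rule contr_wedge[where a = "co2 A l" and w = "th c" and y = y, OF co2_alt[OF A y] form_alt[OF th], symmetric])
 also have "... = qb A l y * th c y I0"
  unfolding p qb_def by (rule pairing_top[OF w _ I0]) (rule form_alt[OF th, unfolded p])
 finally show ?thesis .
qed

lemma smooth_qb:
 assumes A: "Lc 2 p D c A" and c: "c \<in> \<A>"
 shows "Sm (cimg c) (qb A l)"
proof -
 have "Sm (cimg c) (%y. SU i. wedge i (co2 A l i y) I0)"
  by (intro sm_sum oc[OF c] sm_wedge sm_mult sm_const coeffs_smooth[OF A]) auto
 then show ?thesis by (simp add: qb_def[abs_def])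
qed

lemma top_form: "th \<in> Om (Suc p) ==> th c y I = th c y I0 * eps (Suc p) I0 I"
 using top_component[OF _ I0, of "th c y" I] form_alt[of th "Suc p" c y] unfolding p by blast

text \<open>Replacing one index of \<open>I0\<close> by a different one repeats an index, as
  \<open>I0\<close> contains all of them; only the trace of the derivative of \<open>V\<close> is
  left.\<close>

lemma lie_top:
 assumes th: "th \<in> Om (Suc p)" and c: "c \<in> \<A>" and y: "y \<in> cimg c"
 shows "LF V th c y I0 = (SU l. V c y $ l * pd l (%z. th c z I0) y + pd l (%z. V c z $ l) y * th c y I0)"
proof -
 have l: "length I0 = Suc p" using I0(2) p by simp
 have "(\<Sum>s<Suc p. SU j. pd (I0 ! s) (%z. V c z $ j) y * th c y (I0[s := j])) = (\<Sum>s<Suc p. pd (I0 ! s) (%z. V c z $ (I0 ! s)) y * th c y I0)"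
 proof (rule scong)
  fix s assume "s \<in> {..<Suc p}"
  then have s: "s < length I0" using l by simp
  have z: "th c y (I0[s := j]) = 0" if "j ~= I0 ! s" for j
  proof -
   have "j \<in> set I0" using set_I0 by simp
   then obtain t where t: "t < length I0" "I0 ! t = j" by (auto simp: in_set_conv_nth)
   then have "t ~= s" using that by auto
   then have "I0[s := j] ! t = I0[s := j] ! s" using t s by simp
   then have "\<not> distinct (I0[s := j])" using t s `t ~= s` by (metis length_list_update nth_eq_iff_index_eq)
   then show ?thesis by (rule alt_not_distinct[OF form_alt[OF th]])
  qed
  have "(SU j. pd (I0 ! s) (%z. V c z $ j) y * th c y (I0[s := j])) = (\<Sum>j\<in>{I0 ! s}. pd (I0 ! s) (%z. V c z $ j) y * th c y (I0[s := j]))"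
   by (rule sum.mono_neutral_right) (auto simp: z)
  then show "(SU j. pd (I0 ! s) (%z. V c z $ j) y * th c y (I0[s := j])) = pd (I0 ! s) (%z. V c z $ (I0 ! s)) y * th c y I0"
   by simp
 qed
 also have "... = (SU l. pd l (%z. V c z $ l) y * th c y I0)"
  by (rule sum.reindex_bij_betw[OF bij_betw_nth[OF I0(1)], where g = "%l. pd l (%z. V c z $ l) y * th c y I0"])
   (use l set_I0 in auto)
 finally show ?thesis unfolding lie_form_chart[OF th c y l] sum.distrib by simp
qed

lemma qz_add:
 assumes A: "Lc 2 p D c A" and c: "c \<in> \<A>" and y: "y \<in> cimg c" and th: "th \<in> Om (Suc p)" "th' \<in> Om (Suc p)"
 shows "qz A (%c y I. th c y I + th' c y I) c y = qz A th c y + qz A th' c y"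
proof -
 note d = sm_diffble[OF form_smooth[OF th(1) c] oc[OF c] y] sm_diffble[OF form_smooth[OF th(2) c] oc[OF c] y]
 show ?thesis unfolding qz_def pd_add[OF d] sum.distrib[symmetric] by (intro sum.cong refl) (simp add: algebra_simps)
qed

text \<open>In top degree \<open>\<Q>(S)\<theta> \<bullet> \<theta>\<close> is half the Lie derivative of \<open>\<theta>\<close> along the vector field \<open>S\<close> contracted into \<open>\<theta>\<close>, whence the ordering does not
  depend on the chart.\<close>

lemma qz_chart:
 assumes D: "D \<in> DO 2 p" and B: "!!c. c \<in> \<A> ==> Lc 2 p D c (B c)"
  and th: "th \<in> Om (Suc p)" and c: "c \<in> \<A>" "c' \<in> \<A>" and x: "x \<in> cdom c" "x \<in> cdom c'"
 shows "qz (B c) th c (coord c x) = qz (B c') th c' (coord c' x)"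
proof -
 have sq: "qz (B c) th c (coord c x) * th c (coord c x) I0 = qz (B c') th c' (coord c' x) * th c (coord c x) I0"
  if th: "th \<in> Om (Suc p)" for th
 proof -
  \<comment> \<open>The symbol contracted into \<open>th\<close>; that its components transform as
    those of a vector field is \<open>e2_value\<close>.\<close>
  define V where "V c y = (if c \<in> \<A> & y \<in> cimg c then (\<chi> l. contr p (co2 (B c) l) (th c) y) else 0)" for c y
  have Vb: "V c y $ l = qb (B c) l y * th c y I0" if "c \<in> \<A>" "y \<in> cimg c" for c y l
   using that contr_top[OF B[OF that(1)] that(2) th] by (simp add: V_def)
  have V: "V \<in> Vect"
   unfolding vector_fields_def mem_Collect_eq
  proof (intro conjI allI ballI impI)
   fix c y assume "c ~: \<A> \<or> y ~: cimg c" then show "V c y = 0" by (auto simp: V_def)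
  next
   fix c j assume c: "c \<in> \<A>"
   show "Sm (cimg c) (%y. V c y $ j)"
    by (rule sm_cong[OF oc[OF c] _ sm_mult[OF oc[OF c] smooth_qb[OF B[OF c] c] form_smooth[OF th c]]])
     (rule Vb[OF c, symmetric])
  next
   fix c c' x j assume c: "c \<in> \<A>" "c' \<in> \<A>" and "x \<in> cdom c \<inter> cdom c'"
   then have x: "x \<in> cdom c" "x \<in> cdom c'" by auto
   let ?y' = "coord c' x"
   have y: "coord c x \<in> cimg c" and y': "?y' \<in> cimg c'" using x by auto
   have x': "cinv c' ?y' = x" by (rule cinv_coord[OF c(2) x(2)])
   obtain r rh where "mpt X \<A> c' ?y' r rh" using point_locale[OF c(2) y'] .
   then interpret m: mpt X \<A> c' ?y' r rh .
   have xc: "m.x0 \<in> cdom c" using x(1) unfolding x' .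
   have "contr p (co2 (B c') j) (th c') ?y' = (SU i. Jac c c' (coord c x) i j * contr p (co2 (B c) i) (th c) (coord c x))"
    using m.e2_value[OF th c(1) xc B[OF c(1)], of j] m.e2_value_self[OF th B[OF c(2)], of j] unfolding x' by simp
   then show "V c' ?y' $ j = (SU i. pd i (transition c c' j) (coord c x) * V c (coord c x) $ i)"
    using c y y' by (simp add: V_def)
  qed
  have L: "LF V th c y I = 2 * qz (B c) th c y * th c y I" if c: "c \<in> \<A>" and y: "y \<in> cimg c" for c y I
  proof -
   note dd = sm_diffble[OF _ oc[OF c] y]
   note d = dd[OF smooth_qb[OF B[OF c] c]] dd[OF form_smooth[OF th c]]
   have pV: "pd l (%z. V c z $ l) y = qb (B c) l y * pd l (%z. th c z I0) y + pd l (qb (B c) l) y * th c y I0" for l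
   proof -
    have "pd l (%z. V c z $ l) y = pd l (%z. qb (B c) l z * th c z I0) y"
     by (rule pd_cong[OF oc[OF c] y]) (rule Vb[OF c])
    then show ?thesis unfolding pd_mult[OF d] .
   qed
   have "LF V th c y I0 = 2 * qz (B c) th c y * th c y I0"
    unfolding lie_top[OF th c y] pV Vb[OF c y] qz_def sum_distrib_left sum_distrib_right
    by (intro sum.cong refl) (simp add: algebra_simps)
   then show ?thesis
    using top_form[OF lie_forms[OF th V], of c y I] top_form[OF th, of c y I] by simp
  qed
  have y: "coord c x \<in> cimg c" and y': "coord c' x \<in> cimg c'" using x by auto
  have "2 * qz (B c) th c (coord c x) * th c (coord c x) I0 = LF V th c (coord c x) I0" by (rule L[OF c(1) y, symmetric])
  also have "... = pb (Suc p) (Jac c c' (coord c x)) (LF V th c' (coord c' x)) I0"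
   unfolding form_pb[OF lie_forms[OF th V] c x] ..
  also have "... = 2 * qz (B c') th c' (coord c' x) * pb (Suc p) (Jac c c' (coord c x)) (th c' (coord c' x)) I0"
   unfolding pb_def L[OF c(2) y'] by (simp add: sum_distrib_left mult_ac)
  also have "... = 2 * qz (B c') th c' (coord c' x) * th c (coord c x) I0"
   unfolding form_pb[OF th c x] ..
  finally show ?thesis by simp
 qed
 show ?thesis
 proof (cases "th c (coord c x) I0 = 0")
  case False
  then show ?thesis using sq[OF th] by simp
 next
  \<comment> \<open>Where \<open>th\<close> vanishes, division is impossible. A form with component
    1 at the point is added: the claim holds for it and for the sum, and both sides are additive in
    the form.\<close>
  case True
  have y: "coord c x \<in> cimg c" and y': "coord c' x \<in> cimg c'" using x by auto
  obtain r rh where "mpt X \<A> c (coord c x) r rh" using point_locale[OF c(1) y] .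
  then interpret m: mpt X \<A> c "coord c x" r rh .
  let ?th1 = "m.mform (Suc p) (%_. 1) I0"
  have th1: "?th1 \<in> Om (Suc p)" by (rule m.mform_forms[OF sm_const[where c = 1]])
  have "?th1 c (coord c x) I0 = 1"
   unfolding m.mform_near[OF m.U0(2)] using eps_self[OF I0] p by simp
  then show ?thesis
   using sq[OF th1] sq[OF forms_add[OF th th1]] True
   unfolding qz_add[OF B[OF c(1)] c(1) y th th1] qz_add[OF B[OF c(2)] c(2) y' th th1] by simp
 qed
qed

lemma qz_cong:
 assumes "Lc 2 p D c A" "Lc 2 p D c A'" "c \<in> \<A>" "y \<in> cimg c"
 shows "qz A th c y = qz A' th c y"
proof -
 have "qb A l z = qb A' l z" if "z \<in> cimg c" for l z
  unfolding qb_def using coeffs_unique[OF assms(1,2,3) that] by simp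
 then have "qb A i y = qb A' i y" "pd i (qb A i) y = pd i (qb A' i) y" for i
  using assms(4) by (auto intro: pd_cong[OF oc[OF assms(3)]])
 then show ?thesis unfolding qz_def by simp
qed

text \<open>As for order one, the chart selected by \<open>glue\<close> is traded for a given one,
  now by \<open>qz_chart\<close>.\<close>

lemma K_map_2:
 assumes D: "D \<in> DO 2 p" and th: "th \<in> Om (Suc p)" and c: "c \<in> \<A>" and y: "y \<in> cimg c"
  and A: "Lc 2 p D c A"
 shows "Km 2 p D th (cinv c y) = qz A th c y"
proof -
 let ?x = "cinv c y"
 have xp: "?x \<in> pts" by (rule cdom_points[OF c cinv_in[OF y]])
 define c' where "c' = idx ?x"
 define y' where "y' = coord c' ?x"
 have c': "c' \<in> \<A>" "?x \<in> cdom c'" using idx[OF xp] unfolding c'_def by auto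
 have y': "y' \<in> cimg c'" using c'(2) unfolding y'_def by (rule imageI)
 define B where "B c = (SOME A. Lc 2 p D c A)" for c
 have B: "Lc 2 p D c (B c)" if "c \<in> \<A>" for c
  unfolding B_def using coeffs_exist[OF D that] by (metis someI_ex)
 let ?W = "%i z I. SU j. wedge j (co2 (B c') i j z) I"
 have W: "koszul (principal_symbol \<A> 2 p D) c' z (axis i 1) I = ?W i z I" if "z \<in> cimg c'" for z i I
  by (rule koszul_2[OF c'(1) that B[OF c'(1)]])
 have Wa: "alternating CARD('n) (?W i z)" if "z \<in> cimg c'" for i z
  unfolding p[symmetric] by (intro alt_sum alt_wedge co2_alt[OF B[OF c'(1)] that])
 have t: "alternating CARD('n) (th c' y')" "alternating CARD('n) (%I. pd i (%z. th c' z I) y')" for i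
  using form_alt[OF th] pd_form_alt[OF th c'(1) y'] unfolding p by auto
 have pW: "pd i (%z. koszul (principal_symbol \<A> 2 p D) c' z (axis i 1) I) y' = pd i (qb (B c') i) y' * eps CARD('n) I0 I" for i I
 proof -
  have "pd i (%z. koszul (principal_symbol \<A> 2 p D) c' z (axis i 1) I) y' = pd i (%z. eps CARD('n) I0 I * qb (B c') i z) y'"
  proof (rule pd_cong[OF oc[OF c'(1)] y'])
   fix z assume z: "z \<in> cimg c'"
   show "koszul (principal_symbol \<A> 2 p D) c' z (axis i 1) I = eps CARD('n) I0 I * qb (B c') i z"
    unfolding W[OF z] top_component[OF Wa[OF z] I0, of i I] qb_def by simp
  qed
  also have "... = eps CARD('n) I0 I * pd i (qb (B c') i) y'"
   by (rule pd_cmult[OF sm_diffble[OF smooth_qb[OF B[OF c'(1)] c'(1)] oc[OF c'(1)] y']])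
  finally show ?thesis by simp
 qed
 have "Km 2 p D th ?x = (SU i. pairing CARD('n) (koszul (principal_symbol \<A> 2 p D) c' y' (axis i 1)) (%I. pd i (%z. th c' z I) y')) +
   1/2 * (SU i. pairing CARD('n) (%I. pd i (%z. koszul (principal_symbol \<A> 2 p D) c' z (axis i 1) I) y') (th c' y'))"
  using th xp unfolding p by (simp add: K_map_def quantize1_def restrict0_def glue_eq c'_def y'_def)
 also have "(SU i. pairing CARD('n) (koszul (principal_symbol \<A> 2 p D) c' y' (axis i 1)) (%I. pd i (%z. th c' z I) y')) =
   (SU i. qb (B c') i y' * pd i (%z. th c' z I0) y')"
  unfolding W[OF y', abs_def] pairing_top[OF Wa[OF y'] t(2) I0] qb_def ..
 also have "(SU i. pairing CARD('n) (%I. pd i (%z. koszul (principal_symbol \<A> 2 p D) c' z (axis i 1) I) y') (th c' y')) =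
   (SU i. pd i (qb (B c') i) y' * th c' y' I0)"
  unfolding pW pairing_cmult_left pairing_eps[OF t(1) I0(2)] ..
 also have "(SU i. qb (B c') i y' * pd i (%z. th c' z I0) y') + 1/2 * (SU i. pd i (qb (B c') i) y' * th c' y' I0) = qz (B c') th c' y'"
  unfolding qz_def by (simp add: sum.distrib sum_distrib_left)
 also have "... = qz (B c) th c (coord c ?x)" unfolding y'_def
  by (rule qz_chart[OF D B th c'(1) c c'(2) cinv_in[OF y]])
 also have "... = qz A th c y" unfolding coord_cinv[OF y] by (rule qz_cong[OF B[OF c] A c y])
 finally show ?thesis .
qed

text \<open>The law \<open>b'\<close> of the vector density is found from \<open>contr_lie_2\<close>
  by testing against a form with constant component 1 near the point, whose Lie derivative has the
  divergence as component there. The rest is \<open>quantization_commutes\<close>.\<close>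

lemma qz_lie:
 assumes D: "D \<in> DO 2 p" and V: "V \<in> Vect" and th: "th \<in> Om (Suc p)" and c: "c \<in> \<A>" and y: "y \<in> cimg c"
  and A: "Lc 2 p D c A" "Lc 2 p (LO p V D) c A'"
 shows "qz A' th c y = (SU m. V c y $ m * pd m (qz A th c) y) - qz A (LF V th) c y"
proof -
 note S = oc[OF c]
 have b': "qb A' i z = (SU l. V c z $ l * pd l (qb A i) z - qb A l z * pd l (%z. V c z $ i) z - pd l (%z. V c z $ l) z * qb A i z)"
  if z: "z \<in> cimg c" for i z
 proof -
  obtain r rh where "mpt X \<A> c z r rh" using point_locale[OF c z] .
  then interpret m: mpt X \<A> c z r rh .
  let ?th = "m.mform (Suc p) (%_. 1) I0"
  have et: "?th \<in> Om (Suc p)" by (rule m.mform_forms[OF sm_const[where c = 1]])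
  have t1: "?th c w I0 = 1" if "w \<in> m.U0" for w
   unfolding m.mform_near[OF that] using eps_self[OF I0] p by simp
  have pt: "pd l (%w. ?th c w I0) z = 0" for l
   using pd_cong[OF m.U0(1,2), of "%w. ?th c w I0" "%_. 1" l] t1 by simp
  have pq: "pd l (%w. contr p (co2 A i) (?th c) w) z = pd l (qb A i) z" for l
   by (rule pd_cong[OF m.U0(1,2)]) (simp add: contr_top[OF A(1) m.U0(4) et] t1)
  have s: "Sm (cimg c) (%z. co2 A i j z b)" for j b
   by (intro sm_mult S sm_const coeffs_smooth[OF A(1)]) simp
  have "qb A' i z = contr p (co2 A' i) (?th c) z"
   unfolding contr_top[OF A(2) z et] t1[OF m.U0(2)] by simp
  also have "... = (SU l. V c z $ l * pd l (%w. contr p (co2 A i) (?th c) w) z) - contr p (co2 A i) (LF V ?th c) z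
    - (SU u. pd u (%z. V c z $ i) z * contr p (co2 A u) (?th c) z)"
   unfolding contr_lie_2[OF D V et c z A] contr_lie[OF et V c z s] ..
  also have "... = (SU l. V c z $ l * pd l (qb A i) z) - qb A i z * (SU l. pd l (%z. V c z $ l) z)
    - (SU u. pd u (%z. V c z $ i) z * qb A u z)"
   unfolding pq contr_top[OF A(1) z et] contr_top[OF A(1) z lie_forms[OF et V]] lie_top[OF et c z] t1[OF m.U0(2)] pt by simp
  finally show ?thesis by (simp add: sum_subtractf sum_distrib_left mult_ac)
 qed
 have "qz A' th c y = (SU l. V c y $ l * pd l (%z. SU i. qb A i z * pd i (%z. th c z I0) z + 1/2 * (pd i (qb A i) z * th c z I0)) y) -
  (SU i. qb A i y * pd i (%z. LF V th c z I0) y + 1/2 * (pd i (qb A i) y * LF V th c y I0))"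
  unfolding qz_def
  by (rule quantization_commutes[OF S y, where v = "%l z. V c z $ l" and b = "qb A" and b' = "qb A'"])
   (auto simp: b' lie_top[OF th c] intro: vf_smooth[OF V c] smooth_qb[OF A(1) c] form_smooth[OF th c])
 then show ?thesis unfolding qz_def[symmetric] .
qed

end

section \<open>Invariance of the second generator\<close>

context mfd
begin

lemma lop_ext_d:
 assumes c: "c \<in> \<A>" and I: "length I = Suc p"
 shows "lop c (cimg c) 2 p (%om y. Ed om c y I)"
proof -
 interpret jets "Om p" "%om b z. om c z b" "(Ls p)" "cimg c"
  by (rule jets_forms[OF c oc[OF c]]) simp
 obtain i b where I': "I = i # b" and b: "length b = p" using I by (auto simp: length_Suc_conv)
 have w: "dop 2 (%om. pd i (%z. om c z b))" if "length b = p" for i b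
  using dop_pd_Suc[of 1 "%om z. om c z b" i] dop_cmp[of b "{#}" 1] that by (simp add: numeral_2_eq_2)
 have "dop 2 (%om y. pd i (%z. om c z b) y - (\<Sum>s<p. pd (b ! s) (%z. om c z (b[s := i])) y))"
  by (intro dop_diff dop_sum w) (use b in auto)
 then show ?thesis
  by (rule dop_cong) (simp add: ext_d_chart[OF _ c] dform_def I' b)
qed

text \<open>As \<open>d\<close> commutes with Lie derivatives, it is enough that K is additive,
  homogeneous and equivariant in each chart. The parameter \<open>N\<close> bounds the order of the
  resulting operators.\<close>

lemma d_star_K_invariantI:
 assumes lop: "!!D c. D \<in> DO k p ==> c \<in> \<A> ==> lop c (cimg c) (Suc N) p (%om y. Km k p D (Ed om) (cinv c y))"
  and add: "!!D E th c y. D \<in> DO k p ==> E \<in> DO k p ==> th \<in> Om (Suc p) ==> c \<in> \<A> ==> y \<in> cimg c ==>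
   Km k p (D + E) th (cinv c y) = Km k p D th (cinv c y) + Km k p E th (cinv c y)"
  and scale: "!!D t th c y. D \<in> DO k p ==> th \<in> Om (Suc p) ==> c \<in> \<A> ==> y \<in> cimg c ==>
   Km k p (%om x. t * D om x) th (cinv c y) = t * Km k p D th (cinv c y)"
  and lie: "!!D V th c y. D \<in> DO k p ==> V \<in> Vect ==> th \<in> Om (Suc p) ==> c \<in> \<A> ==> y \<in> cimg c ==>
   Km k p (LO p V D) th (cinv c y) =
   (SU m. V c y $ m * pd m (%z. Km k p D th (cinv c z)) y) - Km k p D (LF V th) (cinv c y)"
 shows "dK k p \<in> Inv k p p"
proof -
 have T: "dK k p D om x = (if om \<in> Om p then Km k p D (Ed om) x else 0)" if "D \<in> DO k p" for D om x
  using that by (simp add: d_star_K_def d_star_def restrict0_def)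
 have K0: "Km k p D th x = 0" if "x ~: pts" for D th x
  using that by (simp add: K_map_def quantize0_def quantize1_def restrict0_def glue_eq)
 have in_diff: "dK k p D \<in> DO N p" if D: "D \<in> DO k p" for D
 proof (rule diffops_leI)
  show "lop c (cimg c) (Suc N) p (%om y. dK k p D om (cinv c y))" if c: "c \<in> \<A>" for c
   by (rule jets.dop_cong[OF jets_forms[OF c oc[OF c] order.refl] lop[OF D c]]) (simp add: T[OF D])
 qed (auto simp: T[OF D] K0)
 have eqI: "F = G" if "!!om x. om ~: Om p ==> F om x = G om x" "!!om x. x ~: pts ==> F om x = G om x"
  "!!om c y. om \<in> Om p ==> c \<in> \<A> ==> y \<in> cimg c ==> F om (cinv c y) = G om (cinv c y)" for F G :: "('a, 'n) operator"
 proof (intro ext)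
  fix om x
  show "F om x = G om x"
  proof (cases "om \<in> Om p & x \<in> pts")
   case True
   then obtain c where c: "c \<in> \<A>" "x \<in> cdom c" unfolding points_def by auto
   then show ?thesis using that(3)[of om c "coord c x"] True by simp
  qed (use that in auto)
 qed
 show ?thesis unfolding invariant_ops_def mem_Collect_eq
 proof (intro conjI allI ballI impI)
  fix D assume "D ~: DO k p" then show "dK k p D = 0" by (simp add: d_star_K_def restrict0_def)
 next
  fix D assume "D \<in> DO k p" then show "dK k p D \<in> diffops \<A> p" using in_diff unfolding diffops_def by blast
 next
  fix D E assume D: "D \<in> DO k p" and E: "E \<in> DO k p"
  show "dK k p (D + E) = dK k p D + dK k p E"
   by (rule eqI) (simp_all add: T[OF D] T[OF E] T[OF DO_add[OF D E]] K0 add[OF D E] d_forms)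
 next
  fix D t assume D: "D \<in> DO k p"
  show "dK k p (%om x. t * D om x) = (%om x. t * dK k p D om x)"
   by (rule eqI) (simp_all add: T[OF D] T[OF DO_scale[OF D]] K0 scale[OF D] d_forms)
 next
  fix V D assume V: "V \<in> Vect" and D: "D \<in> DO k p"
  note L = lie_op_diffops_le[OF D V] and L' = lie_op_diffops_le[OF in_diff[OF D] V]
  show "dK k p (LO p V D) = LO p V (dK k p D)"
  proof (rule eqI)
   fix om :: "('a, 'n) form" and x assume "om ~: Om p"
   then show "dK k p (LO p V D) om x = LO p V (dK k p D) om x"
    using diffops_leD(1)[OF L'] by (simp add: T[OF L])
  next
   fix om :: "('a, 'n) form" and x assume "x ~: pts"
   then show "dK k p (LO p V D) om x = LO p V (dK k p D) om x"
    using diffops_leD(2)[OF L'] by (simp add: T[OF L] K0)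
  next
   fix om c y assume om: "om \<in> Om p" and c: "c \<in> \<A>" and y: "y \<in> cimg c"
   show "dK k p (LO p V D) om (cinv c y) = LO p V (dK k p D) om (cinv c y)"
    unfolding lie_op_chart[OF in_diff[OF D] V c om y] T[OF L] T[OF D]
    using om lie_forms[OF om V] by (simp add: lie[OF D V d_forms[OF om] c y] ext_d_lie[OF om V])
  qed
 qed
qed

lemma lop_pairing:
 assumes "c \<in> \<A>" "!!b. Sm (cimg c) (%y. a y b)" "!!b. length b = q ==> lop c (cimg c) m p (%om y. w om y b)"
 shows "lop c (cimg c) m p (%om y. pairing q (a y) (w om y))"
proof -
 interpret jets "Om p" "%om b z. om c z b" "(Ls p)" "cimg c"
  by (rule jets_forms[OF assms(1) oc[OF assms(1)]]) simp
 have "dop m (%om y. 1 / fact q * (\<Sum>b\<in>Ls q. a y b * w om y b))"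
  by (intro dop_mult dop_sum sm_const assms) auto
 then show ?thesis by (rule dop_cong) (simp add: pairing_def)
qed

lemma d_star_K_invariant_1: "dK 1 p \<in> Inv 1 p p"
proof (rule d_star_K_invariantI[where N = 1])
 fix D c assume D: "D \<in> DO 1 p" and c: "c \<in> \<A>"
 obtain A where A: "Lc 1 p D c A" using coeffs_exist[OF D c] .
 interpret jets "Om p" "%om b z. om c z b" "(Ls p)" "cimg c"
  by (rule jets_forms[OF c oc[OF c]]) simp
 have "dop 2 (%om y. SU i. pairing p (A {#i#} y) (%b. Ed om c y (i # b)))"
  by (intro dop_sum lop_pairing[OF c] coeffs_smooth[OF A] lop_ext_d[OF c]) auto
 then have "dop (Suc 1) (%om y. SU i. pairing p (A {#i#} y) (%b. Ed om c y (i # b)))" by (simp add: numeral_2_eq_2)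
 then show "dop (Suc 1) (%om y. Km 1 p D (Ed om) (cinv c y))"
  by (rule dop_cong) (unfold K_map_1[OF D d_forms c _ A] contr_def, rule refl)
next
 fix D E th c y assume h: "D \<in> DO 1 p" "E \<in> DO 1 p" "th \<in> Om (Suc p)" "c \<in> \<A>" "y \<in> cimg c"
 obtain A B where A: "Lc 1 p D c A" and B: "Lc 1 p E c B"
  using coeffs_exist[OF h(1,4)] coeffs_exist[OF h(2,4)] by metis
 show "Km 1 p (D + E) th (cinv c y) = Km 1 p D th (cinv c y) + Km 1 p E th (cinv c y)"
  unfolding K_map_1[OF DO_add[OF h(1,2)] h(3,4,5) coeffs_add[OF A B h(4)]] K_map_1[OF h(1,3,4,5) A] K_map_1[OF h(2-5) B]
  by (simp add: contr_def pairing_add_left sum.distrib)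
next
 fix D t th c y assume h: "D \<in> DO 1 p" "th \<in> Om (Suc p)" "c \<in> \<A>" "y \<in> cimg c"
 obtain A where A: "Lc 1 p D c A" using coeffs_exist[OF h(1,3)] .
 show "Km 1 p (%om x. t * D om x) th (cinv c y) = t * Km 1 p D th (cinv c y)"
  unfolding K_map_1[OF DO_scale[OF h(1)] h(2-4) coeffs_scale[OF A h(3)]] K_map_1[OF h A]
  by (simp add: contr_def pairing_cmult_left sum_distrib_left)
next
 fix D V th c y assume D: "D \<in> DO 1 p" and V: "V \<in> Vect" and th: "th \<in> Om (Suc p)" and c: "c \<in> \<A>" and y: "y \<in> cimg c"
 note L = lie_op_diffops_le[OF D V]
 obtain A A' where A: "Lc 1 p D c A" and A': "Lc 1 p (LO p V D) c A'"
  using coeffs_exist[OF D c] coeffs_exist[OF L c] by metis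
 have P: "pd m (%z. Km 1 p D th (cinv c z)) y = pd m (%z. contr p (co1 A) (th c) z) y" for m
  by (rule pd_cong[OF oc[OF c] y]) (rule K_map_1[OF D th c _ A])
 have s: "Sm (cimg c) (%z. co1 A i z b)" for i b by (rule coeffs_smooth[OF A]) simp
 show "Km 1 p (LO p V D) th (cinv c y) =
   (SU m. V c y $ m * pd m (%z. Km 1 p D th (cinv c z)) y) - Km 1 p D (LF V th) (cinv c y)"
  unfolding K_map_1[OF L th c y A'] K_map_1[OF D lie_forms[OF th V] c y A] P
   contr_lie_1[OF D V th c y A A'] contr_lie[OF th V c y s] ..
qed

end

context top_degree
begin

lemma d_star_K_invariant_2: "dK 2 p \<in> Inv 2 p p"
proof (rule d_star_K_invariantI[where N = 2])
 fix D c assume D: "D \<in> DO 2 p" and c: "c \<in> \<A>"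
 obtain A where A: "Lc 2 p D c A" using coeffs_exist[OF D c] .
 interpret jets "Om p" "%om b z. om c z b" "(Ls p)" "cimg c"
  by (rule jets_forms[OF c oc[OF c]]) simp
 have l: "length I0 = Suc p" using I0 p by simp
 have "dop (Suc 2) (%om y. SU i. qb A i y * pd i (%z. Ed om c z I0) y + 1/2 * (pd i (qb A i) y * Ed om c y I0))"
  by (intro dop_sum dop_add dop_mult sm_const smooth_qb[OF A c] sm_pd dop_pd_Suc lop_ext_d[OF c l] dop_mono[OF _ lop_ext_d[OF c l]]) auto
 then show "dop (Suc 2) (%om y. Km 2 p D (Ed om) (cinv c y))"
  by (rule dop_cong) (unfold K_map_2[OF D d_forms c _ A] qz_def, rule refl)
next
 fix D E th c y assume h: "D \<in> DO 2 p" "E \<in> DO 2 p" "th \<in> Om (Suc p)" "c \<in> \<A>" "y \<in> cimg c"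
 obtain A B where A: "Lc 2 p D c A" and B: "Lc 2 p E c B"
  using coeffs_exist[OF h(1,4)] coeffs_exist[OF h(2,4)] by metis
 have q: "qb (%al y b. A al y b + B al y b) i = (%z. qb A i z + qb B i z)" for i
 proof
  fix z
  have "wedge j (%b. mult2 i j * (A {#i, j#} z b + B {#i, j#} z b)) I0 = wedge j (co2 A i j z) I0 + wedge j (co2 B i j z) I0" for j
   unfolding wedge_def sum.distrib[symmetric] by (intro sum.cong refl) (simp add: algebra_simps)
  then show "qb (%al y b. A al y b + B al y b) i z = qb A i z + qb B i z" by (simp only: qb_def sum.distrib)
 qed
 note d = sm_diffble[OF _ oc[OF h(4)] h(5)]
 show "Km 2 p (D + E) th (cinv c y) = Km 2 p D th (cinv c y) + Km 2 p E th (cinv c y)"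
  unfolding K_map_2[OF DO_add[OF h(1,2)] h(3,4,5) coeffs_add[OF A B h(4)]] K_map_2[OF h(1,3,4,5) A] K_map_2[OF h(2-5) B]
   qz_def q pd_add[OF d[OF smooth_qb[OF A h(4)]] d[OF smooth_qb[OF B h(4)]]] sum.distrib[symmetric]
  by (intro sum.cong refl) (simp add: algebra_simps)
next
 fix D t th c y assume h: "D \<in> DO 2 p" "th \<in> Om (Suc p)" "c \<in> \<A>" "y \<in> cimg c"
 obtain A where A: "Lc 2 p D c A" using coeffs_exist[OF h(1,3)] .
 have q: "qb (%al y b. t * A al y b) i = (%z. t * qb A i z)" for i
 proof
  fix z
  have "wedge j (%b. mult2 i j * (t * A {#i, j#} z b)) I0 = t * wedge j (co2 A i j z) I0" for j
   unfolding wedge_def sum_distrib_left by (intro sum.cong refl) (simp add: algebra_simps)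
  then show "qb (%al y b. t * A al y b) i z = t * qb A i z" by (simp only: qb_def sum_distrib_left)
 qed
 note d = sm_diffble[OF _ oc[OF h(3)] h(4)]
 show "Km 2 p (%om x. t * D om x) th (cinv c y) = t * Km 2 p D th (cinv c y)"
  unfolding K_map_2[OF DO_scale[OF h(1)] h(2-4) coeffs_scale[OF A h(3)]] K_map_2[OF h A]
   qz_def q pd_cmult[OF d[OF smooth_qb[OF A h(3)]]] sum_distrib_left
  by (intro sum.cong refl) (simp add: algebra_simps)
next
 fix D V th c y assume D: "D \<in> DO 2 p" and V: "V \<in> Vect" and th: "th \<in> Om (Suc p)" and c: "c \<in> \<A>" and y: "y \<in> cimg c"
 note L = lie_op_diffops_le[OF D V]
 obtain A A' where A: "Lc 2 p D c A" and A': "Lc 2 p (LO p V D) c A'"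
  using coeffs_exist[OF D c] coeffs_exist[OF L c] by metis
 have P: "pd m (%z. Km 2 p D th (cinv c z)) y = pd m (qz A th c) y" for m
  by (rule pd_cong[OF oc[OF c] y]) (rule K_map_2[OF D th c _ A])
 show "Km 2 p (LO p V D) th (cinv c y) =
   (SU m. V c y $ m * pd m (%z. Km 2 p D th (cinv c z)) y) - Km 2 p D (LF V th) (cinv c y)"
  unfolding K_map_2[OF L th c y A'] K_map_2[OF D lie_forms[OF th V] c y A] P
  by (rule qz_lie[OF D V th c y A A'])
qed

end

section \<open>Pointwise classification\<close>

context inv
begin

text \<open>From the value of order 0, \<open>order_relation\<close> and \<open>bb_zero\<close>
  annihilate all scalars below order \<open>k\<close>. At a positive order \<open>k\<close> the
  single relation \<open>aa k + k * bb k = 0\<close> is left, and each alternative in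
  \<open>hk\<close> forces one of the two scalars to vanish, hence both.\<close>

lemma kills_all:
 assumes b0: "distinct (l1 # b0)" "length b0 = p"
  and h0: "tw {#} b0 (mform p (%_. 1) b0) = 0"
  and hk: "tw (rp k l1) b0 (mform p (mon y0 (rp k l1)) b0) = 0 \<or> k \<ge> 3 \<or> k = 2 & (\<exists>l3. l3 ~: set (l1 # b0))"
  and D: "D \<in> DO k p"
 shows "T D om x0 = 0"
proof -
 \<comment> \<open>The scalars are needed for every choice of the first exterior letter, since
   \<open>tw_cyclic_vector_zero\<close> lets any letter \<open>x\<close> of \<open>b0\<close> change
   places with \<open>l1\<close>.\<close>
 have loc: "inv2 X \<A> c0 y0 r rh k p T l1 x b" if "distinct (x # b)" "set (x # b) = set b0" for x b
 proof
  show "distinct (l1 # x # b)" using that b0 by auto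
  show "Suc (length b) = p" using that b0 distinct_card[of "x # b"] distinct_card[of b0] by simp
 qed
 have aa: "inv2.aa \<A> c0 y0 rh p T l1 x b j = tw (rp j l1) b0 (mform p (mon y0 (rp j l1)) b0) / fact j"
  if xb: "distinct (x # b)" "set (x # b) = set b0" and j: "j \<le> k" for x b j
 proof -
  interpret i2: inv2 X \<A> c0 y0 r rh k p T l1 x b by (rule loc[OF xb])
  have "tw (rp j l1) (x # b) (mform p (mon y0 (rp j l1)) (x # b)) = tw (rp j l1) b0 (mform p (mon y0 (rp j l1)) b0)"
   by (rule tw_same_set) (use xb b0 j smooth_mon in auto)
  then show ?thesis by (simp add: i2.aa_def i2.ta_def i2.mm_def)
 qed
 have low: "inv2.aa \<A> c0 y0 rh p T l1 x b j = 0 & inv2.bb \<A> c0 y0 rh p T l1 x b j = 0"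
  if xb: "distinct (x # b)" "set (x # b) = set b0" and j: "j < k \<or> j = 0" for x b j
 proof -
  interpret i2: inv2 X \<A> c0 y0 r rh k p T l1 x b by (rule loc[OF xb])
  show ?thesis using j
  proof (induction j)
   case 0
   show ?case using aa[OF xb, of 0] h0 by (simp add: i2.bb_def)
  next
   case (Suc m)
   then have m: "Suc (Suc m) \<le> k" by simp
   then show ?case using Suc.IH i2.bb_zero[OF m] i2.order_relation[of m] by simp
  qed
 qed
 obtain l2 bb where lb: "b0 = l2 # bb" using b0 p by (cases b0) auto
 have b0': "distinct b0" "l1 ~: set b0" using b0 by auto
 have cyc: "tw al B om = 0" if z: "!!x b. distinct (x # b) ==> set (x # b) = set b0 ==>
   inv2.aa \<A> c0 y0 rh p T l1 x b j = 0 & inv2.bb \<A> c0 y0 rh p T l1 x b j = 0"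
   and j: "j \<le> k" "size al = j" "length B = p" for al B om j
 proof (rule tw_cyclic[OF b0'(1) b0(2) b0'(2) j(1) _ j(2,3)])
  show "tw (rp j l1) b0 om = 0" for om
  proof (rule tw_cyclic_vector_zero[OF b0'(1) b0(2) b0'(2) j(1)])
   show "tw (rp j l1) b0 (mform p (mon y0 (rp j l1)) b0) = 0"
    using aa[of l2 bb j] z[of l2 bb] j(1) b0' unfolding lb by auto
   fix x b j' assume x: "j = Suc j'" "distinct (x # b)" "set (x # b) = set b0"
   interpret i2: inv2 X \<A> c0 y0 r rh k p T l1 x b by (rule loc[OF x(2,3)])
   show "tw (rp j l1) (x # b) (mform p (mon y0 (am x (rp j' l1))) (l1 # b)) = 0"
    using z[OF x(2,3)] x(1) by (simp add: i2.bb_def i2.ta_def i2.mm_def)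
  qed
 qed
 have tw_low: "tw al B om = 0" if "size al < k" "length B = p" for al B om
  by (rule cyc[OF _ _ refl that(2)]) (use low that(1) in auto)
 have top: "inv2.aa \<A> c0 y0 rh p T l1 x b k = 0 & inv2.bb \<A> c0 y0 rh p T l1 x b k = 0"
  if xb: "distinct (x # b)" "set (x # b) = set b0" for x b
 proof (cases k)
  case 0
  then show ?thesis using low[OF xb, of 0] by simp
 next
  case (Suc m)
  interpret i2: inv2 X \<A> c0 y0 r rh k p T l1 x b by (rule loc[OF xb])
  have rel: "i2.aa k + k * i2.bb k = 0" using i2.order_relation[of m] low[OF xb, of m] Suc by simp
  have kp: "real k > 0" using Suc by simp
  have "i2.aa k = 0 \<or> i2.bb k = 0"
   using hk
  proof (elim disjE conjE exE)
   assume "tw (rp k l1) b0 (mform p (mon y0 (rp k l1)) b0) = 0"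
   then show ?thesis using aa[OF xb order.refl] by simp
  next
   assume k3: "k \<ge> 3"
   have "Tw g al B om = 0" if "size al < k" "length B = p" "Sm S0 g" for al B g om
    by (rule Tw_span[where j = m]) (use Suc that tw_low in auto)
   then show ?thesis using i2.bb_zero_top[OF k3 _ rel] by blast
  next
   fix l3 assume k2: "k = 2" and l3: "l3 ~: set (l1 # b0)"
   have "l3 ~: set (l1 # x # b)" using l3 xb(2) by auto
   from i2.aa_zero_of_third_letter[OF k2 this tw_low] show ?thesis using k2 by simp
  qed
  then show ?thesis using rel kp by auto
 qed
 show ?thesis
 proof (rule T_kills[OF order.refl _ D])
  fix al :: "'n multiset" and B :: "'n list" and om assume h: "size al \<le> k" "length B = p"
  show "tw al B om = 0"
  proof (cases "size al < k")
   case False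
   then have "size al = k" using h by simp
   then show ?thesis using cyc[OF top order.refl _ h(2)] by blast
  qed (rule tw_low[OF _ h(2)])
 qed
qed

text \<open>Translation invariance in the chart makes the values below locally constant.\<close>

lemma translation_zero:
 assumes b: "length b = p" and al: "size al \<le> k" and om: "om \<in> Om p" and y: "y \<in> U0"
  and L: "!!i z. z \<in> U0 ==> T (wop p (%_. 1) al b) (LF (vf (%_. 1) i) om) (cinv c0 z) = 0"
  and 0: "T (wop p (%_. 1) al b) om x0 = 0"
 shows "T (wop p (%_. 1) al b) om (cinv c0 y) = 0"
proof -
 let ?C = "wop p (%_. 1) al b" and ?V = "%i. vf (%_. 1) i"
 note S = oc[OF c0]
 have s1: "Sm S0 (%_. 1)" by (rule sm_const)
 note C = wop_in[OF s1 b al] and V = vf_fields[OF s1]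
 obtain K where K: "T ?C \<in> DO K p" using T_diffops[OF C] by blast
 define F where "F z = T ?C om (cinv c0 z)" for z
 have Fs: "Sm S0 F"
  using diffops_leD(4)[OF K om] c0 unfolding smooth_functions_def F_def o_def by blast
 have LC: "LO p (?V i) ?C et (cinv c0 z) = 0" if et: "et \<in> Om p" and z: "z \<in> U0" for et z i
 proof -
  have f: "Sm S0 (%z. et c0 z b)" by (rule form_smooth[OF et c0])
  have "mpd al (%z. (SU j. (if j = i then 1 else 0) * pd j (%z. et c0 z b) z) +
    (\<Sum>s<p. SU j. pd (b ! s) (%z. if j = i then 1 else 0) z * et c0 z (b[s := j]))) z = mpd al (pd i (%z. et c0 z b)) z"
   by (rule mpd_cong[OF S U0(4)[OF z]]) (simp add: mult_if cong: if_cong)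
  also have "... = mpd (am i al) (%z. et c0 z b) z"
   by (simp add: mpd_pd[OF S f U0(4)[OF z]] mpd_add_mset[OF S f U0(4)[OF z]])
  finally have e: "mpd al (%z. (SU j. (if j = i then 1 else 0) * pd j (%z. et c0 z b) z) +
    (\<Sum>s<p. SU j. pd (b ! s) (%z. if j = i then 1 else 0) z * et c0 z (b[s := j]))) z = mpd (am i al) (%z. et c0 z b) z" .
  have sv: "Sm S0 (%y. if j = i then 1 else (0::real))" for j by simp
  show ?thesis unfolding vf_def lie_wop_near[where v = "%y j. if j = i then 1 else 0", OF sv b s1 et z] e
   by (simp add: mult_if cong: if_cong)
 qed
 \<comment> \<open>Near \<open>z\<close> the constant field annihilates the word, although the
   cutoffs prevent this globally. Locality of \<open>T\<close> at \<open>z\<close> then makes the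
   derivative of \<open>F\<close> equal to the value on the Lie derivative of the form, which is
   zero by \<open>L\<close>.\<close>
 have pF: "pd i F z = 0" if z: "z \<in> U0" for i z
 proof -
  obtain r' rh' where "mpt X \<A> c0 z r' rh'" using point_locale[OF c0 U0(4)[OF z]] .
  then interpret iz: inv X \<A> c0 z r' rh' k p T using T p by (simp add: inv_def inv_axioms_def)
  have "iz.near p (LO p (?V i) ?C) 0"
   unfolding iz.near_def by (rule exI[of _ "U0 \<inter> iz.U0"]) (use LC z U0(1) iz.U0 in auto)
  then have "T (LO p (?V i) ?C) om (cinv c0 z) = 0"
   by (rule iz.T_local_0[OF lie_op_diffops_le[OF C V]])
  then have "(SU j. ?V i c0 z $ j * pd j F z) = T ?C (LF (?V i) om) (cinv c0 z)"
   unfolding T_lie[OF V C] lie_op_chart[OF K V c0 om U0(4)[OF z]] F_def by simp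
  also have "... = 0" by (rule L[OF z])
  also have "(SU j. ?V i c0 z $ j * pd j F z) = pd i F z"
   unfolding vf_def vext_near[OF z] by (simp add: mult_if cong: if_cong)
  finally show ?thesis .
 qed
 have "(F has_derivative (%v. 0)) (at z within U0)" if z: "z \<in> U0" for z
  using has_derivative_pd[OF sm_diffble[OF Fs S U0(4)[OF z]]] unfolding pF[OF z]
  by (simp add: has_derivative_at_withinI)
 then obtain q where "!!z. z \<in> U0 ==> F z = q"
  using has_derivative_zero_constant[of U0 F] by (metis convex_ball)
 then have "F y = F y0" using y U0(2) by metis
 then show ?thesis using 0 unfolding F_def by simp
qed

end

section \<open>The classification\<close>

context mfd
begin

definition special :: "nat => nat => bool" where
 "special k p \<longleftrightarrow> k = 1 \<or> k = 2 & Suc p = CARD('n)"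

text \<open>The second generator where it exists and zero elsewhere, so that one formula covers both
  cases of the classification.\<close>

definition Sop :: "nat => nat => ('a, 'n) operator => ('a, 'n) operator" where
 "Sop k p = (if special k p then dK k p else 0)"

lemma operator_eqI:
 assumes "!!om x. om ~: Om p ==> F om x = G om x" "!!om x. x ~: pts ==> F om x = G om x"
  "!!om c y. om \<in> Om p ==> c \<in> \<A> ==> y \<in> cimg c ==> F om (cinv c y) = G om (cinv c y)"
 shows "F = (G :: ('a, 'n) operator)"
proof (intro ext)
 fix om x
 show "F om x = G om x"
 proof (cases "om \<in> Om p & x \<in> pts")
  case True
  then obtain c where c: "c \<in> \<A>" "x \<in> cdom c" unfolding points_def by auto
  then show ?thesis using assms(3)[of om c "coord c x"] True by simp
 qed (use assms in auto)
qed

lemma lie_op_linear: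
 assumes D: "D \<in> DO k p" and E: "E \<in> DO k p" and V: "V \<in> Vect"
 shows "LO p V (%om x. D om x + t * E om x) = (%om x. LO p V D om x + t * LO p V E om x)"
proof -
 have "D + (%om x. t * E om x) \<in> DO k p" by (rule DO_add[OF D DO_scale[OF E]])
 then have F: "(%om x. D om x + t * E om x) \<in> DO k p" by (simp add: plus_fun_def)
 note l = lie_op_diffops_le[OF D V] lie_op_diffops_le[OF E V] lie_op_diffops_le[OF F V]
 show ?thesis
 proof (rule operator_eqI)
  fix om :: "('a, 'n) form" and x assume "om ~: Om p"
  then show "LO p V (%om x. D om x + t * E om x) om x = LO p V D om x + t * LO p V E om x"
   by (simp add: lie_op_def restrict0_def)
 next
  fix om :: "('a, 'n) form" and x assume "x ~: pts"
  then show "LO p V (%om x. D om x + t * E om x) om x = LO p V D om x + t * LO p V E om x"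
   using diffops_leD(2)[OF l(1)] diffops_leD(2)[OF l(2)] diffops_leD(2)[OF l(3)] by simp
 next
  fix om c y assume om: "om \<in> Om p" and c: "c \<in> \<A>" and y: "y \<in> cimg c"
  have s: "Sm (cimg c) (%z. F om (cinv c z))" if "F \<in> DO k p" for F
   using diffops_leD(4)[OF that om] c unfolding smooth_functions_def o_def by blast
  have d: "(%z. F om (cinv c z)) differentiable at y" if "F \<in> DO k p" for F
   by (rule sm_diffble[OF s[OF that] oc[OF c] y])
  have d2: "(%z. t * E om (cinv c z)) differentiable at y"
   by (rule sm_diffble[OF sm_mult[OF oc[OF c] sm_const s[OF E]] oc[OF c] y])
  have "pd i (%z. D om (cinv c z) + t * E om (cinv c z)) y = pd i (%z. D om (cinv c z)) y + t * pd i (%z. E om (cinv c z)) y" for i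
   unfolding pd_add[OF d[OF D] d2] pd_cmult[OF d[OF E]] ..
  then show "LO p V (%om x. D om x + t * E om x) om (cinv c y) = LO p V D om (cinv c y) + t * LO p V E om (cinv c y)"
   unfolding lie_op_chart[OF D V c om y] lie_op_chart[OF E V c om y] lie_op_chart[OF F V c om y]
   by (simp add: algebra_simps sum.distrib sum_distrib_left)
 qed
qed

lemma invariant_comb:
 assumes T: "T \<in> Inv k p p" and U: "U \<in> Inv k p p"
 shows "(%D om x. T D om x + t * U D om x) \<in> Inv k p p"
 unfolding invariant_ops_def mem_Collect_eq
proof (intro conjI allI ballI impI)
 fix D assume "D ~: DO k p"
 then have "T D = 0" "U D = 0" using T U unfolding invariant_ops_def by auto
 then show "(%om x. T D om x + t * U D om x) = 0" by (simp add: fun_eq_iff)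
next
 fix D assume D: "D \<in> DO k p"
 have "T D \<in> diffops \<A> p" "U D \<in> diffops \<A> p" using D T U unfolding invariant_ops_def by auto
 then obtain i j where "T D \<in> DO i p" "U D \<in> DO j p" unfolding diffops_def by auto
 then have ij: "T D \<in> DO (max i j) p" "U D \<in> DO (max i j) p"
  by (auto elim: DO_mono)
 from DO_add[OF ij(1) DO_scale[OF ij(2), of t]] have m: "(%om x. T D om x + t * U D om x) \<in> DO (max i j) p"
  by (simp add: plus_fun_def)
 then show "(%om x. T D om x + t * U D om x) \<in> diffops \<A> p" unfolding diffops_def by blast
 show "(%om x. T (%om x. s * D om x) om x + t * U (%om x. s * D om x) om x) = (%om x. s * (T D om x + t * U D om x))" for s
 proof -
  have "T (%om x. s * D om x) = (%om x. s * T D om x)" "U (%om x. s * D om x) = (%om x. s * U D om x)"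
   using D T U unfolding invariant_ops_def by blast+
  then show ?thesis by (simp add: algebra_simps)
 qed
 fix V assume V: "V \<in> Vect"
 have "T (LO p V D) = LO p V (T D)" "U (LO p V D) = LO p V (U D)"
  using D V T U unfolding invariant_ops_def by blast+
 then show "(%om x. T (LO p V D) om x + t * U (LO p V D) om x) = LO p V (%om x. T D om x + t * U D om x)"
  by (simp add: lie_op_linear[OF ij V])
next
 fix D E assume D: "D \<in> DO k p" "E \<in> DO k p"
 then have "T (D + E) = T D + T E" "U (D + E) = U D + U E" using T U unfolding invariant_ops_def by blast+
 then show "(%om x. T (D + E) om x + t * U (D + E) om x) = (%om x. T D om x + t * U D om x) + (%om x. T E om x + t * U E om x)"
  by (simp add: fun_eq_iff algebra_simps)
qed

lemma invariant_zero: "0 \<in> Inv k p p"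
proof -
 have "LO p V 0 = 0" if V: "V \<in> Vect" for V
  using lie_op_linear[OF DO_zero DO_zero that, of p "-1"] by (simp add: zero_fun_def)
 moreover have "0 \<in> diffops \<A> p" unfolding diffops_def using DO_zero by blast
 ultimately show ?thesis unfolding invariant_ops_def by (auto simp: fun_eq_iff)
qed

lemma invariant_identity: "idop k p \<in> Inv k p p"
 unfolding invariant_ops_def identity_op_def restrict0_def diffops_def
 using DO_add DO_scale lie_op_diffops_le by auto

lemma ex_top_list: "\<exists>I0 :: 'n list. distinct I0 & length I0 = CARD('n)"
 using finite_distinct_list[of "UNIV :: 'n set"] distinct_card by force

lemma invariant_Sop: "Sop k p \<in> Inv k p p"
proof (cases "special k p")
 case True
 then consider "k = 1" | "k = 2" "Suc p = CARD('n)" unfolding special_def by blast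
 then show ?thesis
 proof cases
  case 1
  then show ?thesis using d_star_K_invariant_1 True by (simp add: Sop_def)
 next
  case 2
  obtain I0 :: "'n list" where "distinct I0" "length I0 = CARD('n)" using ex_top_list by blast
  then interpret top_degree X \<A> p I0 using 2 by unfold_locales
  show ?thesis using d_star_K_invariant_2 True 2 by (simp add: Sop_def)
 qed
qed (simp add: Sop_def invariant_zero)

lemma coeffs_raise:
 assumes "Lc j p D c A" "j \<le> k"
 shows "Lc k p D c (%al y b. if size al \<le> j then A al y b else 0)"
 unfolding local_coeffs_def
proof (intro conjI allI impI ballI)
 fix om y assume "om \<in> Om p" "y \<in> cimg c"
 then have "D om (cinv c y) = (\<Sum>al | size al \<le> j. pairing p (A al y) (%I. mpd al (%z. om c z I) y))"
  using assms(1) unfolding local_coeffs_def by blast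
 also have "... = (\<Sum>al | size al \<le> k. pairing p (%b. if size al \<le> j then A al y b else 0) (%I. mpd al (%z. om c z I) y))"
  by (rule sum.mono_neutral_cong_left) (use assms(2) in "auto simp: pairing_def")
 finally show "D om (cinv c y) = ..." .
next
 fix al :: "'n multiset" and y assume "size al \<le> k & y \<in> cimg c"
 then show "alternating p (%b. if size al \<le> j then A al y b else 0)"
  using coeffs_alt[OF assms(1)] by (cases "size al \<le> j") auto
next
 fix al :: "'n multiset" and I
 show "Sm (cimg c) (%y. if size al \<le> j then A al y I else 0)"
  using coeffs_smooth[OF assms(1)] by (cases "size al \<le> j") auto
qed

lemma Sop_K:
 assumes "special k p" "D \<in> DO k p" "om \<in> Om p"
 shows "Sop k p D om x = Km k p D (Ed om) x"
 using assms by (simp add: Sop_def d_star_K_def d_star_def restrict0_def)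

text \<open>The symbol of order \<open>k\<close> of an operator of lower order is zero;
  \<open>coeffs_raise\<close> supplies coefficients that show this.\<close>

lemma Sop_lower:
 assumes D: "D \<in> DO j p" and j: "j < k" and om: "om \<in> Om p" and c: "c \<in> \<A>" "y \<in> cimg c"
 shows "Sop k p D om (cinv c y) = 0"
proof (cases "special k p")
 case True
 note Dk = DO_mono[OF D less_imp_le[OF j]]
 obtain A where "Lc j p D c A" using coeffs_exist[OF D c(1)] .
 note A = coeffs_raise[OF this less_imp_le[OF j]]
 have w0: "wedge i (%b. 0) = (%I. 0)" for i :: 'n by (rule ext) (simp add: wedge_def cong: if_cong)
 consider "k = 1" | "k = 2" "Suc p = CARD('n)" using True unfolding special_def by blast
 then show ?thesis
 proof cases
  case 1
  show ?thesis unfolding Sop_K[OF True Dk om] 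
   using K_map_1[OF Dk[unfolded 1] d_forms[OF om] c A[unfolded 1]] j 1 by (simp add: contr_def pairing_def)
 next
  case 2
  obtain I0 :: "'n list" where "distinct I0" "length I0 = CARD('n)" using ex_top_list by blast
  then interpret top_degree X \<A> p I0 using 2 by unfold_locales
  have "qb (%al y b. if size al \<le> j then A al y b else 0) i = (%_. 0)" for i
   using j 2(1) by (simp add: qb_def fun_eq_iff w0)
  then show ?thesis unfolding Sop_K[OF True Dk om]
   using K_map_2[OF Dk[unfolded 2(1)] d_forms[OF om] c A[unfolded 2(1)]] 2(1) by (simp add: qz_def)
 qed
qed (simp add: Sop_def)

end

context mpt
begin

lemma wop_K1:
 assumes z: "z \<in> U0" and th: "th \<in> Om (Suc p)" and B: "length B = p"
 shows "Km 1 p (wop p (%_. 1) {#l1#} B) th (cinv c0 z) = th c0 z (l1 # B)"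
proof -
 note zc = U0(4)[OF z]
 have C: "wop p (%_. 1) {#l1#} B \<in> DO 1 p"
  using wop_diffops_le[OF sm_const[where c = 1] B, of "{#l1#}"] by simp
 obtain A where A: "Lc 1 p (wop p (%_. 1) {#l1#} B) c0 A" using coeffs_exist[OF C c0] .
 obtain r' rh' where "mpt X \<A> c0 z r' rh'" using point_locale[OF c0 zc] .
 then interpret mz: mpt X \<A> c0 z r' rh' .
 have x: "cinv c0 z \<in> cdom c0" "coord c0 (cinv c0 z) = z" using cinv_in[OF zc] coord_cinv[OF zc] by auto
 have "Km 1 p (wop p (%_. 1) {#l1#} B) th (cinv c0 z) = wop p (%_. 1) {#l1#} B (mz.e1 p th) (cinv c0 z)"
  using K_map_1[OF C th c0 zc A] mz.e1_value[OF th c0 x(1) A] unfolding x(2) by simp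
 also have "... = th c0 z (l1 # B)"
  using wop_near[OF mz.e1_forms(1)[OF th] z, of "%_. 1" "{#l1#}" B] mz.e1_jet(2)[OF th c0 x(1) B, of l1]
  unfolding x(2) by (simp add: mpd_single)
 finally show ?thesis .
qed

text \<open>The symbol is a square, whose derivative gives the factor 2. Its coefficient is constant
  near the point, so the divergence term of the ordering vanishes.\<close>

lemma wop_K2:
 assumes z: "z \<in> U0" and th: "th \<in> Om (Suc p)" and B: "length B = p" and lB: "distinct (l1 # B)" and p: "Suc p = CARD('n)"
 shows "Km 2 p (wop p (%_. 1) {#l1, l1#} B) th (cinv c0 z) = 2 * pd l1 (%z. th c0 z (l1 # B)) z"
proof -
 interpret td: top_degree X \<A> p "l1 # B" using lB B p by unfold_locales auto
 let ?C = "wop p (%_. 1) {#l1, l1#} B"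
 have C: "?C \<in> DO 2 p"
  using wop_diffops_le[OF sm_const[where c = 1] B, of "{#l1, l1#}"] by (simp add: numeral_2_eq_2)
 obtain A where A: "Lc 2 p ?C c0 A" using coeffs_exist[OF C c0] .
 have qb: "td.qb A i w = (if i = l1 then 2 else 0)" if w: "w \<in> U0" for i w
 proof -
  note wc = U0(4)[OF w]
  obtain r' rh' where "mpt X \<A> c0 w r' rh'" using point_locale[OF c0 wc] .
  then interpret mz: mpt X \<A> c0 w r' rh' .
  let ?et = "mz.mform (Suc p) (%_. 1) (l1 # B)"
  have et: "?et \<in> Om (Suc p)" by (rule mz.mform_forms[OF sm_const[where c = 1]])
  have t: "?et c0 w (l1 # B) = 1" unfolding mz.mform_near[OF mz.U0(2)] using eps_self[OF lB] B by simp
  have x: "cinv c0 w \<in> cdom c0" "coord c0 (cinv c0 w) = w" using cinv_in[OF wc] coord_cinv[OF wc] by auto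
  have "td.qb A i w = contr p (co2 A i) (?et c0) w" unfolding td.contr_top[OF A wc et] t by simp
  also have "... = ?C (mz.e2 p i ?et) (cinv c0 w)" by (rule mz.e2_value_self[OF et A, symmetric])
  also have "... = mpd {#l1, l1#} (%z. mz.e2 p i ?et c0 z B) w"
   using wop_near[OF mz.e2_forms(1)[OF et] w] by simp
  also have "... = (if i = l1 then 2 else 0)"
   using mz.mpd_e2(2)[OF et c0 x(1) B, of l1 l1 i] t unfolding x(2) by (simp add: Jac_self[OF c0 wc])
  finally show ?thesis .
 qed
 have pq: "pd i (td.qb A i) z = 0" for i
  using pd_cong[OF U0(1) z, of "td.qb A i" "%_. if i = l1 then 2 else 0" i] qb by simp
 show ?thesis
  unfolding td.K_map_2[OF C th c0 U0(4)[OF z] A] td.qz_def pq qb[OF z]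
  by (simp add: mult_if cong: if_cong)
qed

lemma ext_d_monomial:
 assumes B: "length B = p" "distinct (l1 # B)" and y: "y \<in> U0"
 shows "Ed (mform p (mon y0 (rp m l1)) B) c0 y (l1 # B) = m * mon y0 (rp (m - 1) l1) y"
proof -
 let ?f = "mon y0 (rp m l1)" 
 have f: "Sm S0 ?f" by (rule sm_mon[OF oc[OF c0]])
 have e: "pd i (%z. mform p ?f B c0 z I) y = eps p B I * pd i ?f y" for i I
  using mpd_mform[OF f y, where p = p and al = "{#i#}" and b = B and I = I] by (simp add: mpd_single)
 have z: "pd (B ! s) ?f y = 0" if "s < p" for s
 proof -
  have "B ! s ~= l1" using B that nth_mem by (metis distinct.simps(2))
  then show ?thesis by (simp add: pd_mon)
 qed
 have "Ed (mform p ?f B) c0 y (l1 # B) = eps p B B * pd l1 ?f y"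
  unfolding ext_d_chart[OF mform_forms[OF f] c0 U0(4)[OF y]] dform_def e using B(1) by (simp add: z)
 also have "... = m * mon y0 (rp (m - 1) l1) y"
  using eps_self[of B p] B by (cases m) (simp_all add: pd_mon)
 finally show ?thesis .
qed

text \<open>One factor \<open>k\<close> stems from the Koszul derivative of a \<open>k\<close>-th
  power, the other from the \<open>k\<close> derivatives falling on the monomial, as k! = k for the
  two possible orders. Monomials of lower degree give zero, which later makes the values constant
  under translation.\<close>

lemma Sop_value:
 assumes sp: "special k p" and B: "length B = p" "distinct (l1 # B)" and y: "y \<in> U0" and m: "m \<le> k"
 shows "Sop k p (wop p (%_. 1) (rp k l1) B) (mform p (mon y0 (rp m l1)) B) (cinv c0 y) = (if m = k then real (k * k) else 0)"
proof -
 let ?mu = "mform p (mon y0 (rp m l1)) B"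
 have mu: "?mu \<in> Om p" by (rule mform_forms[OF sm_mon[OF oc[OF c0]]])
 have C: "wop p (%_. 1) (rp k l1) B \<in> DO k p"
  using wop_diffops_le[OF sm_const[where c = 1] B(1), of "rp k l1"] by simp
 consider "k = 1" | "k = 2" "Suc p = CARD('n)" using sp unfolding special_def by blast
 then show ?thesis
 proof cases
  case 1
  then have "m = 0 \<or> m = 1" using m by auto
  then show ?thesis unfolding Sop_K[OF sp C mu]
   using wop_K1[OF y d_forms[OF mu] B(1), of l1] ext_d_monomial[OF B y, of m] 1 by auto
 next
  case 2
  then have m': "m = 0 \<or> m = 1 \<or> m = 2" using m by auto
  have r2: "rp 2 l1 = {#l1, l1#}" by (simp add: numeral_2_eq_2)
  have "pd l1 (%z. Ed ?mu c0 z (l1 # B)) y = pd l1 (%z. m * mon y0 (rp (m - 1) l1) z) y"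
   by (rule pd_cong[OF U0(1) y]) (rule ext_d_monomial[OF B])
  also have "... = m * pd l1 (mon y0 (rp (m - 1) l1)) y"
   by (rule pd_cmult) (rule sm_diffble[OF sm_mon[OF open_UNIV] open_UNIV UNIV_I])
  also have "... = (if m = 2 then 2 else 0)" using m' by (auto simp: pd_mon)
  finally have "Km 2 p (wop p (%_. 1) (rp 2 l1) B) (Ed ?mu) (cinv c0 y) = (if m = 2 then 4 else 0)"
   unfolding r2 using wop_K2[OF y d_forms[OF mu] B 2(2)] by simp
  then show ?thesis using Sop_K[OF sp C mu, of "cinv c0 y"] unfolding 2(1) by simp
 qed
qed

lemma lie_translation_monomial:
 assumes B: "length B = p" "distinct (l1 # B)" and y: "y \<in> U0" and I: "length I = p"
 shows "LF (vext (%y j. if j = i then 1 else 0)) (mform p (mon y0 (rp m l1)) B) c0 y I =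
  (if i = l1 then m else 0) * mform p (mon y0 (rp (m - 1) l1)) B c0 y I"
proof -
 have f: "Sm S0 (mon y0 (rp m l1))" by (rule sm_mon[OF oc[OF c0]])
 have v: "Sm S0 (%y. if j = i then 1 else (0::real))" for j by simp
 have "pd i (mon y0 (rp m l1)) y = (if i = l1 then m else 0) * mon y0 (rp (m - 1) l1) y"
  by (cases m) (auto simp: pd_mon)
 then show ?thesis
  unfolding lie_mform_near[where v = "%y j. if j = i then 1 else 0", OF v f B(1) y I] mform_near[OF y]
  by (simp add: mult_if cong: if_cong)
qed

end

section \<open>The two scalars at a point and on the manifold\<close>

locale classify = mfd X \<A> for X :: "'a topology" and \<A> :: "('a, 'n::finite) chart set" +
 fixes k p :: nat
 assumes p1: "p \<ge> 1" and pn: "Suc p \<le> CARD('n)"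
begin

text \<open>The condition on \<open>s\<close> makes the pair of scalars unique also where
  \<open>Sop\<close> is zero and its coefficient would be arbitrary.\<close>

definition combo :: "(('a, 'n) operator => ('a, 'n) operator) => 'a => real => real => bool" where
 "combo T x a s \<longleftrightarrow> (special k p \<or> s = 0) &
  (\<forall>D\<in>DO k p. \<forall>om\<in>Om p. T D om x = a * D om x + s * Sop k p D om x)"

lemma ex_words: obtains l1 :: 'n and b0 where "distinct (l1 # b0)" "length b0 = p"
proof -
 obtain I0 :: "'n list" where "distinct I0" "length I0 = CARD('n)" using ex_top_list by blast
 then have "distinct (take (Suc p) I0)" "length (take (Suc p) I0) = Suc p" using pn by auto
 then show ?thesis using that by (cases "take (Suc p) I0") auto
qed

lemma subtract:
 assumes T: "T \<in> Inv k p p"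
 shows "(%D om x. T D om x + (-a) * idop k p D om x + (-s) * Sop k p D om x) \<in> Inv k p p"
 by (rule invariant_comb[OF invariant_comb[OF T invariant_identity] invariant_Sop])

lemma identity_eq: "D \<in> DO k p ==> idop k p D = D"
 by (simp add: identity_op_def restrict0_def)

lemma wop_one:
 assumes "mpt X \<A> c y r rh" "length b = p" "distinct b" "z \<in> ball y (r / 2)"
 shows "mpt.wop \<A> c rh p (%_. 1) {#} b (mpt.mform \<A> c rh p (%_. 1) b) (cinv c z) = 1"
proof -
 interpret mpt X \<A> c y r rh by (rule assms)
 show ?thesis
  unfolding wop_near[OF mform_forms[OF sm_const[where c = 1]] assms(4)]
  using mform_near[OF assms(4), of p "%_. 1" b b] eps_self[OF assms(3,2)] by simp
qed

lemma Sop_one: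
 assumes "mpt X \<A> c y r rh" "length b = p" "z \<in> ball y (r / 2)" "om \<in> Om p"
 shows "Sop k p (mpt.wop \<A> c rh p (%_. 1) {#} b) om (cinv c z) = 0"
proof (cases "special k p")
 case True
 interpret mpt X \<A> c y r rh by (rule assms)
 have "wop p (%_. 1) {#} b \<in> DO 0 p"
  using wop_diffops_le[OF sm_const[where c = 1] assms(2), of "{#}"] by simp
 moreover have "0 < k" using True by (auto simp: special_def)
 ultimately show ?thesis by (rule Sop_lower[OF _ _ assms(4) c0 U0(4)[OF assms(3)]])
qed (simp add: Sop_def)

lemma combo_exists:
 assumes T: "T \<in> Inv k p p" and x: "x \<in> pts"
 shows "\<exists>a s. combo T x a s"
proof -
 obtain c0 where c0: "c0 \<in> \<A>" "x \<in> cdom c0" using x unfolding points_def by auto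
 define y0 where "y0 = coord c0 x"
 have y0: "y0 \<in> cimg c0" "cinv c0 y0 = x" using c0 unfolding y0_def by auto
 obtain r rh where M: "mpt X \<A> c0 y0 r rh" using point_locale[OF c0(1) y0(1)] .
 then interpret m: mpt X \<A> c0 y0 r rh .
 obtain l1 :: 'n and b0 where lb: "distinct (l1 # b0)" "length b0 = p" by (rule ex_words)
 have db: "distinct b0" using lb by simp
 let ?C0 = "m.wop p (%_. 1) {#} b0" and ?Ck = "m.wop p (%_. 1) (rp k l1) b0"
 let ?mu0 = "m.mform p (%_. 1) b0" and ?muk = "m.mform p (mon y0 (rp k l1)) b0"
 have mu0: "?mu0 \<in> Om p" by (rule m.mform_forms[OF sm_const[where c = 1]])
 have C0: "?C0 \<in> DO k p"
  using DO_mono[OF m.wop_diffops_le[OF sm_const[where c = 1] lb(2), of "{#}"], of k] by simp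
 have Ck: "?Ck \<in> DO k p"
  using m.wop_diffops_le[OF sm_const[where c = 1] lb(2), of "rp k l1"] by simp
 \<comment> \<open>On the constant word and its form the identity gives 1 and the second generator
   0, so this is the coefficient of the identity.\<close>
 define a where "a = T ?C0 ?mu0 x"
 \<comment> \<open>The denominator is the value of the second generator on the top word and its
   monomial form, by \<open>Sop_value\<close>.\<close>
 define s where "s = (if special k p then (T ?Ck ?muk x - a * ?Ck ?muk x) / real (k * k) else 0)"
 define T' where "T' = (%D om x. T D om x + (-a) * idop k p D om x + (-s) * Sop k p D om x)"
 have T': "T' \<in> Inv k p p" unfolding T'_def by (rule subtract[OF T])
 interpret i: inv X \<A> c0 y0 r rh k p T' using M T' p1 by (simp add: inv_def inv_axioms_def)
 have T'D: "T' D om x = T D om x - a * D om x - s * Sop k p D om x" if "D \<in> DO k p" for D om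
  using that by (simp add: T'_def identity_eq)
 have z: "T' D om x = 0" if D: "D \<in> DO k p" for D om
  unfolding y0(2)[symmetric]
 proof (rule i.kills_all[OF lb _ _ D])
  show "i.tw {#} b0 ?mu0 = 0"
   unfolding i.Tw_def y0(2) T'D[OF C0]
   using wop_one[OF M lb(2) db m.U0(2)] Sop_one[OF M lb(2) m.U0(2) mu0] unfolding y0(2) by (simp add: a_def)
  show "i.tw (rp k l1) b0 ?muk = 0 \<or> k \<ge> 3 \<or> k = 2 & (\<exists>l3. l3 ~: set (l1 # b0))"
  proof (cases "special k p")
   case True
   have "Sop k p ?Ck ?muk x = real (k * k)"
    using m.Sop_value[OF True lb(2,1) m.U0(2) order.refl] unfolding y0(2) by simp
   moreover have "real (k * k) ~= 0" using True by (auto simp: special_def)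
   ultimately have "T' ?Ck ?muk x = 0" unfolding T'D[OF Ck] s_def if_P[OF True] by simp
   then show ?thesis unfolding i.Tw_def y0(2) by simp
  next
   case False
   then consider "k = 0" | "k \<ge> 3" | "k = 2" "Suc p ~= CARD('n)" unfolding special_def by linarith
   then show ?thesis
   proof cases
    case 1
    have "i.tw {#} b0 ?mu0 = 0"
     unfolding i.Tw_def y0(2) T'D[OF C0]
     using wop_one[OF M lb(2) db m.U0(2)] Sop_one[OF M lb(2) m.U0(2) mu0] unfolding y0(2) by (simp add: a_def)
    then show ?thesis using 1 by simp
   next
    case 3
    have "card (set (l1 # b0)) = Suc p" using distinct_card[OF lb(1)] lb(2) by simp
    then have "set (l1 # b0) ~= UNIV" using 3(2) by metis
    then show ?thesis using 3(1) by blast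
   qed auto
  qed
 qed
 have "T D om x = a * D om x + s * Sop k p D om x" if "D \<in> DO k p" for D om
  using z[OF that, of om] unfolding T'D[OF that] by simp
 then have "combo T x a s" unfolding combo_def by (auto simp: s_def)
 then show ?thesis by blast
qed

text \<open>The two test values are triangular in \<open>a\<close> and \<open>s\<close>: the first
  sees only \<open>a\<close>, the second only \<open>s\<close> once \<open>a\<close> is
  zero.\<close>

lemma combo_zero:
 assumes "mpt X \<A> c y r rh" and z: "z \<in> ball y (r / 2)" and lb: "distinct (l1 # b0)" "length b0 = p" and cb: "combo T (cinv c z) a s"
  and k: "special k p ==> a = 0 ==>
   T (mpt.wop \<A> c rh p (%_. 1) (rp k l1) b0) (mpt.mform \<A> c rh p (mon y (rp k l1)) b0) (cinv c z) = 0"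
  and 0: "T (mpt.wop \<A> c rh p (%_. 1) {#} b0) (mpt.mform \<A> c rh p (%_. 1) b0) (cinv c z) = 0"
 shows "a = 0" "s = 0"
proof -
 interpret m: mpt X \<A> c y r rh by (rule assms)
 have mu: "m.mform p (%_. 1) b0 \<in> Om p" "m.mform p (mon y (rp k l1)) b0 \<in> Om p"
  by (rule m.mform_forms[OF sm_const[where c = 1]], rule m.mform_forms[OF sm_mon[OF oc[OF m.c0]]])
 have C0: "m.wop p (%_. 1) {#} b0 \<in> DO k p"
  using DO_mono[OF m.wop_diffops_le[OF sm_const[where c = 1] lb(2), of "{#}"], of k] by simp
 have Ck: "m.wop p (%_. 1) (rp k l1) b0 \<in> DO k p"
  using m.wop_diffops_le[OF sm_const[where c = 1] lb(2), of "rp k l1"] by simp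
 have db: "distinct b0" using lb by simp
 show a: "a = 0"
  using cb 0 C0 mu(1) wop_one[OF assms(1) lb(2) db z] Sop_one[OF assms(1) lb(2) z mu(1)] unfolding combo_def by simp
 show "s = 0"
 proof (cases "special k p")
  case True
  then have "k * k ~= 0" by (auto simp: special_def)
  then show ?thesis
   using cb k[OF True a] Ck mu(2) m.Sop_value[OF True lb(2,1) z order.refl] a unfolding combo_def by simp
 qed (use cb in "simp add: combo_def")
qed

lemma combo_diff: "combo T x a s ==> combo T x a' s' ==> combo 0 x (a - a') (s - s')"
 unfolding combo_def by (auto simp: algebra_simps)

lemma combo_unique:
 assumes "combo T x a s" "combo T x a' s'" "x \<in> pts"
 shows "a = a' & s = s'"
proof -
 obtain c where c: "c \<in> \<A>" "x \<in> cdom c" using assms(3) unfolding points_def by auto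
 define y where "y = coord c x"
 have y: "y \<in> cimg c" "cinv c y = x" using c unfolding y_def by auto
 obtain r rh where M: "mpt X \<A> c y r rh" using point_locale[OF c(1) y(1)] .
 obtain l1 :: 'n and b0 where lb: "distinct (l1 # b0)" "length b0 = p" by (rule ex_words)
 note cd = combo_diff[OF assms(1,2), folded y(2)]
 have "y \<in> ball y (r / 2)" using mpt.U0(2)[OF M] .
 from combo_zero[OF M this lb cd] show ?thesis by simp
qed

text \<open>After subtraction the scalars at \<open>x\<close> are zero, and the test values have to
  vanish nearby. The constant form is invariant under translations, which settles \<open>a\<close>.
  The derivative of the top monomial along a translation is of lower degree; there, with
  \<open>a = 0\<close> already known, the value is zero by \<open>Sop_value\<close>, and this
  settles \<open>s\<close>.\<close>

lemma combo_open:
 assumes T: "T \<in> Inv k p p" and x: "x \<in> pts" and cb: "combo T x a s"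
 shows "\<exists>W. openin X W & x \<in> W & (\<forall>x'\<in>W. combo T x' a s)"
proof -
 obtain c0 where c0: "c0 \<in> \<A>" "x \<in> cdom c0" using x unfolding points_def by auto
 define y0 where "y0 = coord c0 x"
 have y0: "y0 \<in> cimg c0" "cinv c0 y0 = x" using c0 unfolding y0_def by auto
 obtain r rh where M: "mpt X \<A> c0 y0 r rh" using point_locale[OF c0(1) y0(1)] .
 then interpret m: mpt X \<A> c0 y0 r rh .
 obtain l1 :: 'n and b0 where lb: "distinct (l1 # b0)" "length b0 = p" by (rule ex_words)
 have db: "distinct b0" using lb by simp
 define T' where "T' = (%D om x. T D om x + (-a) * idop k p D om x + (-s) * Sop k p D om x)"
 have T': "T' \<in> Inv k p p" unfolding T'_def by (rule subtract[OF T])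
 interpret i: inv X \<A> c0 y0 r rh k p T' using M T' p1 by (simp add: inv_def inv_axioms_def)
 have T'D: "T' D om x = T D om x - a * D om x - s * Sop k p D om x" if "D \<in> DO k p" for D om x
  using that by (simp add: T'_def identity_eq)
 have s1: "Sm (cimg c0) (%_. 1)" by (rule sm_const)
 have sm: "Sm (cimg c0) (mon y0 al)" for al by (rule sm_mon[OF oc[OF m.c0]])
 let ?C = "%j. m.wop p (%_. 1) (rp j l1) b0" and ?mu = "%j. m.mform p (mon y0 (rp j l1)) b0"
 have C: "?C j \<in> DO k p" if "j \<le> k" for j by (rule i.wop_in[OF s1 lb(2)]) (use that in simp)
 have mu: "?mu j \<in> Om p" for j by (rule m.mform_forms[OF sm])
 have zero: "T' D om x = 0" if "D \<in> DO k p" "om \<in> Om p" for D om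
  using cb that unfolding combo_def T'D[OF that(1)] by simp
 have L: "T' (?C j) (LF (i.vf (%_. 1) l) (?mu m)) (cinv c0 z) = (if l = l1 then m else 0) * T' (?C j) (?mu (m - 1)) (cinv c0 z)"
  if j: "j \<le> k" and z: "z \<in> m.U0" for j l m z
 proof -
  obtain K where K: "T' (?C j) \<in> DO K p" using i.T_diffops[OF C[OF j]] by blast
  have "T' (?C j) (LF (i.vf (%_. 1) l) (?mu m)) (cinv c0 z) = (\<Sum>q\<in>{()}. (if l = l1 then m else 0) * T' (?C j) (?mu (m - 1)) (cinv c0 z))"
   by (rule diffop_linear[OF K m.c0 m.U0(1) z m.U0(3) _ lie_forms[OF mu i.vf_fields[OF s1]] mu])
    (use m.lie_translation_monomial[OF lb(2,1)] in "auto simp: i.vf_def")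
  then show ?thesis by simp
 qed
 have A: "T' (?C 0) (?mu 0) (cinv c0 z) = 0" if z: "z \<in> m.U0" for z
  by (rule i.translation_zero[OF lb(2) _ mu z]) (use L[of 0 _ _ 0] zero[OF C[of 0] mu[of 0]] y0(2) in auto)
 have ex: "\<exists>s'. combo T' (cinv c0 z) 0 s'" if z: "z \<in> m.U0" for z
 proof -
  have "cinv c0 z \<in> pts" by (rule cdom_points[OF m.c0 cinv_in[OF m.U0(4)[OF z]]])
  then obtain a' s' where c: "combo T' (cinv c0 z) a' s'" using combo_exists[OF T'] by blast
  have "a' = 0"
   using c A[OF z] C[of 0] mu[of 0] wop_one[OF M lb(2) db z] Sop_one[OF M lb(2) z mu[of 0]] unfolding combo_def by simp
  then show ?thesis using c by blast
 qed
 have B: "T' (?C k) (?mu k) (cinv c0 z) = 0" if sp: "special k p" and z: "z \<in> m.U0" for z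
 proof (rule i.translation_zero[OF lb(2) _ mu z])
  fix l z assume z: "z \<in> m.U0"
  obtain s' where c: "combo T' (cinv c0 z) 0 s'" using ex[OF z] by blast
  have k0: "k - 1 < k" using sp by (auto simp: special_def)
  have "T' (?C k) (?mu (k - 1)) (cinv c0 z) = 0"
   using c C[OF order.refl] mu[of "k - 1"] m.Sop_value[OF sp lb(2,1) z less_imp_le[OF k0]] k0 unfolding combo_def by simp
  then show "T' (?C k) (LF (i.vf (%_. 1) l) (?mu k)) (cinv c0 z) = 0"
   unfolding L[OF order.refl z] by simp
 qed (use zero[OF C[OF order.refl] mu] y0(2) in auto)
 have main: "combo T (cinv c0 z) a s" if z: "z \<in> m.U0" for z
 proof -
  obtain s' where c: "combo T' (cinv c0 z) 0 s'" using ex[OF z] by blast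
  have "s' = 0"
   by (rule combo_zero(2)[OF M z lb c]) (use B[OF _ z] A[OF z] in auto)
  then show ?thesis using c cb T'D unfolding combo_def by (auto simp: algebra_simps)
 qed
 define W where "W = {x \<in> cdom c0. coord c0 x \<in> m.U0}"
 have "openin X W"
 proof -
  have cont: "continuous_map (subtopology X (cdom c0)) (top_of_set (cimg c0)) (coord c0)"
   by (rule homeomorphic_imp_continuous_map[OF homeo[OF m.c0]])
  have "openin (top_of_set (cimg c0)) m.U0"
   using m.U0(1,3) open_subset by blast
  from openin_continuous_map_preimage[OF cont this]
  moreover have "{x \<in> topspace (subtopology X (cdom c0)). coord c0 x \<in> m.U0} = W"
   unfolding W_def topspace_subtopology using cdom_topspace[OF m.c0] by blast
  ultimately have "openin (subtopology X (cdom c0)) W" by (simp only:)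
  then show ?thesis using openin_trans_full[OF _ openin_cdom[OF m.c0]] by blast
 qed
 moreover have "x \<in> W" using c0 m.U0(2) unfolding W_def y0_def by simp
 moreover have "combo T x' a s" if "x' \<in> W" for x'
  using main[of "coord c0 x'"] that cinv_coord[OF m.c0, of x'] unfolding W_def by simp
 ultimately show ?thesis by blast
qed

text \<open>Points with the scalars of \<open>x1\<close> and points with other scalars form two open
  sets, disjoint by uniqueness and covering the manifold; connectedness empties the second.\<close>

lemma combo_global:
 assumes T: "T \<in> Inv k p p"
 shows "\<exists>a s. \<forall>x\<in>pts. combo T x a s"
proof (cases "pts = {}")
 case False
 then obtain x1 where x1: "x1 \<in> pts" by blast
 obtain a s where as: "combo T x1 a s" using combo_exists[OF T x1] by blast
 define E1 where "E1 = {x \<in> pts. combo T x a s}"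
 define E2 where "E2 = {x \<in> pts. \<exists>a' s'. combo T x a' s' & (a', s') ~= (a, s)}"
 have sub: "W \<subseteq> pts" if "openin X W" for W using openin_subset[OF that] points_topspace by simp
 have "openin X E1"
 proof (subst openin_subopen, intro ballI)
  fix x assume "x \<in> E1"
  then show "\<exists>W. openin X W & x \<in> W & W \<subseteq> E1" using combo_open[OF T, of x a s] sub unfolding E1_def by blast
 qed
 moreover have "openin X E2"
 proof (subst openin_subopen, intro ballI)
  fix x assume "x \<in> E2"
  then obtain a' s' where x: "x \<in> pts" "combo T x a' s'" "(a', s') ~= (a, s)" unfolding E2_def by blast
  obtain W where "openin X W" "x \<in> W" "\<forall>x'\<in>W. combo T x' a' s'" using combo_open[OF T x(1,2)] by blast
  then show "\<exists>W. openin X W & x \<in> W & W \<subseteq> E2" using sub x(3) unfolding E2_def by blast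
 qed
 moreover have "topspace X \<subseteq> E1 \<union> E2"
 proof
  fix x assume "x \<in> topspace X"
  then have x: "x \<in> pts" using points_topspace by simp
  then obtain a' s' where "combo T x a' s'" using combo_exists[OF T] by blast
  then show "x \<in> E1 \<union> E2" using x unfolding E1_def E2_def by (cases "(a', s') = (a, s)") auto
 qed
 moreover have "E1 \<inter> E2 = {}" unfolding E1_def E2_def using combo_unique by blast
 moreover have "E1 ~= {}" using x1 as unfolding E1_def by blast
 moreover have "connected_space X" using mfd unfolding smooth_manifold_def by blast
 ultimately have "E2 = {}" unfolding connected_space_def by blast
 then have "combo T x a s" if "x \<in> pts" for x
  using that combo_exists[OF T that] unfolding E2_def by blast
 then show ?thesis by blast
qed simp

lemma invariant_form:
 assumes T: "T \<in> Inv k p p"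
 shows "\<exists>a s. (special k p \<or> s = 0) & T = (op_scale a (idop k p) + op_scale s (Sop k p))"
proof -
 obtain a s where as: "!!x. x \<in> pts ==> combo T x a s" using combo_global[OF T] by blast
 define s' where "s' = (if special k p then s else 0)"
 have "T D om x = a * idop k p D om x + s' * Sop k p D om x" for D om x
 proof (cases "D \<in> DO k p")
  case True
  have "T D \<in> diffops \<A> p" "Sop k p D \<in> diffops \<A> p" using True T invariant_Sop[of k p] unfolding invariant_ops_def by auto
  then obtain i j where ij: "T D \<in> DO i p" "Sop k p D \<in> DO j p" unfolding diffops_def by auto
  show ?thesis
  proof (cases "om \<in> Om p & x \<in> pts")
   case w: True
   then have "T D om x = a * D om x + s * Sop k p D om x" "special k p \<or> s = 0" using as[of x] True unfolding combo_def by auto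
   then show ?thesis by (auto simp: identity_eq[OF True] s'_def)
  next
   case False
   then show ?thesis
    using diffops_leD(1,2)[OF ij(1)] diffops_leD(1,2)[OF ij(2)] diffops_leD(1,2)[OF True] identity_eq[OF True] by auto
  qed
 next
  case False
  then have "T D = 0" "Sop k p D = 0" using T invariant_Sop[of k p] unfolding invariant_ops_def by auto
  then show ?thesis using False by (simp add: identity_op_def restrict0_def)
 qed
 then have "T = op_scale a (idop k p) + op_scale s' (Sop k p)"
  by (simp add: fun_eq_iff op_scale_def)
 moreover have "special k p \<or> s' = 0" by (simp add: s'_def)
 ultimately show ?thesis by blast
qed

lemma invariant_span:
 "Inv k p p = module.span op_scale (if special k p then {idop k p, dK k p} else {idop k p})"
 (is "_ = module.span _ ?G")
proof -
 interpret m: module op_scale by (rule module_op_scale)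
 have "m.subspace (Inv k p p)"
 proof (rule m.subspaceI)
  show "0 \<in> Inv k p p" by (rule invariant_zero)
  show "T + U \<in> Inv k p p" if "T \<in> Inv k p p" "U \<in> Inv k p p" for T U
   using invariant_comb[OF that, of 1] by (simp add: plus_fun_def)
  show "op_scale t T \<in> Inv k p p" if "T \<in> Inv k p p" for t T
   using invariant_comb[OF invariant_zero that, of t] by (simp add: op_scale_def)
 qed
 moreover have "?G \<subseteq> Inv k p p"
  using invariant_identity[of k p] invariant_Sop[of k p] by (auto simp: Sop_def split: if_splits)
 ultimately have "m.span ?G \<subseteq> Inv k p p" by (intro m.span_minimal)
 moreover have "T \<in> m.span ?G" if T: "T \<in> Inv k p p" for T
 proof -
  obtain a s where as: "special k p \<or> s = 0" "T = op_scale a (idop k p) + op_scale s (Sop k p)"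
   using invariant_form[OF T] by blast
  have "op_scale s (Sop k p) \<in> m.span ?G"
  proof (cases "special k p")
   case True
   then show ?thesis by (simp add: Sop_def m.span_base m.span_scale)
  next
   case False
   then have "op_scale s (Sop k p) = 0" using as(1) by simp
   then show ?thesis by (simp only: m.span_zero)
  qed
  moreover have "op_scale a (idop k p) \<in> m.span ?G" by (intro m.span_scale m.span_base) auto
  ultimately show ?thesis unfolding as(2) by (intro m.span_add)
 qed
 ultimately show ?thesis by blast
qed

end

theorem theorem11:
  fixes X :: "'a topology" and \<A> :: "('a, 'n::finite) chart set" and k p :: nat
  assumes "smooth_manifold X \<A>"
    and "CARD('n) \<ge> 2"
    and "1 \<le> p" and "p \<le> CARD('n) - 1"
  shows "(k \<noteq> 1 \<and> (k, p) \<noteq> (2, CARD('n) - 1) \<longrightarrow>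
            invariant_ops \<A> k p p = module.span op_scale {identity_op \<A> k p}) \<and>
         (k = 1 \<or> (k, p) = (2, CARD('n) - 1) \<longrightarrow>
            invariant_ops \<A> k p p = module.span op_scale {identity_op \<A> k p, d_star_K \<A> k p})"
proof -
  interpret classify X \<A> k p using assms by unfold_locales auto
  have "special k p \<longleftrightarrow> k = 1 \<or> (k, p) = (2, CARD('n) - 1)"
    using assms unfolding special_def by auto
  then show ?thesis using invariant_span by auto
qed

end
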